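(* Let $\mathcal D\subset\mathbb R^d$ be a bounded domain satisfying the standing assumptions in the context, let $(X_t,V_t)_{t\ge0}$ be the stochastic billiard with reflection density $\bar\gamma$ and $\chi$ its invariant probability measure, and let $\psi$ be the density (with respect to $(d-1)$-dimensional Hausdorff measure on $\partial\mathcal D$) of the unique invariant probability measure $\hat\mu$ of the random walk $(\xi_n)$. Let $\mu_0$ and $\nu_0$ be the uniform probability measures on $\mathcal D$ and $\mathbb S^{d-1}$ respectively. Then $\chi$ is absolutely continuous with respect to $\mu_0\otimes\nu_0$, and is given by $$\chi(dx,dv)=\frac{1}{\mathbf E_{\hat\mu}\|\xi_1-\xi_0\|}\;\psi(z)\,\frac{\bar\gamma(U_z^{-1}v)}{\cos\phi_z(v)}\,dx\,dv,\qquad z=\mathsf h_x(-v),$$ where $\mathbf E_{\hat\mu}$ is the expectation for the walk with $\xi_0\sim\hat\mu$. In particular, for the cosine reflection law $\bar\gamma(u)=\gamma_d\,e\cdot u$, the product measure $\mu_0\otimes\nu_0$ is invariant for the corresponding process $(\tilde X_t,\tilde V_t)$ (the Knudsen stochastic billiard).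
   Context: Notation: $d\ge 2$; $\|\cdot\|$ is the Euclidean norm, $\mathcal B(x,\varepsilon)$ the open ball, $\mathbb S^{d-1}$ the unit sphere, $e=(1,0,\dots,0)$, and $\mathbb S_v=\{w\in\mathbb S^{d-1}:v\cdot w>0\}$. $dx$ on $\mathcal D$ is Lebesgue measure, $dv$ on $\mathbb S^{d-1}$ is (unnormalized) surface measure, and $\partial\mathcal D$ carries $(d-1)$-dimensional Hausdorff measure. Standing assumptions on the domain: $\mathcal D\subset\mathbb R^d$ is open and connected, and (Lipschitz condition) for every $x\in\partial\mathcal D$ there exist $\varepsilon_x>0$, an affine isometry $\mathfrak I_x:\mathbb R^d\to\mathbb R^d$ with $\mathfrak I_x x=0$ and a Lipschitz function $f_x:\mathbb R^{d-1}\to\mathbb R$ with $f_x(0)=0$ such that $\mathfrak I_x(\mathcal D\cap\mathcal B(x,\varepsilon_x))=\{z\in\mathcal B(0,\varepsilon_x):z^{(d)}>f_x(z^{(1)},\dots,z^{(d-1)})\}$. Moreover there is a relatively open set $\tilde{\mathcal R}\subset\partial\mathcal D$, with $\partial\mathcal D\setminus\tilde{\mathcal R}$ of Hausdorff measure zero, such that $\partial\mathcal D$ has a local $C^1$ parametrization at each point of $\tilde{\mathcal R}$. For $x\in\tilde{\mathcal R}$, $\mathbf n(x)$ is the unit normal vector pointing into $\mathcal D$, and $\phi_x(u)=\arccos(u\cdot\mathbf n(x))$. Reflection law: $\bar\gamma$ is a probability density on $\mathbb S_e$ with $\inf_{u\in B}\bar\gamma(u)>0$ for every compact $B\subset\mathbb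 S_e$. $(U_x,x\in\partial\mathcal D)$ is a measurable family of orthogonal linear operators of $\mathbb R^d$ with $U_xe=\mathbf n(x)$ for all $x\in\tilde{\mathcal R}$. Case 1: $\bar\gamma(u)$ depends only on $u\cdot e$; then $\mathcal R:=\tilde{\mathcal R}$. Case 2: otherwise; then $x\mapsto U_x$ is assumed continuous at almost every $x\in\partial\mathcal D$ and $\mathcal R:=\{x\in\tilde{\mathcal R}: x\mapsto U_x\text{ is continuous at }x\}$. In the cosine law, $\gamma_d=\big(\int_{\mathbb S_e}u\cdot e\,du\big)^{-1}$. Random walk and stochastic billiard: for $x\in\tilde{\mathcal R},u\in\mathbb S_{\mathbf n(x)}$ or $x\in\mathcal D,u\in\mathbb S^{d-1}$ let $\mathsf r_x(u)=\inf\{t>0:x+tu\in\partial\mathcal D\}$ and $\mathsf h_x(u)=x+u\,\mathsf r_x(u)$. Let $\eta_0,\eta_1,\dots$ be i.i.d. with density $\bar\gamma$. Started from $\xi_0\in\mathcal R$: $\xi_{n+1}=\mathsf h_{\xi_n}(U_{\xi_n}\eta_n)$, $\tau_0=0$, $\tau_n=\sum_{i=0}^{n-1}\mathsf r_{\xi_i}(U_{\xi_i}\eta_i)$, and for $t\in[\tau_n,\tau_{n+1})$, $X_t=\xi_n+(t-\tau_n)U_{\xi_n}\eta_n$ and $V_t=U_{\xi_n}\eta_n$ (almost surely $\xi_n\in\mathcal R$ for all $n$ and $\tau_n\to\infty$). Started from $(x_0,v_0)\in\mathcal D\times\mathbb S^{d-1}$: the particle moves as $X_t=x_0+tv_0$,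 $V_t=v_0$ up to time $\mathsf r_{x_0}(v_0)$ and then continues as the process just described started from $\mathsf h_{x_0}(v_0)$. The initial condition may be random (independent of the $\eta$'s), provided the first boundary point visited lies in $\mathcal R$ almost surely. Invariant measures: it is known that $(\xi_n)$ has a unique invariant probability measure $\hat\mu$ on $\partial\mathcal D$, and that it is absolutely continuous with respect to Hausdorff measure; $\chi$ is the unique probability measure on $\mathcal D\times\mathbb S^{d-1}$ to which the law of $(X_t,V_t)$ converges in total variation as $t\to\infty$, whatever the initial distribution (its existence is known). *)

theory Defs
  imports "HOL-Probability.Probability"
begin

type_synonym 'n point = "(real, 'n) vec"
type_synonym 'n matrix = "((real, 'n) vec, 'n) vec"

section \<open>Hausdorff measure\<close>

text \<open>The normalisation is the usual one, for which the \<open>k\<close>-dimensional Hausdorff measure of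
  \<open>\<real>\<^sup>k\<close> is Lebesgue measure. Covering sets are required to be bounded because
  \<^const>\<open>diameter\<close> is meaningless on unbounded sets.\<close>

definition hausdorff_content :: "nat \<Rightarrow> real \<Rightarrow> 'a::metric_space set \<Rightarrow> ennreal" where
  "hausdorff_content k \<delta> A =
     (INF C \<in> {C :: nat \<Rightarrow> 'a set. A \<subseteq> (\<Union>i. C i) \<and> (\<forall>i. bounded (C i) \<and> diameter (C i) \<le> \<delta>)}.
        \<Sum>i. if C i = {} then 0
             else ennreal (unit_ball_vol (real k) * (diameter (C i) / 2) ^ k))"

definition hausdorff_outer_measure :: "nat \<Rightarrow> 'a::metric_space set \<Rightarrow> ennreal" where
  "hausdorff_outer_measure k A = (SUP \<delta> \<in> {0<..}. hausdorff_content k \<delta> A)"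

text \<open>A metric outer measure is countably additive on the Borel sets.\<close>

definition hausdorff_measure :: "nat \<Rightarrow> 'a::metric_space measure" where
  "hausdorff_measure k = measure_of UNIV (sets borel) (hausdorff_outer_measure k)"

definition surface_measure :: "'n::finite point measure" where
  "surface_measure = hausdorff_measure (CARD('n) - 1)"


section \<open>Domains\<close>

text \<open>The coordinates of \<open>real ^ 'n\<close> are ordered by \<open>'n :: linorder\<close>: the first one is
  \<open>Min UNIV\<close>, the last one \<open>Max UNIV\<close>. The hyperplane where the last coordinate vanishes serves
  as \<open>\<real>\<^sup>d\<^sup>-\<^sup>1\<close>.\<close>

definition e_vec :: "'n::{finite,linorder} point" where
  "e_vec = axis (Min UNIV) 1"

definition last_coord :: "'n::{finite,linorder} point \<Rightarrow> real" where
  "last_coord z = z $ Max UNIV"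

definition base_part :: "'n::{finite,linorder} point \<Rightarrow> 'n point" where
  "base_part z = z - axis (Max UNIV) (last_coord z)"

definition base_space :: "'n::{finite,linorder} point set" where
  "base_space = {z. last_coord z = 0}"

definition half_sphere :: "'n::finite point \<Rightarrow> 'n point set" where
  "half_sphere v = {w \<in> sphere 0 1. v \<bullet> w > 0}"

definition affine_isometry :: "('n::finite point \<Rightarrow> 'n point) \<Rightarrow> bool" where
  "affine_isometry J \<longleftrightarrow> (\<exists>Q b. orthogonal_transformation Q \<and> J = (\<lambda>y. Q y + b))"

definition lipschitz_boundary :: "'n::{finite,linorder} point set \<Rightarrow> bool" where
  "lipschitz_boundary D \<longleftrightarrow>
     (\<forall>x \<in> frontier D. \<exists>\<epsilon> > 0. \<exists>J f L.
        affine_isometry J \<and> J x = 0 \<and> L-lipschitz_on base_space f \<and> f 0 = 0 \<and>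
        J ` (D \<inter> ball x \<epsilon>) = {z \<in> ball 0 \<epsilon>. last_coord z > f (base_part z)})"

text \<open>\<open>p\<close> is a regular \<open>C\<^sup>1\<close> parametrization, with derivative \<open>p'\<close>, of a relatively open part
  of \<open>S\<close> by the relatively open subset \<open>G\<close> of \<open>\<real>\<^sup>d\<^sup>-\<^sup>1\<close>.\<close>

definition C1_parametrization ::
  "'n::{finite,linorder} point set \<Rightarrow> 'n point set \<Rightarrow> ('n point \<Rightarrow> 'n point)
    \<Rightarrow> ('n point \<Rightarrow> 'n point \<Rightarrow> 'n point) \<Rightarrow> bool" where
  "C1_parametrization S G p p' \<longleftrightarrow>
     openin (top_of_set base_space) G \<and> openin (top_of_set S) (p ` G) \<and>
     (\<exists>q. homeomorphism G (p ` G) p q) \<and>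
     (\<forall>y\<in>G. (p has_derivative p' y) (at y within base_space) \<and> inj_on (p' y) base_space) \<and>
     (\<forall>w\<in>base_space. continuous_on G (\<lambda>y. p' y w))"

definition is_inner_normal ::
  "'n::{finite,linorder} point set \<Rightarrow> 'n point \<Rightarrow> 'n point \<Rightarrow> bool" where
  "is_inner_normal D x m \<longleftrightarrow>
     norm m = 1 \<and>
     (\<exists>G p p' y. C1_parametrization (frontier D) G p p' \<and> y \<in> G \<and> p y = x \<and>
        (\<forall>w\<in>base_space. m \<bullet> p' y w = 0)) \<and>
     (\<exists>\<epsilon>>0. \<forall>t. 0 < t \<and> t < \<epsilon> \<longrightarrow> x + t *\<^sub>R m \<in> D)"

definition inner_normal :: "'n::{finite,linorder} point set \<Rightarrow> 'n point \<Rightarrow> 'n point" where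
  "inner_normal D x = (THE m. is_inner_normal D x m)"

definition normal_angle ::
  "'n::{finite,linorder} point set \<Rightarrow> 'n point \<Rightarrow> 'n point \<Rightarrow> real" where
  "normal_angle D x u = arccos (u \<bullet> inner_normal D x)"

text \<open>\<open>Rt\<close> is the part of the boundary, of full surface measure, assumed to be \<open>C\<^sup>1\<close>. Boundedness
  of \<open>D\<close> is not included.\<close>

definition billiard_domain ::
  "'n::{finite,linorder} point set \<Rightarrow> 'n point set \<Rightarrow> bool" where
  "billiard_domain D Rt \<longleftrightarrow>
     D \<noteq> {} \<and> open D \<and> connected D \<and> lipschitz_boundary D \<and>
     openin (top_of_set (frontier D)) Rt \<and>
     frontier D - Rt \<in> null_sets surface_measure \<and>
     (\<forall>x\<in>Rt. \<exists>G p p'. C1_parametrization (frontier D) G p p' \<and> x \<in> p ` G)"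


section \<open>Reflection laws\<close>

definition reflection_law :: "('n::{finite,linorder} point \<Rightarrow> real) \<Rightarrow> 'n point measure" where
  "reflection_law \<gamma> = density (restrict_space surface_measure (half_sphere e_vec)) (\<lambda>u. ennreal (\<gamma> u))"

definition reflection_density :: "('n::{finite,linorder} point \<Rightarrow> real) \<Rightarrow> bool" where
  "reflection_density \<gamma> \<longleftrightarrow>
     \<gamma> \<in> borel_measurable (restrict_space borel (half_sphere e_vec)) \<and>
     (\<forall>u \<in> half_sphere e_vec. 0 \<le> \<gamma> u) \<and>
     prob_space (reflection_law \<gamma>) \<and>
     (\<forall>B. compact B \<and> B \<noteq> {} \<and> B \<subseteq> half_sphere e_vec \<longrightarrow> (INF u\<in>B. \<gamma> u) > 0)"

definition axially_symmetric :: "('n::{finite,linorder} point \<Rightarrow> real) \<Rightarrow> bool" where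
  "axially_symmetric \<gamma> \<longleftrightarrow> (\<exists>g. \<forall>u \<in> half_sphere e_vec. \<gamma> u = g (u \<bullet> e_vec))"

definition reflection_frames ::
  "'n::{finite,linorder} point set \<Rightarrow> 'n point set \<Rightarrow> ('n point \<Rightarrow> real)
    \<Rightarrow> ('n point \<Rightarrow> 'n matrix) \<Rightarrow> bool" where
  "reflection_frames D Rt \<gamma> U \<longleftrightarrow>
     (\<forall>x \<in> frontier D. orthogonal_matrix (U x)) \<and>
     U \<in> borel_measurable (restrict_space borel (frontier D)) \<and>
     (\<forall>x \<in> Rt. U x *v e_vec = inner_normal D x) \<and>
     (\<not> axially_symmetric \<gamma> \<longrightarrow>
        (AE x in restrict_space surface_measure (frontier D).
           continuous (at x within frontier D) U))"

text \<open>For a density symmetric about \<open>e_vec\<close> the law of \<open>U x *v u\<close> depends on \<open>inner_normal D x\<close> only, so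
  no continuity of \<open>U\<close> is asked for.\<close>

definition regular_points ::
  "'n::{finite,linorder} point set \<Rightarrow> 'n point set \<Rightarrow> ('n point \<Rightarrow> real)
    \<Rightarrow> ('n point \<Rightarrow> 'n matrix) \<Rightarrow> 'n point set" where
  "regular_points D Rt \<gamma> U =
     (if axially_symmetric \<gamma> then Rt
      else {x \<in> Rt. continuous (at x within frontier D) U})"

definition cosine_density :: "'n::{finite,linorder} point \<Rightarrow> real" where
  "cosine_density u =
     inverse (LINT w|restrict_space surface_measure (half_sphere (e_vec :: 'n point)). w \<bullet> e_vec)
       * (e_vec \<bullet> u)"


section \<open>The random walk and the stochastic billiard\<close>

text \<open>If the ray never meets the boundary the flight time is set to \<open>0\<close>, so that the walk below
  never leaves \<open>frontier D\<close>, the only place where the operators \<open>U x\<close> are controlled.\<close>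

definition flight_time :: "'n::finite point set \<Rightarrow> 'n point \<Rightarrow> 'n point \<Rightarrow> real" where
  "flight_time D x u =
     (if \<exists>t>0. x + t *\<^sub>R u \<in> frontier D then Inf {t. t > 0 \<and> x + t *\<^sub>R u \<in> frontier D} else 0)"

definition next_hit :: "'n::finite point set \<Rightarrow> 'n point \<Rightarrow> 'n point \<Rightarrow> 'n point" where
  "next_hit D x u = x + flight_time D x u *\<^sub>R u"

text \<open>The walk and the billiard are functions of the starting point and of the sequence
  \<open>\<eta>\<close> driving the reflections.\<close>

primrec walk ::
  "'n::finite point set \<Rightarrow> ('n point \<Rightarrow> 'n matrix) \<Rightarrow> 'n point \<Rightarrow> (nat \<Rightarrow> 'n point)
    \<Rightarrow> nat \<Rightarrow> 'n point" where
  "walk D U x \<eta> 0 = x"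
| "walk D U x \<eta> (Suc n) = next_hit D (walk D U x \<eta> n) (U (walk D U x \<eta> n) *v \<eta> n)"

definition out_velocity ::
  "'n::finite point set \<Rightarrow> ('n point \<Rightarrow> 'n matrix) \<Rightarrow> 'n point \<Rightarrow> (nat \<Rightarrow> 'n point)
    \<Rightarrow> nat \<Rightarrow> 'n point" where
  "out_velocity D U x \<eta> n = U (walk D U x \<eta> n) *v \<eta> n"

definition hit_time ::
  "'n::finite point set \<Rightarrow> ('n point \<Rightarrow> 'n matrix) \<Rightarrow> 'n point \<Rightarrow> (nat \<Rightarrow> 'n point)
    \<Rightarrow> nat \<Rightarrow> real" where
  "hit_time D U x \<eta> n = (\<Sum>i<n. flight_time D (walk D U x \<eta> i) (out_velocity D U x \<eta> i))"

text \<open>For \<open>t \<ge> 0\<close> the index \<open>n\<close> below is the one with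
  \<open>hit_time n \<le> t < hit_time (n + 1)\<close>.\<close>

definition boundary_path ::
  "'n::finite point set \<Rightarrow> ('n point \<Rightarrow> 'n matrix) \<Rightarrow> 'n point \<Rightarrow> (nat \<Rightarrow> 'n point)
    \<Rightarrow> real \<Rightarrow> 'n point \<times> 'n point" where
  "boundary_path D U x \<eta> t =
     (let n = (LEAST n. t < hit_time D U x \<eta> (Suc n)); w = out_velocity D U x \<eta> n
      in (walk D U x \<eta> n + (t - hit_time D U x \<eta> n) *\<^sub>R w, w))"

definition interior_path ::
  "'n::finite point set \<Rightarrow> ('n point \<Rightarrow> 'n matrix) \<Rightarrow> 'n point \<times> 'n point
    \<Rightarrow> (nat \<Rightarrow> 'n point) \<Rightarrow> real \<Rightarrow> 'n point \<times> 'n point" where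
  "interior_path D U = (\<lambda>(x, v) \<eta> t.
     if t < flight_time D x v then (x + t *\<^sub>R v, v)
     else boundary_path D U (next_hit D x v) \<eta> (t - flight_time D x v))"

definition noise :: "('n::{finite,linorder} point \<Rightarrow> real) \<Rightarrow> (nat \<Rightarrow> 'n point) measure" where
  "noise \<gamma> = (\<Pi>\<^sub>M i\<in>UNIV. reflection_law \<gamma>)"

definition boundary_space :: "'n::finite point set \<Rightarrow> 'n point measure" where
  "boundary_space D = restrict_space borel (frontier D)"

definition phase_space :: "'n::finite point set \<Rightarrow> ('n point \<times> 'n point) measure" where
  "phase_space D = restrict_space borel (D \<times> sphere 0 1)"

text \<open>The laws of \<open>(X\<^sub>t, V\<^sub>t)\<close> are taken on the ambient space since \<open>X\<^sub>t\<close> is on the boundary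
  at the hitting times.\<close>

definition law_from_boundary ::
  "'n::{finite,linorder} point set \<Rightarrow> ('n point \<Rightarrow> real) \<Rightarrow> ('n point \<Rightarrow> 'n matrix)
    \<Rightarrow> 'n point measure \<Rightarrow> real \<Rightarrow> ('n point \<times> 'n point) measure" where
  "law_from_boundary D \<gamma> U \<mu> t =
     distr (\<mu> \<Otimes>\<^sub>M noise \<gamma>) borel (\<lambda>(x, \<eta>). boundary_path D U x \<eta> t)"

definition law_from_interior ::
  "'n::{finite,linorder} point set \<Rightarrow> ('n point \<Rightarrow> real) \<Rightarrow> ('n point \<Rightarrow> 'n matrix)
    \<Rightarrow> ('n point \<times> 'n point) measure \<Rightarrow> real \<Rightarrow> ('n point \<times> 'n point) measure" where
  "law_from_interior D \<gamma> U \<mu> t =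
     distr (\<mu> \<Otimes>\<^sub>M noise \<gamma>) borel (\<lambda>(s, \<eta>). interior_path D U s \<eta> t)"

definition ambient ::
  "('n::finite point \<times> 'n point) measure \<Rightarrow> ('n point \<times> 'n point) measure" where
  "ambient \<mu> = distr \<mu> borel (\<lambda>s. s)"


section \<open>Invariant measures\<close>

definition boundary_start ::
  "'n::{finite,linorder} point set \<Rightarrow> 'n point set \<Rightarrow> ('n point \<Rightarrow> real)
    \<Rightarrow> ('n point \<Rightarrow> 'n matrix) \<Rightarrow> 'n point measure \<Rightarrow> bool" where
  "boundary_start D Rt \<gamma> U \<mu> \<longleftrightarrow>
     prob_space \<mu> \<and> sets \<mu> = sets (boundary_space D) \<and>
     (AE x in \<mu>. x \<in> regular_points D Rt \<gamma> U)"

definition interior_start ::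
  "'n::{finite,linorder} point set \<Rightarrow> 'n point set \<Rightarrow> ('n point \<Rightarrow> real)
    \<Rightarrow> ('n point \<Rightarrow> 'n matrix) \<Rightarrow> ('n point \<times> 'n point) measure \<Rightarrow> bool" where
  "interior_start D Rt \<gamma> U \<mu> \<longleftrightarrow>
     prob_space \<mu> \<and> sets \<mu> = sets (phase_space D) \<and>
     (AE (x, v) in \<mu>. next_hit D x v \<in> regular_points D Rt \<gamma> U)"

definition walk_invariant ::
  "'n::{finite,linorder} point set \<Rightarrow> 'n point set \<Rightarrow> ('n point \<Rightarrow> real)
    \<Rightarrow> ('n point \<Rightarrow> 'n matrix) \<Rightarrow> 'n point measure \<Rightarrow> bool" where
  "walk_invariant D Rt \<gamma> U \<mu> \<longleftrightarrow>
     boundary_start D Rt \<gamma> U \<mu> \<and>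
     distr (\<mu> \<Otimes>\<^sub>M noise \<gamma>) (boundary_space D) (\<lambda>(x, \<eta>). walk D U x \<eta> 1) = \<mu>"

definition unique_walk_invariant ::
  "'n::{finite,linorder} point set \<Rightarrow> 'n point set \<Rightarrow> ('n point \<Rightarrow> real)
    \<Rightarrow> ('n point \<Rightarrow> 'n matrix) \<Rightarrow> 'n point measure \<Rightarrow> bool" where
  "unique_walk_invariant D Rt \<gamma> U \<mu> \<longleftrightarrow>
     walk_invariant D Rt \<gamma> U \<mu> \<and> (\<forall>\<nu>. walk_invariant D Rt \<gamma> U \<nu> \<longrightarrow> \<nu> = \<mu>)"

definition boundary_density ::
  "'n::finite point set \<Rightarrow> 'n point measure \<Rightarrow> ('n point \<Rightarrow> real) \<Rightarrow> bool" where
  "boundary_density D \<mu> \<psi> \<longleftrightarrow>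
     \<psi> \<in> borel_measurable (boundary_space D) \<and> (\<forall>x \<in> frontier D. 0 \<le> \<psi> x) \<and>
     \<mu> = density (restrict_space surface_measure (frontier D)) (\<lambda>x. ennreal (\<psi> x))"

definition mean_jump ::
  "'n::{finite,linorder} point set \<Rightarrow> ('n point \<Rightarrow> real) \<Rightarrow> ('n point \<Rightarrow> 'n matrix)
    \<Rightarrow> 'n point measure \<Rightarrow> real" where
  "mean_jump D \<gamma> U \<mu> =
     (\<integral>(x, \<eta>). norm (walk D U x \<eta> 1 - walk D U x \<eta> 0) \<partial>(\<mu> \<Otimes>\<^sub>M noise \<gamma>))"

definition tv_distance :: "'a::topological_space measure \<Rightarrow> 'a measure \<Rightarrow> real" where
  "tv_distance M N = (SUP A \<in> sets borel. \<bar>measure M A - measure N A\<bar>)"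

definition billiard_limit ::
  "'n::{finite,linorder} point set \<Rightarrow> 'n point set \<Rightarrow> ('n point \<Rightarrow> real)
    \<Rightarrow> ('n point \<Rightarrow> 'n matrix) \<Rightarrow> ('n point \<times> 'n point) measure \<Rightarrow> bool" where
  "billiard_limit D Rt \<gamma> U chi \<longleftrightarrow>
     prob_space chi \<and> sets chi = sets (phase_space D) \<and>
     (\<forall>\<mu>. boundary_start D Rt \<gamma> U \<mu> \<longrightarrow>
        ((\<lambda>t. tv_distance (law_from_boundary D \<gamma> U \<mu> t) (ambient chi)) \<longlongrightarrow> 0) at_top) \<and>
     (\<forall>\<mu>. interior_start D Rt \<gamma> U \<mu> \<longrightarrow>
        ((\<lambda>t. tv_distance (law_from_interior D \<gamma> U \<mu> t) (ambient chi)) \<longlongrightarrow> 0) at_top)"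

definition billiard_invariant ::
  "'n::{finite,linorder} point set \<Rightarrow> 'n point set \<Rightarrow> ('n point \<Rightarrow> real)
    \<Rightarrow> ('n point \<Rightarrow> 'n matrix) \<Rightarrow> ('n point \<times> 'n point) measure \<Rightarrow> bool" where
  "billiard_invariant D Rt \<gamma> U \<mu> \<longleftrightarrow>
     interior_start D Rt \<gamma> U \<mu> \<and> (\<forall>t\<ge>0. law_from_interior D \<gamma> U \<mu> t = ambient \<mu>)"

definition volume_on :: "'n::finite point set \<Rightarrow> 'n point measure" where
  "volume_on D = restrict_space lborel D"

definition sphere_measure :: "'n::finite point measure" where
  "sphere_measure = restrict_space surface_measure (sphere 0 1)"

definition uniform_phase :: "'n::finite point set \<Rightarrow> ('n point \<times> 'n point) measure" where
  "uniform_phase D =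
     uniform_measure (volume_on D) D \<Otimes>\<^sub>M uniform_measure sphere_measure (sphere 0 1)"

end

theory Submission
  imports Defs
begin

text \<open>The phase-space measure is the stationary measure of a suspension flow. For stationary \<open>\<xi>\<^sub>0\<close>, choose a flight of the walk with
  probability proportional to its length and a uniform point on it: by stationarity of the walk, the law
  of the resulting pair of position and velocity is preserved by the billiard, so it must be the limit \<open>\<chi>\<close>.
  To compute its density, parametrize \<open>\<D>\<close>, for a fixed direction \<open>v\<close>, by the starting point \<open>z\<close> of the flight
  through a given point and by the distance from \<open>z\<close>. Projecting \<open>\<partial>\<D>\<close> along \<open>v\<close> contracts surface measure by the
  factor \<open>v \<bullet> n(z) = cos \<phi>\<^sub>z(v)\<close>, so that \<open>cos \<phi>\<^sub>z(v) dz ds = dx\<close>. This rests on Lebesgue measure being the product of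
  the Hausdorff measure of a hyperplane with Lebesgue measure on its normal, hence on the isodiametric inequality.
  For the cosine law the same formula makes the walk reversible with respect to surface measure, and the
  density is constant.\<close>


section \<open>Hausdorff measure\<close>

text \<open>A factor \<open>c\<close> between Hausdorff measure on hyperplanes and Lebesgue measure
  would survive in the density of \<chi>, so \<open>c = 1\<close> is needed exactly: translation
  invariance yields proportionality, the isodiametric inequality gives \<open>1 \<le> c\<close>, and
  covers by balls inscribed in fine cubes give \<open>c \<le> 1\<close>. On the boundary no area
  formula is invoked. Near a regular point all chords are almost orthogonal to the normal, so the
  projection of the boundary onto the tangent plane along \<open>v\<close> is nearly an isometry,
  and Lipschitz bounds on Hausdorff measure do the rest. A parametrization does not tell on which
  side of the surface the domain lies; the Lipschitz graph does, because its vertical direction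
  cannot be tangent to the surface. Two kinds of exceptional behaviour are discarded. Flights that
  start outside \<open>Rt\<close> or tangentially: for almost every \<open>v\<close> such boundary
  points form a null set, and hence so do the lines through them. Infinitely many reflections in
  finite time: they are excluded for the stationary start only, which is all that the suspension
  requires.\<close>

definition cover_cost :: "nat \<Rightarrow> 'a::metric_space set \<Rightarrow> ennreal" where
  "cover_cost k E = (if E = {} then 0 else ennreal (unit_ball_vol (real k) * (diameter E / 2) ^ k))"

definition admissible_cover :: "real \<Rightarrow> 'a::metric_space set \<Rightarrow> (nat \<Rightarrow> 'a set) \<Rightarrow> bool" where
  "admissible_cover \<delta> A C \<longleftrightarrow> A \<subseteq> (\<Union>i. C i) \<and> (\<forall>i. bounded (C i) \<and> diameter (C i) \<le> \<delta>)"

lemma hausdorff_content_eq: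
  "hausdorff_content k \<delta> A = (INF C \<in> Collect (admissible_cover \<delta> A). \<Sum>i. cover_cost k (C i))"
  unfolding hausdorff_content_def cover_cost_def admissible_cover_def by simp

text \<open>For \<open>k = 0\<close> the power formula would charge 1 for the empty set; the case
  distinction is what lets finite covers be padded to sequences.\<close>

lemma cover_cost_empty [simp]: "cover_cost k {} = 0"
  by (simp add: cover_cost_def)

lemma hausdorff_content_le:
  "admissible_cover \<delta> A C \<Longrightarrow> hausdorff_content k \<delta> A \<le> (\<Sum>i. cover_cost k (C i))"
  unfolding hausdorff_content_eq by (rule INF_lower) simp

lemma hausdorff_content_ge:
  "(\<And>C. admissible_cover \<delta> A C \<Longrightarrow> b \<le> (\<Sum>i. cover_cost k (C i))) \<Longrightarrow> b \<le> hausdorff_content k \<delta> A"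
  unfolding hausdorff_content_eq by (rule INF_greatest) simp

lemma hausdorff_content_mono: "A \<subseteq> B \<Longrightarrow> hausdorff_content k \<delta> A \<le> hausdorff_content k \<delta> B"
  by (rule hausdorff_content_ge, rule hausdorff_content_le) (auto simp: admissible_cover_def)

lemma hausdorff_content_antimono: "\<delta> \<le> \<delta>' \<Longrightarrow> hausdorff_content k \<delta>' A \<le> hausdorff_content k \<delta> A"
  by (rule hausdorff_content_ge, rule hausdorff_content_le)
     (auto simp: admissible_cover_def intro: order_trans)

lemma hausdorff_content_empty: "\<delta> \<ge> 0 \<Longrightarrow> hausdorff_content k \<delta> {} = 0"
  using hausdorff_content_le[of \<delta> "{}" "\<lambda>_. {}" k] by (simp add: admissible_cover_def)

lemma hausdorff_content_le_cost:
  assumes "bounded A" "diameter A \<le> \<delta>"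
  shows "hausdorff_content k \<delta> A \<le> cover_cost k A"
proof -
  have d: "\<delta> \<ge> 0" using assms diameter_ge_0[of A] by simp
  let ?C = "\<lambda>i::nat. if i = 0 then A else {}"
  have "hausdorff_content k \<delta> A \<le> (\<Sum>i. cover_cost k (?C i))"
    using assms d by (intro hausdorff_content_le) (auto simp: admissible_cover_def)
  also have "(\<Sum>i. cover_cost k (?C i)) = (\<Sum>i\<in>{0}. cover_cost k (?C i))"
    by (rule suminf_finite) auto
  finally show ?thesis by simp
qed

text \<open>Covers of the \<open>A n\<close> with errors \<open>e / 2 ^ Suc n\<close> are merged
  into a single sequence through \<open>prod_decode\<close>.\<close>

lemma hausdorff_content_UN:
  fixes A :: "nat \<Rightarrow> 'a::metric_space set"
  shows "hausdorff_content k \<delta> (\<Union>i. A i) \<le> (\<Sum>i. hausdorff_content k \<delta> (A i))"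
proof (rule ennreal_le_epsilon)
  fix e :: real assume e: "0 < e" and fin: "(\<Sum>n. hausdorff_content k \<delta> (A n)) < top"
  let ?O = "hausdorff_content k \<delta>"
  have *: "?O (A n) < ?O (A n) + e * (1/2)^Suc n" for n
    using e fin by (auto simp add: less_top dest!: ennreal_suminf_lessD)
  have "\<exists>B. admissible_cover \<delta> (A n) B \<and> (\<Sum>i. cover_cost k (B i)) \<le> ?O (A n) + e * (1/2)^Suc n" for n
    using *[of n] unfolding hausdorff_content_eq INF_less_iff
    by (auto intro: less_imp_le)
  then obtain B where B: "\<And>n. admissible_cover \<delta> (A n) (B n)"
    and Ble: "\<And>n. (\<Sum>i. cover_cost k (B n i)) \<le> ?O (A n) + e * (1/2)^Suc n"
    by metis
  define C where "C = case_prod B o prod_decode"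
  have "(\<Union>i. A i) \<subseteq> (\<Union>i. C i)"
    using B by (auto simp add: C_def subset_eq admissible_cover_def) (metis prod.case prod_encode_inverse)
  then have "admissible_cover \<delta> (\<Union>i. A i) C"
    using B by (auto simp: admissible_cover_def C_def split: prod.split)
  then have "?O (\<Union>i. A i) \<le> (\<Sum>i. cover_cost k (C i))"
    by (rule hausdorff_content_le)
  also have "\<dots> = (\<Sum>n. \<Sum>i. cover_cost k (B n i))"
    using suminf_ennreal_2dimen[of "\<lambda>n. \<Sum>i. cover_cost k (B n i)" "\<lambda>(n,i). cover_cost k (B n i)"]
    by (simp add: C_def split_beta')
  also have "\<dots> \<le> (\<Sum>n. ?O (A n) + e * (1/2) ^ Suc n)"
    by (intro suminf_le allI Ble) auto
  also have "... = (\<Sum>n. ?O (A n)) + (\<Sum>n. ennreal e * ennreal ((1/2) ^ Suc n))"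
    using e by (subst suminf_add[symmetric])
               (auto simp del: ennreal_suminf_cmult simp add: ennreal_mult[symmetric])
  also have "\<dots> = (\<Sum>n. ?O (A n)) + e"
    unfolding ennreal_suminf_cmult
    by (subst suminf_ennreal_eq[OF zero_le_power power_half_series]) auto
  finally show "?O (\<Union>i. A i) \<le> (\<Sum>n. ?O (A n)) + e" .
qed

lemma hausdorff_content_UN_finite:
  assumes "finite I" "\<delta> \<ge> 0"
  shows "hausdorff_content k \<delta> (\<Union>i\<in>I. A i) \<le> (\<Sum>i\<in>I. hausdorff_content k \<delta> (A i))"
proof -
  obtain f and n::nat where f: "bij_betw f {..<n} I"
    using \<open>finite I\<close> by (metis ex_bij_betw_nat_finite atLeast0LessThan)
  let ?A = "\<lambda>i::nat. if i < n then A (f i) else {}"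
  have "(\<Union>i\<in>I. A i) = (\<Union>i. ?A i)"
    using f by (force simp: bij_betw_def)
  also have "hausdorff_content k \<delta> \<dots> \<le> (\<Sum>i. hausdorff_content k \<delta> (?A i))"
    by (rule hausdorff_content_UN)
  also have "\<dots> = (\<Sum>i<n. hausdorff_content k \<delta> (?A i))"
    by (rule suminf_finite) (auto simp: hausdorff_content_empty assms)
  also have "\<dots> = (\<Sum>i\<in>I. hausdorff_content k \<delta> (A i))"
    using f by (subst sum.reindex_bij_betw[OF f, symmetric]) auto
  finally show ?thesis .
qed

lemma hausdorff_content_Un:
  assumes "\<delta> \<ge> 0"
  shows "hausdorff_content k \<delta> (A \<union> B) \<le> hausdorff_content k \<delta> A + hausdorff_content k \<delta> B"
  using hausdorff_content_UN_finite[of "{True,False}" \<delta> k "\<lambda>b. if b then A else B"] assms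
  by (simp add: Un_commute)

lemma hausdorff_content_le_outer: "\<delta> > 0 \<Longrightarrow> hausdorff_content k \<delta> A \<le> hausdorff_outer_measure k A"
  unfolding hausdorff_outer_measure_def by (rule SUP_upper) auto

lemma hausdorff_outer_mono: "A \<subseteq> B \<Longrightarrow> hausdorff_outer_measure k A \<le> hausdorff_outer_measure k B"
  unfolding hausdorff_outer_measure_def by (intro SUP_mono') (auto intro: hausdorff_content_mono)

lemma hausdorff_outer_empty [simp]: "hausdorff_outer_measure k {} = 0"
  unfolding hausdorff_outer_measure_def
  by (rule antisym) (auto intro!: SUP_least simp: hausdorff_content_empty)

lemma hausdorff_outer_UN:
  "hausdorff_outer_measure k (\<Union>i::nat. A i) \<le> (\<Sum>i. hausdorff_outer_measure k (A i))"
proof -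
  have "hausdorff_content k \<delta> (\<Union>i. A i) \<le> (\<Sum>i. hausdorff_outer_measure k (A i))" if "\<delta> > 0" for \<delta>
    using that
    by (intro order_trans[OF hausdorff_content_UN] suminf_le hausdorff_content_le_outer) auto
  then show ?thesis
    unfolding hausdorff_outer_measure_def[of k "\<Union>i. A i"] by (auto intro!: SUP_least)
qed

lemma hausdorff_outer_Un:
  "hausdorff_outer_measure k (A \<union> B) \<le> hausdorff_outer_measure k A + hausdorff_outer_measure k B"
proof -
  have "hausdorff_content k \<delta> (A \<union> B) \<le> hausdorff_outer_measure k A + hausdorff_outer_measure k B" if "\<delta> > 0" for \<delta>
    using hausdorff_content_Un[of \<delta> k A B] that
    by (meson add_mono hausdorff_content_le_outer less_imp_le order_trans)
  then show ?thesis
    unfolding hausdorff_outer_measure_def[of k "A \<union> B"] by (auto intro!: SUP_least)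
qed

text \<open>No covering set of diameter at most \<delta> can meet both parts, so a cover of the
  union splits into two covers whose costs add up to at most the original cost.\<close>

lemma hausdorff_content_separated:
  assumes sep: "\<And>x y. x \<in> A \<Longrightarrow> y \<in> B \<Longrightarrow> \<delta> < dist x y" and "\<delta> \<ge> 0"
  shows "hausdorff_content k \<delta> A + hausdorff_content k \<delta> B \<le> hausdorff_content k \<delta> (A \<union> B)"
proof (rule hausdorff_content_ge)
  fix C assume C: "admissible_cover \<delta> (A \<union> B) C"
  define CA where "CA i = (if C i \<inter> A = {} then {} else C i)" for i
  define CB where "CB i = (if C i \<inter> B = {} then {} else C i)" for i
  have A: "admissible_cover \<delta> A CA" and B: "admissible_cover \<delta> B CB"
    using C \<open>\<delta> \<ge> 0\<close> unfolding admissible_cover_def CA_def CB_def subset_iff by (simp; blast)+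
  have "C i \<inter> A = {} \<or> C i \<inter> B = {}" for i
  proof (rule ccontr)
    assume "\<not> ?thesis"
    then obtain x y where xy: "x \<in> C i" "x \<in> A" "y \<in> C i" "y \<in> B" by blast
    have "dist x y \<le> diameter (C i)"
      using C xy by (intro diameter_bounded_bound) (auto simp: admissible_cover_def)
    also have "\<dots> \<le> \<delta>" using C by (auto simp: admissible_cover_def)
    finally show False using sep[OF xy(2,4)] by simp
  qed
  then have le: "cover_cost k (CA i) + cover_cost k (CB i) \<le> cover_cost k (C i)" for i
    by (auto simp: CA_def CB_def)
  have "hausdorff_content k \<delta> A + hausdorff_content k \<delta> B
      \<le> (\<Sum>i. cover_cost k (CA i)) + (\<Sum>i. cover_cost k (CB i))"
    by (intro add_mono hausdorff_content_le A B)
  also have "\<dots> = (\<Sum>i. cover_cost k (CA i) + cover_cost k (CB i))"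
    by (rule suminf_add) auto
  also have "\<dots> \<le> (\<Sum>i. cover_cost k (C i))"
    by (intro suminf_le le) auto
  finally show "hausdorff_content k \<delta> A + hausdorff_content k \<delta> B \<le> (\<Sum>i. cover_cost k (C i))" .
qed

lemma hausdorff_outer_separated:
  assumes sep: "\<And>x y. x \<in> A \<Longrightarrow> y \<in> B \<Longrightarrow> e \<le> dist x y" and "e > 0"
  shows "hausdorff_outer_measure k A + hausdorff_outer_measure k B \<le> hausdorff_outer_measure k (A \<union> B)"
proof -
  have *: "hausdorff_content k \<delta>1 A + hausdorff_content k \<delta>2 B \<le> hausdorff_outer_measure k (A \<union> B)"
    if "\<delta>1 > 0" "\<delta>2 > 0" for \<delta>1 \<delta>2
  proof -
    let ?d = "min (min \<delta>1 \<delta>2) (e/2)"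
    have "hausdorff_content k \<delta>1 A + hausdorff_content k \<delta>2 B \<le> hausdorff_content k ?d A + hausdorff_content k ?d B"
      by (intro add_mono hausdorff_content_antimono) auto
    also have "\<dots> \<le> hausdorff_content k ?d (A \<union> B)"
      using sep \<open>e > 0\<close> that by (intro hausdorff_content_separated) force+
    also have "\<dots> \<le> hausdorff_outer_measure k (A \<union> B)"
      using \<open>e > 0\<close> that by (intro hausdorff_content_le_outer) auto
    finally show ?thesis .
  qed
  have "hausdorff_outer_measure k A + hausdorff_outer_measure k B =
     (SUP \<delta>1\<in>{0<..}. SUP \<delta>2\<in>{0<..}. hausdorff_content k \<delta>1 A + hausdorff_content k \<delta>2 B)"
    unfolding hausdorff_outer_measure_def[of k A] hausdorff_outer_measure_def[of k B]
    by (subst ennreal_SUP_add_left[symmetric]) (auto simp: ennreal_SUP_add_right)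
  also have "\<dots> \<le> hausdorff_outer_measure k (A \<union> B)"
    by (intro SUP_least *) auto
  finally show ?thesis .
qed

text \<open>The gap may depend on the later index, as it must for shells that accumulate at a closed
  set; the induction splits off the last set.\<close>

lemma hausdorff_outer_separated_UN:
  fixes A :: "nat \<Rightarrow> 'a::metric_space set"
  assumes sep: "\<And>i j x y. i < j \<Longrightarrow> x \<in> A i \<Longrightarrow> y \<in> A j \<Longrightarrow> e j \<le> dist x y" and e: "\<And>j. e j > 0"
  shows "(\<Sum>i<n. hausdorff_outer_measure k (A i)) \<le> hausdorff_outer_measure k (\<Union>i<n. A i)"
proof (induction n)
  case (Suc n)
  have "(\<Sum>i<Suc n. hausdorff_outer_measure k (A i))
     \<le> hausdorff_outer_measure k (\<Union>i<n. A i) + hausdorff_outer_measure k (A n)"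
    using Suc by (auto intro: add_mono)
  also have "\<dots> \<le> hausdorff_outer_measure k ((\<Union>i<n. A i) \<union> A n)"
    by (rule hausdorff_outer_separated[where e = "e n"]) (use sep e in auto)
  also have "(\<Union>i<n. A i) \<union> A n = (\<Union>i<Suc n. A i)"
    by (auto simp: less_Suc_eq)
  finally show ?case .
qed simp

text \<open>The shells around \<open>F\<close> of even index, and likewise those of odd index, are pairwise separated,
  so the outer measures of all shells are summable.\<close>

lemma hausdorff_outer_closed_split:
  fixes F A :: "'a::metric_space set"
  assumes F: "closed F"
  shows "hausdorff_outer_measure k (F \<inter> A) + hausdorff_outer_measure k (A - F) \<le> hausdorff_outer_measure k A"
proof (cases "hausdorff_outer_measure k A = \<infinity> \<or> F = {}")
  case True
  then show ?thesis by auto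
next
  case False
  let ?H = "hausdorff_outer_measure k"
  have Fne: "F \<noteq> {}" and fin: "?H A < \<infinity>" using False by (auto simp: less_top)
  define a where "a n = 1 / real (Suc n)" for n
  have a0: "a n > 0" for n by (simp add: a_def)
  have a_mono: "m \<le> n \<Longrightarrow> a n \<le> a m" for m n by (auto simp: a_def divide_simps)
  have a_strict: "m < n \<Longrightarrow> a n < a m" for m n by (auto simp: a_def divide_simps)
  define B where "B n = {x\<in>A. infdist x F \<ge> a n}" for n
  define R where "R n = {x\<in>A. a (Suc n) \<le> infdist x F \<and> infdist x F < a n}" for n
  have sepR: "a (Suc i) - a j \<le> dist x y" if "Suc i < j" "x \<in> R i" "y \<in> R j" for i j x y
  proof -
    have "infdist x F \<le> infdist y F + dist x y" by (rule infdist_triangle)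
    with that show ?thesis by (auto simp: R_def)
  qed
  have bound: "(\<Sum>i<n. ?H (R (2*i+p))) \<le> ?H A" for n p
  proof -
    have "(\<Sum>i<n. ?H (R (2*i+p))) \<le> ?H (\<Union>i<n. R (2*i+p))"
    \<comment> \<open>For \<open>j = 0\<close> there is no earlier shell to be separated from, but a
      positive gap is still demanded, and truncated subtraction can make the difference of radii
      vanish; the summand 1 takes care of this.\<close>
    proof (rule hausdorff_outer_separated_UN[where e = "\<lambda>j. a (2*j+p-1) - a (2*j+p) + (if j = 0 then 1 else 0)"])
      fix i j x y assume ij: "i < (j::nat)" "x \<in> R (2*i+p)" "y \<in> R (2*j+p)"
      then have "a (Suc (2*i+p)) - a (2*j+p) \<le> dist x y" by (intro sepR) auto
      moreover have "a (2*j+p-1) \<le> a (Suc (2*i+p))" using ij by (intro a_mono) auto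
      ultimately show "a (2*j+p-1) - a (2*j+p) + (if j = 0 then 1 else 0) \<le> dist x y" using ij by auto
    next
      fix j :: nat
      show "a (2*j+p-1) - a (2*j+p) + (if j = 0 then 1 else 0) > 0"
        using a_strict[of "2*j+p-1" "2*j+p"] a_mono[of "p-1" p] by (cases "j = 0") auto
    qed
    also have "\<dots> \<le> ?H A" by (intro hausdorff_outer_mono) (auto simp: R_def)
    finally show ?thesis .
  qed
  have sumR: "(\<Sum>i. ?H (R i)) < \<infinity>"
  proof -
    have "(\<Sum>i<n. ?H (R i)) \<le> ?H A + ?H A" for n
    proof -
      have "(\<Sum>i<n. ?H (R i)) \<le> (\<Sum>i<2*n. ?H (R i))" by (intro sum_mono2) auto
      also have "\<dots> = (\<Sum>i<n. ?H (R (2*i+0)) + ?H (R (2*i+1)))"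
        by (induction n) (auto simp: algebra_simps)
      also have "\<dots> \<le> ?H A + ?H A"
        unfolding sum.distrib by (intro add_mono bound)
      finally show ?thesis .
    qed
    then have "(\<Sum>i. ?H (R i)) \<le> ?H A + ?H A"
      unfolding suminf_eq_SUP by (intro SUP_least)
    also have "\<dots> < \<infinity>" using fin by (auto simp: less_top)
    finally show ?thesis .
  qed
  have "A - F \<subseteq> B n \<union> (\<Union>i. R (i + n))" for n
  proof
    fix x assume x: "x \<in> A - F"
    then have pos: "infdist x F > 0" using in_closed_iff_infdist_zero[OF F Fne] infdist_nonneg[of x F]
      by (auto simp: less_le)
    show "x \<in> B n \<union> (\<Union>i. R (i + n))"
    proof (cases "infdist x F \<ge> a n")
      case False
      have "\<exists>m. a m \<le> infdist x F"
        using reals_Archimedean[OF pos] by (auto simp: a_def inverse_eq_divide intro: less_imp_le)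
      define m where "m = (LEAST m. a m \<le> infdist x F)"
      have m: "a m \<le> infdist x F" unfolding m_def by (rule LeastI_ex) fact
      have nm: "n < m" using False m a_mono[of m n] by (metis not_le order.trans)
      then obtain l where l: "m = Suc l" by (cases m) auto
      have "\<not> a l \<le> infdist x F" using not_less_Least[of l "\<lambda>m. a m \<le> infdist x F"] l by (auto simp: m_def)
      then have "x \<in> R l" using m l x by (auto simp: R_def)
      moreover have "l = (l - n) + n" using nm l by auto
      ultimately show ?thesis by (metis UN_I UNIV_I UnI2)
    qed (use x in \<open>auto simp: B_def\<close>)
  qed
  then have "?H (A - F) \<le> ?H (B n) + (\<Sum>i. ?H (R (i + n)))" for n
    using order_trans[OF hausdorff_outer_mono order_trans[OF hausdorff_outer_Un
        add_left_mono[OF hausdorff_outer_UN]]] by blast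
  then have "?H (F \<inter> A) + ?H (A - F) \<le> ?H (F \<inter> A) + ?H (B n) + (\<Sum>i. ?H (R (i + n)))" for n
    by (metis add_left_mono add.assoc)
  moreover have "?H (F \<inter> A) + ?H (B n) \<le> ?H A" for n
  proof -
    have "?H (F \<inter> A) + ?H (B n) \<le> ?H ((F \<inter> A) \<union> B n)"
    proof (rule hausdorff_outer_separated[where e = "a n"])
      fix x y assume "x \<in> F \<inter> A" "y \<in> B n"
      then show "a n \<le> dist x y" using infdist_le[of x F y] by (auto simp: B_def dist_commute)
    qed (rule a0)
    also have "\<dots> \<le> ?H A" by (intro hausdorff_outer_mono) (auto simp: B_def)
    finally show ?thesis .
  qed
  ultimately have *: "?H (F \<inter> A) + ?H (A - F) \<le> ?H A + (\<Sum>i. ?H (R (i + n)))" for n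
    by (meson add_right_mono order_trans)
  \<comment> \<open>What \<open>B n\<close> misses of \<open>A - F\<close> lies in the shells from
    index \<open>n\<close> on, so summability makes the loss vanish in the limit.\<close>
  have "(\<lambda>n. \<Sum>i. ?H (R (i + n))) \<longlonglongrightarrow> 0"
  proof -
    define r where "r i = enn2real (?H (R i))" for i
    have r: "?H (R i) = ennreal (r i)" "r i \<ge> 0" for i
      using sumR ennreal_suminf_lessD[of "\<lambda>i. ?H (R i)" \<infinity> i] by (auto simp: r_def less_top)
    have s: "summable r"
      using sumR r by (intro summable_suminf_not_top) (auto simp: less_top)
    have "(\<lambda>n. \<Sum>i. r (i + n)) \<longlonglongrightarrow> 0" using s by (rule suminf_exist_split2)
    then have "(\<lambda>n. ennreal (\<Sum>i. r (i + n))) \<longlonglongrightarrow> ennreal 0" by (intro tendsto_ennrealI)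
    moreover have "ennreal (\<Sum>i. r (i + n)) = (\<Sum>i. ?H (R (i + n)))" for n
      using s r by (simp add: suminf_ennreal2[symmetric] summable_iff_shift)
    ultimately show ?thesis by simp
  qed
  then have "(\<lambda>n. ?H A + (\<Sum>i. ?H (R (i + n)))) \<longlonglongrightarrow> ?H A + 0"
    by (intro tendsto_add tendsto_const)
  then show ?thesis using * by (intro LIMSEQ_le_const) auto
qed

text \<open>Caratheodory: closed sets split every set additively, so the measurable sets form a
  sigma-algebra containing the Borel sets.\<close>

lemma measure_space_hausdorff: "measure_space UNIV (sets borel) (hausdorff_outer_measure k :: 'a::metric_space set \<Rightarrow> ennreal)"
proof -
  let ?H = "hausdorff_outer_measure k :: 'a set \<Rightarrow> ennreal"
  interpret P: sigma_algebra UNIV "Pow UNIV :: 'a set set" by (rule sigma_algebra_Pow)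
  have oms: "outer_measure_space (Pow UNIV) ?H"
    unfolding outer_measure_space_def positive_def increasing_def countably_subadditive_def
    by (auto intro: hausdorff_outer_mono hausdorff_outer_UN)
  have ms: "measure_space UNIV (lambda_system UNIV (Pow UNIV) ?H) ?H"
    by (rule P.caratheodory_lemma[OF oms])
  have "closed F \<Longrightarrow> F \<in> lambda_system UNIV (Pow UNIV) ?H" for F :: "'a set"
  proof -
    assume F: "closed F"
    have "?H (F \<inter> A) + ?H ((UNIV - F) \<inter> A) = ?H A" for A
    proof (rule antisym)
      have "(UNIV - F) \<inter> A = A - F" by auto
      then show "?H (F \<inter> A) + ?H ((UNIV - F) \<inter> A) \<le> ?H A"
        using hausdorff_outer_closed_split[OF F, of k A] by simp
      have "A = (F \<inter> A) \<union> ((UNIV - F) \<inter> A)" by auto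
      then show "?H A \<le> ?H (F \<inter> A) + ?H ((UNIV - F) \<inter> A)"
        using hausdorff_outer_Un[of k "F \<inter> A" "(UNIV - F) \<inter> A"] by simp
    qed
    then show ?thesis by (simp add: lambda_system_def)
  qed
  then have "sigma_sets UNIV (Collect closed) \<subseteq> lambda_system UNIV (Pow UNIV) ?H"
    using ms by (intro sigma_algebra.sigma_sets_subset) (auto simp: measure_space_def)
  then have "sets borel \<subseteq> lambda_system UNIV (Pow UNIV) ?H"
    by (simp add: borel_eq_closed)
  then show ?thesis
    using measure_down[OF ms] sets.sigma_algebra_axioms[of "borel :: 'a measure"] by simp
qed

lemma sets_hausdorff_measure [measurable_cong, simp]: "sets (hausdorff_measure k) = sets borel"
  using sets.sigma_sets_eq[of borel] unfolding hausdorff_measure_def by (simp add: sets_measure_of_conv)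

lemma space_hausdorff_measure [simp]: "space (hausdorff_measure k) = UNIV"
  by (simp add: hausdorff_measure_def space_measure_of_conv)

lemma emeasure_hausdorff_measure: "A \<in> sets borel \<Longrightarrow> emeasure (hausdorff_measure k) A = hausdorff_outer_measure k A"
  unfolding hausdorff_measure_def using measure_space_hausdorff[of k, unfolded measure_space_def]
  by (intro emeasure_measure_of_sigma) (auto simp: measure_space_def)

text \<open>Only the traces of the covering sets on \<open>A\<close> are mapped, because
  \<open>f\<close> is Lipschitz on \<open>A\<close> alone.\<close>

lemma hausdorff_content_lipschitz_image:
  fixes f :: "'a::metric_space \<Rightarrow> 'b::metric_space"
  assumes lip: "\<And>x y. x \<in> A \<Longrightarrow> y \<in> A \<Longrightarrow> dist (f x) (f y) \<le> L * dist x y" and L: "L > 0"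
    and "\<delta> > 0"
  shows "hausdorff_content k (L * \<delta>) (f ` A) \<le> ennreal (L ^ k) * hausdorff_content k \<delta> A"
proof -
    define \<delta>' where "\<delta>' = L * \<delta>"
    have d: "\<delta> > 0" "L * \<delta> = \<delta>'" and d': "\<delta>' > 0" using L \<open>\<delta> > 0\<close> by (auto simp: \<delta>'_def)
    have "hausdorff_content k \<delta>' (f ` A) \<le> ennreal (L^k) * (\<Sum>i. cover_cost k (C i))" if C: "admissible_cover \<delta> A C" for C
    proof -
      define E where "E i = f ` (C i \<inter> A)" for i
      have dist: "dist u v \<le> L * diameter (C i)" if uv: "u \<in> E i" "v \<in> E i" for i u v
      proof -
        from uv obtain x y where xy: "x \<in> C i \<inter> A" "y \<in> C i \<inter> A" "u = f x" "v = f y" by (auto simp: E_def)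
        have "dist u v \<le> L * dist x y" using lip xy by auto
        also have "\<dots> \<le> L * diameter (C i)"
          using C xy L by (intro mult_left_mono diameter_bounded_bound) (auto simp: admissible_cover_def)
        finally show ?thesis .
      qed
      have bd: "bounded (E i)" for i
        unfolding bounded_two_points using dist by blast
      have dia: "E i \<noteq> {} \<Longrightarrow> diameter (E i) \<le> L * diameter (C i)" for i
        unfolding diameter_def[of "E i"] using dist[of _ i] by (auto intro!: cSUP_least)
      have dC: "0 \<le> diameter (C i)" "diameter (C i) \<le> \<delta>" for i
        using C by (auto simp: admissible_cover_def diameter_ge_0)
      have dia2: "diameter (E i) \<le> \<delta>'" for i
        using dia[of i] dC[of i] d d' L mult_left_mono[of "diameter (C i)" \<delta> L] by (cases "E i = {}") auto
      have "f ` A \<subseteq> (\<Union>i. E i)" using C by (fastforce simp: admissible_cover_def E_def)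
      then have adm: "admissible_cover \<delta>' (f ` A) E"
        using dia2 bd by (auto simp: admissible_cover_def)
      have cost: "cover_cost k (E i) \<le> ennreal (L^k) * cover_cost k (C i)" for i
      proof (cases "E i = {}")
        case False
        then have ne: "C i \<noteq> {}" by (auto simp: E_def)
        have "(diameter (E i) / 2) ^ k \<le> (L * diameter (C i) / 2) ^ k"
          using dia[OF False] diameter_ge_0[OF bd[of i]] by (intro power_mono) auto
        then have "unit_ball_vol (real k) * (diameter (E i) / 2) ^ k \<le> L ^ k * (unit_ball_vol (real k) * (diameter (C i) / 2) ^ k)"
          using mult_left_mono[of _ _ "unit_ball_vol (real k)"] by (fastforce simp: field_simps power_mult_distrib)
        then show ?thesis using False ne dC(1)[of i] L
          by (simp add: cover_cost_def ennreal_mult[symmetric] ennreal_leI)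
      qed simp
      have "hausdorff_content k \<delta>' (f ` A) \<le> (\<Sum>i. cover_cost k (E i))"
        by (rule hausdorff_content_le[OF adm])
      also have "\<dots> \<le> (\<Sum>i. ennreal (L^k) * cover_cost k (C i))"
        by (intro suminf_le cost) auto
      finally show ?thesis by simp
    qed
    \<comment> \<open>The factor is moved to the left so that the infimum over covers can be taken
      on the right.\<close>
    then have "hausdorff_content k \<delta>' (f ` A) / ennreal (L^k) \<le> hausdorff_content k \<delta> A"
      using L by (intro hausdorff_content_ge divide_le_posI_ennreal) (auto simp: mult.commute)
    then have "ennreal (L^k) * (hausdorff_content k \<delta>' (f ` A) / ennreal (L^k)) \<le> ennreal (L^k) * hausdorff_content k \<delta> A"
      by (rule mult_left_mono) simp
    then show ?thesis using L d
      by (simp add: ennreal_times_divide ennreal_mult_divide_eq mult.commute[of "ennreal (L^k)"] ennreal_mult_divide_eq)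
qed

lemma hausdorff_outer_lipschitz_image:
  fixes f :: "'a::metric_space \<Rightarrow> 'b::metric_space"
  assumes lip: "\<And>x y. x \<in> A \<Longrightarrow> y \<in> A \<Longrightarrow> dist (f x) (f y) \<le> L * dist x y" and L: "L > 0"
  shows "hausdorff_outer_measure k (f ` A) \<le> ennreal (L ^ k) * hausdorff_outer_measure k A"
proof -
  have "hausdorff_content k \<delta> (f ` A) \<le> ennreal (L ^ k) * hausdorff_outer_measure k A" if d: "\<delta> > 0" for \<delta>
  proof -
    have "hausdorff_content k (L * (\<delta> / L)) (f ` A) \<le> ennreal (L ^ k) * hausdorff_content k (\<delta> / L) A"
      using L d by (intro hausdorff_content_lipschitz_image lip) auto
    also have "\<dots> \<le> ennreal (L ^ k) * hausdorff_outer_measure k A"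
      using L d by (intro mult_left_mono hausdorff_content_le_outer) auto
    finally show ?thesis using L by simp
  qed
  then show ?thesis
    unfolding hausdorff_outer_measure_def[of k "f ` A"] by (auto intro!: SUP_least)
qed

lemma hausdorff_outer_isometry:
  assumes "\<And>x y. x \<in> A \<Longrightarrow> y \<in> A \<Longrightarrow> dist (f x) (f y) = dist x y"
  shows "hausdorff_outer_measure k (f ` A) = hausdorff_outer_measure k A"
proof (rule antisym)
  show "hausdorff_outer_measure k (f ` A) \<le> hausdorff_outer_measure k A"
    using hausdorff_outer_lipschitz_image[of A f 1 k] assms by simp
  have inj: "inj_on f A" using assms by (metis dist_eq_0_iff inj_onI)
  have "dist (inv_into A f x) (inv_into A f y) \<le> 1 * dist x y" if "x \<in> f ` A" "y \<in> f ` A" for x y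
    using that assms by (auto simp: inv_into_f_f[OF inj])
  from hausdorff_outer_lipschitz_image[OF this, of "f ` A" k]
  have "hausdorff_outer_measure k (inv_into A f ` (f ` A)) \<le> hausdorff_outer_measure k (f ` A)"
    by simp
  then show "hausdorff_outer_measure k A \<le> hausdorff_outer_measure k (f ` A)" using inj by simp
qed


section \<open>The isodiametric inequality\<close>

definition flip_closed :: "'i \<Rightarrow> ('i \<Rightarrow> real) set \<Rightarrow> bool" where
  "flip_closed j A \<longleftrightarrow> (\<forall>x\<in>A. x(j := - x j) \<in> A)"

definition fibre_length :: "'i \<Rightarrow> ('i \<Rightarrow> real) set \<Rightarrow> ('i \<Rightarrow> real) \<Rightarrow> ennreal" where
  "fibre_length i A x = (\<integral>\<^sup>+t. indicator A (x(i := t)) \<partial>lborel)"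

text \<open>Each line in direction \<open>i\<close> meets the new set in the open interval centred
  at 0 whose length is that of the old fibre. Comparing \<open>2 * \<bar>x i\<bar>\<close> with the
  length in \<open>ennreal\<close> includes fibres of infinite length.\<close>

definition steiner :: "'i set \<Rightarrow> 'i \<Rightarrow> ('i \<Rightarrow> real) set \<Rightarrow> ('i \<Rightarrow> real) set" where
  "steiner I i A = {x \<in> space (\<Pi>\<^sub>M j\<in>I. lborel). ennreal (2 * \<bar>x i\<bar>) < fibre_length i A x}"

lemma emeasure_lborel_centred: "emeasure lborel {t::real. ennreal (2 * \<bar>t\<bar>) < a} = a"
proof (cases a)
  case (real r)
  have "{t::real. ennreal (2 * \<bar>t\<bar>) < a} = {-r/2<..<r/2}"
    using real by (auto simp: ennreal_less_iff)
  then show ?thesis using real by simp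
next
  case top
  then have "{t::real. ennreal (2 * \<bar>t\<bar>) < a} = UNIV" by auto
  then show ?thesis using top by simp
qed

context
  fixes I :: "'i set" and i :: 'i
  assumes I: "finite I" "i \<in> I"
begin

lemma measurable_fibre_length [measurable]:
  assumes [measurable]: "A \<in> sets (\<Pi>\<^sub>M j\<in>I. lborel)"
  shows "fibre_length i A \<in> borel_measurable (\<Pi>\<^sub>M j\<in>I. lborel)"
proof -
  have [measurable]: "(\<lambda>(f, y). f(i := y)) \<in> measurable ((\<Pi>\<^sub>M j\<in>I. lborel) \<Otimes>\<^sub>M lborel) (\<Pi>\<^sub>M j\<in>I. lborel :: real measure)"
    using measurable_add_dim[of i I "\<lambda>_. lborel :: real measure"] I by (simp add: insert_absorb)
  show ?thesis
    unfolding fibre_length_def by (intro lborel.borel_measurable_nn_integral) measurable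
qed

lemma steiner_sets:
  assumes [measurable]: "A \<in> sets (\<Pi>\<^sub>M j\<in>I. lborel)"
  shows "steiner I i A \<in> sets (\<Pi>\<^sub>M j\<in>I. lborel)"
proof -
  have [measurable]: "(\<lambda>x. x i) \<in> borel_measurable (\<Pi>\<^sub>M j\<in>I. lborel :: real measure)"
    using measurable_component_singleton[of i I "\<lambda>_. lborel :: real measure"] I by simp
  show ?thesis unfolding steiner_def by measurable
qed

lemma emeasure_PiM_fibres:
  assumes [measurable]: "A \<in> sets (\<Pi>\<^sub>M j\<in>I. lborel)"
  shows "emeasure (\<Pi>\<^sub>M j\<in>I. lborel) A = (\<integral>\<^sup>+f. fibre_length i A f \<partial>(\<Pi>\<^sub>M j\<in>I-{i}. lborel))"
proof -
  interpret product_sigma_finite "\<lambda>_::'i. lborel :: real measure" ..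
  have eq: "I = insert i (I - {i})" using I by auto
  have "emeasure (\<Pi>\<^sub>M j\<in>I. lborel) A = (\<integral>\<^sup>+x. indicator A x \<partial>(\<Pi>\<^sub>M j\<in>I. lborel))"
    by simp
  also have "\<dots> = (\<integral>\<^sup>+x. indicator A x \<partial>(\<Pi>\<^sub>M j\<in>insert i (I - {i}). lborel))"
    using eq by simp
  also have "\<dots> = (\<integral>\<^sup>+f. fibre_length i A f \<partial>(\<Pi>\<^sub>M j\<in>I-{i}. lborel))"
    unfolding fibre_length_def
    by (rule product_nn_integral_insert) (use I assms eq in auto)
  finally show ?thesis .
qed

lemma fibre_length_upd: "fibre_length i A (x(i := t)) = fibre_length i A x"
  by (simp add: fibre_length_def)

text \<open>Fibre lengths are preserved, and the volume is the integral of fibre lengths.\<close>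

lemma emeasure_steiner:
  assumes A: "A \<in> sets (\<Pi>\<^sub>M j\<in>I. lborel)"
  shows "emeasure (\<Pi>\<^sub>M j\<in>I. lborel) (steiner I i A) = emeasure (\<Pi>\<^sub>M j\<in>I. lborel) A"
proof -
  have "fibre_length i (steiner I i A) f = fibre_length i A f" if f: "f \<in> space (\<Pi>\<^sub>M j\<in>I-{i}. lborel)" for f
  proof -
    have "f(i := t) \<in> space (\<Pi>\<^sub>M j\<in>I. lborel :: real measure)" for t
      using f I by (auto simp: space_PiM PiE_iff extensional_def)
    then have "fibre_length i (steiner I i A) f = (\<integral>\<^sup>+t. indicator {t. ennreal (2 * \<bar>t\<bar>) < fibre_length i A f} t \<partial>lborel)"
      unfolding fibre_length_def[of i "steiner I i A"]
      by (intro nn_integral_cong) (simp add: steiner_def fibre_length_upd indicator_def)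
    also have "\<dots> = fibre_length i A f"
      by (subst nn_integral_indicator) (auto simp: emeasure_lborel_centred)
    finally show ?thesis .
  qed
  then show ?thesis
    using A by (simp add: emeasure_PiM_fibres steiner_sets cong: nn_integral_cong)
qed

lemma flip_closed_steiner_same: "flip_closed i (steiner I i A)"
  using I by (auto simp: flip_closed_def steiner_def fibre_length_upd space_PiM PiE_iff extensional_def)

text \<open>Reflecting coordinate \<open>j\<close> carries lines in direction \<open>i\<close> to
  lines with equal fibre length. Hence symmetries gained earlier survive when the coordinates are
  treated one after the other.\<close>

lemma flip_closed_steiner_other:
  assumes "flip_closed j A" "j \<in> I" "j \<noteq> i"
  shows "flip_closed j (steiner I i A)"
proof -
  have "x(j := - x j) \<in> A \<longleftrightarrow> x \<in> A" for x
    using assms(1) fun_upd_upd[of x j "- x j" "x j"] unfolding flip_closed_def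
    by (metis add.inverse_inverse fun_upd_same fun_upd_triv fun_upd_upd)
  then have "indicator A (x(j := - x j, i := t)) = (indicator A (x(i := t)) :: ennreal)" for x t
    using assms(3) by (metis fun_upd_other fun_upd_twist indicator_simps)
  then have "fibre_length i A (x(j := - x j)) = fibre_length i A x" for x
    by (simp add: fibre_length_def)
  then show ?thesis
    using assms by (auto simp: flip_closed_def steiner_def space_PiM PiE_iff extensional_def)
qed

lemma steiner_fibre_gap:
  fixes S :: "real set"
  assumes S: "S \<noteq> {}" "bdd_above S" "bdd_below S" and l: "ennreal l < emeasure lborel S" "l \<ge> 0" "S \<in> sets borel"
  shows "l < Sup S - Inf S"
proof -
  have "S \<subseteq> {Inf S..Sup S}" using S by (auto intro: cInf_lower cSup_upper)
  then have "emeasure lborel S \<le> emeasure lborel {Inf S..Sup S}" by (intro emeasure_mono) auto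
  also have "\<dots> = ennreal (Sup S - Inf S)" using cInf_le_cSup[OF S] by simp
  finally show ?thesis using l by (metis ennreal_less_iff order.strict_trans2)
qed

text \<open>Two symmetrized points are compared with points of \<open>A\<close> on the same two
  lines, chosen near opposite ends of their fibres: these are at least as far apart in coordinate
  \<open>i\<close> and agree with the given ones in all other coordinates.\<close>

lemma steiner_diameter:
  assumes A[measurable]: "A \<in> sets (\<Pi>\<^sub>M j\<in>I. lborel)"
    and D: "\<And>x y. x \<in> A \<Longrightarrow> y \<in> A \<Longrightarrow> (\<Sum>j\<in>I. (x j - y j)\<^sup>2) \<le> D"
    and x: "x \<in> steiner I i A" and y: "y \<in> steiner I i A"
  shows "(\<Sum>j\<in>I. (x j - y j)\<^sup>2) \<le> D"
proof -
  define F where "F z = {t. z(i := t) \<in> A}" for z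
  have upd: "(\<Sum>j\<in>I. ((u(i:=s)) j - (w(i:=t)) j)\<^sup>2) = (s - t)\<^sup>2 + (\<Sum>j\<in>I-{i}. (u j - w j)\<^sup>2)" for u w s t
    using I by (subst sum.remove[of _ i]) (auto intro!: sum.cong)
  have F: "F z \<noteq> {} \<and> bdd_above (F z) \<and> bdd_below (F z) \<and> 2 * \<bar>z i\<bar> < Sup (F z) - Inf (F z)"
    if z: "z \<in> steiner I i A" for z
  proof -
    have zs: "z \<in> space (\<Pi>\<^sub>M j\<in>I. lborel)" using z by (simp add: steiner_def)
    have "(\<lambda>t. z(i := t)) \<in> measurable lborel (\<Pi>\<^sub>M j\<in>I. lborel :: real measure)"
      using zs I by (intro measurable_PiM_single') (auto simp: space_PiM PiE_iff extensional_def fun_upd_def)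
    from measurable_sets[OF this A] have Fs: "F z \<in> sets borel" by (simp add: F_def vimage_def)
    have len: "fibre_length i A z = emeasure lborel (F z)"
    proof -
      have "fibre_length i A z = (\<integral>\<^sup>+t. indicator (F z) t \<partial>lborel)"
        unfolding fibre_length_def by (intro nn_integral_cong) (simp add: F_def indicator_def)
      then show ?thesis using Fs by simp
    qed
    then have l: "ennreal (2 * \<bar>z i\<bar>) < emeasure lborel (F z)" using z by (simp add: steiner_def)
    then have ne: "F z \<noteq> {}" by auto
    then obtain t where t: "t \<in> F z" by auto
    have "\<bar>s - t\<bar> \<le> sqrt D" if "s \<in> F z" for s
    proof -
      have "(s - t)\<^sup>2 \<le> (s - t)\<^sup>2 + (\<Sum>j\<in>I-{i}. (z j - z j)\<^sup>2)" by (simp add: sum_nonneg)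
      also have "\<dots> \<le> D" using D[of "z(i:=s)" "z(i:=t)"] that t by (simp only: upd F_def mem_Collect_eq)
      finally show ?thesis by (simp add: real_le_rsqrt)
    qed
    then have "bdd_above (F z)" "bdd_below (F z)"
      by (fastforce intro!: bdd_aboveI[of _ "t + sqrt D"], fastforce intro!: bdd_belowI[of _ "t - sqrt D"])
    then show ?thesis using steiner_fibre_gap[OF ne _ _ l _ Fs] ne by auto
  qed
  have main: "(\<Sum>j\<in>I. (u j - w j)\<^sup>2) \<le> D"
    if u: "u \<in> steiner I i A" and w: "w \<in> steiner I i A" and lt: "\<bar>u i - w i\<bar> < Sup (F u) - Inf (F w)" for u w
  proof -
    have "Inf (F w) + \<bar>u i - w i\<bar> < Sup (F u)" using lt by simp
    then obtain s where s: "s \<in> F u" "Inf (F w) + \<bar>u i - w i\<bar> < s"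
      using F[OF u] by (subst (asm) less_cSup_iff) auto
    then have "Inf (F w) < s - \<bar>u i - w i\<bar>" by simp
    then obtain t where t: "t \<in> F w" "t < s - \<bar>u i - w i\<bar>"
      using F[OF w] by (subst (asm) cInf_less_iff) auto
    have "(u i - w i)\<^sup>2 \<le> (s - t)\<^sup>2" using t by (intro power2_le_iff_abs_le[THEN iffD2]) auto
    then have "(\<Sum>j\<in>I. (u j - w j)\<^sup>2) \<le> (\<Sum>j\<in>I. ((u(i:=s)) j - (w(i:=t)) j)\<^sup>2)"
      using upd[of u "u i" w "w i"] upd[of u s w t] by simp
    also have "\<dots> \<le> D" using D[of "u(i := s)" "w(i := t)"] s t unfolding F_def by blast
    finally show ?thesis .
  qed
  \<comment> \<open>The two right-hand sides add up to the spans of both fibres, which exceed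
    \<open>2 * \<bar>x i\<bar> + 2 * \<bar>y i\<bar>\<close>, so at least one of them is large
    enough.\<close>
  have "\<bar>x i - y i\<bar> < Sup (F x) - Inf (F y) \<or> \<bar>y i - x i\<bar> < Sup (F y) - Inf (F x)"
    using F[OF x] F[OF y] by linarith
  then show ?thesis
  proof
    assume "\<bar>y i - x i\<bar> < Sup (F y) - Inf (F x)"
    then have "(\<Sum>j\<in>I. (y j - x j)\<^sup>2) \<le> D" by (rule main[OF y x])
    then show ?thesis by (simp add: power2_commute)
  qed (rule main[OF x y])
qed

end

lemma flip_closed_many:
  assumes "finite J" "\<And>j. j \<in> J \<Longrightarrow> flip_closed j B" "x \<in> B"
  shows "(\<lambda>j. if j \<in> J then - x j else x j) \<in> B"
  using assms
proof (induction J)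
  case (insert j J)
  let ?x = "\<lambda>j. if j \<in> J then - x j else x j"
  have "?x(j := - ?x j) \<in> B" using insert unfolding flip_closed_def by blast
  also have "?x(j := - ?x j) = (\<lambda>l. if l \<in> insert j J then - x l else x l)"
    using insert by auto
  finally show ?case .
qed simp

text \<open>Steiner symmetrization in all coordinates makes the set centrally symmetric without increasing its
  diameter, so that it lies in a ball of half that diameter.\<close>

lemma isodiametric_PiM:
  fixes I :: "'i set"
  assumes I: "finite I" and A: "A \<in> sets (\<Pi>\<^sub>M j\<in>I. lborel)" and r: "r > 0"
    and D: "\<And>x y. x \<in> A \<Longrightarrow> y \<in> A \<Longrightarrow> (\<Sum>j\<in>I. (x j - y j)\<^sup>2) \<le> (2 * r)\<^sup>2"
  shows "emeasure (\<Pi>\<^sub>M j\<in>I. lborel) A \<le> ennreal (unit_ball_vol (real (card I)) * r ^ card I)"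
proof -
  let ?M = "\<Pi>\<^sub>M j\<in>I. lborel :: real measure"
  have "\<exists>B\<in>sets ?M. emeasure ?M B = emeasure ?M A \<and> (\<forall>j\<in>J. flip_closed j B) \<and>
      (\<forall>x\<in>B. \<forall>y\<in>B. (\<Sum>j\<in>I. (x j - y j)\<^sup>2) \<le> (2 * r)\<^sup>2)" if "finite J" "J \<subseteq> I" for J
    using that
  proof (induction J)
    case empty
    then show ?case using A D by auto
  next
    case (insert i J)
    then obtain B where B: "B \<in> sets ?M" "emeasure ?M B = emeasure ?M A" "\<forall>j\<in>J. flip_closed j B"
      and D': "\<And>x y. x\<in>B \<Longrightarrow> y\<in>B \<Longrightarrow> (\<Sum>j\<in>I. (x j - y j)\<^sup>2) \<le> (2 * r)\<^sup>2" by auto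
    have i: "i \<in> I" using insert by auto
    show ?case
    proof (intro bexI[of _ "steiner I i B"] conjI ballI)
      show "steiner I i B \<in> sets ?M" using steiner_sets[OF I i B(1)] .
      show "emeasure ?M (steiner I i B) = emeasure ?M A" using emeasure_steiner[OF I i B(1)] B by simp
      fix j assume j: "j \<in> insert i J"
      show "flip_closed j (steiner I i B)"
      proof (cases "j = i")
        case True then show ?thesis using flip_closed_steiner_same[OF I i] by simp
      next
        case False
        then show ?thesis using j B(3) insert(4) by (intro flip_closed_steiner_other[OF I i]) auto
      qed
    next
      fix x y assume "x \<in> steiner I i B" "y \<in> steiner I i B"
      then show "(\<Sum>j\<in>I. (x j - y j)\<^sup>2) \<le> (2 * r)\<^sup>2"
        using steiner_diameter[OF I i B(1), of "(2*r)\<^sup>2"] D' by blast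
    qed
  qed
  from this[OF I order_refl] obtain B where B: "B \<in> sets ?M" "emeasure ?M B = emeasure ?M A"
      "\<And>j. j \<in> I \<Longrightarrow> flip_closed j B"
      and D': "\<And>x y. x\<in>B \<Longrightarrow> y\<in>B \<Longrightarrow> (\<Sum>j\<in>I. (x j - y j)\<^sup>2) \<le> (2 * r)\<^sup>2" by auto
  have "sqrt (\<Sum>j\<in>I. (x j)\<^sup>2) \<le> r" if x: "x \<in> B" for x
  proof -
    have "(\<lambda>j. if j \<in> I then - x j else x j) \<in> B" by (rule flip_closed_many[OF I B(3) x])
    from D'[OF x this] have "(\<Sum>j\<in>I. (2 * x j)\<^sup>2) \<le> (2 * r)\<^sup>2" by simp
    then have "(\<Sum>j\<in>I. (x j)\<^sup>2) \<le> r\<^sup>2" by (simp add: power_mult_distrib sum_distrib_left[symmetric])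
    then show ?thesis using r by (simp add: real_le_lsqrt)
  qed
  then have sub: "B \<subseteq> {f. sqrt (\<Sum>i\<in>I. (f i)\<^sup>2) \<le> r} \<inter> space ?M" (is "_ \<subseteq> ?E")
    using sets.sets_into_space[OF B(1)] by auto
  have E: "emeasure ?M ?E = ennreal (unit_ball_vol (real (card I)) * r ^ card I)"
    by (rule emeasure_cball_aux[OF I r])
  have "?E = {f \<in> space ?M. sqrt (\<Sum>i\<in>I. (f i)\<^sup>2) \<le> r}" by auto
  also have "\<dots> \<in> sets ?M" by measurable
  finally have "emeasure ?M B \<le> emeasure ?M ?E" using sub by (intro emeasure_mono)
  then show ?thesis using B E by simp
qed

section \<open>Hyperplanes and translation-invariant measures\<close>

definition hyperplane :: "'a::euclidean_space \<Rightarrow> 'a set" where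
  "hyperplane m = {x. x \<bullet> m = 0}"

lemma closed_hyperplane0 [simp]: "closed (hyperplane m)"
  unfolding hyperplane_def inner_commute[of _ m] by (rule closed_hyperplane)

lemma hyperplane_borel [measurable, simp]: "hyperplane m \<in> sets borel"
  by (rule borel_closed) simp

lemma emeasure_hausdorff_isometry:
  assumes A: "A \<in> sets borel" "f ` A \<in> sets borel" "\<And>x y. x \<in> A \<Longrightarrow> y \<in> A \<Longrightarrow> dist (f x) (f y) = dist x y"
  shows "emeasure (hausdorff_measure k) (f ` A) = emeasure (hausdorff_measure k) A"
  using assms by (simp add: emeasure_hausdorff_measure hausdorff_outer_isometry)

lemma translation_borel:
  fixes A :: "'a::euclidean_space set"
  assumes "A \<in> sets borel" shows "(+) a ` A \<in> sets borel"
proof -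
  have "(+) a ` A = (\<lambda>x. x - a) -` A" by (auto simp: image_iff) (metis add.commute diff_add_cancel)
  moreover have "(\<lambda>x. x - a) \<in> borel_measurable borel" by measurable
  ultimately show ?thesis using measurable_sets[of "\<lambda>x. x - a" borel borel A] assms by simp
qed

lemma emeasure_hausdorff_translation:
  fixes A :: "'a::euclidean_space set"
  assumes "A \<in> sets borel"
  shows "emeasure (hausdorff_measure k) ((+) a ` A) = emeasure (hausdorff_measure k) A"
  using assms by (intro emeasure_hausdorff_isometry translation_borel) auto

text \<open>Evaluate the \<open>N \<Otimes> lborel\<close>-integral of \<open>1\<^sub>A(x + y) 1\<^sub>B(y)\<close> in both orders.\<close>

lemma translation_invariant_eq_lborel:
  fixes N :: "'a::euclidean_space measure"
  assumes N[simp, measurable_cong]: "sets N = sets borel" and sf: "sigma_finite_measure N"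
    and inv: "\<And>a A. A \<in> sets borel \<Longrightarrow> emeasure N ((\<lambda>x. x + a) -` A) = emeasure N A"
  shows "\<exists>c. \<forall>A\<in>sets borel. emeasure N A = c * emeasure lborel A"
proof -
  interpret N: sigma_finite_measure N by fact
  interpret P: pair_sigma_finite N lborel ..
  have spN[simp]: "space N = UNIV" using sets_eq_imp_space_eq[OF N] by simp
  \<comment> \<open>Any Borel set of Lebesgue measure 1 would serve; the \<open>N\<close>-measure of
    its reflection becomes the constant of proportionality.\<close>
  define B :: "'a set" where "B = box 0 One"
  have B[measurable]: "B \<in> sets borel" by (simp add: B_def)
  have B1: "emeasure lborel B = 1" by (simp add: B_def emeasure_lborel_box)
  have "emeasure N A = emeasure N (uminus -` B) * emeasure lborel A" if A[measurable]: "A \<in> sets borel" for A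
  proof -
    have "emeasure N A = (\<integral>\<^sup>+y. emeasure N A * indicator B y \<partial>lborel)"
      by (subst nn_integral_cmult) (auto simp: B1)
    also have "\<dots> = (\<integral>\<^sup>+y. (\<integral>\<^sup>+x. indicator A (x + y) * indicator B y \<partial>N) \<partial>lborel)"
    proof (rule nn_integral_cong)
      fix y :: 'a
      have "(\<lambda>x. x + y) \<in> borel_measurable borel"
        by (intro borel_measurable_continuous_onI continuous_intros)
      from measurable_sets[OF this A] have m: "(\<lambda>x. x + y) -` A \<in> sets N" by simp
      have "(\<integral>\<^sup>+x. indicator A (x + y) * indicator B y \<partial>N) = (\<integral>\<^sup>+x. indicator ((\<lambda>x. x + y) -` A) x * indicator B y \<partial>N)"
        by (intro nn_integral_cong) (auto simp: indicator_def)
      also have "\<dots> = emeasure N A * indicator B y"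
        using m by (subst nn_integral_multc) (auto simp: inv)
      finally show "emeasure N A * indicator B y = (\<integral>\<^sup>+x. indicator A (x + y) * indicator B y \<partial>N)" by simp
    qed
    also have "\<dots> = (\<integral>\<^sup>+x. (\<integral>\<^sup>+y. indicator A (x + y) * indicator B y \<partial>lborel) \<partial>N)"
      by (rule P.Fubini') measurable
    also have "\<dots> = (\<integral>\<^sup>+x. (\<integral>\<^sup>+y. indicator A y * indicator B (y - x) \<partial>lborel) \<partial>N)"
    proof (rule nn_integral_cong)
      fix x :: 'a
      have "(\<integral>\<^sup>+y. indicator A y * indicator B (y - x) \<partial>lborel) = (\<integral>\<^sup>+y. indicator A y * indicator B (y - x) \<partial>distr lborel borel ((+) x))"
        by (simp add: lborel_distr_plus)
      also have "\<dots> = (\<integral>\<^sup>+y. indicator A (x + y) * indicator B y \<partial>lborel)"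
        by (subst nn_integral_distr) (auto simp: add.commute)
      finally show "(\<integral>\<^sup>+y. indicator A (x + y) * indicator B y \<partial>lborel) = (\<integral>\<^sup>+y. indicator A y * (indicator B (y - x)::ennreal) \<partial>lborel)"
        by simp
    qed
    also have "\<dots> = (\<integral>\<^sup>+y. (\<integral>\<^sup>+x. indicator A y * indicator B (y - x) \<partial>N) \<partial>lborel)"
      by (rule P.Fubini'[symmetric]) measurable
    also have "\<dots> = (\<integral>\<^sup>+y. emeasure N (uminus -` B) * indicator A y \<partial>lborel)"
    proof (rule nn_integral_cong)
      fix y :: 'a
      have "(uminus :: 'a \<Rightarrow> 'a) \<in> borel_measurable borel"
        by (intro borel_measurable_continuous_onI continuous_intros)
      from measurable_sets[OF this B] have m: "uminus -` B \<in> sets borel" by simp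
      have "(\<lambda>x. x + (- y)) \<in> borel_measurable borel"
        by (intro borel_measurable_continuous_onI continuous_intros)
      from measurable_sets[OF this m] have m': "(\<lambda>x. x + (- y)) -` (uminus -` B) \<in> sets N" by simp
      have "(\<integral>\<^sup>+x. indicator A y * indicator B (y - x) \<partial>N) = (\<integral>\<^sup>+x. indicator A y * indicator ((\<lambda>x. x + (- y)) -` (uminus -` B)) x \<partial>N)"
        by (intro nn_integral_cong) (auto simp: indicator_def)
      also have "\<dots> = indicator A y * emeasure N (uminus -` B)"
        using m' inv[OF m, of "- y"] by (subst nn_integral_cmult) auto
      finally show "(\<integral>\<^sup>+x. indicator A y * indicator B (y - x) \<partial>N) = emeasure N (uminus -` B) * indicator A y"
        by (simp add: mult.commute)
    qed
    also have "\<dots> = emeasure N (uminus -` B) * emeasure lborel A"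
      by (subst nn_integral_cmult) auto
    finally show ?thesis .
  qed
  then show ?thesis by blast
qed

lemma two_power_ennreal: "(2::ennreal) ^ n = ennreal (2 ^ n)"
  by (metis ennreal_numeral ennreal_power zero_le_numeral)

section \<open>Coordinate hyperplanes\<close>

context
  fixes b :: "'a::euclidean_space"
  assumes b: "b \<in> Basis"
begin

definition base_point :: "('a \<Rightarrow> real) \<Rightarrow> 'a" where
  "base_point f = (\<Sum>i\<in>Basis-{b}. f i *\<^sub>R i)"

text \<open>This is Lebesgue measure of dimension \<open>DIM('a) - 1\<close> on the coordinate
  hyperplane orthogonal to \<open>b\<close>, realized as a product over the remaining
  coordinates.\<close>

definition base_measure :: "'a set \<Rightarrow> ennreal" where
  "base_measure Q = emeasure (\<Pi>\<^sub>M i\<in>Basis-{b}. lborel) {f \<in> space (\<Pi>\<^sub>M i\<in>Basis-{b}. lborel :: real measure). base_point f \<in> Q}"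

definition base_cube :: "real \<Rightarrow> 'a set" where
  "base_cube r = {x \<in> hyperplane b. \<forall>i\<in>Basis-{b}. 0 \<le> x \<bullet> i \<and> x \<bullet> i \<le> r}"

lemma measurable_base_point [measurable]: "base_point \<in> measurable (\<Pi>\<^sub>M i\<in>Basis-{b}. lborel) borel"
  unfolding base_point_def by measurable

lemma base_point_inner:
  assumes i: "i \<in> Basis"
  shows "base_point f \<bullet> i = (if i = b then 0 else f i)"
proof -
  have "base_point f \<bullet> i = (\<Sum>j\<in>Basis-{b}. if j = i then f j else 0)"
    unfolding base_point_def inner_sum_left using i by (intro sum.cong) (auto simp: inner_Basis)
  also have "\<dots> = (if i = b then 0 else f i)" using i by simp
  finally show ?thesis .
qed

lemma base_point_hyperplane: "base_point f \<in> hyperplane b"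
  using base_point_inner[OF b] by (simp add: hyperplane_def)

lemma base_point_dist: "dist (base_point f) (base_point g) = sqrt (\<Sum>i\<in>Basis-{b}. (f i - g i)\<^sup>2)"
proof -
  have "dist (base_point f) (base_point g) = sqrt (\<Sum>i\<in>Basis. ((base_point f - base_point g) \<bullet> i)\<^sup>2)"
    by (subst euclidean_dist_l2) (simp add: L2_set_def dist_real_def inner_diff_left)
  also have "(\<Sum>i\<in>Basis. ((base_point f - base_point g) \<bullet> i)\<^sup>2) = (\<Sum>i\<in>Basis-{b}. (f i - g i)\<^sup>2)"
    using b by (subst sum.remove[of _ b]) (auto simp: inner_diff_left base_point_inner intro!: sum.cong)
  finally show ?thesis .
qed

text \<open>A slab of thickness 1 translates between volume and base measure. The same slab,
  measured by Hausdorff measure times length, gives the Hausdorff measure of its base, which is how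
  the two are compared.\<close>

lemma lborel_slab:
  assumes Q[measurable]: "Q \<in> sets borel"
  shows "emeasure lborel {x. 0 \<le> x \<bullet> b \<and> x \<bullet> b < 1 \<and> x - (x \<bullet> b) *\<^sub>R b \<in> Q} = base_measure Q"
proof -
  interpret product_sigma_finite "\<lambda>_::'a. lborel :: real measure" ..
  let ?C = "{x. 0 \<le> x \<bullet> b \<and> x \<bullet> b < 1 \<and> x - (x \<bullet> b) *\<^sub>R b \<in> Q}"
  have C[measurable]: "?C \<in> sets borel" by measurable
  have eq: "Basis = insert b (Basis - {b})" using b by auto
  let ?F = "\<lambda>f. indicator ?C (\<Sum>i\<in>Basis. f i *\<^sub>R i) :: ennreal"
  have m: "?F \<in> borel_measurable (\<Pi>\<^sub>M i\<in>Basis. lborel)" by measurable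
  have "emeasure lborel ?C = (\<integral>\<^sup>+x. indicator ?C x \<partial>lborel)" by simp
  also have "\<dots> = (\<integral>\<^sup>+f. ?F f \<partial>(\<Pi>\<^sub>M i\<in>Basis. lborel))"
    by (subst lborel_eq, rule nn_integral_distr) measurable
  also have "\<dots> = (\<integral>\<^sup>+f. ?F f \<partial>(\<Pi>\<^sub>M i\<in>insert b (Basis-{b}). lborel))"
    using eq by simp
  also have "\<dots> = (\<integral>\<^sup>+f. (\<integral>\<^sup>+t. ?F (f(b := t)) \<partial>lborel) \<partial>(\<Pi>\<^sub>M i\<in>Basis-{b}. lborel))"
    by (rule product_nn_integral_insert) (use m eq in auto)
  also have "\<dots> = (\<integral>\<^sup>+f. indicator {f \<in> space (\<Pi>\<^sub>M i\<in>Basis-{b}. lborel :: real measure). base_point f \<in> Q} f \<partial>(\<Pi>\<^sub>M i\<in>Basis-{b}. lborel))"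
  proof (rule nn_integral_cong)
    fix f assume f: "f \<in> space (\<Pi>\<^sub>M i\<in>Basis-{b}. lborel :: real measure)"
    have s: "(\<Sum>i\<in>Basis. (f(b := t)) i *\<^sub>R i) = base_point f + t *\<^sub>R b" for t
      using b unfolding base_point_def by (subst sum.remove[of _ b]) (auto intro!: sum.cong)
    have "?F (f(b := t)) = indicator {0..<1} t * indicator Q (base_point f)" for t
      unfolding s using b base_point_hyperplane[of f]
      by (auto simp: indicator_def inner_add_left hyperplane_def)
    then show "(\<integral>\<^sup>+t. ?F (f(b := t)) \<partial>lborel) = indicator {f \<in> space (\<Pi>\<^sub>M i\<in>Basis-{b}. lborel :: real measure). base_point f \<in> Q} f"
      using f by (simp add: nn_integral_multc) (simp add: indicator_def)
  qed
  also have "\<dots> = base_measure Q"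
    unfolding base_measure_def by (rule nn_integral_indicator) measurable
  finally show ?thesis .
qed

text \<open>Covering sets need not be measurable; the closure is Borel and has the same
  diameter.\<close>

lemma base_measure_isodiametric:
  assumes E: "bounded E"
  shows "base_measure (closure E) \<le> cover_cost (DIM('a) - 1) E"
proof (cases "E = {}")
  case True
  then show ?thesis by (simp add: base_measure_def)
next
  case False
  let ?k = "DIM('a) - 1"
  have k: "card (Basis - {b}) = ?k" using b by simp
  let ?A = "{f \<in> space (\<Pi>\<^sub>M i\<in>Basis-{b}. lborel :: real measure). base_point f \<in> closure E}"
  have A: "?A \<in> sets (\<Pi>\<^sub>M i\<in>Basis-{b}. lborel :: real measure)"
  proof -
    have [measurable]: "closure E \<in> sets borel" by simp
    show ?thesis by measurable
  qed
  have d0: "diameter E \<ge> 0" using diameter_ge_0[OF E] .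
  \<comment> \<open>The isodiametric bound wants a positive radius, but a one-point set has diameter
    0; the radius is enlarged by \<open>e\<close>, which then tends to 0.\<close>
  have bound: "base_measure (closure E) \<le> ennreal (unit_ball_vol (real ?k) * (diameter E / 2 + e) ^ ?k)" if e: "e > 0" for e
  proof -
    have "(\<Sum>i\<in>Basis-{b}. (f i - g i)\<^sup>2) \<le> (2 * (diameter E / 2 + e))\<^sup>2" if f: "f \<in> ?A" and g: "g \<in> ?A" for f g
    proof -
      have "sqrt (\<Sum>i\<in>Basis-{b}. (f i - g i)\<^sup>2) \<le> diameter (closure E)"
        unfolding base_point_dist[symmetric] using f g E by (intro diameter_bounded_bound) auto
      also have "\<dots> \<le> 2 * (diameter E / 2 + e)" using e diameter_closure[OF E] by simp
      finally show ?thesis by (simp add: real_sqrt_le_iff' sqrt_le_D)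
    qed
    from isodiametric_PiM[OF _ A _ this] show ?thesis
      using d0 e k by (simp add: base_measure_def)
  qed
  have "((\<lambda>e. ennreal (unit_ball_vol (real ?k) * (diameter E / 2 + e) ^ ?k)) \<longlongrightarrow> ennreal (unit_ball_vol (real ?k) * (diameter E / 2 + 0) ^ ?k)) (at_right 0)"
    by (intro tendsto_intros)
  then have "base_measure (closure E) \<le> ennreal (unit_ball_vol (real ?k) * (diameter E / 2 + 0) ^ ?k)"
    by (rule tendsto_lowerbound) (use bound in \<open>auto simp del: of_nat_diff intro!: eventually_at_rightI[of 0 1]\<close>)
  then show ?thesis using False by (simp add: cover_cost_def)
qed

lemma base_cube_borel [measurable, simp]: "base_cube r \<in> sets borel"
proof -
  have "base_cube r = hyperplane b \<inter> (\<Inter>i\<in>Basis-{b}. {x. 0 \<le> x \<bullet> i} \<inter> {x. x \<bullet> i \<le> r})"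
    by (auto simp: base_cube_def)
  also have "closed \<dots>"
    by (intro closed_Int closed_INT closed_hyperplane0 ballI closed_Collect_le continuous_intros)
  finally show ?thesis by (rule borel_closed)
qed

lemma base_measure_cube: "r \<ge> 0 \<Longrightarrow> base_measure (base_cube r) = ennreal (r ^ (DIM('a) - 1))"
proof -
  assume r: "r \<ge> 0"
  interpret product_sigma_finite "\<lambda>_::'a. lborel :: real measure" ..
  have "{f \<in> space (\<Pi>\<^sub>M i\<in>Basis-{b}. lborel :: real measure). base_point f \<in> base_cube r} = (\<Pi>\<^sub>E i\<in>Basis-{b}. {0..r})"
    using base_point_hyperplane by (auto simp: base_cube_def base_point_inner space_PiM PiE_iff extensional_def)
  then have "base_measure (base_cube r) = (\<Prod>i\<in>Basis-{b}. emeasure lborel {0..r})"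
    by (simp add: base_measure_def emeasure_PiM)
  also have "\<dots> = ennreal (r ^ (DIM('a) - 1))"
    using r b by (simp add: ennreal_power)
  finally show ?thesis .
qed

lemma base_measure_ball:
  assumes "r > 0"
  shows "base_measure (hyperplane b \<inter> cball 0 r) = ennreal (unit_ball_vol (real (DIM('a) - 1)) * r ^ (DIM('a) - 1))"
proof -
  have "norm (base_point f) = sqrt (\<Sum>i\<in>Basis-{b}. (f i)\<^sup>2)" for f
    using base_point_dist[of f "\<lambda>_. 0"] by (simp add: base_point_def)
  then have "{f \<in> space (\<Pi>\<^sub>M i\<in>Basis-{b}. lborel :: real measure). base_point f \<in> hyperplane b \<inter> cball 0 r}
     = {f. sqrt (\<Sum>i\<in>Basis-{b}. (f i)\<^sup>2) \<le> r} \<inter> space (\<Pi>\<^sub>M i\<in>Basis-{b}. lborel :: real measure)"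
    using base_point_hyperplane by auto
  then show ?thesis
    using emeasure_cball_aux[of "Basis-{b}" r] assms b by (simp add: base_measure_def)
qed

text \<open>The double cube is covered by translates of the cube, one for each set of coordinates
  that are shifted by \<open>r\<close>.\<close>

lemma base_cube_doubling:
  assumes "\<delta> > 0" "r \<ge> 0"
  shows "hausdorff_content k \<delta> (base_cube (2 * r)) \<le> 2 ^ (DIM('a) - 1) * hausdorff_content k \<delta> (base_cube r)"
proof -
  define s where "s S = (\<Sum>i\<in>S. r *\<^sub>R i)" for S :: "'a set"
  have s: "s S \<bullet> i = (if i \<in> S then r else 0)" if "S \<subseteq> Basis - {b}" "i \<in> Basis" for S i
  proof -
    have fS: "finite S" using that by (auto intro: finite_subset)
    have "s S \<bullet> i = (\<Sum>j\<in>S. if i = j then r else 0)"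
      unfolding s_def inner_sum_left using that by (intro sum.cong) (auto simp: inner_Basis)
    then show ?thesis using fS by simp
  qed
  have "base_cube (2 * r) \<subseteq> (\<Union>S\<in>Pow (Basis - {b}). (+) (s S) ` base_cube r)"
  proof
    fix x assume x: "x \<in> base_cube (2 * r)"
    define S where "S = {i\<in>Basis-{b}. x \<bullet> i > r}"
    have S: "S \<subseteq> Basis - {b}" by (auto simp: S_def)
    have "x - s S \<in> base_cube r"
      using x s[OF S] b assms(2) by (auto simp: base_cube_def hyperplane_def inner_diff_left S_def)
    then have "x \<in> (+) (s S) ` base_cube r" by (auto intro!: image_eqI[of _ _ "x - s S"])
    then show "x \<in> (\<Union>S\<in>Pow (Basis - {b}). (+) (s S) ` base_cube r)" using S by blast
  qed
  then have "hausdorff_content k \<delta> (base_cube (2 * r)) \<le> hausdorff_content k \<delta> (\<Union>S\<in>Pow (Basis - {b}). (+) (s S) ` base_cube r)"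
    by (rule hausdorff_content_mono)
  also have "\<dots> \<le> (\<Sum>S\<in>Pow (Basis - {b}). hausdorff_content k \<delta> ((+) (s S) ` base_cube r))"
    using assms by (intro hausdorff_content_UN_finite) auto
  also have "\<dots> \<le> (\<Sum>S\<in>Pow (Basis - {b}). hausdorff_content k \<delta> (base_cube r))"
  proof (intro sum_mono)
    fix S
    show "hausdorff_content k \<delta> ((+) (s S) ` base_cube r) \<le> hausdorff_content k \<delta> (base_cube r)"
      using hausdorff_content_lipschitz_image[of "base_cube r" "(+) (s S)" 1 \<delta> k] assms by simp
  qed
  also have "\<dots> = 2 ^ (DIM('a) - 1) * hausdorff_content k \<delta> (base_cube r)"
    using b by (simp add: card_Pow)
  finally show ?thesis .
qed

lemma base_cube_grid:
  assumes "\<delta> > 0"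
  shows "hausdorff_content k \<delta> (base_cube 1) \<le> 2 ^ ((DIM('a) - 1) * n) * hausdorff_content k \<delta> (base_cube (1 / 2 ^ n))"
proof (induction n)
  case (Suc n)
  have "hausdorff_content k \<delta> (base_cube (1 / 2 ^ n)) \<le> 2 ^ (DIM('a) - 1) * hausdorff_content k \<delta> (base_cube (1 / 2 ^ Suc n))"
    using base_cube_doubling[OF assms, of "1 / 2 ^ Suc n" k] by simp
  then have "2 ^ ((DIM('a) - 1) * n) * hausdorff_content k \<delta> (base_cube (1 / 2 ^ n))
    \<le> 2 ^ ((DIM('a) - 1) * n) * (2 ^ (DIM('a) - 1) * hausdorff_content k \<delta> (base_cube (1 / 2 ^ Suc n)))"
    by (rule mult_left_mono) simp
  also have "\<dots> = 2 ^ ((DIM('a) - 1) * Suc n) * hausdorff_content k \<delta> (base_cube (1 / 2 ^ Suc n))"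
    by (simp only: mult.assoc[symmetric] power_add[symmetric] mult_Suc_right add.commute)
  finally show ?case using Suc by (rule order_trans[rotated])
qed simp

lemma base_cube_diameter:
  assumes "r \<ge> 0"
  shows "bounded (base_cube r)" "diameter (base_cube r) \<le> real DIM('a) * r"
proof -
  have *: "norm (x - y) \<le> real DIM('a) * r" if "x \<in> base_cube r" "y \<in> base_cube r" for x y
  proof -
    have "\<bar>(x - y) \<bullet> i\<bar> \<le> r" if i: "i \<in> Basis" for i
    proof (cases "i = b")
      case True then show ?thesis using \<open>x \<in> _\<close> \<open>y \<in> _\<close> assms by (simp add: base_cube_def hyperplane_def inner_diff_left)
    next
      case False
      then have "0 \<le> x \<bullet> i" "x \<bullet> i \<le> r" "0 \<le> y \<bullet> i" "y \<bullet> i \<le> r" using \<open>x \<in> _\<close> \<open>y \<in> _\<close> i by (auto simp: base_cube_def)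
      then show ?thesis by (simp add: inner_diff_left)
    qed
    then have "(\<Sum>i\<in>Basis. \<bar>(x - y) \<bullet> i\<bar>) \<le> (\<Sum>i\<in>(Basis::'a set). r)" by (intro sum_mono)
    then show ?thesis using norm_le_l1[of "x - y"] by simp
  qed
  show "bounded (base_cube r)" unfolding bounded_two_points using * by (auto simp: dist_norm)
  show "diameter (base_cube r) \<le> real DIM('a) * r" using * assms by (intro diameter_le) auto
qed

lemma base_cube_content_small:
  assumes "\<delta> > 0"
  shows "\<exists>n. real DIM('a) * (1 / 2 ^ n) \<le> \<delta>"
proof -
  obtain n where "(1/2::real) ^ n < \<delta> / real DIM('a)"
    using real_arch_pow_inv[of "\<delta> / real DIM('a)" "1/2"] assms by auto
  then have "real DIM('a) * (1/2) ^ n < \<delta>" by (simp add: field_simps)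
  then show ?thesis by (auto simp: power_one_over intro!: exI[of _ n])
qed

text \<open>The number of subcubes of side \<open>1 / 2 ^ n\<close> exactly cancels the power of the
  side in their cost, so the bound does not depend on the scale \<delta>.\<close>

lemma hausdorff_base_cube_finite: "emeasure (hausdorff_measure (DIM('a) - 1)) (base_cube 1) < \<infinity>"
proof -
  let ?k = "DIM('a) - 1"
  let ?C = "ennreal (unit_ball_vol (real ?k) * (real DIM('a) / 2) ^ ?k)"
  have "hausdorff_content ?k \<delta> (base_cube 1) \<le> ?C" if d: "\<delta> > 0" for \<delta>
  proof -
    obtain n where n: "real DIM('a) * (1 / 2 ^ n) \<le> \<delta>" using base_cube_content_small[OF d] by auto
    let ?r = "1 / 2 ^ n :: real"
    have bd: "bounded (base_cube ?r)" "diameter (base_cube ?r) \<le> real DIM('a) * ?r" using base_cube_diameter[of ?r] by auto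
    have "hausdorff_content ?k \<delta> (base_cube ?r) \<le> cover_cost ?k (base_cube ?r)"
      using n bd by (intro hausdorff_content_le_cost) auto
    also have "\<dots> \<le> ennreal (unit_ball_vol (real ?k) * (real DIM('a) * ?r / 2) ^ ?k)"
      unfolding cover_cost_def using bd diameter_ge_0[OF bd(1)]
      by (auto intro!: ennreal_leI mult_left_mono power_mono)
    finally have h: "hausdorff_content ?k \<delta> (base_cube ?r) \<le> ennreal (unit_ball_vol (real ?k) * (real DIM('a) * ?r / 2) ^ ?k)" .
    have "hausdorff_content ?k \<delta> (base_cube 1) \<le> 2 ^ (?k * n) * hausdorff_content ?k \<delta> (base_cube ?r)"
      by (rule base_cube_grid[OF d])
    also have "\<dots> \<le> ennreal (2 ^ (?k * n)) * ennreal (unit_ball_vol (real ?k) * (real DIM('a) * ?r / 2) ^ ?k)"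
      unfolding two_power_ennreal by (intro mult_left_mono h) simp
    also have "\<dots> = ennreal (2 ^ (?k * n) * (unit_ball_vol (real ?k) * (real DIM('a) * ?r / 2) ^ ?k))"
      by (rule ennreal_mult'[symmetric]) simp
    also have "2 ^ (?k * n) * (unit_ball_vol (real ?k) * (real DIM('a) * ?r / 2) ^ ?k) = unit_ball_vol (real ?k) * (real DIM('a) / 2) ^ ?k"
      by (simp add: power_mult_distrib power_divide power_mult[symmetric] mult.commute[of n] del: of_nat_diff)
    finally show ?thesis .
  qed
  then have "hausdorff_outer_measure ?k (base_cube 1) \<le> ?C"
    unfolding hausdorff_outer_measure_def by (intro SUP_least) auto
  then show ?thesis by (simp add: emeasure_hausdorff_measure order.strict_trans1)
qed

lemma hausdorff_base_bounded_finite: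
  assumes A: "A \<subseteq> hyperplane b" "bounded A"
  shows "hausdorff_outer_measure (DIM('a) - 1) A < \<infinity>"
proof -
  let ?k = "DIM('a) - 1"
  obtain r where r: "r > 0" "\<And>x. x \<in> A \<Longrightarrow> norm x \<le> r" using A(2) bounded_pos by metis
  define s where "s = (\<Sum>i\<in>Basis-{b}. (-r) *\<^sub>R i)"
  have s: "s \<bullet> i = (if i = b then 0 else - r)" if "i \<in> Basis" for i
    using base_point_inner[OF that, of "\<lambda>_. -r"] by (simp add: s_def base_point_def)
  have "A \<subseteq> (\<lambda>x. s + (2*r) *\<^sub>R x) ` base_cube 1"
  proof
    fix x assume x: "x \<in> A"
    have "\<bar>x \<bullet> i\<bar> \<le> r" if "i \<in> Basis" for i using Basis_le_norm[OF that, of x] r(2)[OF x] by simp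
    then have "(1/(2*r)) *\<^sub>R (x - s) \<in> base_cube 1"
      using x A(1) s b r(1) by (auto simp: base_cube_def hyperplane_def inner_diff_left field_simps abs_le_iff)
        (smt (verit))+
    moreover have "x = s + (2*r) *\<^sub>R ((1/(2*r)) *\<^sub>R (x - s))" using r(1) by simp
    ultimately show "x \<in> (\<lambda>x. s + (2*r) *\<^sub>R x) ` base_cube 1" by blast
  qed
  then have "hausdorff_outer_measure ?k A \<le> hausdorff_outer_measure ?k ((\<lambda>x. s + (2*r) *\<^sub>R x) ` base_cube 1)"
    by (rule hausdorff_outer_mono)
  also have "\<dots> \<le> ennreal ((2*r)^?k) * hausdorff_outer_measure ?k (base_cube 1)"
    using r by (intro hausdorff_outer_lipschitz_image) (auto simp: dist_norm scaleR_diff_right[symmetric])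
  also have "\<dots> < \<infinity>" using hausdorff_base_cube_finite
    by (simp add: emeasure_hausdorff_measure ennreal_mult_less_top)
  finally show ?thesis .
qed

end

section \<open>Product of Hausdorff measure on a hyperplane with length along its normal\<close>

definition plane_measure :: "'a::euclidean_space \<Rightarrow> 'a measure" where
  "plane_measure m = restrict_space (hausdorff_measure (DIM('a) - 1)) (hyperplane m)"

lemma space_plane_measure [simp]: "space (plane_measure m) = hyperplane m"
  by (simp add: plane_measure_def space_restrict_space)

lemma sets_plane_measure: "sets (plane_measure m) = sets (restrict_space borel (hyperplane m))"
  unfolding plane_measure_def by (intro sets_restrict_space_cong) simp

lemma emeasure_plane_measure:
  "A \<in> sets borel \<Longrightarrow> A \<subseteq> hyperplane m \<Longrightarrow> emeasure (plane_measure m) A = emeasure (hausdorff_measure (DIM('a) - 1)) (A::'a::euclidean_space set)"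
  unfolding plane_measure_def by (subst emeasure_restrict_space) auto

lemma measurable_plane_measure_ident [measurable]: "(\<lambda>x. x) \<in> measurable (plane_measure m) borel"
  unfolding measurable_cong_sets[OF sets_plane_measure refl] by (rule measurable_restrict_space1) simp

text \<open>Finiteness on bounded sets is a hypothesis because it is first available for coordinate
  hyperplanes only; orthogonal maps carry it to the others later.\<close>

lemma sigma_finite_plane_measure:
  fixes m :: "'a::euclidean_space"
  assumes "\<And>A. A \<subseteq> hyperplane m \<Longrightarrow> bounded A \<Longrightarrow> hausdorff_outer_measure (DIM('a) - 1) A < \<infinity>"
  shows "sigma_finite_measure (plane_measure m)"
proof
  let ?A = "range (\<lambda>n::nat. hyperplane m \<inter> cball 0 (real n))"
  show "\<exists>A. countable A \<and> A \<subseteq> sets (plane_measure m) \<and> \<Union> A = space (plane_measure m) \<and> (\<forall>a\<in>A. emeasure (plane_measure m) a \<noteq> \<infinity>)"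
  proof (intro exI[of _ ?A] conjI ballI)
    show "?A \<subseteq> sets (plane_measure m)"
      by (auto simp: sets_plane_measure sets_restrict_space_iff)
    show "\<Union> ?A = space (plane_measure m)" using real_arch_simple by auto
    fix a assume "a \<in> ?A"
    then obtain n :: nat where a: "a = hyperplane m \<inter> cball 0 (real n)" by auto
    have "bounded a" unfolding a by (meson bounded_cball bounded_subset inf_le2)
    with assms[of a] show "emeasure (plane_measure m) a \<noteq> \<infinity>"
      by (auto simp: a emeasure_plane_measure emeasure_hausdorff_measure)
  qed auto
qed

lemma emeasure_slab_product:
  fixes m :: "'a::euclidean_space"
  assumes "sigma_finite_measure (plane_measure m)" and A[measurable]: "A \<in> sets borel"
  shows "emeasure (distr (plane_measure m \<Otimes>\<^sub>M lborel) borel (\<lambda>(x, h). x + h *\<^sub>R m)) A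
     = (\<integral>\<^sup>+h. emeasure (hausdorff_measure (DIM('a) - 1)) {x \<in> hyperplane m. x + h *\<^sub>R m \<in> A} \<partial>lborel)"
proof -
  interpret sigma_finite_measure "plane_measure m" by fact
  interpret P: pair_sigma_finite "plane_measure m" lborel ..
  have m[measurable]: "(\<lambda>(x, h). x + h *\<^sub>R m) \<in> measurable (plane_measure m \<Otimes>\<^sub>M lborel) borel" by measurable
  have "emeasure (distr (plane_measure m \<Otimes>\<^sub>M lborel) borel (\<lambda>(x, h). x + h *\<^sub>R m)) A
     = emeasure (plane_measure m \<Otimes>\<^sub>M lborel) ((\<lambda>(x, h). x + h *\<^sub>R m) -` A \<inter> space (plane_measure m \<Otimes>\<^sub>M lborel))"
    by (rule emeasure_distr) (use A in simp_all)
  also have "\<dots> = (\<integral>\<^sup>+h. emeasure (plane_measure m) ((\<lambda>x. (x, h)) -` ((\<lambda>(x, h). x + h *\<^sub>R m) -` A \<inter> space (plane_measure m \<Otimes>\<^sub>M lborel))) \<partial>lborel)"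
    by (rule P.emeasure_pair_measure_alt2) (rule measurable_sets[OF m], use A in simp)
  also have "\<dots> = (\<integral>\<^sup>+h. emeasure (hausdorff_measure (DIM('a) - 1)) {x \<in> hyperplane m. x + h *\<^sub>R m \<in> A} \<partial>lborel)"
  proof (rule nn_integral_cong)
    fix h :: real
    have "(\<lambda>x. (x, h)) -` ((\<lambda>(x, h). x + h *\<^sub>R m) -` A \<inter> space (plane_measure m \<Otimes>\<^sub>M lborel)) = {x \<in> hyperplane m. x + h *\<^sub>R m \<in> A}"
      by (auto simp: space_pair_measure)
    moreover have "{x \<in> hyperplane m. x + h *\<^sub>R m \<in> A} \<in> sets borel" by measurable
    ultimately show "emeasure (plane_measure m) ((\<lambda>x. (x, h)) -` ((\<lambda>(x, h). x + h *\<^sub>R m) -` A \<inter> space (plane_measure m \<Otimes>\<^sub>M lborel)))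
        = emeasure (hausdorff_measure (DIM('a) - 1)) {x \<in> hyperplane m. x + h *\<^sub>R m \<in> A}"
      by (simp add: emeasure_plane_measure subset_iff)
  qed
  finally show ?thesis .
qed

lemma measurable_slice_hausdorff:
  fixes m :: "'a::euclidean_space"
  assumes "sigma_finite_measure (plane_measure m)" and A[measurable]: "A \<in> sets borel"
  shows "(\<lambda>h. emeasure (hausdorff_measure (DIM('a) - 1)) {x \<in> hyperplane m. x + h *\<^sub>R m \<in> A}) \<in> borel_measurable borel"
proof -
  interpret sigma_finite_measure "plane_measure m" by fact
  let ?S = "(\<lambda>(h,x). x + h *\<^sub>R m) -` A \<inter> space (lborel \<Otimes>\<^sub>M plane_measure m)"
  have "(\<lambda>(h,x). x + h *\<^sub>R m) \<in> measurable (lborel \<Otimes>\<^sub>M plane_measure m) borel" by measurable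
  from measurable_sets[OF this A] have "?S \<in> sets (lborel \<Otimes>\<^sub>M plane_measure m)" .
  from measurable_emeasure_Pair[OF this]
  have "(\<lambda>h. emeasure (plane_measure m) (Pair h -` ?S)) \<in> borel_measurable borel"
    by simp
  also have "(\<lambda>h. emeasure (plane_measure m) (Pair h -` ?S)) = (\<lambda>h. emeasure (hausdorff_measure (DIM('a) - 1)) {x \<in> hyperplane m. x + h *\<^sub>R m \<in> A})"
  proof
    fix h
    have "Pair h -` ?S = {x \<in> hyperplane m. x + h *\<^sub>R m \<in> A}"
      by (auto simp: space_pair_measure)
    moreover have "{x \<in> hyperplane m. x + h *\<^sub>R m \<in> A} \<in> sets borel" by measurable
    ultimately show "emeasure (plane_measure m) (Pair h -` ?S) = emeasure (hausdorff_measure (DIM('a) - 1)) {x \<in> hyperplane m. x + h *\<^sub>R m \<in> A}"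
      by (simp add: emeasure_plane_measure subset_iff)
  qed
  finally show ?thesis .
qed

context
  fixes b :: "'a::euclidean_space" and N :: "'a measure"
  assumes b: "b \<in> Basis"
  defines "N \<equiv> distr (plane_measure b \<Otimes>\<^sub>M lborel) borel (\<lambda>(x, h). x + h *\<^sub>R b)"
begin

abbreviation (input) "HH \<equiv> hausdorff_measure (DIM('a) - 1) :: 'a measure"

lemma sigma_finite_coordinate_plane: "sigma_finite_measure (plane_measure b)"
  using hausdorff_base_bounded_finite[OF b] by (rule sigma_finite_plane_measure)

lemma slab_N: "A \<in> sets borel \<Longrightarrow> emeasure N A = (\<integral>\<^sup>+h. emeasure HH {x \<in> hyperplane b. x + h *\<^sub>R b \<in> A} \<partial>lborel)"
  unfolding N_def using sigma_finite_coordinate_plane by (rule emeasure_slab_product)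

lemma slab_bb: "b \<bullet> b = 1"
  using b by simp

lemma slab_sets: "sets N = sets borel" "space N = UNIV"
  by (auto simp: N_def)

lemma slab_unit:
  assumes Q[measurable]: "Q \<in> sets borel"
  shows "emeasure N {x. 0 \<le> x \<bullet> b \<and> x \<bullet> b < 1 \<and> x - (x \<bullet> b) *\<^sub>R b \<in> Q} = emeasure HH (hyperplane b \<inter> Q)"
proof -
    have "{x. 0 \<le> x \<bullet> b \<and> x \<bullet> b < 1 \<and> x - (x \<bullet> b) *\<^sub>R b \<in> Q} \<in> sets borel" by measurable
    from slab_N[OF this] have "emeasure N {x. 0 \<le> x \<bullet> b \<and> x \<bullet> b < 1 \<and> x - (x \<bullet> b) *\<^sub>R b \<in> Q}
       = (\<integral>\<^sup>+h. emeasure HH {x \<in> hyperplane b. 0 \<le> (x + h *\<^sub>R b) \<bullet> b \<and> (x + h *\<^sub>R b) \<bullet> b < 1 \<and> (x + h *\<^sub>R b) - ((x + h *\<^sub>R b) \<bullet> b) *\<^sub>R b \<in> Q} \<partial>lborel)"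
      by simp
    also have "\<dots> = (\<integral>\<^sup>+h. emeasure HH (hyperplane b \<inter> Q) * indicator {0..<1::real} h \<partial>lborel)"
    proof (rule nn_integral_cong)
      fix h :: real
      have "{x \<in> hyperplane b. 0 \<le> (x + h *\<^sub>R b) \<bullet> b \<and> (x + h *\<^sub>R b) \<bullet> b < 1 \<and> (x + h *\<^sub>R b) - ((x + h *\<^sub>R b) \<bullet> b) *\<^sub>R b \<in> Q}
         = (if h \<in> {0..<1} then hyperplane b \<inter> Q else {})"
        by (auto simp: hyperplane_def inner_add_left slab_bb)
      then show "emeasure HH {x \<in> hyperplane b. 0 \<le> (x + h *\<^sub>R b) \<bullet> b \<and> (x + h *\<^sub>R b) \<bullet> b < 1 \<and> (x + h *\<^sub>R b) - ((x + h *\<^sub>R b) \<bullet> b) *\<^sub>R b \<in> Q}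
        = emeasure HH (hyperplane b \<inter> Q) * indicator {0..<1} h"
        by (simp add: indicator_def)
    qed
    also have "\<dots> = emeasure HH (hyperplane b \<inter> Q)" by (simp add: nn_integral_cmult)
    finally show ?thesis .
qed

text \<open>The component of \<open>a\<close> along \<open>b\<close> shifts the height of the
  slices, where length is invariant; the remaining component \<open>a'\<close> shifts each slice
  within the hyperplane, where Hausdorff measure is invariant.\<close>

lemma slab_translation:
  assumes A[measurable]: "A \<in> sets borel"
  shows "emeasure N ((\<lambda>x. x + a) -` A) = emeasure N A"
proof -
    define a' where "a' = a - (a \<bullet> b) *\<^sub>R b"
    have a': "a' \<bullet> b = 0" by (simp add: a'_def inner_diff_left slab_bb)
    have "(\<lambda>x. x + a) \<in> borel_measurable borel" by measurable
    from measurable_sets[OF this A] have mA: "(\<lambda>x. x + a) -` A \<in> sets borel" by simp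
    have meas: "(\<lambda>h. emeasure HH {x \<in> hyperplane b. x + h *\<^sub>R b \<in> A}) \<in> borel_measurable borel"
      using sigma_finite_coordinate_plane A by (rule measurable_slice_hausdorff)
    have "emeasure N ((\<lambda>x. x + a) -` A) = (\<integral>\<^sup>+h. emeasure HH {x \<in> hyperplane b. x + h *\<^sub>R b \<in> ((\<lambda>x. x + a) -` A)} \<partial>lborel)"
      by (rule slab_N[OF mA])
    also have "\<dots> = (\<integral>\<^sup>+h. emeasure HH {x \<in> hyperplane b. x + ((a \<bullet> b) + h) *\<^sub>R b \<in> A} \<partial>lborel)"
    proof (rule nn_integral_cong)
      fix h
      let ?S = "{x \<in> hyperplane b. x + h *\<^sub>R b \<in> ((\<lambda>x. x + a) -` A)}"
      have S: "?S \<in> sets borel" by measurable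
      have "(+) a' ` ?S = {x \<in> hyperplane b. x + ((a \<bullet> b) + h) *\<^sub>R b \<in> A}"
      proof safe
        fix x assume "x \<in> hyperplane b" "x + h *\<^sub>R b + a \<in> A"
        then show "a' + x \<in> hyperplane b" "a' + x + ((a \<bullet> b) + h) *\<^sub>R b \<in> A"
          using a' by (auto simp: hyperplane_def inner_add_left a'_def algebra_simps)
      next
        fix x assume "x \<in> hyperplane b" "x + ((a \<bullet> b) + h) *\<^sub>R b \<in> A"
        then show "x \<in> (+) a' ` ?S"
          using a' by (intro image_eqI[of _ _ "x - a'"]) (auto simp: hyperplane_def inner_diff_left a'_def algebra_simps)
      qed
      then show "emeasure HH ?S = emeasure HH {x \<in> hyperplane b. x + ((a \<bullet> b) + h) *\<^sub>R b \<in> A}"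
        using emeasure_hausdorff_translation[OF S, of _ a'] by simp
    qed
    also have "\<dots> = (\<integral>\<^sup>+h. emeasure HH {x \<in> hyperplane b. x + h *\<^sub>R b \<in> A} \<partial>distr lborel borel ((+) (a \<bullet> b)))"
      using meas by (simp add: nn_integral_distr)
    also have "\<dots> = emeasure N A" by (simp add: lborel_distr_plus slab_N)
    finally show ?thesis .
qed

lemma slab_sigma_finite: "sigma_finite_measure N"
proof
    let ?A = "range (\<lambda>n::nat. ball 0 (real n) :: 'a set)"
    show "\<exists>A. countable A \<and> A \<subseteq> sets N \<and> \<Union> A = space N \<and> (\<forall>a\<in>A. emeasure N a \<noteq> \<infinity>)"
    proof (intro exI[of _ ?A] conjI ballI)
      show "\<Union> ?A = space N" using reals_Archimedean2 by (auto simp: slab_sets)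
      fix a assume "a \<in> ?A"
      then obtain n :: nat where a: "a = ball 0 (real n)" by auto
      have "emeasure N a = (\<integral>\<^sup>+h. emeasure HH {x \<in> hyperplane b. x + h *\<^sub>R b \<in> a} \<partial>lborel)"
        by (rule slab_N) (simp add: a)
      also have "\<dots> \<le> (\<integral>\<^sup>+h. emeasure HH (hyperplane b \<inter> cball 0 n) * indicator {-real n..real n} h \<partial>lborel)"
      proof (intro nn_integral_mono)
        fix h
        have "norm x \<le> n \<and> \<bar>h\<bar> \<le> n" if "x \<in> hyperplane b" "x + h *\<^sub>R b \<in> a" for x
        proof -
          have "(norm (x + h *\<^sub>R b))\<^sup>2 = (norm x)\<^sup>2 + h\<^sup>2"
            using that(1) unfolding power2_norm_eq_inner by (simp add: hyperplane_def inner_add_left inner_add_right slab_bb inner_commute power2_eq_square)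
          moreover have "(norm (x + h *\<^sub>R b))\<^sup>2 \<le> (real n)\<^sup>2" using that(2) by (intro power_mono) (auto simp: a)
          ultimately have "(norm x)\<^sup>2 \<le> (real n)\<^sup>2" "h\<^sup>2 \<le> (real n)\<^sup>2" using zero_le_power2[of h] zero_le_power2[of "norm x"] by linarith+
          then show ?thesis using power2_le_imp_le[of "norm x" n] abs_le_square_iff[of h n] by auto
        qed
        then show "emeasure HH {x \<in> hyperplane b. x + h *\<^sub>R b \<in> a} \<le> emeasure HH (hyperplane b \<inter> cball 0 n) * indicator {-real n..real n} h"
        proof (cases "\<bar>h\<bar> \<le> n")
          case True
          then have "emeasure HH {x \<in> hyperplane b. x + h *\<^sub>R b \<in> a} \<le> emeasure HH (hyperplane b \<inter> cball 0 n)"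
            using \<open>\<And>x. x \<in> hyperplane b \<Longrightarrow> x + h *\<^sub>R b \<in> a \<Longrightarrow> norm x \<le> n \<and> \<bar>h\<bar> \<le> n\<close>
            by (intro emeasure_mono) auto
          then show ?thesis using True by (simp add: indicator_def abs_le_iff)
        next
          case False
          then have eq: "{x \<in> hyperplane b. x + h *\<^sub>R b \<in> a} = {}"
            using \<open>\<And>x. x \<in> hyperplane b \<Longrightarrow> x + h *\<^sub>R b \<in> a \<Longrightarrow> norm x \<le> n \<and> \<bar>h\<bar> \<le> n\<close> by auto
          show ?thesis unfolding eq by simp
        qed
      qed
      also have "\<dots> = emeasure HH (hyperplane b \<inter> cball 0 n) * ennreal (2 * n)"
        by (simp add: nn_integral_cmult)
      also have "\<dots> < \<infinity>"
        using hausdorff_base_bounded_finite[OF b, of "hyperplane b \<inter> cball 0 n"]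
        by (simp add: emeasure_hausdorff_measure ennreal_mult_less_top bounded_Int)
      finally show "emeasure N a \<noteq> \<infinity>" by simp
    qed (auto simp: slab_sets)
qed

text \<open>The same constant serves for volumes and for bases: the second claim is the first one
  for slabs of thickness 1.\<close>

lemma slab_factor:
  obtains c where "\<And>A. A \<in> sets borel \<Longrightarrow> emeasure N A = c * emeasure lborel A"
    and "\<And>Q. Q \<in> sets borel \<Longrightarrow> Q \<subseteq> hyperplane b \<Longrightarrow> emeasure HH Q = c * base_measure b Q"
proof -
  obtain c where c: "\<And>A. A \<in> sets borel \<Longrightarrow> emeasure N A = c * emeasure lborel A"
    using translation_invariant_eq_lborel[OF slab_sets(1) slab_sigma_finite slab_translation] by auto
  moreover have "emeasure HH Q = c * base_measure b Q" if Q: "Q \<in> sets borel" "Q \<subseteq> hyperplane b" for Q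
  proof -
    have [measurable]: "Q \<in> sets borel" by fact
    have "{x. 0 \<le> x \<bullet> b \<and> x \<bullet> b < 1 \<and> x - (x \<bullet> b) *\<^sub>R b \<in> Q} \<in> sets borel" by measurable
    from c[OF this] show ?thesis
      using slab_unit[OF Q(1)] lborel_slab[OF b Q(1)] Q(2) by (simp add: Int_absorb1)
  qed
  ultimately show ?thesis by (rule that)
qed

lemma base_cube_hyperplane: "base_cube b r \<subseteq> hyperplane b"
  by (auto simp: base_cube_def[OF b])

context
  fixes c
  assumes cb: "\<And>Q. Q \<in> sets borel \<Longrightarrow> Q \<subseteq> hyperplane b \<Longrightarrow> emeasure HH Q = c * base_measure b Q"
begin

lemma slab_c1: "emeasure HH (base_cube b 1) = c"
  using cb[OF base_cube_borel[OF b] base_cube_hyperplane, of 1] base_measure_cube[OF b, of 1] by simp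

text \<open>By the isodiametric inequality every cover of the unit cube costs at least its volume.
  The single scale 1 suffices, since each content is a lower bound for the outer measure.\<close>

lemma slab_c_ge: "1 \<le> c"
proof -
  have "1 \<le> hausdorff_content (DIM('a) - 1) 1 (base_cube b 1)"
  proof (rule hausdorff_content_ge)
    fix C assume C: "admissible_cover 1 (base_cube b 1) C"
    have ms: "{f \<in> space (\<Pi>\<^sub>M i\<in>Basis-{b}. lborel :: real measure). base_point b f \<in> closure (C i)} \<in> sets (\<Pi>\<^sub>M i\<in>Basis-{b}. lborel)" for i
    proof -
      note measurable_base_point[OF b, measurable]
      have [measurable]: "closure (C i) \<in> sets borel" by simp
      show ?thesis by measurable
    qed
    have "1 = base_measure b (base_cube b 1)" using base_measure_cube[OF b, of 1] by simp
    also have "\<dots> \<le> emeasure (\<Pi>\<^sub>M i\<in>Basis-{b}. lborel) (\<Union>i. {f \<in> space (\<Pi>\<^sub>M i\<in>Basis-{b}. lborel :: real measure). base_point b f \<in> closure (C i)})"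
      unfolding base_measure_def[OF b] using C closure_subset
      by (intro emeasure_mono) (auto simp: admissible_cover_def intro!: sets.countable_UN ms, blast)
    also have "\<dots> \<le> (\<Sum>i. base_measure b (closure (C i)))"
      unfolding base_measure_def[OF b] by (rule emeasure_subadditive_countably) (use ms in auto)
    also have "\<dots> \<le> (\<Sum>i. cover_cost (DIM('a) - 1) (C i))"
      using C by (intro suminf_le base_measure_isodiametric[OF b]) (auto simp: admissible_cover_def)
    finally show "1 \<le> (\<Sum>i. cover_cost (DIM('a) - 1) (C i))" .
  qed
  also have "\<dots> \<le> c" unfolding slab_c1[symmetric] by (simp add: emeasure_hausdorff_measure base_cube_borel[OF b] hausdorff_content_le_outer)
  finally show ?thesis .
qed

text \<open>A cube of a fine grid is covered by its inscribed ball, of cost \<open>q\<close> times its volume, and a remainder of relative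
  measure \<open>c (1 - q)\<close>; hence \<open>c \<le> q + c (1 - q)\<close>.\<close>

lemma slab_c_le: "c \<le> 1"
proof -
  have cfin: "c < \<infinity>" using hausdorff_base_cube_finite[OF b] slab_c1 by simp
  \<comment> \<open>The share of a cube that its inscribed ball fills, independent of the
    side.\<close>
  define q where "q = (unit_ball_vol (real (DIM('a) - 1))) / 2 ^ (DIM('a) - 1)"
  have q0: "q > 0" by (simp add: q_def)
  obtain r where r: "c = ennreal r" "r \<ge> 0" using cfin by (cases c) auto
  have "hausdorff_content (DIM('a) - 1) \<delta> (base_cube b 1) \<le> ennreal (q + (r - r * q))" if d: "\<delta> > 0" for \<delta>
  proof -
    obtain n where n: "real DIM('a) * (1 / 2 ^ n) \<le> \<delta>" using base_cube_content_small[OF b d] by auto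
    define s where "s = (1 / 2 ^ n :: real)"
    have s: "s > 0" by (simp add: s_def)
    define p where "p = base_point b (\<lambda>_. s / 2)"
    have ph: "p \<in> hyperplane b" using base_point_hyperplane[OF b] by (simp add: p_def)
    define B where "B = (+) p ` (hyperplane b \<inter> cball 0 (s / 2))"
    have Bb: "B \<in> sets borel" unfolding B_def by (intro translation_borel) auto
    have Bsub: "B \<subseteq> base_cube b s"
    proof
      fix x assume "x \<in> B"
      then obtain y where y: "x = p + y" "y \<in> hyperplane b" "norm y \<le> s / 2" by (auto simp: B_def)
      have "\<bar>y \<bullet> i\<bar> \<le> s / 2" if "i \<in> Basis" for i using Basis_le_norm[OF that, of y] y(3) by simp
      then show "x \<in> base_cube b s"
        using y ph base_point_inner[OF b, of _ "\<lambda>_. s/2"] unfolding base_cube_def[OF b]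
        by (fastforce simp: hyperplane_def inner_add_left p_def abs_le_iff)
    qed
    have HB: "emeasure HH B = ennreal (r * (q * s ^ (DIM('a) - 1)))"
    proof -
      have "emeasure HH B = emeasure HH (hyperplane b \<inter> cball 0 (s / 2))"
        unfolding B_def by (rule emeasure_hausdorff_translation) auto
      also have "\<dots> = c * base_measure b (hyperplane b \<inter> cball 0 (s / 2))" by (rule cb) auto
      also have "\<dots> = ennreal (r * (q * s ^ (DIM('a) - 1)))"
        using s r by (subst base_measure_ball[OF b]) (auto simp: ennreal_mult[symmetric] q_def power_divide)
      finally show ?thesis .
    qed
    have HQ: "emeasure HH (base_cube b s) = ennreal (r * s ^ (DIM('a) - 1))"
      using cb[OF base_cube_borel[OF b] base_cube_hyperplane, of s] base_measure_cube[OF b, of s] s r by (simp add: ennreal_mult)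
    have diaB: "bounded B" "diameter B \<le> s"
    proof -
      have "norm (x - y) \<le> s" if "x \<in> B" "y \<in> B" for x y
      proof -
        obtain u where u: "x = p + u" "norm u \<le> s / 2" using \<open>x \<in> B\<close> by (auto simp: B_def)
        obtain w where w: "y = p + w" "norm w \<le> s / 2" using \<open>y \<in> B\<close> by (auto simp: B_def)
        note uw = u w
        then show ?thesis using norm_triangle_ineq4[of u w] by simp
      qed
      then show "bounded B" "diameter B \<le> s" using s by (auto simp: bounded_two_points dist_norm intro: diameter_le)
    qed
    have sd: "s \<le> \<delta>"
    proof -
      have "1 * s \<le> real DIM('a) * s" using s by (intro mult_right_mono) (auto simp: Suc_le_eq)
      then show ?thesis using n by (simp add: s_def)
    qed
    have "hausdorff_content (DIM('a) - 1) \<delta> (base_cube b s) \<le> hausdorff_content (DIM('a) - 1) \<delta> (B \<union> (base_cube b s - B))"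
      by (intro hausdorff_content_mono) auto
    also have "\<dots> \<le> hausdorff_content (DIM('a) - 1) \<delta> B + hausdorff_content (DIM('a) - 1) \<delta> (base_cube b s - B)"
      using d by (intro hausdorff_content_Un) auto
    also have "\<dots> \<le> cover_cost (DIM('a) - 1) B + emeasure HH (base_cube b s - B)"
      using d diaB sd Bb base_cube_borel[OF b]
      by (intro add_mono hausdorff_content_le_cost) (auto simp: emeasure_hausdorff_measure hausdorff_content_le_outer)
    also have "\<dots> \<le> ennreal (q * s ^ (DIM('a) - 1)) + ennreal (r * s ^ (DIM('a) - 1) - r * (q * s ^ (DIM('a) - 1)))"
    proof (intro add_mono)
      have "(diameter B / 2) ^ (DIM('a) - 1) \<le> (s / 2) ^ (DIM('a) - 1)" using diaB diameter_ge_0[OF diaB(1)] by (intro power_mono) auto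
      then have "(unit_ball_vol (real (DIM('a) - 1))) * (diameter B / 2) ^ (DIM('a) - 1) \<le> (unit_ball_vol (real (DIM('a) - 1))) * (s / 2) ^ (DIM('a) - 1)" by (intro mult_left_mono) auto
      then show "cover_cost (DIM('a) - 1) B \<le> ennreal (q * s ^ (DIM('a) - 1))"
        using s by (auto simp: cover_cost_def q_def power_divide intro!: ennreal_leI)
      have "emeasure HH (base_cube b s - B) = emeasure HH (base_cube b s) - emeasure HH B"
        using Bb Bsub base_cube_borel[OF b] HB by (intro emeasure_Diff) auto
      also have "\<dots> = ennreal (r * s ^ (DIM('a) - 1) - r * (q * s ^ (DIM('a) - 1)))"
        unfolding HB HQ using r s q0 by (intro ennreal_minus) auto
      finally show "emeasure HH (base_cube b s - B) \<le> ennreal (r * s ^ (DIM('a) - 1) - r * (q * s ^ (DIM('a) - 1)))" by simp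
    qed
    also have "\<dots> = ennreal (s ^ (DIM('a) - 1) * (q + (r - r * q)))"
    proof -
      have "r * (q * s ^ (DIM('a) - 1)) \<le> r * s ^ (DIM('a) - 1)"
      proof -
        have "emeasure HH B \<le> emeasure HH (base_cube b s)" using Bsub base_cube_borel[OF b] by (intro emeasure_mono) auto
        then show ?thesis unfolding HB HQ using r s q0 by simp
      qed
      then show ?thesis using s q0 by (subst ennreal_plus[symmetric]) (auto simp: algebra_simps)
    qed
    finally have h: "hausdorff_content (DIM('a) - 1) \<delta> (base_cube b s) \<le> ennreal (s ^ (DIM('a) - 1) * (q + (r - r * q)))" .
    have "hausdorff_content (DIM('a) - 1) \<delta> (base_cube b 1) \<le> 2 ^ ((DIM('a) - 1) * n) * hausdorff_content (DIM('a) - 1) \<delta> (base_cube b s)"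
      unfolding s_def by (rule base_cube_grid[OF b d])
    also have "\<dots> \<le> ennreal (2 ^ ((DIM('a) - 1) * n)) * ennreal (s ^ (DIM('a) - 1) * (q + (r - r * q)))"
      unfolding two_power_ennreal by (intro mult_left_mono h) simp
    also have "\<dots> = ennreal (2 ^ ((DIM('a) - 1) * n) * (s ^ (DIM('a) - 1) * (q + (r - r * q))))"
      by (rule ennreal_mult'[symmetric]) simp
    also have "2 ^ ((DIM('a) - 1) * n) * (s ^ (DIM('a) - 1) * (q + (r - r * q))) = q + (r - r * q)"
      by (simp add: s_def power_one_over power_mult[symmetric] mult.commute power_divide)
    finally show ?thesis .
  qed
  then have "c \<le> ennreal (q + (r - r * q))"
    unfolding slab_c1[symmetric] emeasure_hausdorff_measure[OF base_cube_borel[OF b]] hausdorff_outer_measure_def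
    by (intro SUP_least) auto
  \<comment> \<open>The alternative \<open>r = 0\<close> appears because \<open>ennreal\<close>
    truncates negative numbers to 0; either case gives \<open>r \<le> 1\<close>.\<close>
  then have "r \<le> q + (r - r * q) \<or> r = 0" using r by (auto simp: ennreal_le_iff2)
  then have "r * q \<le> 1 * q \<or> r = 0" by auto
  then have "r \<le> 1" using q0 by auto
  then show ?thesis using r by (simp add: ennreal_le_1)
qed

end

lemma hausdorff_coordinate_slab: "N = lborel"
proof -
  obtain c where c: "\<And>A. A \<in> sets borel \<Longrightarrow> emeasure N A = c * emeasure lborel A"
    and cb: "\<And>Q. Q \<in> sets borel \<Longrightarrow> Q \<subseteq> hyperplane b \<Longrightarrow> emeasure HH Q = c * base_measure b Q"
    using slab_factor by blast
  have "c = 1" using slab_c_ge[OF cb] slab_c_le[OF cb] by simp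
  then show ?thesis using c by (intro measure_eqI) (auto simp: slab_sets)
qed

end

section \<open>From coordinate hyperplanes to arbitrary ones\<close>

lemma hausdorff_outer_UN_finite:
  "finite I \<Longrightarrow> hausdorff_outer_measure k (\<Union>z\<in>I. A z) \<le> (\<Sum>z\<in>I. hausdorff_outer_measure k (A z))"
proof (induction I rule: finite_induct)
  case (insert z I)
  have "hausdorff_outer_measure k (\<Union>z\<in>insert z I. A z) \<le> hausdorff_outer_measure k (A z) + hausdorff_outer_measure k (\<Union>z\<in>I. A z)"
    using hausdorff_outer_Un[of k "A z"] by simp
  also have "\<dots> \<le> hausdorff_outer_measure k (A z) + (\<Sum>z\<in>I. hausdorff_outer_measure k (A z))"
    by (intro add_mono insert.IH) simp
  finally show ?case using insert.hyps by simp
qed simp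

lemma orthogonal_transformation_borel_image:
  fixes f :: "real^'n \<Rightarrow> real^'n"
  assumes f: "orthogonal_transformation f" and A: "A \<in> sets borel"
  shows "f ` A \<in> sets borel"
proof -
  have "f ` A = inv f -` A"
    using orthogonal_transformation_bij[OF f] by (simp add: bij_vimage_eq_inv_image inv_inv_eq bij_imp_bij_inv)
  moreover have "inv f \<in> borel_measurable borel"
    using orthogonal_transformation_linear[OF orthogonal_transformation_inv[OF f]]
    by (intro borel_measurable_continuous_onI linear_continuous_on linear_conv_bounded_linear[THEN iffD1])
  ultimately show ?thesis using measurable_sets[of "inv f" borel borel A] A by simp
qed

lemma orthogonal_transformation_measurable:
  fixes f :: "real^'n \<Rightarrow> real^'n"
  assumes f: "orthogonal_transformation f"
  shows "f \<in> borel_measurable borel"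
  using orthogonal_transformation_linear[OF f]
  by (intro borel_measurable_continuous_onI linear_continuous_on linear_conv_bounded_linear[THEN iffD1])

lemma orthogonal_transformation_dist:
  fixes f :: "real^'n \<Rightarrow> real^'n"
  assumes "orthogonal_transformation f" shows "dist (f x) (f y) = dist x y"
  using assms orthogonal_transformation_isometry by blast

lemma emeasure_hausdorff_orthogonal:
  fixes f :: "real^'n \<Rightarrow> real^'n"
  assumes f: "orthogonal_transformation f" and A: "A \<in> sets borel"
  shows "emeasure (hausdorff_measure k) (f ` A) = emeasure (hausdorff_measure k) A"
  using orthogonal_transformation_borel_image[OF assms] A orthogonal_transformation_dist[OF f]
  by (intro emeasure_hausdorff_isometry)

text \<open>The image measure is again translation invariant, hence a multiple of
  \<open>lborel\<close>; since balls about 0 are preserved, the factor is 1.\<close>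

lemma lborel_distr_orthogonal:
  fixes f :: "real^'n \<Rightarrow> real^'n"
  assumes f: "orthogonal_transformation f"
  shows "distr lborel borel f = lborel"
proof -
  note lin = orthogonal_transformation_linear[OF f]
  note m[measurable] = orthogonal_transformation_measurable[OF f]
  note bij = orthogonal_transformation_bij[OF f]
  define N where "N = distr lborel borel f"
  have sN: "sets N = sets borel" "space N = UNIV" by (auto simp: N_def)
  have ball: "f -` ball 0 r = ball 0 r" for r
    using orthogonal_transformation_norm[OF f] by auto
  have Nball: "emeasure N (ball 0 r) = emeasure lborel (ball (0::real^'n) r)" for r
    by (simp add: N_def emeasure_distr ball)
  have "sigma_finite_measure N"
  proof
    show "\<exists>A. countable A \<and> A \<subseteq> sets N \<and> \<Union> A = space N \<and> (\<forall>a\<in>A. emeasure N a \<noteq> \<infinity>)"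
    proof (intro exI[of _ "range (\<lambda>n::nat. ball 0 (real n))"] conjI ballI)
      show "\<Union> (range (\<lambda>n::nat. ball 0 (real n))) = space N" using reals_Archimedean2 by (auto simp: sN)
      fix a assume "a \<in> range (\<lambda>n::nat. ball (0::real^'n) (real n))"
      then obtain n :: nat where a: "a = ball 0 (real n)" by auto
      have "emeasure lborel (ball (0::real^'n) (real n)) < \<infinity>" by (rule emeasure_bounded_finite) simp
      then show "emeasure N a \<noteq> \<infinity>" unfolding a Nball by simp
    qed (auto simp: sN)
  qed
  moreover have "emeasure N ((\<lambda>x. x + a) -` A) = emeasure N A" if A[measurable]: "A \<in> sets borel" for a A
  proof -
    obtain b where b: "a = f b" using bij by (metis bij_pointE)
    have "(\<lambda>x. x + a) \<in> borel_measurable borel" by measurable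
    from measurable_sets[OF this A] have "emeasure N ((\<lambda>x. x + a) -` A) = emeasure lborel (f -` (\<lambda>x. x + a) -` A)"
      by (simp add: N_def emeasure_distr)
    also have "f -` (\<lambda>x. x + a) -` A = (+) b -` (f -` A)"
      using lin by (auto simp: b linear_add add.commute)
    also have "emeasure lborel \<dots> = emeasure (distr lborel borel ((+) b)) (f -` A)"
      using measurable_sets[OF m A] by (simp add: emeasure_distr)
    also have "\<dots> = emeasure N A" by (simp add: lborel_distr_plus N_def emeasure_distr)
    finally show ?thesis .
  qed
  ultimately obtain c where c: "\<And>A. A \<in> sets borel \<Longrightarrow> emeasure N A = c * emeasure lborel A"
    using translation_invariant_eq_lborel[OF sN(1)] by auto
  have "emeasure lborel (ball (0::real^'n) 1) = ennreal (unit_ball_vol (real CARD('n)))"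
    by (subst emeasure_ball) auto
  moreover have "unit_ball_vol (real CARD('n)) > 0" by simp
  moreover have "emeasure lborel (ball (0::real^'n) 1) = c * emeasure lborel (ball (0::real^'n) 1)"
    using c[of "ball 0 1"] Nball[of 1] by simp
  ultimately obtain u where "ennreal u = c * ennreal u" "u > 0" by metis
  then have "c = 1"
    by (cases c) (auto simp: ennreal_mult[symmetric] ennreal_top_mult simp flip: ennreal_1)
  then show ?thesis using c unfolding N_def[symmetric] by (intro measure_eqI) (auto simp: sN)
qed

definition frame_of :: "real^'n \<Rightarrow> real^'n \<Rightarrow> (real^'n \<Rightarrow> real^'n) \<Rightarrow> bool" where
  "frame_of m b f \<longleftrightarrow> b \<in> Basis \<and> orthogonal_transformation f \<and> f b = m \<and> f ` hyperplane b = hyperplane m"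

lemma frame_exists:
  fixes m :: "real^'n"
  assumes "norm m = 1"
  shows "\<exists>b f. frame_of m b f"
proof -
  obtain b :: "real^'n" where b: "b \<in> Basis" using nonempty_Basis by blast
  then have "norm b = norm m" using assms by simp
  then obtain f where f: "orthogonal_transformation f" "f b = m"
    using orthogonal_transformation_exists by blast
  have "f ` hyperplane b = hyperplane m"
  proof safe
    fix x assume "x \<in> hyperplane b"
    then show "f x \<in> hyperplane m" using f unfolding orthogonal_transformation_def hyperplane_def by force
  next
    fix y assume y: "y \<in> hyperplane m"
    obtain x where x: "y = f x" using orthogonal_transformation_bij[OF f(1)] by (metis bij_pointE)
    then have "x \<in> hyperplane b" using y f unfolding orthogonal_transformation_def hyperplane_def by force
    then show "y \<in> f ` hyperplane b" using x by blast
  qed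
  then show ?thesis using b f by (auto simp: frame_of_def)
qed

lemma hausdorff_plane_bounded_finite:
  fixes m :: "real^'n"
  assumes m: "norm m = 1" and A: "A \<subseteq> hyperplane m" "bounded A"
  shows "hausdorff_outer_measure (CARD('n) - 1) A < \<infinity>"
proof -
  obtain b f where "frame_of m b f"
    using frame_exists[OF m] by blast
  then have f: "b \<in> Basis" "orthogonal_transformation f" "f b = m" "f ` hyperplane b = hyperplane m"
    by (simp_all add: frame_of_def)
  obtain B where B: "B \<subseteq> hyperplane b" "A = f ` B" using A(1) f(4) by (metis subset_imageE)
  obtain a where a: "\<And>x. x \<in> A \<Longrightarrow> norm x \<le> a" using A(2) by (auto simp: bounded_iff)
  have "norm x \<le> a" if "x \<in> B" for x
    using a[of "f x"] that B(2) orthogonal_transformation_norm[OF f(2)] by auto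
  then have "bounded B" by (auto simp: bounded_iff)
  then have "hausdorff_outer_measure (CARD('n) - 1) B < \<infinity>"
    using hausdorff_base_bounded_finite[OF f(1) B(1)] by simp
  moreover have "hausdorff_outer_measure (CARD('n) - 1) (f ` B) = hausdorff_outer_measure (CARD('n) - 1) B"
    by (rule hausdorff_outer_isometry) (rule orthogonal_transformation_dist[OF f(2)])
  ultimately show ?thesis unfolding B(2) by simp
qed

lemma sigma_finite_plane:
  fixes m :: "real^'n"
  assumes "norm m = 1" shows "sigma_finite_measure (plane_measure m)"
  using hausdorff_plane_bounded_finite[OF assms] by (intro sigma_finite_plane_measure) simp

text \<open>An orthogonal map carries a coordinate hyperplane and its normal to those of
  \<open>m\<close>; it preserves the Hausdorff measure of the slices and Lebesgue measure.\<close>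

lemma hausdorff_slab:
  fixes m :: "real^'n"
  assumes m: "norm m = 1"
  shows "distr (plane_measure m \<Otimes>\<^sub>M lborel) borel (\<lambda>(x, h). x + h *\<^sub>R m) = lborel"
proof (rule measure_eqI)
  obtain b f where "frame_of m b f"
    using frame_exists[OF m] by blast
  then have f: "b \<in> Basis" "orthogonal_transformation f" "f b = m" "f ` hyperplane b = hyperplane m"
    by (simp_all add: frame_of_def)
  have nb: "norm b = 1" using f(1) by simp
  note lin = orthogonal_transformation_linear[OF f(2)]
  note fm = orthogonal_transformation_measurable[OF f(2)]
  have inj: "inj f" using orthogonal_transformation_bij[OF f(2)] by (simp add: bij_def)
  let ?H = "hausdorff_measure (CARD('n) - 1) :: (real^'n) measure"
  fix A assume "A \<in> sets (distr (plane_measure m \<Otimes>\<^sub>M lborel) borel (\<lambda>(x, h). x + h *\<^sub>R m))"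
  then have A[measurable]: "A \<in> sets borel" by simp
  have A': "f -` A \<in> sets borel" using measurable_sets[OF fm A] by simp
  have "emeasure (distr (plane_measure m \<Otimes>\<^sub>M lborel) borel (\<lambda>(x, h). x + h *\<^sub>R m)) A
     = (\<integral>\<^sup>+h. emeasure ?H {x \<in> hyperplane m. x + h *\<^sub>R m \<in> A} \<partial>lborel)"
    using emeasure_slab_product[OF sigma_finite_plane[OF m] A] by simp
  also have "\<dots> = (\<integral>\<^sup>+h. emeasure ?H {x \<in> hyperplane b. x + h *\<^sub>R b \<in> f -` A} \<partial>lborel)"
  proof (rule nn_integral_cong)
    fix h
    have "{x \<in> hyperplane m. x + h *\<^sub>R m \<in> A} = f ` {x \<in> hyperplane b. x + h *\<^sub>R b \<in> f -` A}"
      unfolding f(4)[symmetric] using f(3) lin inj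
      by (auto simp: linear_add linear_cmul inj_image_mem_iff)
    moreover have "{x \<in> hyperplane b. x + h *\<^sub>R b \<in> f -` A} \<in> sets borel" using A' by measurable
    ultimately show "emeasure ?H {x \<in> hyperplane m. x + h *\<^sub>R m \<in> A} = emeasure ?H {x \<in> hyperplane b. x + h *\<^sub>R b \<in> f -` A}"
      by (simp add: emeasure_hausdorff_orthogonal[OF f(2)])
  qed
  also have "\<dots> = emeasure (distr (plane_measure b \<Otimes>\<^sub>M lborel) borel (\<lambda>(x, h). x + h *\<^sub>R b)) (f -` A)"
    using emeasure_slab_product[OF sigma_finite_plane[OF nb] A'] by simp
  also have "\<dots> = emeasure lborel (f -` A)" by (simp add: hausdorff_coordinate_slab[OF f(1)])
  also have "\<dots> = emeasure (distr lborel borel f) A" using fm by (simp add: emeasure_distr)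
  also have "\<dots> = emeasure lborel A" by (simp add: lborel_distr_orthogonal[OF f(2)])
  finally show "emeasure (distr (plane_measure m \<Otimes>\<^sub>M lborel) borel (\<lambda>(x, h). x + h *\<^sub>R m)) A = emeasure lborel A" .
qed simp

lemma nn_integral_slices:
  fixes m :: "real^'n"
  assumes m: "norm m = 1" and f[measurable]: "f \<in> borel_measurable borel"
  shows "(\<integral>\<^sup>+x. f x \<partial>lborel) = (\<integral>\<^sup>+x. (\<integral>\<^sup>+h. f (x + h *\<^sub>R m) \<partial>lborel) \<partial>plane_measure m)"
proof -
  interpret sigma_finite_measure "plane_measure m" by (rule sigma_finite_plane[OF m])
  have mm[measurable]: "(\<lambda>(x, h). x + h *\<^sub>R m) \<in> measurable (plane_measure m \<Otimes>\<^sub>M lborel) borel" by measurable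
  have "(\<integral>\<^sup>+x. f x \<partial>lborel) = (\<integral>\<^sup>+x. f x \<partial>distr (plane_measure m \<Otimes>\<^sub>M lborel) borel (\<lambda>(x, h). x + h *\<^sub>R m))"
    by (simp add: hausdorff_slab[OF m])
  also have "\<dots> = (\<integral>\<^sup>+z. f (case z of (x, h) \<Rightarrow> x + h *\<^sub>R m) \<partial>(plane_measure m \<Otimes>\<^sub>M lborel))"
    by (rule nn_integral_distr) (use mm in auto)
  also have "\<dots> = (\<integral>\<^sup>+x. (\<integral>\<^sup>+h. f (x + h *\<^sub>R m) \<partial>lborel) \<partial>plane_measure m)"
    by (subst lborel.nn_integral_fst[symmetric]) auto
  finally show ?thesis .
qed

lemma nn_integral_slices':
  fixes m :: "real^'n"
  assumes m: "norm m = 1" and f[measurable]: "f \<in> borel_measurable borel"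
  shows "(\<integral>\<^sup>+x. f x \<partial>lborel) = (\<integral>\<^sup>+h. (\<integral>\<^sup>+x. f (x + h *\<^sub>R m) \<partial>plane_measure m) \<partial>lborel)"
proof -
  interpret sigma_finite_measure "plane_measure m" by (rule sigma_finite_plane[OF m])
  interpret P: pair_sigma_finite "plane_measure m" lborel ..
  show ?thesis unfolding nn_integral_slices[OF assms]
    by (rule P.Fubini'[symmetric]) measurable
qed

section \<open>Spheres\<close>

lemma surface_measure_sets [measurable_cong, simp]: "sets surface_measure = sets borel"
  by (simp add: surface_measure_def)

lemma surface_measure_space [simp]: "space surface_measure = UNIV"
  by (simp add: surface_measure_def)

lemma emeasure_surface:
  "A \<in> sets borel \<Longrightarrow> emeasure surface_measure A = hausdorff_outer_measure (CARD('n) - 1) (A :: (real^'n) set)"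
  by (simp add: surface_measure_def emeasure_hausdorff_measure)

lemma emeasure_plane_surface:
  "A \<in> sets borel \<Longrightarrow> A \<subseteq> hyperplane m \<Longrightarrow> emeasure (plane_measure m) A = emeasure surface_measure (A :: (real^'n) set)"
  by (simp add: surface_measure_def emeasure_plane_measure)

text \<open>The hyperplane contains infinitely many disjoint concentric copies with radii in
  \<open>(1, 2]\<close>, all within a set of finite measure. Shrinking a copy to radius 1 does not
  increase its measure, so each is at least as large as the original, which must therefore be
  null.\<close>

lemma great_sphere_null:
  fixes m :: "real^'n"
  assumes m: "norm m = 1"
  shows "emeasure surface_measure {x. norm x = 1 \<and> x \<bullet> m = 0} = 0"
proof -
  let ?k = "CARD('n) - 1"
  let ?H = "hausdorff_outer_measure ?k :: (real^'n) set \<Rightarrow> ennreal"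
  define E where "E = {x::real^'n. norm x = 1 \<and> x \<bullet> m = 0}"
  define c where "c j = 1 + 1 / real (Suc j)" for j :: nat
  have c: "c j > 1" "c j \<le> 2" for j by (auto simp: c_def divide_simps)
  have cinj: "c i = c j \<Longrightarrow> i = j" for i j by (auto simp: c_def)
  define F where "F j = {x::real^'n. norm x = c j \<and> x \<bullet> m = 0}" for j
  have Fb[measurable]: "F j \<in> sets borel" for j unfolding F_def by measurable
  have Eb[measurable]: "E \<in> sets borel" unfolding E_def by measurable
  have EF: "?H E \<le> emeasure surface_measure (F j)" for j
  proof -
    have "E \<subseteq> (\<lambda>x. (1 / c j) *\<^sub>R x) ` F j"
    proof
      fix x assume "x \<in> E"
      then have "c j *\<^sub>R x \<in> F j" using c[of j] by (auto simp: E_def F_def)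
      moreover have "x = (1 / c j) *\<^sub>R (c j *\<^sub>R x)" using c[of j] by simp
      ultimately show "x \<in> (\<lambda>x. (1 / c j) *\<^sub>R x) ` F j" by blast
    qed
    then have "?H E \<le> ?H ((\<lambda>x. (1 / c j) *\<^sub>R x) ` F j)" by (rule hausdorff_outer_mono)
    also have "\<dots> \<le> ennreal (1 ^ ?k) * ?H (F j)"
    proof (rule hausdorff_outer_lipschitz_image)
      fix x y
      have "dist ((1 / c j) *\<^sub>R x) ((1 / c j) *\<^sub>R y) = norm ((1 / c j) *\<^sub>R (x - y))"
        by (simp only: dist_norm scaleR_diff_right)
      also have "\<dots> = (1 / c j) * dist x y" using c(1)[of j] by (simp add: dist_norm)
      also have "\<dots> \<le> 1 * dist x y" using c[of j] by (intro mult_right_mono) auto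
      finally show "dist ((1 / c j) *\<^sub>R x) ((1 / c j) *\<^sub>R y) \<le> 1 * dist x y" .
    qed simp
    finally show ?thesis by (simp add: emeasure_surface)
  qed
  let ?B = "hyperplane m \<inter> cball 0 2"
  have fin: "emeasure surface_measure ?B < \<infinity>"
    using hausdorff_plane_bounded_finite[OF m, of ?B] by (simp add: emeasure_surface bounded_Int)
  have le: "of_nat n * ?H E \<le> emeasure surface_measure ?B" for n
  proof -
    have "of_nat n * ?H E = (\<Sum>j<n. ?H E)" by simp
    also have "\<dots> \<le> (\<Sum>j<n. emeasure surface_measure (F j))" by (intro sum_mono EF)
    also have "\<dots> = emeasure surface_measure (\<Union>j<n. F j)"
      by (rule sum_emeasure) (use cinj in \<open>auto simp: disjoint_family_on_def F_def\<close>)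
    also have "\<dots> \<le> emeasure surface_measure ?B"
      using c(2) by (intro emeasure_mono) (auto simp: F_def hyperplane_def)
    finally show ?thesis .
  qed
  have "?H E = 0"
  proof (rule ccontr)
    assume ne: "?H E \<noteq> 0"
    obtain C where C: "emeasure surface_measure ?B = ennreal C" "C \<ge> 0" using fin by (cases "emeasure surface_measure ?B") auto
    have "?H E < \<infinity>" using le[of 1] fin by simp
    then obtain h where h: "?H E = ennreal h" "h > 0" using ne by (cases "?H E") (auto simp: less_le)
    obtain n :: nat where "C / h < real n" using reals_Archimedean2 by blast
    then have "C < real n * h" using h by (simp add: field_simps)
    moreover have "real n * h \<le> C" using le[of n] h C
      by (simp add: ennreal_of_nat_eq_real_of_nat ennreal_mult[symmetric])
    ultimately show False by simp
  qed
  then show ?thesis by (simp add: emeasure_surface E_def[symmetric])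
qed

lemma surface_translate_plane_finite:
  fixes m a :: "real^'n"
  assumes m: "norm m = 1" and A: "bounded A" "\<And>x. x \<in> A \<Longrightarrow> x - a \<in> hyperplane m"
  shows "hausdorff_outer_measure (CARD('n) - 1) A < \<infinity>"
proof -
  have "hausdorff_outer_measure (CARD('n) - 1) ((\<lambda>x. x - a) ` A) < \<infinity>"
    using assms by (intro hausdorff_plane_bounded_finite[OF m] bounded_translation_minus) auto
  moreover have "hausdorff_outer_measure (CARD('n) - 1) ((\<lambda>x. x - a) ` A) = hausdorff_outer_measure (CARD('n) - 1) A"
    by (rule hausdorff_outer_isometry) (simp add: dist_norm)
  ultimately show ?thesis by simp
qed

text \<open>The faces of a large cube cover the sphere under the nearest-point projection onto the unit ball.\<close>

lemma sphere_surface_finite: "emeasure surface_measure (sphere (0::real^'n) 1) < \<infinity>"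
proof -
  let ?k = "CARD('n) - 1"
  let ?H = "hausdorff_outer_measure ?k :: (real^'n) set \<Rightarrow> ennreal"
  let ?B = "cball (0::real^'n) 1"
  define P where "P = closest_point ?B"
  \<comment> \<open>Some coordinate of a unit vector is at least \<open>1 / r\<close> in absolute
    value, so scaling the vector onto a face of the cube stretches it by at most
    \<open>r\<close>.\<close>
  define r where "r = real CARD('n)"
  have r: "r \<ge> 1" by (simp add: r_def Suc_le_eq)
  define F where "F i s = {x::real^'n. x \<bullet> i = s \<and> norm x \<le> r}" for i s
  have "sphere (0::real^'n) 1 \<subseteq> (\<Union>(i,s)\<in>Basis \<times> {1,-1}. P ` F i s)"
  proof
    fix x :: "real^'n" assume "x \<in> sphere 0 1"
    then have nx: "norm x = 1" by simp
    have "\<exists>i\<in>Basis. 1 / r \<le> \<bar>x \<bullet> i\<bar>"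
    proof (rule ccontr)
      assume "\<not> ?thesis"
      then have "(\<Sum>i\<in>Basis. \<bar>x \<bullet> i\<bar>) < (\<Sum>i\<in>(Basis::(real^'n) set). 1 / r)" by (intro sum_strict_mono) auto
      also have "\<dots> = 1" by (simp add: r_def)
      finally show False using norm_le_l1[of x] nx by simp
    qed
    then obtain i where i: "i \<in> Basis" "1 / r \<le> \<bar>x \<bullet> i\<bar>" by blast
    have p: "\<bar>x \<bullet> i\<bar> > 0" using i(2) r by (meson less_le_trans zero_less_divide_1_iff zero_less_one)
    define y where "y = (1 / \<bar>x \<bullet> i\<bar>) *\<^sub>R x"
    have y1: "y \<bullet> i = sgn (x \<bullet> i)" using p by (simp add: y_def sgn_if divide_simps abs_if)
    have y2: "norm y \<le> r" using i p r nx by (simp add: y_def field_simps)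
    have ny: "norm y \<ge> 1" using Basis_le_norm[OF i(1), of x] p nx by (simp add: y_def field_simps)
    have "P y = x"
    proof -
      have "closest_point ?B y = (1 / norm y) *\<^sub>R y"
      proof (rule closest_point_unique[symmetric])
        show "\<forall>z\<in>?B. dist y ((1 / norm y) *\<^sub>R y) \<le> dist y z"
        proof
          fix z assume "z \<in> ?B"
          have "y - (1 / norm y) *\<^sub>R y = (1 - 1 / norm y) *\<^sub>R y" by (simp add: algebra_simps)
          then have "dist y ((1 / norm y) *\<^sub>R y) = \<bar>1 - 1 / norm y\<bar> * norm y"
            by (simp only: dist_norm norm_scaleR)
          also have "\<dots> = norm y - 1"
          proof -
            have "norm y > 0" using ny by linarith
            then have "1 - 1 / norm y \<ge> 0" using ny by (simp add: divide_le_eq)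
            then have "\<bar>1 - 1 / norm y\<bar> * norm y = (1 - 1 / norm y) * norm y" by (simp only: abs_of_nonneg)
            moreover have "norm y \<noteq> 0" using ny by auto
            ultimately show ?thesis by (simp add: left_diff_distrib)
          qed
          also have "\<dots> \<le> dist y z" using norm_triangle_ineq2[of y z] \<open>z \<in> ?B\<close> by (simp add: dist_norm)
          finally show "dist y ((1 / norm y) *\<^sub>R y) \<le> dist y z" .
        qed
      qed (use ny in auto)
      then show ?thesis using p nx by (simp add: P_def y_def)
    qed
    moreover have "y \<in> F i (sgn (x \<bullet> i))" using y1 y2 by (simp add: F_def)
    moreover have "sgn (x \<bullet> i) \<in> {1, -1}" using p by (auto simp: sgn_if)
    ultimately show "x \<in> (\<Union>(i,s)\<in>Basis \<times> {1,-1}. P ` F i s)" using i(1) by fast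
  qed
  then have "?H (sphere 0 1) \<le> ?H (\<Union>z\<in>Basis \<times> {1,-1}. P ` F (fst z) (snd z))"
    by (intro hausdorff_outer_mono) (auto simp: split_beta')
  also have "\<dots> \<le> (\<Sum>z\<in>Basis \<times> {1,-1}. ?H (P ` F (fst z) (snd z)))"
    by (rule hausdorff_outer_UN_finite) auto
  also have "\<dots> < \<infinity>"
  proof -
    have "?H (P ` F i s) < \<infinity>" if i: "i \<in> Basis" for i s
    proof -
      have "?H (P ` F i s) \<le> ennreal (1 ^ ?k) * ?H (F i s)"
        unfolding P_def by (intro hausdorff_outer_lipschitz_image) (auto intro!: closest_point_lipschitz)
      also have "\<dots> < \<infinity>"
      proof -
        have "bounded (F i s)" by (auto simp: F_def bounded_iff)
        moreover have "x - s *\<^sub>R i \<in> hyperplane i" if "x \<in> F i s" for x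
          using that i by (simp add: hyperplane_def inner_diff_left F_def)
        ultimately have "?H (F i s) < \<infinity>"
          using i by (intro surface_translate_plane_finite[of i _ "s *\<^sub>R i"]) auto
        then show ?thesis by simp
      qed
      finally show ?thesis .
    qed
    then show ?thesis by (auto simp: less_top[symmetric])
  qed
  finally show ?thesis by (simp add: emeasure_surface)
qed

section \<open>Lipschitz boundaries\<close>

lemma axis_diff: "axis i a - axis i b = axis i (a - b :: real)"
  by (simp add: vec_eq_iff axis_def)

lemma base_part_base_space: "base_part z \<in> base_space"
  by (simp add: base_part_def base_space_def last_coord_def axis_def)

lemma norm_base_part_le: "norm (base_part z) \<le> norm z"
  by (rule norm_le_componentwise_cart) (simp add: base_part_def last_coord_def axis_def)

lemma linear_base_part: "linear base_part"
  by (rule linearI) (auto simp: base_part_def last_coord_def vec_eq_iff axis_def algebra_simps)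

lemma base_space_hyperplane: "base_space = hyperplane (axis (Max UNIV) 1)"
  by (simp add: base_space_def hyperplane_def last_coord_def inner_axis)

declare compact_frontier_bounded [simp]

lemma norm_axis_real: "norm (axis i (a::real)) = \<bar>a\<bar>"
  by (simp add: norm_eq_sqrt_inner inner_axis_axis)

lemma continuous_on_base_part: "continuous_on A base_part"
  by (intro linear_continuous_on linear_base_part linear_conv_bounded_linear[THEN iffD1])

lemma continuous_on_last_coord: "continuous_on A (last_coord :: 'n::{finite,linorder} point \<Rightarrow> real)"
  unfolding last_coord_def by (intro continuous_intros)

text \<open>The domain condition describes \<open>D\<close> only. A frontier point is not in the
  open set \<open>D\<close>, hence not strictly above the graph, and as a limit of points of
  \<open>D\<close> it is not strictly below. Since the isometry sends \<open>x\<close> to 0, it is a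
  linear map applied to \<open>y - x\<close>.\<close>

lemma lipschitz_boundary_graph:
  fixes D :: "'n::{finite,linorder} point set"
  assumes D: "open D" "lipschitz_boundary D" and x: "x \<in> frontier D"
  shows "\<exists>\<epsilon> (Q :: 'n point \<Rightarrow> 'n point) f L. \<epsilon> > 0 \<and> orthogonal_transformation Q \<and> L-lipschitz_on base_space f \<and> f 0 = 0 \<and>
     (\<forall>y\<in>ball x \<epsilon>. y \<in> D \<longleftrightarrow> f (base_part (Q (y - x))) < last_coord (Q (y - x))) \<and>
     (\<forall>y\<in>frontier D \<inter> ball x \<epsilon>. last_coord (Q (y - x)) = f (base_part (Q (y - x))))"
proof -
  obtain \<epsilon> J f L where e: "\<epsilon> > 0" and J: "affine_isometry J" "J x = 0" and L: "L-lipschitz_on base_space f" "f 0 = 0"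
    and eq: "J ` (D \<inter> ball x \<epsilon>) = {z \<in> ball 0 \<epsilon>. last_coord z > f (base_part z)}"
    using D(2) x unfolding lipschitz_boundary_def by blast
  obtain Q b where Q: "orthogonal_transformation Q" "J = (\<lambda>y. Q y + b)"
    using J(1) by (auto simp: affine_isometry_def)
  have JQ: "J y = Q (y - x)" for y
  proof -
    have "b = - Q x" using J(2) unfolding Q(2) by (simp add: eq_neg_iff_add_eq_0 add.commute)
    then show ?thesis by (simp add: Q(2) linear_diff[OF orthogonal_transformation_linear[OF Q(1)]])
  qed
  have distJ: "dist (J u) (J w) = dist u w" for u w
    using orthogonal_transformation_dist[OF Q(1), of u w] by (simp add: Q(2))
  have injJ: "J u = J w \<Longrightarrow> u = w" for u w using distJ[of u w] by simp
  have contJ: "continuous_on A J" for A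
    unfolding continuous_on_iff distJ by blast
  have ballJ: "J y \<in> ball 0 \<epsilon> \<longleftrightarrow> y \<in> ball x \<epsilon>" for y
    using distJ[of x y] J(2) by (simp add: dist_commute)
  have inD: "y \<in> D \<longleftrightarrow> f (base_part (J y)) < last_coord (J y)" if y: "y \<in> ball x \<epsilon>" for y
  proof
    assume "y \<in> D"
    then have "J y \<in> J ` (D \<inter> ball x \<epsilon>)" using y by blast
    then show "f (base_part (J y)) < last_coord (J y)" unfolding eq by blast
  next
    assume "f (base_part (J y)) < last_coord (J y)"
    then have "J y \<in> J ` (D \<inter> ball x \<epsilon>)" unfolding eq using y ballJ by blast
    then show "y \<in> D" using injJ by blast
  qed
  have "last_coord (J y) = f (base_part (J y))" if y: "y \<in> frontier D" "y \<in> ball x \<epsilon>" for y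
  proof -
    have "y \<notin> D" using y(1) D(1) frontier_disjoint_eq by blast
    then have "\<not> f (base_part (J y)) < last_coord (J y)" using inD[OF y(2)] by blast
    moreover have "f (base_part (J y)) \<le> last_coord (J y)"
    proof -
      have ycl: "y \<in> closure (D \<inter> ball x \<epsilon>)"
        using y open_Int_closure_subset[of "ball x \<epsilon>" D] by (auto simp: frontier_def Int_commute)
      have cl: "closed {z. f (base_part z) \<le> last_coord z}"
      proof (rule closed_Collect_le)
        show "continuous_on UNIV (\<lambda>z. f (base_part z))"
          by (rule continuous_on_compose2[OF lipschitz_on_continuous_on[OF L(1)] continuous_on_base_part])
             (auto simp: base_part_base_space)
      qed (rule continuous_on_last_coord)
      have "J ` (D \<inter> ball x \<epsilon>) \<subseteq> {z. f (base_part z) \<le> last_coord z}"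
        unfolding eq by auto
      from image_closure_subset[OF contJ cl this] imageI[OF ycl]
      have "J y \<in> {z. f (base_part z) \<le> last_coord z}" by (rule subsetD)
      then show ?thesis by simp
    qed
    ultimately show ?thesis by simp
  qed
  then show ?thesis using e Q(1) L inD unfolding JQ by blast
qed

text \<open>After the isometry the boundary piece lies in the image of a bounded part of a
  hyperplane under the graph map \<open>g\<close>, which is Lipschitz with constant
  \<open>1 + L\<close>.\<close>

lemma lipschitz_boundary_locally_finite:
  fixes D :: "'n::{finite,linorder} point set"
  assumes D: "open D" "lipschitz_boundary D" and x: "x \<in> frontier D"
  shows "\<exists>\<epsilon>>0. hausdorff_outer_measure (CARD('n) - 1) (frontier D \<inter> ball x \<epsilon>) < \<infinity>"
proof -
  let ?H = "hausdorff_outer_measure (CARD('n) - 1) :: 'n point set \<Rightarrow> ennreal"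
  obtain \<epsilon> f L and Q :: "'n point \<Rightarrow> 'n point"
    where e: "\<epsilon> > 0" and Q: "orthogonal_transformation Q" and L: "L-lipschitz_on base_space f"
    and graph: "\<forall>y\<in>frontier D \<inter> ball x \<epsilon>. last_coord (Q (y - x)) = f (base_part (Q (y - x)))"
    using lipschitz_boundary_graph[OF assms] by metis
  have L0: "L \<ge> 0" using L by (rule lipschitz_on_nonneg)
  define J where "J y = Q (y - x)" for y
  have normJ: "norm (J y) = norm (y - x)" for y
    unfolding J_def by (rule orthogonal_transformation_norm[OF Q])
  define g where "g w = w + axis (Max UNIV) (f w)" for w
  have sub: "J ` (frontier D \<inter> ball x \<epsilon>) \<subseteq> g ` (base_space \<inter> cball 0 \<epsilon>)"
  proof safe
    fix y assume y: "y \<in> frontier D" "y \<in> ball x \<epsilon>"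
    then have "last_coord (J y) = f (base_part (J y))" using graph by (simp add: J_def)
    then have "J y = g (base_part (J y))" by (simp add: g_def base_part_def)
    moreover have "base_part (J y) \<in> base_space \<inter> cball 0 \<epsilon>"
      using y(2) normJ[of y] norm_base_part_le[of "J y"] by (simp add: base_part_base_space dist_norm norm_minus_commute)
    ultimately show "J y \<in> g ` (base_space \<inter> cball 0 \<epsilon>)" by blast
  qed
  have "?H (frontier D \<inter> ball x \<epsilon>) = ?H (J ` (frontier D \<inter> ball x \<epsilon>))"
    by (rule hausdorff_outer_isometry[symmetric])
       (simp only: J_def orthogonal_transformation_dist[OF Q], simp add: dist_norm)
  also have "\<dots> \<le> ?H (g ` (base_space \<inter> cball 0 \<epsilon>))" by (rule hausdorff_outer_mono[OF sub])
  also have "\<dots> \<le> ennreal ((1 + L) ^ (CARD('n) - 1)) * ?H (base_space \<inter> cball 0 \<epsilon>)"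
  proof (rule hausdorff_outer_lipschitz_image)
    fix u w :: "'n point" assume uw: "u \<in> base_space \<inter> cball 0 \<epsilon>" "w \<in> base_space \<inter> cball 0 \<epsilon>"
    have "dist (g u) (g w) = norm ((u - w) + axis (Max UNIV) (f u - f w))"
      by (simp add: dist_norm g_def axis_diff[symmetric] algebra_simps)
    also have "\<dots> \<le> norm (u - w) + \<bar>f u - f w\<bar>"
      by (rule order_trans[OF norm_triangle_ineq]) (simp add: norm_axis_real)
    also have "\<bar>f u - f w\<bar> \<le> L * dist u w"
      using lipschitz_onD[OF L, of u w] uw by (simp add: dist_real_def)
    finally show "dist (g u) (g w) \<le> (1 + L) * dist u w" by (simp add: dist_norm algebra_simps)
  qed (use L0 in simp)
  also have "\<dots> < \<infinity>"
  proof -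
    have "?H (base_space \<inter> cball 0 \<epsilon>) < \<infinity>"
      unfolding base_space_hyperplane by (intro hausdorff_plane_bounded_finite) (auto simp: bounded_Int norm_axis_real)
    then show ?thesis by (simp add: ennreal_mult_less_top)
  qed
  finally show ?thesis using e by blast
qed

lemma lipschitz_boundary_finite:
  fixes D :: "'n::{finite,linorder} point set"
  assumes D: "open D" "bounded D" "lipschitz_boundary D"
  shows "emeasure surface_measure (frontier D) < \<infinity>"
proof -
  let ?H = "hausdorff_outer_measure (CARD('n) - 1) :: 'n point set \<Rightarrow> ennreal"
  have "\<forall>x\<in>frontier D. \<exists>\<epsilon>>0. ?H (frontier D \<inter> ball x \<epsilon>) < \<infinity>"
    using lipschitz_boundary_locally_finite[OF D(1,3)] by blast
  then obtain e where e: "\<And>x. x \<in> frontier D \<Longrightarrow> e x > 0 \<and> ?H (frontier D \<inter> ball x (e x)) < \<infinity>" by metis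
  obtain C where C: "C \<subseteq> frontier D" "finite C" "frontier D \<subseteq> (\<Union>x\<in>C. ball x (e x))"
    by (rule compactE_image[of "frontier D" "frontier D" "\<lambda>x. ball x (e x)"]) (use D e in auto)
  have "?H (frontier D) \<le> ?H (\<Union>x\<in>C. frontier D \<inter> ball x (e x))" using C(3) by (intro hausdorff_outer_mono) auto
  also have "\<dots> \<le> (\<Sum>x\<in>C. ?H (frontier D \<inter> ball x (e x)))" by (rule hausdorff_outer_UN_finite[OF C(2)])
  also have "\<dots> < \<infinity>" using C e by (auto simp: less_top[symmetric])
  finally show ?thesis by (simp add: emeasure_surface)
qed

section \<open>Projections\<close>

definition proj :: "real^'n \<Rightarrow> real^'n \<Rightarrow> real^'n" where
  "proj v x = x - (x \<bullet> v) *\<^sub>R v"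

text \<open>Projection onto \<open>hyperplane m\<close> parallel to \<open>v\<close>, meaningful for
  \<open>v \<bullet> m \<noteq> 0\<close>. It is constant along the same lines as
  \<open>proj v\<close>, so that \<open>proj v\<close> factors through it.\<close>

definition oblique :: "real^'n \<Rightarrow> real^'n \<Rightarrow> real^'n \<Rightarrow> real^'n" where
  "oblique m v x = x - ((x \<bullet> m) / (v \<bullet> m)) *\<^sub>R v"

lemma continuous_on_proj [continuous_intros]: "continuous_on A (proj v)"
  unfolding proj_def by (intro continuous_intros)

lemma measurable_proj [measurable]: "proj v \<in> borel_measurable borel"
  by (intro borel_measurable_continuous_onI continuous_intros)

lemma continuous_on_oblique [continuous_intros]: "v \<bullet> m \<noteq> 0 \<Longrightarrow> continuous_on A (oblique m v)"
  unfolding oblique_def by (intro continuous_intros) auto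

lemma measurable_oblique [measurable]: "oblique m v \<in> borel_measurable borel"
  unfolding oblique_def by measurable

lemma inner_unit: "norm (v::real^'n) = 1 \<Longrightarrow> v \<bullet> v = 1"
  by (simp add: norm_eq_sqrt_inner)

lemma proj_hyperplane: "norm v = 1 \<Longrightarrow> proj v x \<in> hyperplane v"
  by (simp add: proj_def hyperplane_def inner_diff_left inner_unit)

lemma oblique_hyperplane: "v \<bullet> m \<noteq> 0 \<Longrightarrow> oblique m v x \<in> hyperplane m"
  by (simp add: oblique_def hyperplane_def inner_diff_left)

lemma proj_oblique: "norm v = 1 \<Longrightarrow> proj v (oblique m v x) = proj v x"
  by (simp add: proj_def oblique_def inner_diff_left inner_unit algebra_simps)

lemma oblique_proj: "v \<bullet> m \<noteq> 0 \<Longrightarrow> oblique m v (proj v x) = oblique m v x"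
  by (simp add: proj_def oblique_def inner_diff_left diff_divide_distrib algebra_simps)

lemma oblique_id: "x \<in> hyperplane m \<Longrightarrow> oblique m v x = x"
  by (simp add: oblique_def hyperplane_def)

lemma proj_id: "x \<in> hyperplane v \<Longrightarrow> proj v x = x"
  by (simp add: proj_def hyperplane_def)

lemma proj_plane_image:
  assumes "norm v = 1" "v \<bullet> m \<noteq> 0" "B \<subseteq> hyperplane m"
  shows "proj v ` B = {x \<in> hyperplane v. oblique m v x \<in> B}"
proof safe
  fix x assume x: "x \<in> B"
  show "proj v x \<in> hyperplane v" using assms by (simp add: proj_hyperplane)
  show "oblique m v (proj v x) \<in> B" using x assms by (auto simp: oblique_proj oblique_id)
next
  fix x assume "x \<in> hyperplane v" "oblique m v x \<in> B"
  then show "x \<in> proj v ` B" using assms by (metis image_eqI proj_id proj_oblique)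
qed

text \<open>The Lebesgue measure of \<open>{b + s v | b \<in> B, 0 \<le> s < 1}\<close>, sliced along \<open>m\<close> and along \<open>v\<close>.\<close>

lemma emeasure_proj_plane:
  fixes m v :: "real^'n"
  assumes m: "norm m = 1" and v: "norm v = 1" and a: "v \<bullet> m \<noteq> 0" and B[measurable]: "B \<in> sets borel" and Bs: "B \<subseteq> hyperplane m"
  shows "emeasure surface_measure (proj v ` B) = ennreal \<bar>v \<bullet> m\<bar> * emeasure surface_measure B"
proof -
  define s where "s y = (y \<bullet> m) / (v \<bullet> m)" for y
  define C where "C = {y. 0 \<le> s y \<and> s y < 1 \<and> oblique m v y \<in> B}"
  \<comment> \<open>Raising a point of \<open>hyperplane m\<close> by \<open>h\<close> along
    \<open>m\<close> moves its oblique image by \<open>h *\<^sub>R w\<close>. As \<open>w\<close> is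
    parallel to the hyperplane, every slice of \<open>C\<close> is a translate of \<open>B\<close>
    or empty.\<close>
  define w where "w = m - (1 / (v \<bullet> m)) *\<^sub>R v"
  have [measurable]: "s \<in> borel_measurable borel" unfolding s_def by measurable
  have C[measurable]: "C \<in> sets borel" unfolding C_def by measurable
  have wm: "w \<bullet> m = 0" using m a by (simp add: w_def inner_diff_left inner_unit)
  have Pb: "{x \<in> hyperplane v. oblique m v x \<in> B} \<in> sets borel" by measurable
  have "emeasure lborel C = (\<integral>\<^sup>+y. indicator C y \<partial>lborel)" by simp
  also have "\<dots> = (\<integral>\<^sup>+h. (\<integral>\<^sup>+x. indicator C (x + h *\<^sub>R m) \<partial>plane_measure m) \<partial>lborel)"
    by (rule nn_integral_slices'[OF m]) measurable
  also have "\<dots> = (\<integral>\<^sup>+h. emeasure surface_measure B * indicator {h. 0 \<le> h / (v \<bullet> m) \<and> h / (v \<bullet> m) < 1} h \<partial>lborel)"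
  proof (rule nn_integral_cong)
    fix h :: real
    let ?I = "{h. 0 \<le> h / (v \<bullet> m) \<and> h / (v \<bullet> m) < 1}"
    have T: "(+) (- h *\<^sub>R w) ` B \<in> sets borel" by (rule translation_borel[OF B])
    have Ts: "(+) (- h *\<^sub>R w) ` B \<subseteq> hyperplane m" using Bs wm by (auto simp: hyperplane_def inner_diff_left)
    have "(\<integral>\<^sup>+x. indicator C (x + h *\<^sub>R m) \<partial>plane_measure m) = (\<integral>\<^sup>+x. indicator ?I h * indicator ((+) (- h *\<^sub>R w) ` B) x \<partial>plane_measure m)"
    proof (rule nn_integral_cong)
      fix x assume "x \<in> space (plane_measure m)"
      then have x: "x \<bullet> m = 0" by (simp add: hyperplane_def)
      have sx: "s (x + h *\<^sub>R m) = h / (v \<bullet> m)" using x m by (simp add: s_def inner_add_left inner_unit)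
      have ox: "oblique m v (x + h *\<^sub>R m) = x + h *\<^sub>R w"
        using x m by (simp add: oblique_def inner_add_left inner_unit w_def algebra_simps)
      have "x + h *\<^sub>R w \<in> B \<longleftrightarrow> x \<in> (+) (- h *\<^sub>R w) ` B"
        by (auto simp: image_iff algebra_simps)
      then show "indicator C (x + h *\<^sub>R m) = indicator ?I h * (indicator ((+) (- h *\<^sub>R w) ` B) x :: ennreal)"
        unfolding C_def indicator_def using sx ox by simp
    qed
    also have "\<dots> = indicator ?I h * emeasure (plane_measure m) ((+) (- h *\<^sub>R w) ` B)"
      using T Ts by (subst nn_integral_cmult) (auto simp: sets_plane_measure sets_restrict_space_iff)
    also have "emeasure (plane_measure m) ((+) (- h *\<^sub>R w) ` B) = emeasure surface_measure B"
      by (simp only: emeasure_plane_surface[OF T Ts] surface_measure_def emeasure_hausdorff_translation[OF B])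
    finally show "(\<integral>\<^sup>+x. indicator C (x + h *\<^sub>R m) \<partial>plane_measure m) = emeasure surface_measure B * indicator ?I h"
      by (simp add: mult.commute)
  qed
  also have "\<dots> = emeasure surface_measure B * emeasure lborel {h. 0 \<le> h / (v \<bullet> m) \<and> h / (v \<bullet> m) < 1}"
    by (rule nn_integral_cmult_indicator) measurable
  also have "emeasure lborel {h. 0 \<le> h / (v \<bullet> m) \<and> h / (v \<bullet> m) < 1} = ennreal \<bar>v \<bullet> m\<bar>"
  proof (cases "v \<bullet> m > 0")
    case True
    then have "{h. 0 \<le> h / (v \<bullet> m) \<and> h / (v \<bullet> m) < 1} = {0..<v \<bullet> m}" by (auto simp: field_simps)
    then show ?thesis using True by simp
  next
    case False
    then have neg: "v \<bullet> m < 0" using a by simp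
    then have "{h. 0 \<le> h / (v \<bullet> m) \<and> h / (v \<bullet> m) < 1} = {v \<bullet> m<..0}" by (auto simp: field_simps)
    then show ?thesis using neg by simp
  qed
  finally have 1: "emeasure lborel C = emeasure surface_measure B * ennreal \<bar>v \<bullet> m\<bar>" .
  have "emeasure lborel C = (\<integral>\<^sup>+y. indicator C y \<partial>lborel)" by simp
  also have "\<dots> = (\<integral>\<^sup>+x. (\<integral>\<^sup>+h. indicator C (x + h *\<^sub>R v) \<partial>lborel) \<partial>plane_measure v)"
    by (rule nn_integral_slices[OF v]) measurable
  also have "\<dots> = (\<integral>\<^sup>+x. indicator {x \<in> hyperplane v. oblique m v x \<in> B} x \<partial>plane_measure v)"
  proof (rule nn_integral_cong)
    fix x assume "x \<in> space (plane_measure v)"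
    then have x: "x \<in> hyperplane v" by simp
    have sx: "s (x + h *\<^sub>R v) = s x + h" for h using a by (simp add: s_def inner_add_left add_divide_distrib)
    have ox: "oblique m v (x + h *\<^sub>R v) = oblique m v x" for h
      using a by (simp add: oblique_def inner_add_left add_divide_distrib algebra_simps)
    have "(\<integral>\<^sup>+h. indicator C (x + h *\<^sub>R v) \<partial>lborel) = (\<integral>\<^sup>+h. indicator {x \<in> hyperplane v. oblique m v x \<in> B} x * indicator {- s x..<1 - s x} h \<partial>lborel)"
      using x by (intro nn_integral_cong) (auto simp: C_def sx ox indicator_def)
    also have "\<dots> = indicator {x \<in> hyperplane v. oblique m v x \<in> B} x"
      by (subst nn_integral_cmult_indicator) auto
    finally show "(\<integral>\<^sup>+h. indicator C (x + h *\<^sub>R v) \<partial>lborel) = (indicator {x \<in> hyperplane v. oblique m v x \<in> B} x :: ennreal)" .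
  qed
  also have "\<dots> = emeasure (plane_measure v) {x \<in> hyperplane v. oblique m v x \<in> B}"
    using Pb by (intro nn_integral_indicator) (auto simp: sets_plane_measure sets_restrict_space_iff)
  also have "\<dots> = emeasure surface_measure {x \<in> hyperplane v. oblique m v x \<in> B}"
    using Pb by (simp add: emeasure_plane_surface)
  also have "\<dots> = emeasure surface_measure (proj v ` B)"
    by (simp add: proj_plane_image[OF v a Bs])
  finally show ?thesis using 1 by (simp add: mult.commute)
qed

text \<open>On a compact set a continuous injection has a continuous inverse, and the image is a
  preimage under that inverse.\<close>

lemma inj_compact_borel_image:
  fixes f :: "'a::euclidean_space \<Rightarrow> 'b::euclidean_space"
  assumes K: "compact K" "continuous_on K f" "inj_on f K" and A: "A \<in> sets borel" "A \<subseteq> K"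
  shows "f ` A \<in> sets borel"
proof -
  obtain g where g: "homeomorphism K (f ` K) f g"
    using homeomorphism_compact[OF K(1,2) refl K(3)] by blast
  have fK: "f ` K \<in> sets borel" using K by (intro borel_closed compact_imp_closed compact_continuous_image)
  have "g \<in> borel_measurable (restrict_space borel (f ` K))"
    using g by (intro borel_measurable_continuous_on_restrict) (auto simp: homeomorphism_def)
  from measurable_sets[OF this A(1)] have "g -` A \<inter> f ` K \<in> sets borel"
    using fK by (simp add: space_restrict_space sets_restrict_space_iff)
  also have "g -` A \<inter> f ` K = f ` A"
    using g A(2) by (auto simp: homeomorphism_def subset_iff)
  finally show ?thesis .
qed

context
  fixes K A :: "(real^'n) set" and m v :: "real^'n" and \<epsilon> :: real
  assumes K: "compact K" and m: "norm m = 1" and v: "norm v = 1" and a: "v \<bullet> m \<noteq> 0"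
    and e: "0 \<le> \<epsilon>" "\<epsilon> < 1"
    and flat: "\<And>x y. x \<in> K \<Longrightarrow> y \<in> K \<Longrightarrow> \<bar>(x - y) \<bullet> m\<bar> \<le> \<epsilon> * \<bar>v \<bullet> m\<bar> * norm (x - y)"
begin

text \<open>The factor \<open>\<bar>v \<bullet> m\<bar>\<close> in the flatness hypothesis cancels
  the denominator of the oblique projection: differences change by at most
  \<open>\<epsilon> * norm (x - y)\<close>.\<close>

lemma oblique_bilipschitz:
  assumes "x \<in> K" "y \<in> K"
  shows "dist (oblique m v x) (oblique m v y) \<le> (1 + \<epsilon>) * dist x y"
    "(1 - \<epsilon>) * dist x y \<le> dist (oblique m v x) (oblique m v y)"
proof -
  have eq: "oblique m v x - oblique m v y = (x - y) - (((x - y) \<bullet> m) / (v \<bullet> m)) *\<^sub>R v"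
    by (simp add: oblique_def inner_diff_left diff_divide_distrib algebra_simps)
  have "norm ((((x - y) \<bullet> m) / (v \<bullet> m)) *\<^sub>R v) = \<bar>(x - y) \<bullet> m\<bar> / \<bar>v \<bullet> m\<bar>"
    using v by (simp add: abs_divide)
  also have "\<dots> \<le> \<epsilon> * norm (x - y)"
    using flat[OF assms] a by (simp add: divide_le_eq mult.commute mult.left_commute)
  finally have le: "norm ((((x - y) \<bullet> m) / (v \<bullet> m)) *\<^sub>R v) \<le> \<epsilon> * norm (x - y)" .
  show "dist (oblique m v x) (oblique m v y) \<le> (1 + \<epsilon>) * dist x y"
    unfolding dist_norm eq using norm_triangle_ineq4[of "x - y" "(((x - y) \<bullet> m) / (v \<bullet> m)) *\<^sub>R v"] le
    by (simp add: algebra_simps)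
  show "(1 - \<epsilon>) * dist x y \<le> dist (oblique m v x) (oblique m v y)"
    unfolding dist_norm eq using norm_triangle_ineq2[of "x - y" "(((x - y) \<bullet> m) / (v \<bullet> m)) *\<^sub>R v"] le
    by (simp add: algebra_simps)
qed

lemma inj_on_oblique: "inj_on (oblique m v) K"
proof (rule inj_onI)
  fix x y assume "x \<in> K" "y \<in> K" "oblique m v x = oblique m v y"
  then have "(1 - \<epsilon>) * dist x y \<le> 0" using oblique_bilipschitz(2)[of x y] by simp
  then show "x = y" using e by (simp add: mult_le_0_iff)
qed

lemma inj_on_proj: "inj_on (proj v) K"
  using inj_on_oblique oblique_proj[OF a] unfolding inj_on_def by metis

text \<open>Projecting obliquely to \<open>hyperplane m\<close> distorts measure by at most the
  powers of \<open>1 + \<epsilon>\<close> and \<open>1 - \<epsilon>\<close>; projecting from there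
  along \<open>v\<close> multiplies it by \<open>\<bar>v \<bullet> m\<bar>\<close> exactly.\<close>

lemma flat_projection_bounds:
  assumes A: "A \<in> sets borel" "A \<subseteq> K"
  shows "emeasure surface_measure (proj v ` A) \<le> ennreal (\<bar>v \<bullet> m\<bar> * (1 + \<epsilon>) ^ (CARD('n) - 1)) * emeasure surface_measure A"
    "ennreal (\<bar>v \<bullet> m\<bar> * (1 - \<epsilon>) ^ (CARD('n) - 1)) * emeasure surface_measure A \<le> emeasure surface_measure (proj v ` A)"
proof -
  let ?Q = "oblique m v ` A" and ?k = "CARD('n) - 1"
  have Qb: "?Q \<in> sets borel"
    by (rule inj_compact_borel_image[OF K continuous_on_oblique[OF a] inj_on_oblique A])
  have eq: "emeasure surface_measure (proj v ` A) = ennreal \<bar>v \<bullet> m\<bar> * emeasure surface_measure ?Q"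
  proof -
    have "proj v ` A = proj v ` ?Q" by (simp add: image_image proj_oblique[OF v])
    also have "emeasure surface_measure \<dots> = ennreal \<bar>v \<bullet> m\<bar> * emeasure surface_measure ?Q"
      by (rule emeasure_proj_plane[OF m v a Qb]) (auto simp: oblique_hyperplane[OF a])
    finally show ?thesis .
  qed
  have up: "emeasure surface_measure ?Q \<le> ennreal ((1 + \<epsilon>) ^ ?k) * emeasure surface_measure A"
    unfolding emeasure_surface[OF Qb] emeasure_surface[OF A(1)]
    using oblique_bilipschitz(1) A(2) e by (intro hausdorff_outer_lipschitz_image) auto
  have lo: "emeasure surface_measure A \<le> ennreal ((1 / (1 - \<epsilon>)) ^ ?k) * emeasure surface_measure ?Q"
  proof -
    let ?g = "inv_into A (oblique m v)"
    have inj: "inj_on (oblique m v) A" using inj_on_oblique A(2) by (rule inj_on_subset)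
    have "hausdorff_outer_measure ?k (?g ` ?Q) \<le> ennreal ((1 / (1 - \<epsilon>)) ^ ?k) * hausdorff_outer_measure ?k ?Q"
    proof (rule hausdorff_outer_lipschitz_image)
      fix p q assume "p \<in> ?Q" "q \<in> ?Q"
      then obtain x y where xy: "x \<in> A" "y \<in> A" "p = oblique m v x" "q = oblique m v y" by blast
      then have "(1 - \<epsilon>) * dist x y \<le> dist p q" using oblique_bilipschitz(2) A(2) by blast
      then show "dist (?g p) (?g q) \<le> 1 / (1 - \<epsilon>) * dist p q"
        using xy e by (simp add: inv_into_f_f[OF inj] field_simps)
    qed (use e in simp)
    then show ?thesis using inj unfolding emeasure_surface[OF Qb] emeasure_surface[OF A(1)] by simp
  qed
  show "emeasure surface_measure (proj v ` A) \<le> ennreal (\<bar>v \<bullet> m\<bar> * (1 + \<epsilon>) ^ ?k) * emeasure surface_measure A"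
    unfolding eq using mult_left_mono[OF up, of "ennreal \<bar>v \<bullet> m\<bar>"] e
    by (simp add: ennreal_mult mult.assoc)
  have "ennreal ((1 - \<epsilon>) ^ ?k) * emeasure surface_measure A
     \<le> ennreal ((1 - \<epsilon>) ^ ?k) * (ennreal ((1 / (1 - \<epsilon>)) ^ ?k) * emeasure surface_measure ?Q)"
    by (rule mult_left_mono[OF lo]) simp
  also have "\<dots> = emeasure surface_measure ?Q"
    using e by (simp add: mult.assoc[symmetric] ennreal_mult[symmetric] power_mult_distrib[symmetric])
  finally have "ennreal \<bar>v \<bullet> m\<bar> * (ennreal ((1 - \<epsilon>) ^ ?k) * emeasure surface_measure A) \<le> emeasure surface_measure (proj v ` A)"
    unfolding eq by (rule mult_left_mono) simp
  then show "ennreal (\<bar>v \<bullet> m\<bar> * (1 - \<epsilon>) ^ ?k) * emeasure surface_measure A \<le> emeasure surface_measure (proj v ` A)"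
    using e by (simp add: ennreal_mult mult.assoc)
qed

end

section \<open>Normals\<close>

text \<open>A strict form of tangency: it bounds chords between any two nearby points, not only
  chords through \<open>x\<close>, as a bilipschitz estimate requires.\<close>

definition flat_normal :: "(real^'n) set \<Rightarrow> real^'n \<Rightarrow> real^'n \<Rightarrow> bool" where
  "flat_normal S x m \<longleftrightarrow> norm m = 1 \<and>
     (\<forall>\<delta>>0. \<exists>r>0. \<forall>y\<in>S \<inter> ball x r. \<forall>z\<in>S \<inter> ball x r. \<bar>(y - z) \<bullet> m\<bar> \<le> \<delta> * norm (y - z))"

lemma base_part_id: "w \<in> base_space \<Longrightarrow> base_part w = w"
  by (simp add: base_part_def base_space_def vec_eq_iff axis_def)

lemma subspace_base_space: "subspace base_space"
  unfolding base_space_hyperplane hyperplane_def by (simp add: subspace_hyperplane2)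

lemma base_part_sum: "base_part (w::'n::{finite,linorder} point) = (\<Sum>i\<in>UNIV-{Max UNIV}. (w $ i) *\<^sub>R axis i 1)"
proof -
  have "(\<Sum>i\<in>UNIV-{Max UNIV}. (w $ i) *\<^sub>R axis i 1) $ j = base_part w $ j" for j
  proof -
    have "(\<Sum>i\<in>UNIV-{Max UNIV}. (w $ i) *\<^sub>R axis i (1::real)) $ j = (\<Sum>i\<in>UNIV-{Max UNIV}. if i = j then w $ i else 0)"
      by (simp add: axis_def if_distrib cong: if_cong)
    also have "\<dots> = base_part w $ j" by (simp add: base_part_def last_coord_def axis_def)
    finally show ?thesis .
  qed
  then show ?thesis by (simp add: vec_eq_iff)
qed

text \<open>Continuity of the derivative is given for each fixed vector; expanding in the coordinate
  vectors of \<open>base_space\<close> turns it into a bound uniform in \<open>w\<close>.\<close>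

lemma C1_parametrization_derivative_close:
  fixes p :: "'n::{finite,linorder} point \<Rightarrow> 'n point"
  assumes C: "C1_parametrization S G p p'" and y: "y \<in> G" and e: "\<epsilon> > 0"
  shows "\<exists>\<rho>>0. base_space \<inter> ball y \<rho> \<subseteq> G \<and>
    (\<forall>u\<in>base_space \<inter> ball y \<rho>. \<forall>w. norm (p' u (base_part w) - p' y (base_part w)) \<le> \<epsilon> * norm w)"
proof -
  define N where "N = real CARD('n)"
  have N: "N > 0" by (simp add: N_def)
  have oG: "openin (top_of_set base_space) G" using C by (simp add: C1_parametrization_def)
  then obtain \<rho>0 where r0: "\<rho>0 > 0" "ball y \<rho>0 \<inter> base_space \<subseteq> G"
    using y by (auto simp: openin_contains_ball)
  have ax: "axis i 1 \<in> base_space" if "i \<in> UNIV - {Max UNIV}" for i :: 'n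
    using that by (simp add: base_space_def last_coord_def axis_def)
  have "\<exists>\<rho>>0. \<forall>u\<in>G. dist u y < \<rho> \<longrightarrow> norm (p' u (axis i 1) - p' y (axis i 1)) \<le> \<epsilon> / N" if "i \<in> UNIV - {Max UNIV}" for i
  proof -
    have "continuous_on G (\<lambda>y. p' y (axis i 1))" using C ax[OF that] by (simp add: C1_parametrization_def)
    moreover have "\<epsilon> / N > 0" using e N by simp
    ultimately obtain d where "d > 0" "\<forall>u\<in>G. dist u y < d \<longrightarrow> dist (p' u (axis i 1)) (p' y (axis i 1)) < \<epsilon> / N"
      using y unfolding continuous_on_iff by metis
    then show ?thesis unfolding dist_norm by (meson less_imp_le)
  qed
  then obtain \<rho>1 where r1: "\<And>i. i \<in> UNIV - {Max UNIV} \<Longrightarrow> \<rho>1 i > 0"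
    "\<And>i u. i \<in> UNIV - {Max UNIV} \<Longrightarrow> u \<in> G \<Longrightarrow> dist u y < \<rho>1 i \<Longrightarrow> norm (p' u (axis i 1) - p' y (axis i 1)) \<le> \<epsilon> / N"
    by metis
  define \<rho> where "\<rho> = Min (insert \<rho>0 (\<rho>1 ` (UNIV - {Max UNIV})))"
  have r: "\<rho> > 0" "\<rho> \<le> \<rho>0" "\<And>i. i \<in> UNIV - {Max UNIV} \<Longrightarrow> \<rho> \<le> \<rho>1 i"
    using r0 r1 by (auto simp: \<rho>_def)
  show ?thesis
  proof (intro exI[of _ \<rho>] conjI ballI allI)
    show "\<rho> > 0" by fact
    show sub: "base_space \<inter> ball y \<rho> \<subseteq> G" using r0 r(2) by auto
    fix u w assume u: "u \<in> base_space \<inter> ball y \<rho>"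
    then have uG: "u \<in> G" using sub by blast
    have lin: "linear (p' z)" if "z \<in> G" for z
      using C that has_derivative_linear unfolding C1_parametrization_def by blast
    have "p' z (base_part w) = (\<Sum>i\<in>UNIV-{Max UNIV}. (w $ i) *\<^sub>R p' z (axis i 1))" if "z \<in> G" for z
      unfolding base_part_sum by (simp add: linear_sum[OF lin[OF that]] linear_cmul[OF lin[OF that]])
    then have "norm (p' u (base_part w) - p' y (base_part w)) = norm (\<Sum>i\<in>UNIV-{Max UNIV}. (w $ i) *\<^sub>R (p' u (axis i 1) - p' y (axis i 1)))"
      using uG y by (simp add: sum_subtractf[symmetric] scaleR_diff_right)
    also have "\<dots> \<le> (\<Sum>i\<in>UNIV-{Max UNIV}. norm ((w $ i) *\<^sub>R (p' u (axis i 1) - p' y (axis i 1))))"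
      by (rule norm_sum)
    also have "\<dots> \<le> (\<Sum>i\<in>UNIV-{Max (UNIV::'n set)}. norm w * (\<epsilon> / N))"
    proof (rule sum_mono)
      fix i :: 'n assume i: "i \<in> UNIV - {Max UNIV}"
      have "norm (p' u (axis i 1) - p' y (axis i 1)) \<le> \<epsilon> / N"
        using r1(2)[OF i uG] r(3)[OF i] u by (simp add: dist_commute)
      then show "norm ((w $ i) *\<^sub>R (p' u (axis i 1) - p' y (axis i 1))) \<le> norm w * (\<epsilon> / N)"
        unfolding norm_scaleR using component_le_norm_cart[of w i] by (intro mult_mono) auto
    qed
    also have "\<dots> \<le> (\<Sum>i\<in>(UNIV::'n set). norm w * (\<epsilon> / N))"
      using e N by (intro sum_mono2) auto
    also have "\<dots> = \<epsilon> * norm w" using N by (simp add: N_def)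
    finally show "norm (p' u (base_part w) - p' y (base_part w)) \<le> \<epsilon> * norm w" .
  qed
qed

text \<open>The function \<open>p\<close> is differentiable only within \<open>base_space\<close>.
  Composition with \<open>base_part\<close> extends it to a full ball, where the mean value
  inequality applies to its difference from the linear map \<open>p' y\<close>.\<close>

lemma C1_parametrization_strict_derivative:
  fixes p :: "'n::{finite,linorder} point \<Rightarrow> 'n point"
  assumes C: "C1_parametrization S G p p'" and y: "y \<in> G" and e: "\<epsilon> > 0"
  shows "\<exists>\<rho>>0. base_space \<inter> ball y \<rho> \<subseteq> G \<and>
    (\<forall>a\<in>base_space \<inter> ball y \<rho>. \<forall>b\<in>base_space \<inter> ball y \<rho>. norm (p a - p b - p' y (a - b)) \<le> \<epsilon> * norm (a - b))"
proof -
  obtain \<rho> where r: "\<rho> > 0" "base_space \<inter> ball y \<rho> \<subseteq> G"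
    and cl: "\<And>u w. u \<in> base_space \<inter> ball y \<rho> \<Longrightarrow> norm (p' u (base_part w) - p' y (base_part w)) \<le> \<epsilon> * norm w"
    using C1_parametrization_derivative_close[OF assms] by metis
  have oG: "openin (top_of_set base_space) G" using C by (simp add: C1_parametrization_def)
  have yb: "y \<in> base_space" using openin_imp_subset[OF oG] y by blast
  have lin: "linear (p' y)"
    using C y has_derivative_linear unfolding C1_parametrization_def by blast
  have bp: "base_part u \<in> base_space \<inter> ball y \<rho>" if "u \<in> ball y \<rho>" for u
  proof -
    have "dist y (base_part u) = norm (base_part (y - u))"
      using linear_diff[OF linear_base_part, of y u] base_part_id[OF yb] by (simp add: dist_norm)
    also have "\<dots> \<le> dist y u" using norm_base_part_le[of "y - u"] by (simp add: dist_norm)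
    finally show ?thesis using that by (simp add: base_part_base_space)
  qed
  define q where "q u = p (base_part u) - p' y (base_part u)" for u
  have blb: "bounded_linear base_part" using linear_base_part by (simp add: linear_conv_bounded_linear)
  have "norm (q a - q b) \<le> \<epsilon> * norm (a - b)" if ab: "a \<in> ball y \<rho>" "b \<in> ball y \<rho>" for a b
  proof (rule differentiable_bound[of "ball y \<rho>" q "\<lambda>u w. p' (base_part u) (base_part w) - p' y (base_part w)"])
    fix u assume u: "u \<in> ball y \<rho>"
    have "(p has_derivative p' (base_part u)) (at (base_part u) within base_space)"
      using C bp[OF u] r(2) unfolding C1_parametrization_def by blast
    then have "(p has_derivative p' (base_part u)) (at (base_part u) within (base_part ` ball y \<rho>))"
      by (rule has_derivative_subset) (auto simp: base_part_base_space)
    from has_derivative_in_compose[OF bounded_linear_imp_has_derivative[OF blb] this]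
    have 1: "((\<lambda>u. p (base_part u)) has_derivative (\<lambda>w. p' (base_part u) (base_part w))) (at u within ball y \<rho>)" .
    have "bounded_linear (\<lambda>w. p' y (base_part w))"
      using linear_compose[OF linear_base_part lin] by (simp add: linear_conv_bounded_linear o_def)
    from has_derivative_diff[OF 1 bounded_linear_imp_has_derivative[OF this]]
    show "(q has_derivative (\<lambda>w. p' (base_part u) (base_part w) - p' y (base_part w))) (at u within ball y \<rho>)"
      unfolding q_def .
    show "onorm (\<lambda>w. p' (base_part u) (base_part w) - p' y (base_part w)) \<le> \<epsilon>"
      using cl[OF bp[OF u]] by (intro onorm_bound) (use e in auto)
  qed (use ab in auto)
  moreover have "q a - q b = p a - p b - p' y (a - b)"
    if "a \<in> base_space \<inter> ball y \<rho>" "b \<in> base_space \<inter> ball y \<rho>" for a b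
    using that by (simp add: q_def base_part_id linear_diff[OF lin])
  ultimately have "norm (p a - p b - p' y (a - b)) \<le> \<epsilon> * norm (a - b)"
    if "a \<in> base_space \<inter> ball y \<rho>" "b \<in> base_space \<inter> ball y \<rho>" for a b
    using that by (metis IntD2)
  then show ?thesis using r by blast
qed

text \<open>Chords differ little from values of \<open>p' y\<close>, which are orthogonal to
  \<open>m\<close>. Injectivity of \<open>p' y\<close> bounds parameter distances by chord lengths,
  and the homeomorphism ensures that all nearby points of \<open>S\<close> come from nearby
  parameters.\<close>

lemma C1_parametrization_flat:
  fixes p :: "'n::{finite,linorder} point \<Rightarrow> 'n point"
  assumes C: "C1_parametrization S G p p'" and y: "y \<in> G" and m: "norm m = 1"
    and orth: "\<And>w. w \<in> base_space \<Longrightarrow> m \<bullet> p' y w = 0"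
  shows "flat_normal S (p y) m"
  unfolding flat_normal_def
proof (intro conjI allI impI)
  show "norm m = 1" by fact
  fix \<delta> :: real assume d: "\<delta> > 0"
  have der: "(p has_derivative p' y) (at y within base_space)" "inj_on (p' y) base_space"
    using C y by (auto simp: C1_parametrization_def)
  note lin = has_derivative_linear[OF der(1)]
  have "\<forall>x\<in>base_space. p' y x = 0 \<longrightarrow> x = 0"
    using der(2) linear_0[OF lin] subspace_0[OF subspace_base_space] unfolding inj_on_def by metis
  then obtain c where c: "c > 0" "\<And>w. w \<in> base_space \<Longrightarrow> norm (p' y w) \<ge> c * norm w"
    using injective_imp_isometric[of base_space "p' y"] subspace_base_space closed_subspace[OF subspace_base_space] lin
    by (auto simp: linear_conv_bounded_linear)
  \<comment> \<open>The solution of \<open>\<epsilon> = \<delta> * (c - \<epsilon>)\<close>: chords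
    have length at least \<open>(c - \<epsilon>) * norm (a - b)\<close> while the deviation is at
    most \<open>\<epsilon> * norm (a - b)\<close>.\<close>
  define \<epsilon> where "\<epsilon> = c * \<delta> / (1 + \<delta>)"
  have e: "\<epsilon> > 0" using c d by (simp add: \<epsilon>_def)
  have ed: "\<epsilon> = \<delta> * (c - \<epsilon>)" using d by (simp add: \<epsilon>_def field_simps)
  obtain \<rho> where r: "\<rho> > 0" "base_space \<inter> ball y \<rho> \<subseteq> G"
    and cl: "\<And>a b. a \<in> base_space \<inter> ball y \<rho> \<Longrightarrow> b \<in> base_space \<inter> ball y \<rho> \<Longrightarrow> norm (p a - p b - p' y (a - b)) \<le> \<epsilon> * norm (a - b)"
    using C1_parametrization_strict_derivative[OF C y e] by metis
  obtain q where q: "homeomorphism G (p ` G) p q" using C by (auto simp: C1_parametrization_def)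
  have oG: "openin (top_of_set base_space) G" "openin (top_of_set S) (p ` G)" using C by (auto simp: C1_parametrization_def)
  have yb: "y \<in> base_space" using openin_imp_subset[OF oG(1)] y by blast
  have "openin (top_of_set G) (base_space \<inter> ball y \<rho>)"
    by (rule openin_subset_trans[OF openin_open_Int[OF open_ball] r(2) openin_imp_subset[OF oG(1)]])
  then have "openin (top_of_set (p ` G)) (p ` (base_space \<inter> ball y \<rho>))"
    by (rule homeomorphism_imp_open_map[OF q])
  then have "openin (top_of_set S) (p ` (base_space \<inter> ball y \<rho>))" using oG(2) by (rule openin_trans)
  moreover have "p y \<in> p ` (base_space \<inter> ball y \<rho>)" using yb r(1) by auto
  ultimately obtain s where s: "s > 0" "ball (p y) s \<inter> S \<subseteq> p ` (base_space \<inter> ball y \<rho>)"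
    unfolding openin_contains_ball by metis
  have "\<bar>(u - z) \<bullet> m\<bar> \<le> \<delta> * norm (u - z)" if "u \<in> S \<inter> ball (p y) s" "z \<in> S \<inter> ball (p y) s" for u z
  proof -
    have "u \<in> p ` (base_space \<inter> ball y \<rho>)" "z \<in> p ` (base_space \<inter> ball y \<rho>)" using s(2) that by auto
    then obtain a b where ab: "a \<in> base_space \<inter> ball y \<rho>" "b \<in> base_space \<inter> ball y \<rho>" "u = p a" "z = p b"
      by (metis imageE)
    have abb: "a - b \<in> base_space" using ab subspace_diff[OF subspace_base_space] by blast
    note le = cl[OF ab(1,2)]
    have "\<bar>(u - z) \<bullet> m\<bar> = \<bar>(p a - p b - p' y (a - b)) \<bullet> m\<bar>"
    proof -
      have "p' y (a - b) \<bullet> m = 0" using orth[OF abb] by (simp add: inner_commute)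
      then show ?thesis by (simp add: ab inner_diff_left)
    qed
    also have "\<dots> \<le> norm (p a - p b - p' y (a - b)) * norm m" by (rule Cauchy_Schwarz_ineq2)
    also have "\<dots> \<le> \<epsilon> * norm (a - b)" using le m by simp
    also have "\<dots> = \<delta> * ((c - \<epsilon>) * norm (a - b))" using ed by simp
    also have "\<dots> \<le> \<delta> * norm (u - z)"
    proof (rule mult_left_mono)
      have "c * norm (a - b) \<le> norm (p' y (a - b))" by (rule c(2)[OF abb])
      also have "\<dots> \<le> norm (p a - p b) + norm (p a - p b - p' y (a - b))"
        using norm_triangle_ineq4[of "p a - p b" "p a - p b - p' y (a - b)"] by simp
      finally show "(c - \<epsilon>) * norm (a - b) \<le> norm (u - z)" using le by (simp add: ab algebra_simps)
    qed (use d in simp)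
    finally show ?thesis .
  qed
  then show "\<exists>r>0. \<forall>y'\<in>S \<inter> ball (p y) r. \<forall>z\<in>S \<inter> ball (p y) r. \<bar>(y' - z) \<bullet> m\<bar> \<le> \<delta> * norm (y' - z)"
    using s(1) by blast
qed

text \<open>Tangent vectors are limits of difference quotients, so an estimate for chords at
  \<open>p y\<close> passes to them. The vector \<open>m\<close> is arbitrary: the bound is applied
  to the vertical of the Lipschitz graph, to a rival normal and to the normal at a neighbouring
  point.\<close>

lemma C1_parametrization_tangent_bound:
  fixes p :: "'n::{finite,linorder} point \<Rightarrow> 'n point"
  assumes C: "C1_parametrization S G p p'" and y: "y \<in> G" and w: "w \<in> base_space" and d: "\<delta> \<ge> 0" and r: "r > 0"
    and flat: "\<And>z. z \<in> S \<inter> ball (p y) r \<Longrightarrow> \<bar>(z - p y) \<bullet> m\<bar> \<le> \<delta> * norm (z - p y)"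
  shows "\<bar>p' y w \<bullet> m\<bar> \<le> \<delta> * norm (p' y w)"
proof -
  have der: "(p has_derivative p' y) (at y within base_space)" using C y by (auto simp: C1_parametrization_def)
  note lin = has_derivative_linear[OF der(1)]
  have oG: "openin (top_of_set base_space) G" "openin (top_of_set S) (p ` G)" using C by (auto simp: C1_parametrization_def)
  have yb: "y \<in> base_space" using openin_imp_subset[OF oG(1)] y by blast
  have line: "y + t *\<^sub>R w \<in> base_space" for t
    using yb w subspace_base_space by (intro subspace_add subspace_scale)
  define f where "f t = p (y + t *\<^sub>R w)" for t :: real
  define \<tau> where "\<tau> = p' y w"
  have "((\<lambda>t. y + t *\<^sub>R w) has_derivative (\<lambda>t. t *\<^sub>R w)) (at 0)"
    by (auto intro!: derivative_eq_intros)
  moreover have "(p has_derivative p' y) (at (y + 0 *\<^sub>R w) within range (\<lambda>t. y + t *\<^sub>R w))"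
    using has_derivative_subset[OF der, of "range (\<lambda>t. y + t *\<^sub>R w)"] line by auto
  ultimately have "(f has_derivative (\<lambda>t. p' y (t *\<^sub>R w))) (at 0)"
    unfolding f_def by (rule has_derivative_in_compose)
  then have fd: "(f has_derivative (\<lambda>t. t *\<^sub>R \<tau>)) (at 0)" by (simp add: linear_cmul[OF lin] \<tau>_def)
  then have lim: "((\<lambda>t. norm (f t - f 0 - t *\<^sub>R \<tau>) / norm t) \<longlongrightarrow> 0) (at 0)"
    by (simp add: has_derivative_at)
  have fc: "(f \<longlongrightarrow> f 0) (at 0)" using has_derivative_continuous[OF fd] by (simp add: isCont_def)
  have ev1: "eventually (\<lambda>t. f t \<in> ball (p y) r) (at 0)"
    using tendstoD[OF fc r] by (simp add: f_def dist_commute)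
  obtain s where s: "s > 0" "ball y s \<inter> base_space \<subseteq> G" using oG(1) y by (auto simp: openin_contains_ball)
  have "((\<lambda>t. y + t *\<^sub>R w) \<longlongrightarrow> y + 0 *\<^sub>R w) (at (0::real))" by (intro tendsto_intros)
  from tendstoD[OF this s(1)] have "eventually (\<lambda>t. y + t *\<^sub>R w \<in> G) (at (0::real))"
    by eventually_elim (use s line in \<open>auto simp: dist_commute\<close>)
  then have ev2: "eventually (\<lambda>t. f t \<in> S) (at 0)"
    by eventually_elim (use openin_imp_subset[OF oG(2)] in \<open>auto simp: f_def\<close>)
  have "eventually (\<lambda>t::real. t \<noteq> 0) (at 0)" by (simp add: eventually_at_filter)
  with ev1 ev2 have ev: "eventually (\<lambda>t. \<bar>\<tau> \<bullet> m\<bar> \<le> \<delta> * norm \<tau> + (norm m + \<delta>) * (norm (f t - f 0 - t *\<^sub>R \<tau>) / norm t)) (at 0)"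
  proof eventually_elim
    case (elim t)
    define A where "A = f t - f 0 - t *\<^sub>R \<tau>"
    have f0: "f 0 = p y" by (simp add: f_def)
    have "\<bar>t\<bar> * \<bar>\<tau> \<bullet> m\<bar> = \<bar>(f t - f 0) \<bullet> m - A \<bullet> m\<bar>"
      by (simp add: A_def inner_diff_left abs_mult[symmetric])
    also have "\<dots> \<le> \<bar>(f t - f 0) \<bullet> m\<bar> + \<bar>A \<bullet> m\<bar>" by linarith
    also have "\<dots> \<le> \<delta> * norm (f t - f 0) + norm A * norm m"
      using flat[of "f t"] elim f0 Cauchy_Schwarz_ineq2[of A m] by (intro add_mono) auto
    also have "\<dots> \<le> \<delta> * (\<bar>t\<bar> * norm \<tau> + norm A) + norm A * norm m"
      using norm_triangle_ineq[of "t *\<^sub>R \<tau>" A] d by (intro add_mono mult_left_mono) (auto simp: A_def)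
    finally have le: "\<bar>t\<bar> * \<bar>\<tau> \<bullet> m\<bar> \<le> \<bar>t\<bar> * (\<delta> * norm \<tau>) + (norm m + \<delta>) * norm A" by (simp add: algebra_simps)
    have tp: "\<bar>t\<bar> > 0" using elim by simp
    have "\<bar>\<tau> \<bullet> m\<bar> \<le> (\<bar>t\<bar> * (\<delta> * norm \<tau>) + (norm m + \<delta>) * norm A) / \<bar>t\<bar>"
      using le tp by (simp only: pos_le_divide_eq[OF tp] mult.commute[of "\<bar>\<tau> \<bullet> m\<bar>"])
    also have "\<dots> = \<delta> * norm \<tau> + (norm m + \<delta>) * (norm A / norm t)"
      using tp by (simp add: add_divide_distrib)
    finally show ?case unfolding A_def .
  qed
  have "((\<lambda>t. \<delta> * norm \<tau> + (norm m + \<delta>) * (norm (f t - f 0 - t *\<^sub>R \<tau>) / norm t)) \<longlongrightarrow> \<delta> * norm \<tau> + (norm m + \<delta>) * 0) (at 0)"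
    by (intro tendsto_intros lim)
  from tendsto_lowerbound[OF this ev] show ?thesis by (simp add: \<tau>_def)
qed

text \<open>The injective derivative has an image of codimension 1, which therefore is the whole
  orthogonal complement of a unit vector.\<close>

lemma C1_parametrization_normal_exists:
  fixes p :: "'n::{finite,linorder} point \<Rightarrow> 'n point"
  assumes C: "C1_parametrization S G p p'" and y: "y \<in> G"
  shows "\<exists>m. norm m = 1 \<and> (\<forall>w\<in>base_space. m \<bullet> p' y w = 0) \<and> (\<forall>\<tau>. \<tau> \<bullet> m = 0 \<longrightarrow> (\<exists>w\<in>base_space. \<tau> = p' y w))"
proof -
  have der: "(p has_derivative p' y) (at y within base_space)" "inj_on (p' y) base_space"
    using C y by (auto simp: C1_parametrization_def)
  note lin = has_derivative_linear[OF der(1)]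
  let ?T = "p' y ` base_space"
  have dimb: "dim (base_space :: 'n point set) = CARD('n) - 1"
    unfolding base_space_hyperplane hyperplane_def
    by (subst inner_commute) (simp add: dim_hyperplane axis_eq_0_iff)
  have "dim ?T = dim (base_space :: 'n point set)"
    using der(2) by (intro dim_image_eq[OF lin]) (simp add: span_eq_iff[THEN iffD2, OF subspace_base_space])
  then have dimT: "dim ?T = CARD('n) - 1" using dimb by simp
  have sT: "subspace ?T" by (rule linear_subspace_image[OF lin subspace_base_space])
  have "dim ?T < DIM('n point)" using dimT by simp
  then obtain x where x: "x \<noteq> 0" "\<And>z. z \<in> span ?T \<Longrightarrow> orthogonal x z" using orthogonal_to_subspace_exists by metis
  define m where "m = (1 / norm x) *\<^sub>R x"
  have m: "norm m = 1" "m \<noteq> 0" using x(1) by (auto simp: m_def)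
  have orth: "m \<bullet> z = 0" if "z \<in> ?T" for z using x(2)[OF span_base[OF that]] by (simp add: m_def orthogonal_def)
  have "?T = {z. m \<bullet> z = 0}"
  proof (rule subspace_dim_equal[OF sT subspace_hyperplane])
    show "?T \<subseteq> {z. m \<bullet> z = 0}" using orth by blast
    show "dim ?T \<ge> dim {z. m \<bullet> z = 0}" using dimT m(2) by (simp add: dim_hyperplane)
  qed
  then show ?thesis using m(1) by (intro exI[of _ m]) (auto simp: inner_commute)
qed

text \<open>Here \<open>w\<close> is the vertical of the Lipschitz graph in the original
  coordinates. It shows on which side \<open>D\<close> lies, and the bound with
  \<open>\<delta> < 1\<close> keeps it from being tangent to the boundary.\<close>

lemma lipschitz_boundary_vertical:
  fixes D :: "'n::{finite,linorder} point set"
  assumes D: "open D" "lipschitz_boundary D" and x: "x \<in> frontier D"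
  shows "\<exists>w \<delta> \<epsilon>. norm w = 1 \<and> 0 \<le> \<delta> \<and> \<delta> < 1 \<and> \<epsilon> > 0 \<and>
     (\<forall>t. 0 < t \<and> t < \<epsilon> \<longrightarrow> x + t *\<^sub>R w \<in> D \<and> x - t *\<^sub>R w \<notin> D) \<and>
     (\<forall>z\<in>frontier D \<inter> ball x \<epsilon>. \<bar>(z - x) \<bullet> w\<bar> \<le> \<delta> * norm (z - x))"
proof -
  obtain \<epsilon> f L and Q :: "'n point \<Rightarrow> 'n point"
    where e: "\<epsilon> > 0" and Q: "orthogonal_transformation Q" and L: "L-lipschitz_on base_space f" "f 0 = 0"
    and inD: "\<And>y. y \<in> ball x \<epsilon> \<Longrightarrow> y \<in> D \<longleftrightarrow> f (base_part (Q (y - x))) < last_coord (Q (y - x))"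
    and graph: "\<And>y. y \<in> frontier D \<inter> ball x \<epsilon> \<Longrightarrow> last_coord (Q (y - x)) = f (base_part (Q (y - x)))"
    using lipschitz_boundary_graph[OF assms] by metis
  have L0: "L \<ge> 0" using L(1) by (rule lipschitz_on_nonneg)
  note lin = orthogonal_transformation_linear[OF Q]
  define ed :: "'n point" where "ed = axis (Max UNIV) 1"
  obtain w where w: "Q w = ed" using orthogonal_transformation_surj[OF Q] by (metis surjD)
  have nw: "norm w = 1" using orthogonal_transformation_norm[OF Q, of w] w by (simp add: ed_def norm_axis_real)
  have bped: "base_part (t *\<^sub>R ed) = 0" "last_coord (t *\<^sub>R ed) = t" for t
    by (auto simp: base_part_def last_coord_def ed_def axis_def vec_eq_iff)
  have inn: "u \<bullet> w = last_coord (Q u)" for u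
  proof -
    have "u \<bullet> w = Q u \<bullet> Q w" using Q by (simp add: orthogonal_transformation_def)
    also have "\<dots> = last_coord (Q u)" by (simp add: w ed_def inner_axis last_coord_def)
    finally show ?thesis .
  qed
  \<comment> \<open>The sine of the steepest angle between the base plane and a chord, the tangent
    of that angle being \<open>L\<close>.\<close>
  define \<delta> where "\<delta> = L / sqrt (1 + L\<^sup>2)"
  have sq: "sqrt (1 + L\<^sup>2) > L" using L0 by (intro real_less_rsqrt) simp
  have s0: "sqrt (1 + L\<^sup>2) > 0" by (simp add: add_pos_nonneg)
  have d: "0 \<le> \<delta>" "\<delta> < 1" using L0 sq s0 by (auto simp: \<delta>_def divide_less_eq)
  have tr: "x + t *\<^sub>R w \<in> D \<and> x - t *\<^sub>R w \<notin> D" if t: "0 < t" "t < \<epsilon>" for t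
  proof -
    have 1: "x + t *\<^sub>R w \<in> ball x \<epsilon>" "x - t *\<^sub>R w \<in> ball x \<epsilon>" using t nw by (auto simp: dist_norm)
    have q: "Q (x + t *\<^sub>R w - x) = t *\<^sub>R ed" "Q (x - t *\<^sub>R w - x) = (- t) *\<^sub>R ed"
      using lin w by (auto simp: linear_cmul linear_neg)
    show ?thesis using inD[OF 1(1)] inD[OF 1(2)] t unfolding q bped L(2) by simp
  qed
  have fl: "\<bar>(z - x) \<bullet> w\<bar> \<le> \<delta> * norm (z - x)" if z: "z \<in> frontier D \<inter> ball x \<epsilon>" for z
  proof -
    define u where "u = Q (z - x)"
    define l where "l = last_coord u"
    define b where "b = base_part u"
    have nu: "norm u = norm (z - x)" unfolding u_def by (rule orthogonal_transformation_norm[OF Q])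
    have ub: "u = b + axis (Max UNIV) l" by (simp add: b_def l_def base_part_def)
    have "(norm u)\<^sup>2 = (norm b)\<^sup>2 + l\<^sup>2"
    proof -
      have "b \<bullet> axis (Max UNIV) l = 0" using base_part_base_space[of u]
        by (simp add: b_def base_space_def last_coord_def inner_axis)
      then have "(norm u)\<^sup>2 = (norm b)\<^sup>2 + (norm (axis (Max UNIV :: 'n) l))\<^sup>2"
        unfolding ub by (intro norm_add_Pythagorean) (simp add: orthogonal_def)
      then show ?thesis by (simp add: norm_axis_real)
    qed
    moreover have "\<bar>l\<bar> \<le> L * norm b"
    proof -
      have "l = f b" using graph[OF z] by (simp add: l_def b_def u_def)
      moreover have "dist (f b) (f 0) \<le> L * dist b 0"
        by (rule lipschitz_onD[OF L(1)]) (simp_all add: b_def base_part_base_space subspace_0[OF subspace_base_space])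
      ultimately show ?thesis using L(2) by (simp add: dist_norm)
    qed
    then have "l\<^sup>2 \<le> L\<^sup>2 * (norm b)\<^sup>2"
      using power_mono[of "\<bar>l\<bar>" "L * norm b" 2] by (simp add: power_mult_distrib)
    ultimately have lu: "(1 + L\<^sup>2) * l\<^sup>2 \<le> L\<^sup>2 * (norm u)\<^sup>2" by (simp add: algebra_simps)
    have sqq: "(sqrt (1 + L\<^sup>2))\<^sup>2 = 1 + L\<^sup>2" by (rule real_sqrt_pow2) (simp add: add_nonneg_nonneg)
    have "(sqrt (1 + L\<^sup>2) * \<bar>l\<bar>)\<^sup>2 \<le> (L * norm u)\<^sup>2"
      unfolding power_mult_distrib power2_abs sqq by (rule lu)
    then have "sqrt (1 + L\<^sup>2) * \<bar>l\<bar> \<le> L * norm u" by (rule power2_le_imp_le) (simp add: L0)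
    then have "\<bar>l\<bar> \<le> L * norm u / sqrt (1 + L\<^sup>2)" by (simp only: pos_le_divide_eq[OF s0] mult.commute[of "\<bar>l\<bar>"])
    then have "\<bar>l\<bar> \<le> \<delta> * norm u" by (simp add: \<delta>_def)
    then show ?thesis using nu by (simp add: inn u_def[symmetric] l_def)
  qed
  show ?thesis using nw d e tr fl by blast
qed

text \<open>Flatness frees a small convex cone around \<open>m\<close>, and its mirror image, of
  boundary points. Each is connected, hence entirely inside or outside \<open>D\<close>, and the
  points in direction \<open>w\<close> and \<open>- w\<close> decide which. Off the boundary, lying
  outside \<open>D\<close> means lying outside its closure.\<close>

lemma flat_cone:
  fixes D :: "(real^'n) set"
  assumes D: "open D" and x: "x \<in> frontier D" and fl: "flat_normal (frontier D) x m"
    and w: "norm w = 1" "w \<bullet> m > 0" "e > 0" "\<And>t. 0 < t \<Longrightarrow> t < e \<Longrightarrow> x + t *\<^sub>R w \<in> D \<and> x - t *\<^sub>R w \<notin> D"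
    and u: "u \<bullet> m > 0"
  shows "\<exists>s>0. \<forall>t. 0 < t \<and> t < s \<longrightarrow> x + t *\<^sub>R u \<in> D \<and> x - t *\<^sub>R u \<notin> closure D"
proof -
  have u0: "norm u > 0" using u by auto
  \<comment> \<open>Half the smaller of the cosines between \<open>m\<close> and \<open>w\<close>,
    \<open>u\<close>, so that both directions lie strictly inside the cone.\<close>
  define \<delta> where "\<delta> = min (w \<bullet> m) (u \<bullet> m / norm u) / 2"
  have d: "\<delta> > 0" using w u u0 by (simp add: \<delta>_def)
  have half: "min a b / 2 < a" "min a b / 2 < b" if "a > 0" "b > 0" for a b :: real
    using that by (auto simp: min_def)
  have dw: "\<delta> < w \<bullet> m" unfolding \<delta>_def by (rule half(1)[OF w(2) divide_pos_pos[OF u u0]])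
  have "\<delta> < u \<bullet> m / norm u" unfolding \<delta>_def by (rule half(2)[OF w(2) divide_pos_pos[OF u u0]])
  then have du: "\<delta> * norm u < u \<bullet> m" using u0 by (simp add: pos_less_divide_eq)
  obtain r where r: "r > 0" "\<And>y z. y \<in> frontier D \<inter> ball x r \<Longrightarrow> z \<in> frontier D \<inter> ball x r \<Longrightarrow> \<bar>(y - z) \<bullet> m\<bar> \<le> \<delta> * norm (y - z)"
    using fl d unfolding flat_normal_def by metis
  define C where "C = {h. \<delta> * norm h < h \<bullet> m} \<inter> ball 0 r"
  have cvx: "convex C"
  proof -
    have "convex {h. \<delta> * norm h < h \<bullet> m}"
    proof (rule convexI)
      fix a b :: "real^'n" and s t :: real assume ab: "a \<in> {h. \<delta> * norm h < h \<bullet> m}" "b \<in> {h. \<delta> * norm h < h \<bullet> m}"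
        and st: "0 \<le> s" "0 \<le> t" "s + t = 1"
      have "\<delta> * norm (s *\<^sub>R a + t *\<^sub>R b) \<le> \<delta> * (s * norm a + t * norm b)"
        using norm_triangle_ineq[of "s *\<^sub>R a" "t *\<^sub>R b"] st d by (intro mult_left_mono) auto
      also have "\<dots> = s * (\<delta> * norm a) + t * (\<delta> * norm b)" by (simp add: algebra_simps)
      also have "\<dots> < s * (a \<bullet> m) + t * (b \<bullet> m)"
      proof (cases "s = 0")
        case True then show ?thesis using ab st by simp
      next
        case False
        then have "s * (\<delta> * norm a) < s * (a \<bullet> m)" using ab st by simp
        moreover have "t * (\<delta> * norm b) \<le> t * (b \<bullet> m)" using ab st by (intro mult_left_mono) auto
        ultimately show ?thesis by linarith
      qed
      finally show "s *\<^sub>R a + t *\<^sub>R b \<in> {h. \<delta> * norm h < h \<bullet> m}" by (simp add: inner_add_left)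
    qed
    then show ?thesis unfolding C_def by (intro convex_Int) auto
  qed
  have noS: "x + h \<notin> frontier D" "x - h \<notin> frontier D" if h: "h \<in> C" for h
  proof -
    have hb: "x + h \<in> ball x r" "x - h \<in> ball x r" using h by (auto simp: C_def dist_norm)
    show "x + h \<notin> frontier D" using r(2)[of "x + h" x] hb(1) x r(1) h by (auto simp: C_def)
    show "x - h \<notin> frontier D" using r(2)[of "x - h" x] hb(2) x r(1) h by (auto simp: C_def)
  qed
  define t0 where "t0 = min e r / 2"
  have t0: "0 < t0" "t0 < e" "t0 < r" using w(3) r(1) by (auto simp: t0_def)
  have wC: "t0 *\<^sub>R w \<in> C" using t0 dw w(1) by (simp add: C_def)
  have conn: "connected ((\<lambda>h. x + h) ` C)" "connected ((\<lambda>h. x - h) ` C)"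
    using convex_connected[OF cvx] by (auto intro!: connected_continuous_image continuous_intros)
  have inD: "x + h \<in> D" if h: "h \<in> C" for h
  proof (rule ccontr)
    assume "x + h \<notin> D"
    moreover have "x + t0 *\<^sub>R w \<in> D" using w(4)[OF t0(1,2)] by blast
    ultimately have "(\<lambda>h. x + h) ` C \<inter> frontier D \<noteq> {}"
      using h wC by (intro connected_Int_frontier[OF conn(1)]) auto
    then show False using noS(1) by blast
  qed
  have outD: "x - h \<notin> closure D" if h: "h \<in> C" for h
  proof
    assume "x - h \<in> closure D"
    then have "x - h \<in> D" using noS(2)[OF h] D by (simp add: frontier_def interior_open)
    moreover have "x - t0 *\<^sub>R w \<notin> D" using w(4)[OF t0(1,2)] by blast
    ultimately have "(\<lambda>h. x - h) ` C \<inter> frontier D \<noteq> {}"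
      using h wC by (intro connected_Int_frontier[OF conn(2)]) auto
    then show False using noS(2) by blast
  qed
  have "t *\<^sub>R u \<in> C" if "0 < t" "t < r / norm u" for t
    using that du u0 by (simp add: C_def mult.left_commute pos_less_divide_eq)
  then show ?thesis using inD outD r(1) u0 by (intro exI[of _ "r / norm u"]) auto
qed

text \<open>The last clause says that \<open>frontier D\<close> has tangents in all directions orthogonal to \<open>m\<close>.\<close>

definition good_normal :: "'n::{finite,linorder} point set \<Rightarrow> 'n point \<Rightarrow> 'n point \<Rightarrow> bool" where
  "good_normal D x m \<longleftrightarrow> flat_normal (frontier D) x m \<and>
     (\<forall>u. u \<bullet> m > 0 \<longrightarrow> (\<exists>s>0. \<forall>t. 0 < t \<and> t < s \<longrightarrow> x + t *\<^sub>R u \<in> D \<and> x - t *\<^sub>R u \<notin> closure D)) \<and>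
     (\<forall>\<tau> m0 \<delta> r. \<tau> \<bullet> m = 0 \<and> \<delta> \<ge> 0 \<and> r > 0 \<and> (\<forall>z\<in>frontier D \<inter> ball x r. \<bar>(z - x) \<bullet> m0\<bar> \<le> \<delta> * norm (z - x))
         \<longrightarrow> \<bar>\<tau> \<bullet> m0\<bar> \<le> \<delta> * norm \<tau>)"

lemma billiard_boundary_point:
  assumes D: "billiard_domain D Rt" and x: "x \<in> Rt"
  shows "x \<in> frontier D"
proof -
  have "openin (top_of_set (frontier D)) Rt" using D by (simp add: billiard_domain_def)
  from openin_imp_subset[OF this] show ?thesis using x by blast
qed

text \<open>If the vertical \<open>w\<close> were tangent, the tangent bound would give
  \<open>1 \<le> \<delta>\<close>. So \<open>w\<close> has a nonzero component along the normal
  line, and its sign selects the orientation.\<close>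

lemma good_normal_exists:
  fixes D :: "'n::{finite,linorder} point set"
  assumes D: "billiard_domain D Rt" and x: "x \<in> Rt"
  shows "\<exists>m. good_normal D x m \<and> is_inner_normal D x m"
proof -
  have oD: "open D" "lipschitz_boundary D" using D by (auto simp: billiard_domain_def)
  have xS: "x \<in> frontier D" by (rule billiard_boundary_point[OF D x])
  have "\<exists>G p p'. C1_parametrization (frontier D) G p p' \<and> x \<in> p ` G"
    using D x by (simp add: billiard_domain_def)
  then obtain G p p' where Cx: "C1_parametrization (frontier D) G p p'" "x \<in> p ` G" by (elim exE conjE)
  then obtain y where C: "C1_parametrization (frontier D) G p p'" "y \<in> G" "p y = x" by (metis imageE)
  obtain m0 where m0: "norm m0 = 1" "\<And>w. w\<in>base_space \<Longrightarrow> m0 \<bullet> p' y w = 0" "\<And>\<tau>. \<tau> \<bullet> m0 = 0 \<Longrightarrow> \<exists>w\<in>base_space. \<tau> = p' y w"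
    using C1_parametrization_normal_exists[OF C(1,2)] by metis
  obtain w \<delta> \<epsilon> where w: "norm w = 1" "0 \<le> \<delta>" "\<delta> < 1" "\<epsilon> > 0"
     "\<And>t. 0 < t \<Longrightarrow> t < \<epsilon> \<Longrightarrow> x + t *\<^sub>R w \<in> D \<and> x - t *\<^sub>R w \<notin> D"
     "\<And>z. z\<in>frontier D \<inter> ball x \<epsilon> \<Longrightarrow> \<bar>(z - x) \<bullet> w\<bar> \<le> \<delta> * norm (z - x)"
    using lipschitz_boundary_vertical[OF oD xS] by metis
  have tang: "\<bar>\<tau> \<bullet> n\<bar> \<le> \<delta>' * norm \<tau>" if tm: "\<tau> \<bullet> m0 = 0" "\<delta>' \<ge> 0" "r > 0" "\<And>z. z\<in>frontier D \<inter> ball x r \<Longrightarrow> \<bar>(z - x) \<bullet> n\<bar> \<le> \<delta>' * norm (z - x)" for \<tau> n \<delta>' r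
  proof -
    obtain u where u: "u \<in> base_space" "\<tau> = p' y u" using m0(3)[OF tm(1)] by blast
    show ?thesis unfolding u(2)
      by (rule C1_parametrization_tangent_bound[OF C(1,2) u(1) tm(2,3)]) (use tm(4) C(3) in auto)
  qed
  have wm: "w \<bullet> m0 \<noteq> 0"
  proof
    assume "w \<bullet> m0 = 0"
    from tang[OF this w(2,4,6)] have "\<bar>w \<bullet> w\<bar> \<le> \<delta> * norm w" by blast
    then show False using w(1,3) by (simp add: inner_unit)
  qed
  define m where "m = (if w \<bullet> m0 > 0 then m0 else - m0)"
  have m: "norm m = 1" "w \<bullet> m > 0" "\<And>w. w\<in>base_space \<Longrightarrow> m \<bullet> p' y w = 0" "\<And>\<tau>. \<tau> \<bullet> m = 0 \<longleftrightarrow> \<tau> \<bullet> m0 = 0"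
    using m0 wm by (auto simp: m_def)
  have fl: "flat_normal (frontier D) x m" using C1_parametrization_flat[OF C(1,2) m(1,3)] C(3) by simp
  have cone: "\<exists>s>0. \<forall>t. 0 < t \<and> t < s \<longrightarrow> x + t *\<^sub>R u \<in> D \<and> x - t *\<^sub>R u \<notin> closure D" if "u \<bullet> m > 0" for u
    by (rule flat_cone[OF oD(1) xS fl w(1) m(2) w(4) _ that]) (use w(5) in blast)
  have "good_normal D x m"
    unfolding good_normal_def m(4)
  proof (intro conjI allI impI)
    show "flat_normal (frontier D) x m" by fact
    fix u assume "u \<bullet> m > 0" then show "\<exists>s>0. \<forall>t. 0 < t \<and> t < s \<longrightarrow> x + t *\<^sub>R u \<in> D \<and> x - t *\<^sub>R u \<notin> closure D" by (rule cone)
  next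
    fix \<tau> n \<delta>' r assume "\<tau> \<bullet> m0 = 0 \<and> \<delta>' \<ge> 0 \<and> r > 0 \<and> (\<forall>z\<in>frontier D \<inter> ball x r. \<bar>(z - x) \<bullet> n\<bar> \<le> \<delta>' * norm (z - x))"
    then show "\<bar>\<tau> \<bullet> n\<bar> \<le> \<delta>' * norm \<tau>" using tang[of \<tau> \<delta>' r n] by blast
  qed
  moreover have "is_inner_normal D x m"
  proof -
    have "m \<bullet> m > 0" using m(1) by (simp add: inner_unit)
    from cone[OF this] show ?thesis unfolding is_inner_normal_def using m C by blast
  qed
  ultimately show ?thesis by blast
qed

text \<open>The rival normal may come from another parametrization. The tangent clause of
  \<open>good_normal\<close> makes it orthogonal to everything orthogonal to \<open>m\<close>, hence
  \<open>m' = m\<close> or \<open>m' = - m\<close>; the latter points out of the domain.\<close>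

lemma inner_normal_unique:
  assumes g: "good_normal D x m" and m': "is_inner_normal D x m'"
  shows "m' = m"
proof -
  obtain G p p' y where C: "C1_parametrization (frontier D) G p p'" "y \<in> G" "p y = x" "\<And>w. w\<in>base_space \<Longrightarrow> m' \<bullet> p' y w = 0"
    and n: "norm m' = 1" and ins: "\<exists>\<epsilon>>0. \<forall>t. 0 < t \<and> t < \<epsilon> \<longrightarrow> x + t *\<^sub>R m' \<in> D"
    using m' unfolding is_inner_normal_def by blast
  have "openin (top_of_set (frontier D)) (p ` G)" using C(1) by (simp add: C1_parametrization_def)
  from openin_imp_subset[OF this] have xS: "x \<in> frontier D" using C(2,3) by blast
  have fl: "flat_normal (frontier D) x m'" using C1_parametrization_flat[OF C(1,2) n C(4)] C(3) by simp
  have nm: "norm m = 1" using g by (simp add: good_normal_def flat_normal_def)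
  have orth: "\<tau> \<bullet> m' = 0" if "\<tau> \<bullet> m = 0" for \<tau>
  proof -
    have "\<bar>\<tau> \<bullet> m'\<bar> \<le> \<delta> * norm \<tau>" if d: "\<delta> > 0" for \<delta>
    proof -
      obtain r where r: "r > 0" "\<forall>y\<in>frontier D \<inter> ball x r. \<forall>z\<in>frontier D \<inter> ball x r. \<bar>(y - z) \<bullet> m'\<bar> \<le> \<delta> * norm (y - z)"
        using fl d unfolding flat_normal_def by metis
      then have "\<forall>z\<in>frontier D \<inter> ball x r. \<bar>(z - x) \<bullet> m'\<bar> \<le> \<delta> * norm (z - x)" using xS by simp
      then show ?thesis using g \<open>\<tau> \<bullet> m = 0\<close> d r(1) unfolding good_normal_def by (meson less_imp_le)
    qed
    then have "\<bar>\<tau> \<bullet> m'\<bar> \<le> e" if "e > 0" for e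
      using that \<open>\<And>\<delta>. \<delta> > 0 \<Longrightarrow> _\<close>[of "e / (norm \<tau> + 1)"]
      by (smt (verit, ccfv_SIG) divide_pos_pos mult_left_mono nonzero_eq_divide_eq norm_ge_zero)
    then have "\<bar>\<tau> \<bullet> m'\<bar> \<le> 0" by (meson field_le_epsilon add_0 dual_order.refl order_trans le_add_same_cancel2)
    then show ?thesis by simp
  qed
  define c where "c = m' \<bullet> m"
  have "(m' - c *\<^sub>R m) \<bullet> m = 0" using nm by (simp add: c_def inner_diff_left inner_unit)
  from orth[OF this] have "m' \<bullet> m' - c * (m \<bullet> m') = 0" by (simp only: inner_diff_left inner_scaleR_left)
  then have "c * c = 1" using n by (simp add: inner_unit c_def inner_commute)
  then have c: "c = 1 \<or> c = -1" by (simp add: square_eq_1_iff)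
  have sq: "(norm (m' - c *\<^sub>R m))\<^sup>2 = 1 - c * c"
    using nm n by (simp add: power2_norm_eq_inner inner_diff_left inner_diff_right inner_unit c_def inner_commute algebra_simps)
  then have mc: "m' = c *\<^sub>R m" using \<open>c * c = 1\<close> by simp
  show ?thesis
  proof (cases "c = 1")
    case False
    then have "m' = - m" using c mc by simp
    obtain \<epsilon> where e: "\<epsilon> > 0" "\<And>t. 0 < t \<Longrightarrow> t < \<epsilon> \<Longrightarrow> x + t *\<^sub>R m' \<in> D" using ins by blast
    have "m \<bullet> m > 0" using nm by (simp add: inner_unit)
    then obtain s where s: "s > 0" "\<And>t. 0 < t \<Longrightarrow> t < s \<Longrightarrow> x - t *\<^sub>R m \<notin> closure D"
      using g unfolding good_normal_def by blast
    define t where "t = min \<epsilon> s / 2"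
    have "0 < t" "t < \<epsilon>" "t < s" using e s by (auto simp: t_def)
    then have "x + t *\<^sub>R m' \<in> D" "x - t *\<^sub>R m \<notin> closure D" using e s by auto
    then show ?thesis using \<open>m' = - m\<close> closure_subset by auto
  qed (use mc in simp)
qed

lemma inner_normal_good:
  assumes D: "billiard_domain D Rt" and x: "x \<in> Rt"
  shows "good_normal D x (inner_normal D x)"
proof -
  obtain m where m: "good_normal D x m" "is_inner_normal D x m" using good_normal_exists[OF assms] by (elim exE conjE)
  have "inner_normal D x = m"
    unfolding inner_normal_def
  proof (rule the_equality)
    show "is_inner_normal D x m" by (rule m(2))
    show "m' = m" if "is_inner_normal D x m'" for m' by (rule inner_normal_unique[OF m(1) that])
  qed
  then show ?thesis using m by simp
qed

text \<open>Flatness at \<open>x\<close> also bounds chords at a neighbouring \<open>y\<close>, so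
  the tangential part \<tau> at \<open>y\<close> of the normal at \<open>x\<close> satisfies
  \<open>(norm \<tau>)\<^sup>2 \<le> \<delta> * norm \<tau>\<close>. This makes the normals nearly
  parallel but leaves the sign open, whence the absolute values.\<close>

lemma inner_normal_continuous:
  assumes D: "billiard_domain D Rt" and x: "x \<in> Rt" and v: "norm v = 1" and e: "\<eta> > 0"
  shows "\<exists>r>0. \<forall>y\<in>Rt \<inter> ball x r. \<bar>\<bar>v \<bullet> inner_normal D y\<bar> - \<bar>v \<bullet> inner_normal D x\<bar>\<bar> \<le> \<eta>"
proof -
  let ?n = "inner_normal D"
  define \<delta> where "\<delta> = min 1 (\<eta> / 2)"
  have d: "\<delta> > 0" "\<delta> \<le> 1" "2 * \<delta> \<le> \<eta>" using e by (auto simp: \<delta>_def)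
  have gx: "good_normal D x (?n x)" by (rule inner_normal_good[OF D x])
  then obtain r where r: "r > 0" "\<And>y z. y \<in> frontier D \<inter> ball x r \<Longrightarrow> z \<in> frontier D \<inter> ball x r \<Longrightarrow> \<bar>(y - z) \<bullet> ?n x\<bar> \<le> \<delta> * norm (y - z)"
    using d unfolding good_normal_def flat_normal_def by metis
  have nx: "norm (?n x) = 1" using gx by (simp add: good_normal_def flat_normal_def)
  have "\<bar>\<bar>v \<bullet> ?n y\<bar> - \<bar>v \<bullet> ?n x\<bar>\<bar> \<le> \<eta>" if y: "y \<in> Rt \<inter> ball x r" for y
  proof -
    have gy: "good_normal D y (?n y)" using inner_normal_good[OF D] y by blast
    have ny: "norm (?n y) = 1" using gy by (simp add: good_normal_def flat_normal_def)
    have yS: "y \<in> frontier D" using billiard_boundary_point[OF D] y by blast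
    define s where "s = r - dist x y"
    have s: "s > 0" using y by (simp add: s_def)
    have sub: "ball y s \<subseteq> ball x r"
    proof
      fix z assume "z \<in> ball y s" then show "z \<in> ball x r" using dist_triangle[of x z y] by (simp add: s_def)
    qed
    have fl: "\<forall>z\<in>frontier D \<inter> ball y s. \<bar>(z - y) \<bullet> ?n x\<bar> \<le> \<delta> * norm (z - y)"
      using r(2) sub yS y by blast
    define c where "c = ?n x \<bullet> ?n y"
    define \<tau> where "\<tau> = ?n x - c *\<^sub>R ?n y"
    have t1: "\<tau> \<bullet> ?n y = 0" using ny by (simp add: \<tau>_def c_def inner_diff_left inner_unit)
    have "\<bar>\<tau> \<bullet> ?n x\<bar> \<le> \<delta> * norm \<tau>"
      using gy t1 d s fl unfolding good_normal_def by (meson less_imp_le)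
    moreover have t2: "\<tau> \<bullet> ?n x = 1 - c\<^sup>2"
      unfolding \<tau>_def inner_diff_left inner_scaleR_left inner_commute[of "?n y"] c_def[symmetric]
      by (simp add: inner_unit[OF nx] power2_eq_square)
    moreover have t3: "(norm \<tau>)\<^sup>2 = 1 - c\<^sup>2"
      using t1 t2 unfolding power2_norm_eq_inner by (simp add: \<tau>_def inner_diff_right)
    ultimately have "(norm \<tau>)\<^sup>2 \<le> \<delta> * norm \<tau>" by simp
    then have nt: "norm \<tau> \<le> \<delta>" using d by (cases "norm \<tau> = 0") (auto simp: power2_eq_square)
    have "(norm \<tau>)\<^sup>2 \<le> \<delta>\<^sup>2" using nt by (intro power_mono) auto
    also have "\<dots> \<le> \<delta>" using d by (simp add: power2_eq_square mult_le_one)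
    finally have "1 - c\<^sup>2 \<le> \<delta>" using t3 by simp
    moreover have c1: "\<bar>c\<bar> \<le> 1" using Cauchy_Schwarz_ineq2[of "?n x" "?n y"] nx ny by (simp add: c_def)
    moreover have "c\<^sup>2 \<le> \<bar>c\<bar>" using c1 mult_left_mono[OF c1, of "\<bar>c\<bar>"] by (simp add: power2_eq_square abs_mult[symmetric])
    ultimately have c2: "1 - \<bar>c\<bar> \<le> \<delta>" by linarith
    have vy: "\<bar>v \<bullet> ?n y\<bar> \<le> 1" using Cauchy_Schwarz_ineq2[of v "?n y"] v ny by simp
    have "\<bar>v \<bullet> \<tau>\<bar> \<le> \<delta>" using Cauchy_Schwarz_ineq2[of v \<tau>] v nt by simp
    then have 1: "\<bar>v \<bullet> ?n x - c * (v \<bullet> ?n y)\<bar> \<le> \<delta>" by (simp add: \<tau>_def inner_diff_right)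
    have 2: "\<bar>c * (v \<bullet> ?n y)\<bar> = \<bar>c\<bar> * \<bar>v \<bullet> ?n y\<bar>" by (rule abs_mult)
    have "(1 - \<bar>c\<bar>) * \<bar>v \<bullet> ?n y\<bar> \<le> \<delta> * 1" using c1 c2 vy by (intro mult_mono) auto
    then have 3: "\<bar>v \<bullet> ?n y\<bar> - \<bar>c\<bar> * \<bar>v \<bullet> ?n y\<bar> \<le> \<delta>" by (simp add: algebra_simps)
    have "\<bar>c\<bar> * \<bar>v \<bullet> ?n y\<bar> \<le> \<bar>v \<bullet> ?n y\<bar>" using c1 mult_right_mono[OF c1, of "\<bar>v \<bullet> ?n y\<bar>"] by simp
    then show ?thesis using 1 2 3 d(3) by linarith
  qed
  then show ?thesis using r(1) by blast
qed

declare measurable_plane_measure_ident [measurable del]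

section \<open>Flights\<close>

lemma frontier_open_disjoint: "open D \<Longrightarrow> x \<in> D \<Longrightarrow> x \<notin> frontier D"
  by (simp add: frontier_def interior_open)

lemma segment_hits_frontier:
  fixes D :: "'a::real_normed_vector set"
  assumes "a \<le> b" "x + a *\<^sub>R v \<in> D" "x + b *\<^sub>R v \<notin> D"
  shows "\<exists>t\<in>{a..b}. x + t *\<^sub>R v \<in> frontier D"
proof -
  have "connected ((\<lambda>t. x + t *\<^sub>R v) ` {a..b})"
    by (intro connected_continuous_image continuous_intros connected_Icc)
  moreover have "x + a *\<^sub>R v \<in> (\<lambda>t. x + t *\<^sub>R v) ` {a..b}" "x + b *\<^sub>R v \<in> (\<lambda>t. x + t *\<^sub>R v) ` {a..b}"
    using assms(1) by auto
  ultimately have "(\<lambda>t. x + t *\<^sub>R v) ` {a..b} \<inter> frontier D \<noteq> {}"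
    using assms(2,3) by (intro connected_Int_frontier) blast+
  then show ?thesis by blast
qed

lemma flight_time_eqI:
  assumes "r > 0" "x + r *\<^sub>R v \<in> frontier D" "\<And>t. 0 < t \<Longrightarrow> t < r \<Longrightarrow> x + t *\<^sub>R v \<notin> frontier D"
  shows "flight_time D x v = r"
proof -
  have "Inf {t. t > 0 \<and> x + t *\<^sub>R v \<in> frontier D} = r"
    using assms by (intro cInf_eq_minimum) (auto simp: not_less[symmetric])
  then show ?thesis using assms unfolding flight_time_def by auto
qed

text \<open>The start itself may be on the boundary; flights from interior points and from boundary
  points are treated alike.\<close>

definition starts_inside :: "'n::finite point set \<Rightarrow> 'n point \<Rightarrow> 'n point \<Rightarrow> bool" where
  "starts_inside D x v \<longleftrightarrow> (\<exists>s>0. \<forall>t. 0 < t \<and> t < s \<longrightarrow> x + t *\<^sub>R v \<in> D)"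

context
  fixes D :: "'n::finite point set"
  assumes D: "open D" "bounded D"
begin

text \<open>Staying inside up to time \<open>s\<close> keeps the hitting times away from 0, so they
  form a closed set that contains its infimum. Boundedness of \<open>D\<close> makes the set
  nonempty.\<close>

lemma flight_props:
  assumes v: "norm v = 1" and ins: "starts_inside D x v"
  shows "flight_time D x v > 0" "next_hit D x v \<in> frontier D"
    "\<And>t. 0 < t \<Longrightarrow> t < flight_time D x v \<Longrightarrow> x + t *\<^sub>R v \<in> D"
proof -
  obtain s where s: "s > 0" "\<And>t. 0 < t \<Longrightarrow> t < s \<Longrightarrow> x + t *\<^sub>R v \<in> D"
    using ins by (auto simp: starts_inside_def)
  define T where "T = {t. t > 0 \<and> x + t *\<^sub>R v \<in> frontier D}"
  obtain B where B: "\<And>y. y \<in> D \<Longrightarrow> norm y \<le> B" using D(2) by (auto simp: bounded_iff)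
  define t1 where "t1 = s + \<bar>B\<bar> + norm x + 1"
  have t1: "t1 > s" by (simp add: t1_def add_nonneg_pos)
  have "t1 = norm (t1 *\<^sub>R v)" using v t1 s(1) by simp
  also have "\<dots> \<le> norm (x + t1 *\<^sub>R v) + norm x" using norm_triangle_ineq4[of "x + t1 *\<^sub>R v" x] by simp
  finally have "norm (x + t1 *\<^sub>R v) > B" using s(1) by (simp add: t1_def)
  then have out: "x + t1 *\<^sub>R v \<notin> D" using B by force
  have hit: "\<exists>t'\<in>{t0..t}. x + t' *\<^sub>R v \<in> frontier D" if "0 < t0" "t0 < s" "t0 \<le> t" "x + t *\<^sub>R v \<notin> D" for t0 t
    using segment_hits_frontier[of t0 t x v D] s(2) that by blast
  have ne: "T \<noteq> {}" using hit[of "s/2" t1] s(1) t1 out by (fastforce simp: T_def)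
  have ge: "t \<ge> s" if "t \<in> T" for t
    using that s(2)[of t] frontier_open_disjoint[OF D(1)] by (force simp: T_def)
  have "T = {t. t \<ge> s} \<inter> (\<lambda>t. x + t *\<^sub>R v) -` frontier D" using ge s(1) by (auto simp: T_def)
  moreover have "closed ((\<lambda>t. x + t *\<^sub>R v) -` frontier D)"
    by (intro closed_vimage continuous_intros) auto
  ultimately have "closed T" by (simp add: closed_Int closed_Collect_le continuous_on_id continuous_on_const)
  moreover have bdd: "bdd_below T" using ge by (rule bdd_belowI)
  ultimately have mem: "Inf T \<in> T" using ne by (intro closed_contains_Inf)
  have ft: "flight_time D x v = Inf T"
    using ne unfolding flight_time_def T_def by auto
  show "flight_time D x v > 0" using mem by (simp add: ft T_def)
  show "next_hit D x v \<in> frontier D" using mem by (simp add: next_hit_def ft T_def)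
  fix t assume t: "0 < t" "t < flight_time D x v"
  show "x + t *\<^sub>R v \<in> D"
  proof (rule ccontr)
    assume "x + t *\<^sub>R v \<notin> D"
    then obtain t' where t': "t' \<in> {min (s/2) t..t}" "x + t' *\<^sub>R v \<in> frontier D"
    proof -
      have "0 < min (s/2) t" "min (s/2) t < s" "min (s/2) t \<le> t" using t(1) s(1) by (auto simp: min_def)
      then show ?thesis using hit[of "min (s/2) t" t] \<open>x + t *\<^sub>R v \<notin> D\<close> that by blast
    qed
    then have "t' \<in> T" using t(1) s(1) by (auto simp: T_def)
    then have "Inf T \<le> t'" using bdd by (rule cInf_lower)
    then show False using t(2) t'(1) by (simp add: ft)
  qed
qed

lemma starts_inside_open: "x \<in> D \<Longrightarrow> norm v = 1 \<Longrightarrow> starts_inside D x v"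
  using D(1) by (force simp: starts_inside_def open_contains_ball subset_iff dist_norm)

lemma flight_forward:
  assumes v: "norm v = 1" and ins: "starts_inside D x v" and s: "0 < s" "s < flight_time D x v"
  shows "flight_time D (x + s *\<^sub>R v) v = flight_time D x v - s" "next_hit D (x + s *\<^sub>R v) v = next_hit D x v"
proof -
  note f = flight_props[OF v ins]
  show eq: "flight_time D (x + s *\<^sub>R v) v = flight_time D x v - s"
  proof (rule flight_time_eqI)
    show "x + s *\<^sub>R v + (flight_time D x v - s) *\<^sub>R v \<in> frontier D" using f(2) by (simp add: next_hit_def algebra_simps)
    fix t assume t: "0 < t" "t < flight_time D x v - s"
    have "x + (s + t) *\<^sub>R v \<in> D" using t s by (intro f(3)) auto
    then show "x + s *\<^sub>R v + t *\<^sub>R v \<notin> frontier D" using frontier_open_disjoint[OF D(1)] by (simp add: algebra_simps)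
  qed (use s in simp)
  show "next_hit D (x + s *\<^sub>R v) v = next_hit D x v" by (simp add: next_hit_def eq algebra_simps)
qed

lemma flight_backward:
  assumes v: "norm v = 1" and ins: "starts_inside D x v" and x: "x \<in> frontier D" and s: "0 < s" "s < flight_time D x v"
  shows "flight_time D (x + s *\<^sub>R v) (- v) = s" "next_hit D (x + s *\<^sub>R v) (- v) = x"
proof -
  note f = flight_props[OF v ins]
  show eq: "flight_time D (x + s *\<^sub>R v) (- v) = s"
  proof (rule flight_time_eqI)
    show "x + s *\<^sub>R v + s *\<^sub>R - v \<in> frontier D" using x by simp
    fix t assume t: "0 < t" "t < s"
    have "x + (s - t) *\<^sub>R v \<in> D" using t s by (intro f(3)) auto
    then show "x + s *\<^sub>R v + t *\<^sub>R - v \<notin> frontier D" using frontier_open_disjoint[OF D(1)] by (simp add: algebra_simps)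
  qed (use s in simp)
  show "next_hit D (x + s *\<^sub>R v) (- v) = x" by (simp add: next_hit_def eq)
qed

text \<open>The inverse of parametrizing flights by starting point and elapsed time; backward and
  forward flight times add up to the length of the chord through \<open>y\<close>.\<close>

lemma flight_origin:
  assumes v: "norm v = 1" and y: "y \<in> D"
  defines "z \<equiv> next_hit D y (- v)" and "s \<equiv> flight_time D y (- v)"
  shows "s > 0" "z \<in> frontier D" "y = z + s *\<^sub>R v" "starts_inside D z v" "flight_time D z v = s + flight_time D y v"
    "next_hit D z v = next_hit D y v"
proof -
  have v': "norm (- v) = 1" using v by simp
  note b = flight_props[OF v' starts_inside_open[OF y v']]
  note f = flight_props[OF v starts_inside_open[OF y v]]
  show s: "s > 0" using b(1) by (simp add: s_def)
  show z: "z \<in> frontier D" using b(2) by (simp add: z_def)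
  show yz: "y = z + s *\<^sub>R v" by (simp add: z_def s_def next_hit_def)
  have in1: "z + t *\<^sub>R v \<in> D" if "0 < t" "t < s" for t
  proof -
    have "y + (s - t) *\<^sub>R (- v) \<in> D" using that by (intro b(3)) (auto simp: s_def)
    then show ?thesis by (simp add: yz algebra_simps)
  qed
  then show ins: "starts_inside D z v" using s by (auto simp: starts_inside_def)
  show eq: "flight_time D z v = s + flight_time D y v"
  proof (rule flight_time_eqI)
    show "s + flight_time D y v > 0" using s f(1) by simp
    show "z + (s + flight_time D y v) *\<^sub>R v \<in> frontier D"
      using f(2) by (simp add: next_hit_def) (simp add: z_def s_def next_hit_def algebra_simps)
    fix t assume t: "0 < t" "t < s + flight_time D y v"
    consider "t < s" | "t = s" | "t > s" by linarith
    then have "z + t *\<^sub>R v \<in> D"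
    proof cases
      case 3
      then have "y + (t - s) *\<^sub>R v \<in> D" using t by (intro f(3)) auto
      then show ?thesis by (simp add: yz algebra_simps)
    qed (use in1 t y yz in auto)
    then show "z + t *\<^sub>R v \<notin> frontier D" by (rule frontier_open_disjoint[OF D(1)])
  qed
  show "next_hit D z v = next_hit D y v"
    unfolding next_hit_def[of D z] eq by (simp add: next_hit_def[of D y v]) (simp add: z_def s_def next_hit_def algebra_simps)
qed

end

text \<open>Compactness of the set of times provides a convergent subsequence of hitting times along
  a convergent sequence of rays.\<close>

lemma closed_hit_set:
  fixes F :: "'a::euclidean_space set"
  assumes C: "compact C" and F: "closed F"
  shows "closed {w. \<exists>t\<in>C. fst w + t *\<^sub>R snd w \<in> F}"
  unfolding closed_sequential_limits
proof (intro allI impI, elim conjE)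
  fix X l assume X: "\<forall>n. X n \<in> {w. \<exists>t\<in>C. fst w + t *\<^sub>R snd w \<in> F}" and l: "X \<longlonglongrightarrow> l"
  then obtain t where t: "\<And>n::nat. t n \<in> C" "\<And>n. fst (X n) + t n *\<^sub>R snd (X n) \<in> F" by (auto) metis
  obtain t0 r where r: "t0 \<in> C" "strict_mono r" "(t \<circ> r) \<longlonglongrightarrow> t0"
    using C t(1) unfolding compact_def by metis
  have Xr: "(X \<circ> r) \<longlonglongrightarrow> l" using LIMSEQ_subseq_LIMSEQ[OF l r(2)] .
  have "(\<lambda>n. fst ((X \<circ> r) n) + (t \<circ> r) n *\<^sub>R snd ((X \<circ> r) n)) \<longlonglongrightarrow> fst l + t0 *\<^sub>R snd l"
    by (intro tendsto_intros Xr r(3))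
  then have "fst l + t0 *\<^sub>R snd l \<in> F"
    by (rule closed_sequentially[OF F, rotated]) (simp add: t(2))
  then show "l \<in> {w. \<exists>t\<in>C. fst w + t *\<^sub>R snd w \<in> F}" using r(1) by blast
qed

text \<open>Exhausting the open interval of times by compact ones writes each \<open>hit s\<close>
  as a countable union of closed sets.\<close>

lemma measurable_flight_time:
  fixes D :: "'n::finite point set"
  shows "(\<lambda>w. flight_time D (fst w) (snd w)) \<in> borel_measurable borel"
proof -
  define hit where "hit s = {w :: 'n point \<times> 'n point. \<exists>t. 0 < t \<and> t < s \<and> fst w + t *\<^sub>R snd w \<in> frontier D}" for s :: real
  have hit[measurable]: "hit s \<in> sets borel" for s
  proof -
    have "hit s = (\<Union>n::nat. {w. \<exists>t\<in>{1 / real (Suc n)..s - 1 / real (Suc n)}. fst w + t *\<^sub>R snd w \<in> frontier D})"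
    proof safe
      fix a b assume "(a, b) \<in> hit s"
      then obtain t where t: "0 < t" "t < s" "a + t *\<^sub>R b \<in> frontier D" by (auto simp: hit_def)
      obtain n where n: "1 / real (Suc n) < min t (s - t)"
        using reals_Archimedean[of "min t (s - t)"] t by (auto simp: inverse_eq_divide)
      then have "t \<in> {1 / real (Suc n)..s - 1 / real (Suc n)}" by auto
      then show "(a, b) \<in> (\<Union>n::nat. {w. \<exists>t\<in>{1 / real (Suc n)..s - 1 / real (Suc n)}. fst w + t *\<^sub>R snd w \<in> frontier D})"
        using t(3) by (intro UN_I[of n]) auto
    next
      fix a b n t assume t: "t \<in> {1 / real (Suc n)..s - 1 / real (Suc n)}" "fst (a, b) + t *\<^sub>R snd (a, b) \<in> frontier D"
      have "1 / real (Suc n) > 0" by simp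
      then have "0 < t" "t < s" using t(1) unfolding atLeastAtMost_iff by linarith+
      then show "(a, b) \<in> hit s" using t(2) by (auto simp: hit_def)
    qed
    also have "\<dots> \<in> sets borel"
      by (intro sets.countable_UN) (auto intro!: borel_closed closed_hit_set)
    finally show ?thesis .
  qed
  define E where "E = (\<Union>n::nat. hit (real n))"
  have E[measurable]: "E \<in> sets borel" unfolding E_def by measurable
  have Eiff: "w \<in> E \<longleftrightarrow> (\<exists>t>0. fst w + t *\<^sub>R snd w \<in> frontier D)" for w
    by (auto simp: E_def hit_def) (metis reals_Archimedean2)
  \<comment> \<open>Rays outside \<open>E\<close> never hit and have flight time 0 by convention, so
    they join every sublevel set with \<open>s > 0\<close>.\<close>
  have "{w. flight_time D (fst w) (snd w) < s} = hit s \<union> (if s > 0 then - E else {})" for s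
  proof -
    have 1: "flight_time D (fst w) (snd w) < s \<longleftrightarrow> w \<in> hit s" if w: "w \<in> E" for w
    proof -
      have "bdd_below {t. t > 0 \<and> fst w + t *\<^sub>R snd w \<in> frontier D}" by (auto intro: bdd_belowI[of _ 0])
      moreover have "{t. t > 0 \<and> fst w + t *\<^sub>R snd w \<in> frontier D} \<noteq> {}" using w Eiff by blast
      ultimately show ?thesis using w Eiff[of w]
        by (auto simp: flight_time_def cInf_less_iff hit_def)
    qed
    have 2: "flight_time D (fst w) (snd w) = 0 \<and> w \<notin> hit s" if "w \<notin> E" for w
      using that Eiff[of w] by (auto simp: flight_time_def hit_def)
    have "flight_time D (fst w) (snd w) < s \<longleftrightarrow> w \<in> hit s \<or> (s > 0 \<and> w \<notin> E)" for w
      using 1[of w] 2[of w] by (cases "w \<in> E") auto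
    then show ?thesis by (intro set_eqI) (simp split: if_splits)
  qed
  then show ?thesis
    unfolding borel_measurable_iff_less by auto
qed

lemma measurable_flight_time' [measurable (raw)]:
  assumes "f \<in> borel_measurable M" "g \<in> borel_measurable M"
  shows "(\<lambda>x. flight_time D (f x) (g x)) \<in> borel_measurable M"
  using measurable_compose[OF borel_measurable_Pair[OF assms] measurable_flight_time[of D]] by simp

lemma measurable_next_hit [measurable (raw)]:
  assumes [measurable]: "f \<in> borel_measurable M" "g \<in> borel_measurable M"
  shows "(\<lambda>x. next_hit D (f x) (g x)) \<in> borel_measurable M"
  unfolding next_hit_def by measurable

section \<open>Projecting the boundary\<close>

text \<open>The value 0 off \<open>Rt\<close> makes every condition
  \<open>v \<bullet> normal_field D Rt x \<noteq> 0\<close> confine \<open>x\<close> to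
  \<open>Rt\<close> by itself.\<close>

definition normal_field :: "'n::{finite,linorder} point set \<Rightarrow> 'n point set \<Rightarrow> 'n point \<Rightarrow> 'n point" where
  "normal_field D Rt x = (if x \<in> Rt then inner_normal D x else 0)"

definition transversal :: "'n::{finite,linorder} point set \<Rightarrow> 'n point set \<Rightarrow> 'n point \<Rightarrow> 'n point set" where
  "transversal D Rt v = {x. v \<bullet> normal_field D Rt x \<noteq> 0}"

definition entrance :: "'n::{finite,linorder} point set \<Rightarrow> 'n point set \<Rightarrow> 'n point \<Rightarrow> 'n point set" where
  "entrance D Rt v = {x. v \<bullet> normal_field D Rt x > 0}"

text \<open>The area element of the shadow that the boundary casts in direction \<open>v\<close>,
  counted with multiplicity.\<close>

definition flux :: "'n::{finite,linorder} point set \<Rightarrow> 'n point set \<Rightarrow> 'n point \<Rightarrow> 'n point measure" where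
  "flux D Rt v = density surface_measure (\<lambda>x. ennreal \<bar>v \<bullet> normal_field D Rt x\<bar>)"

lemma ennreal_le_all_factors:
  fixes a b :: ennreal
  assumes "\<And>\<eta>. 0 < \<eta> \<Longrightarrow> \<eta> < 1 \<Longrightarrow> a \<le> ennreal (1 + \<eta>) * b"
  shows "a \<le> b"
proof (rule tendsto_lowerbound[where F="at_right 0"])
  show "((\<lambda>\<eta>. ennreal (1 + \<eta>) * b) \<longlongrightarrow> b) (at_right 0)"
  proof (cases "b = \<infinity>")
    case True
    have "eventually (\<lambda>\<eta>. ennreal (1 + \<eta>) * b = b) (at_right (0::real))"
      using True by (intro eventually_at_rightI[of 0 1]) (auto simp: ennreal_mult_top)
    then show ?thesis by (simp add: tendsto_eventually)
  next
    case False
    then obtain r where r: "b = ennreal r" "r \<ge> 0" by (cases b) auto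
    have "((\<lambda>\<eta>. ennreal ((1 + \<eta>) * r)) \<longlongrightarrow> ennreal ((1 + 0) * r)) (at_right (0::real))"
      by (intro tendsto_intros)
    moreover have "eventually (\<lambda>\<eta>. ennreal ((1 + \<eta>) * r) = ennreal (1 + \<eta>) * b) (at_right (0::real))"
      using r by (intro eventually_at_rightI[of 0 1]) (auto simp: ennreal_mult)
    ultimately show ?thesis using r by (auto intro: Lim_transform_eventually)
  qed
  show "eventually (\<lambda>\<eta>. a \<le> ennreal (1 + \<eta>) * b) (at_right (0::real))"
    using assms by (intro eventually_at_rightI[of 0 1]) auto
qed simp

text \<open>The two ratios are the quotients of the upper bound for the shadow by the lower bound
  for the flux, and the other way round.\<close>

lemma distortion_small:
  fixes \<eta> :: real assumes "\<eta> > 0"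
  shows "\<exists>\<epsilon>. 0 < \<epsilon> \<and> \<epsilon> < 1 \<and> (1 + \<epsilon>) ^ k / (1 - \<epsilon>) \<le> 1 + \<eta> \<and> (1 + \<epsilon>) / (1 - \<epsilon>) ^ k \<le> 1 + \<eta>"
proof -
  have "((\<lambda>\<epsilon>::real. (1 + \<epsilon>) ^ k / (1 - \<epsilon>)) \<longlongrightarrow> (1 + 0) ^ k / (1 - 0)) (at_right 0)"
    by (intro tendsto_intros) auto
  then have 1: "eventually (\<lambda>\<epsilon>::real. (1 + \<epsilon>) ^ k / (1 - \<epsilon>) < 1 + \<eta>) (at_right 0)"
    using assms by (intro order_tendstoD) auto
  have "((\<lambda>\<epsilon>::real. (1 + \<epsilon>) / (1 - \<epsilon>) ^ k) \<longlongrightarrow> (1 + 0) / (1 - 0) ^ k) (at_right 0)"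
    by (intro tendsto_intros) auto
  then have 2: "eventually (\<lambda>\<epsilon>::real. (1 + \<epsilon>) / (1 - \<epsilon>) ^ k < 1 + \<eta>) (at_right 0)"
    using assms by (intro order_tendstoD) auto
  have 3: "eventually (\<lambda>\<epsilon>::real. 0 < \<epsilon> \<and> \<epsilon> < 1) (at_right 0)"
    by (rule eventually_at_rightI[of 0 1]) auto
  from 1 2 3 have "eventually (\<lambda>\<epsilon>::real. 0 < \<epsilon> \<and> \<epsilon> < 1 \<and> (1 + \<epsilon>) ^ k / (1 - \<epsilon>) \<le> 1 + \<eta> \<and> (1 + \<epsilon>) / (1 - \<epsilon>) ^ k \<le> 1 + \<eta>) (at_right 0)"
    by eventually_elim auto
  then show ?thesis by (rule eventually_happens'[OF trivial_limit_at_right_real])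
qed

text \<open>Measurability of the normal enters as an assumption; it is later derived from that of
  the frames \<open>U\<close>.\<close>

locale billiard =
  fixes D Rt :: "'n::{finite,linorder} point set"
  assumes domain: "billiard_domain D Rt" and bounded: "bounded D"
    and normal_measurable [measurable]: "normal_field D Rt \<in> borel_measurable borel"
begin

abbreviation "nf \<equiv> normal_field D Rt"

lemma open_D: "open D" and lipschitz_D: "lipschitz_boundary D" and Rt_open: "openin (top_of_set (frontier D)) Rt"
  using domain by (auto simp: billiard_domain_def)

lemma compact_F: "compact (frontier D)"
  using bounded by simp

lemma F_borel [measurable]: "frontier D \<in> sets borel" and D_borel [measurable]: "D \<in> sets borel"
  using compact_F open_D by (auto intro: borel_closed compact_imp_closed)

lemma Rt_frontier: "x \<in> Rt \<Longrightarrow> x \<in> frontier D"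
  by (rule billiard_boundary_point[OF domain])

lemma good: "x \<in> Rt \<Longrightarrow> good_normal D x (nf x)"
  using inner_normal_good[OF domain] by (simp add: normal_field_def)

lemma norm_nf: "x \<in> Rt \<Longrightarrow> norm (nf x) = 1"
  using good by (simp add: good_normal_def flat_normal_def)

lemma Rt_borel [measurable]: "Rt \<in> sets borel"
proof -
  have "Rt = {x \<in> space borel. nf x \<noteq> 0}"
    using norm_nf by (auto simp: normal_field_def) (metis norm_zero zero_neq_one normal_field_def)
  moreover have "{x \<in> space borel. nf x \<noteq> 0} \<in> sets borel" by measurable
  ultimately show ?thesis by metis
qed

lemma transversal_borel [measurable]: "transversal D Rt v \<in> sets borel"
  and entrance_borel [measurable]: "entrance D Rt v \<in> sets borel"
  unfolding transversal_def entrance_def by measurable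

lemma entrance_transversal: "entrance D Rt v \<subseteq> transversal D Rt v"
  by (auto simp: entrance_def transversal_def)

lemma transversal_Rt: "transversal D Rt v \<subseteq> Rt"
  by (auto simp: transversal_def normal_field_def split: if_splits)

lemma entrance_starts_inside:
  assumes "x \<in> entrance D Rt v" shows "starts_inside D x v"
proof -
  have "x \<in> Rt" "v \<bullet> nf x > 0" using assms entrance_transversal transversal_Rt by (auto simp: entrance_def)
  then show ?thesis using good[of x] unfolding good_normal_def starts_inside_def by blast
qed

lemma not_starts_inside:
  assumes "x \<in> Rt" "v \<bullet> nf x < 0" shows "\<not> starts_inside D x v"
proof
  assume "starts_inside D x v"
  then obtain s where s: "s > 0" "\<And>t. 0 < t \<Longrightarrow> t < s \<Longrightarrow> x + t *\<^sub>R v \<in> D" by (auto simp: starts_inside_def)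
  have "(- v) \<bullet> nf x > 0" using assms(2) by simp
  then obtain s' where s': "s' > 0" "\<And>t. 0 < t \<Longrightarrow> t < s' \<Longrightarrow> x - t *\<^sub>R (- v) \<notin> closure D"
    using good[OF assms(1)] unfolding good_normal_def by blast
  define t where "t = min s s' / 2"
  have "0 < t" "t < s" "t < s'" using s(1) s'(1) by (auto simp: t_def)
  then show False using s(2)[of t] s'(2)[of t] closure_subset by auto
qed

lemma sets_flux [simp, measurable_cong]: "sets (flux D Rt v) = sets borel"
  by (simp add: flux_def)

lemma space_flux [simp]: "space (flux D Rt v) = UNIV"
  by (simp add: flux_def)

text \<open>The radius serves two purposes: the piece is flat relative to the normal at
  \<open>x\<close>, and \<open>\<bar>v \<bullet> nf y\<bar>\<close> stays within the factors
  \<open>1 - \<epsilon>\<close> and \<open>1 + \<epsilon>\<close> of its value at \<open>x\<close>.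
  The closed ball makes the piece compact, so that shadows of Borel sets are Borel.\<close>

lemma transversal_local:
  assumes v: "norm v = 1" and x: "x \<in> transversal D Rt v" and eta: "\<eta> > 0"
  shows "\<exists>r>0. frontier D \<inter> cball x r \<subseteq> transversal D Rt v \<and> inj_on (proj v) (frontier D \<inter> cball x r) \<and>
    (\<forall>A\<in>sets borel. A \<subseteq> frontier D \<inter> cball x r \<longrightarrow> proj v ` A \<in> sets borel \<and>
      emeasure surface_measure (proj v ` A) \<le> ennreal (1 + \<eta>) * emeasure (flux D Rt v) A \<and>
      emeasure (flux D Rt v) A \<le> ennreal (1 + \<eta>) * emeasure surface_measure (proj v ` A))"
proof -
  let ?k = "CARD('n) - 1"
  define m where "m = nf x"
  define a where "a = \<bar>v \<bullet> m\<bar>"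
  have a: "a > 0" "v \<bullet> m \<noteq> 0" using x by (auto simp: a_def m_def transversal_def)
  have xR: "x \<in> Rt" using x transversal_Rt by blast
  have m: "norm m = 1" "m = inner_normal D x" using norm_nf[OF xR] xR by (auto simp: m_def normal_field_def)
  obtain \<epsilon> where e: "0 < \<epsilon>" "\<epsilon> < 1" "(1 + \<epsilon>) ^ ?k / (1 - \<epsilon>) \<le> 1 + \<eta>" "(1 + \<epsilon>) / (1 - \<epsilon>) ^ ?k \<le> 1 + \<eta>"
    using distortion_small[OF eta] by blast
  have ea: "\<epsilon> * a > 0" using e a by simp
  obtain r1 where r1: "r1 > 0" "\<And>y z. y\<in>frontier D \<inter> ball x r1 \<Longrightarrow> z\<in>frontier D \<inter> ball x r1 \<Longrightarrow> \<bar>(y - z) \<bullet> m\<bar> \<le> (\<epsilon> * a) * norm (y - z)"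
    using good[OF xR] ea unfolding good_normal_def flat_normal_def m_def[symmetric] by meson
  obtain r2 where r2: "r2 > 0" "\<And>y. y\<in>Rt \<inter> ball x r2 \<Longrightarrow> \<bar>\<bar>v \<bullet> inner_normal D y\<bar> - \<bar>v \<bullet> inner_normal D x\<bar>\<bar> \<le> \<epsilon> * a"
    using inner_normal_continuous[OF domain xR v ea] by blast
  obtain r3 where r3: "r3 > 0" "ball x r3 \<inter> frontier D \<subseteq> Rt"
    using Rt_open xR unfolding openin_contains_ball by blast
  define r where "r = min r1 (min r2 r3) / 2"
  have r: "r > 0" "r < r1" "r < r2" "r < r3" using r1(1) r2(1) r3(1) by (auto simp: r_def)
  define K where "K = frontier D \<inter> cball x r"
  have K: "compact K" using compact_F by (simp add: K_def compact_Int)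
  have KR: "y \<in> Rt" if "y \<in> K" for y using that r3(2) r(4) by (auto simp: K_def)
  have near: "(1 - \<epsilon>) * a \<le> \<bar>v \<bullet> nf y\<bar> \<and> \<bar>v \<bullet> nf y\<bar> \<le> (1 + \<epsilon>) * a" if y: "y \<in> K" for y
  proof -
    have "\<bar>\<bar>v \<bullet> inner_normal D y\<bar> - a\<bar> \<le> \<epsilon> * a"
      using r2(2)[of y] KR[OF y] y r(3) m(2) by (auto simp: K_def a_def)
    then show ?thesis using KR[OF y] by (simp add: normal_field_def algebra_simps abs_le_iff)
  qed
  have "(1 - \<epsilon>) * a > 0" using e a by simp
  then have Ktr: "K \<subseteq> transversal D Rt v" using near by (force simp: transversal_def)
  have flat: "\<bar>(y - z) \<bullet> m\<bar> \<le> \<epsilon> * \<bar>v \<bullet> m\<bar> * norm (y - z)" if "y \<in> K" "z \<in> K" for y z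
    using r1(2)[of y z] that r(2) by (auto simp: K_def a_def)
  have inj: "inj_on (proj v) K"
    by (rule inj_on_proj[OF K m(1) v a(2) _ e(2) flat]) (use e in auto)
  have main: "proj v ` A \<in> sets borel \<and>
      emeasure surface_measure (proj v ` A) \<le> ennreal (1 + \<eta>) * emeasure (flux D Rt v) A \<and>
      emeasure (flux D Rt v) A \<le> ennreal (1 + \<eta>) * emeasure surface_measure (proj v ` A)"
    if A[measurable]: "A \<in> sets borel" and AK: "A \<subseteq> K" for A
  proof (intro conjI)
    let ?H = "emeasure surface_measure"
    show pA: "proj v ` A \<in> sets borel"
      by (rule inj_compact_borel_image[OF K continuous_on_proj inj A AK])
    have fl: "emeasure (flux D Rt v) A = (\<integral>\<^sup>+x. ennreal \<bar>v \<bullet> nf x\<bar> * indicator A x \<partial>surface_measure)"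
      unfolding flux_def by (rule emeasure_density) measurable
    have up: "emeasure (flux D Rt v) A \<le> ennreal ((1 + \<epsilon>) * a) * ?H A"
    proof -
      have "emeasure (flux D Rt v) A \<le> (\<integral>\<^sup>+x. ennreal ((1 + \<epsilon>) * a) * indicator A x \<partial>surface_measure)"
        unfolding fl using near AK by (intro nn_integral_mono) (auto simp: indicator_def intro!: ennreal_leI)
      then show ?thesis by (simp add: nn_integral_cmult_indicator)
    qed
    have lo: "ennreal ((1 - \<epsilon>) * a) * ?H A \<le> emeasure (flux D Rt v) A"
    proof -
      have "(\<integral>\<^sup>+x. ennreal ((1 - \<epsilon>) * a) * indicator A x \<partial>surface_measure) \<le> emeasure (flux D Rt v) A"
        unfolding fl using near AK by (intro nn_integral_mono) (auto simp: indicator_def intro!: ennreal_leI)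
      then show ?thesis by (simp add: nn_integral_cmult_indicator)
    qed
    have e0: "0 \<le> \<epsilon>" using e by simp
    note b1 = flat_projection_bounds(1)[OF K m(1) v a(2) e0 e(2) flat A AK, folded a_def]
    note b2 = flat_projection_bounds(2)[OF K m(1) v a(2) e0 e(2) flat A AK, folded a_def]
    have "?H (proj v ` A) \<le> ennreal (a * (1 + \<epsilon>) ^ ?k) * ?H A" by (rule b1)
    also have "ennreal (a * (1 + \<epsilon>) ^ ?k) = ennreal ((1 + \<epsilon>) ^ ?k / (1 - \<epsilon>)) * ennreal ((1 - \<epsilon>) * a)"
      using e a by (subst ennreal_mult[symmetric]) auto
    also have "\<dots> * ?H A \<le> ennreal ((1 + \<epsilon>) ^ ?k / (1 - \<epsilon>)) * emeasure (flux D Rt v) A"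
      unfolding mult.assoc by (rule mult_left_mono[OF lo zero_le])
    also have "\<dots> \<le> ennreal (1 + \<eta>) * emeasure (flux D Rt v) A"
      by (intro mult_right_mono ennreal_leI e(3)) simp
    finally show "?H (proj v ` A) \<le> ennreal (1 + \<eta>) * emeasure (flux D Rt v) A" .
    have "emeasure (flux D Rt v) A \<le> ennreal ((1 + \<epsilon>) * a) * ?H A" by (rule up)
    also have "ennreal ((1 + \<epsilon>) * a) = ennreal ((1 + \<epsilon>) / (1 - \<epsilon>) ^ ?k) * ennreal (a * (1 - \<epsilon>) ^ ?k)"
      using e a by (subst ennreal_mult[symmetric]) auto
    also have "\<dots> * ?H A \<le> ennreal ((1 + \<epsilon>) / (1 - \<epsilon>) ^ ?k) * ?H (proj v ` A)"
      unfolding mult.assoc by (rule mult_left_mono[OF b2 zero_le])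
    also have "\<dots> \<le> ennreal (1 + \<eta>) * ?H (proj v ` A)"
      by (intro mult_right_mono ennreal_leI e(4)) simp
    finally show "emeasure (flux D Rt v) A \<le> ennreal (1 + \<eta>) * ?H (proj v ` A)" .
  qed
  show ?thesis using r(1) Ktr inj main unfolding K_def by blast
qed

lemma countable_ball_cover:
  fixes W :: "'n point set"
  assumes r: "\<And>x. x \<in> W \<Longrightarrow> r x > 0" and ne: "W \<noteq> {}"
  shows "\<exists>e::nat \<Rightarrow> 'n point. range e \<subseteq> W \<and> W \<subseteq> (\<Union>i. ball (e i) (r (e i)))"
proof -
  obtain F' where F': "F' \<subseteq> (\<lambda>x. ball x (r x)) ` W" "countable F'" "\<Union> F' = \<Union> ((\<lambda>x. ball x (r x)) ` W)"
    using Lindelof[of "(\<lambda>x. ball x (r x)) ` W"] by auto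
  have "countable F' \<and> F' \<subseteq> (\<lambda>x. ball x (r x)) ` W" using F'(1,2) by simp
  then obtain C where C: "C \<subseteq> W" "countable C" "F' = (\<lambda>x. ball x (r x)) ` C"
    unfolding countable_subset_image by (elim exE conjE)
  have cov: "W \<subseteq> (\<Union>x\<in>C. ball x (r x))"
  proof
    fix x assume "x \<in> W"
    then have "x \<in> \<Union> ((\<lambda>x. ball x (r x)) ` W)" using r by (intro UN_I[of x]) auto
    then show "x \<in> (\<Union>x\<in>C. ball x (r x))" unfolding F'(3)[symmetric] C(3) .
  qed
  then have "C \<noteq> {}" using ne by auto
  then have ran: "range (from_nat_into C) = C" using C(2) by (rule range_from_nat_into)
  have "(\<Union>i. ball (from_nat_into C i) (r (from_nat_into C i))) = (\<Union>x\<in>range (from_nat_into C). ball x (r x))"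
    by auto
  then have "W \<subseteq> (\<Union>i. ball (from_nat_into C i) (r (from_nat_into C i)))"
    using cov unfolding ran by simp
  then show ?thesis using C(1) ran by (intro exI[of _ "from_nat_into C"]) simp
qed

text \<open>A countable subfamily of the local neighbourhoods suffices and is made disjoint, so that
  measures can be summed over it.\<close>

lemma transversal_pieces:
  assumes v: "norm v = 1" and A: "A \<in> sets borel" "A \<subseteq> transversal D Rt v" and eta: "\<eta> > 0"
  shows "\<exists>B::nat \<Rightarrow> 'n point set. disjoint_family B \<and> (\<Union>i. B i) = A \<and> (\<forall>i. B i \<in> sets borel \<and> inj_on (proj v) (B i) \<and>
      proj v ` B i \<in> sets borel \<and> (\<forall>C\<in>sets borel. C \<subseteq> B i \<longrightarrow> proj v ` C \<in> sets borel \<and>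
      emeasure surface_measure (proj v ` C) \<le> ennreal (1 + \<eta>) * emeasure (flux D Rt v) C \<and>
      emeasure (flux D Rt v) C \<le> ennreal (1 + \<eta>) * emeasure surface_measure (proj v ` C)))"
proof (cases "A = {}")
  case True
  then show ?thesis by (intro exI[of _ "\<lambda>_. {}"]) (auto simp: disjoint_family_on_def)
next
  case False
  have "\<forall>x\<in>A. \<exists>r>0. inj_on (proj v) (frontier D \<inter> cball x r) \<and>
    (\<forall>C\<in>sets borel. C \<subseteq> frontier D \<inter> cball x r \<longrightarrow> proj v ` C \<in> sets borel \<and>
      emeasure surface_measure (proj v ` C) \<le> ennreal (1 + \<eta>) * emeasure (flux D Rt v) C \<and>
      emeasure (flux D Rt v) C \<le> ennreal (1 + \<eta>) * emeasure surface_measure (proj v ` C))" (is "\<forall>x\<in>A. \<exists>r>0. ?P x r")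
    using transversal_local[OF v _ eta] A(2) by (meson subsetD)
  then obtain r where r: "\<And>x. x \<in> A \<Longrightarrow> r x > 0" "\<And>x. x \<in> A \<Longrightarrow> ?P x (r x)"
    by (metis bchoice)
  obtain e :: "nat \<Rightarrow> 'n point" where e: "range e \<subseteq> A" "A \<subseteq> (\<Union>i. ball (e i) (r (e i)))"
    using countable_ball_cover[of A r] r(1) False by blast
  define B where "B = disjointed (\<lambda>i. A \<inter> ball (e i) (r (e i)))"
  have Bsub: "B i \<subseteq> A \<inter> ball (e i) (r (e i))" for i unfolding B_def by (rule disjointed_subset)
  have BK: "B i \<subseteq> frontier D \<inter> cball (e i) (r (e i))" for i
    using Bsub[of i] A(2) transversal_Rt Rt_frontier by fastforce
  have Bb: "B i \<in> sets borel" for i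
  proof -
    have "range (\<lambda>i. A \<inter> ball (e i) (r (e i))) \<subseteq> sets borel" using A(1) by auto
    from sets.range_disjointed_sets[OF this] show ?thesis unfolding B_def by auto
  qed
  have P: "?P (e i) (r (e i))" for i using r(2) e(1) by blast
  show ?thesis
  proof (intro exI[of _ B] conjI allI)
    show "disjoint_family B" unfolding B_def by (rule disjoint_family_disjointed)
    show "(\<Union>i. B i) = A" unfolding B_def UN_disjointed_eq using e(2) by auto
    fix i
    show "B i \<in> sets borel" by (rule Bb)
    show "inj_on (proj v) (B i)" using P[of i] BK[of i] inj_on_subset by blast
    show "proj v ` B i \<in> sets borel" using P[of i] BK[of i] Bb by blast
    show "\<forall>C\<in>sets borel. C \<subseteq> B i \<longrightarrow> proj v ` C \<in> sets borel \<and>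
      emeasure surface_measure (proj v ` C) \<le> ennreal (1 + \<eta>) * emeasure (flux D Rt v) C \<and>
      emeasure (flux D Rt v) C \<le> ennreal (1 + \<eta>) * emeasure surface_measure (proj v ` C)"
      using P[of i] BK[of i] by (meson order_trans)
  qed
qed

text \<open>On small pieces the boundary is nearly flat, and projecting them along \<open>v\<close> multiplies surface measure by nearly \<open>\<bar>v \<bullet> nf x\<bar>\<close>.\<close>

lemma emeasure_projection:
  assumes v: "norm v = 1" and A: "A \<in> sets borel" "A \<subseteq> transversal D Rt v" and inj: "inj_on (proj v) A"
  shows "proj v ` A \<in> sets borel" "emeasure surface_measure (proj v ` A) = emeasure (flux D Rt v) A"
proof -
  have *: "proj v ` A \<in> sets borel \<and> emeasure surface_measure (proj v ` A) \<le> ennreal (1 + \<eta>) * emeasure (flux D Rt v) A \<and>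
      emeasure (flux D Rt v) A \<le> ennreal (1 + \<eta>) * emeasure surface_measure (proj v ` A)" if eta: "\<eta> > 0" for \<eta>
  proof -
    obtain B :: "nat \<Rightarrow> 'n point set" where B: "disjoint_family B" "(\<Union>i. B i) = A" "\<And>i. B i \<in> sets borel" "\<And>i. proj v ` B i \<in> sets borel"
      and le: "\<And>i. emeasure surface_measure (proj v ` B i) \<le> ennreal (1 + \<eta>) * emeasure (flux D Rt v) (B i)"
        "\<And>i. emeasure (flux D Rt v) (B i) \<le> ennreal (1 + \<eta>) * emeasure surface_measure (proj v ` B i)"
      using transversal_pieces[OF v A eta] by (metis order_refl)
    have pA: "proj v ` A = (\<Union>i. proj v ` B i)" using B(2) by blast
    have dis: "disjoint_family (\<lambda>i. proj v ` B i)"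
    proof -
      have "proj v ` B i \<inter> proj v ` B j = proj v ` (B i \<inter> B j)" for i j
        using B(2) by (intro inj_on_image_Int[OF inj, symmetric]) auto
      then show ?thesis using B(1) by (auto simp: disjoint_family_on_def)
    qed
    have 1: "emeasure surface_measure (proj v ` A) = (\<Sum>i. emeasure surface_measure (proj v ` B i))"
      unfolding pA by (rule suminf_emeasure[symmetric]) (use B dis in auto)
    have 2: "emeasure (flux D Rt v) A = (\<Sum>i. emeasure (flux D Rt v) (B i))"
      unfolding B(2)[symmetric] by (rule suminf_emeasure[symmetric]) (use B in auto)
    have "proj v ` A \<in> sets borel" unfolding pA using B(4) by auto
    moreover have "emeasure surface_measure (proj v ` A) \<le> (\<Sum>i. ennreal (1 + \<eta>) * emeasure (flux D Rt v) (B i))"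
      unfolding 1 by (intro suminf_le le) auto
    moreover have "emeasure (flux D Rt v) A \<le> (\<Sum>i. ennreal (1 + \<eta>) * emeasure surface_measure (proj v ` B i))"
      unfolding 2 by (intro suminf_le le) auto
    ultimately show ?thesis by (simp add: 1 2)
  qed
  show "proj v ` A \<in> sets borel" using *[of 1] by simp
  show "emeasure surface_measure (proj v ` A) = emeasure (flux D Rt v) A"
  proof (rule antisym)
    show "emeasure surface_measure (proj v ` A) \<le> emeasure (flux D Rt v) A"
      by (rule ennreal_le_all_factors) (use * in blast)
    show "emeasure (flux D Rt v) A \<le> emeasure surface_measure (proj v ` A)"
      by (rule ennreal_le_all_factors) (use * in blast)
  qed
qed

lemma nn_integral_projection:
  assumes v: "norm v = 1" and A[measurable]: "A \<in> sets borel" and AT: "A \<subseteq> transversal D Rt v" and inj: "inj_on (proj v) A"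
    and f[measurable]: "f \<in> borel_measurable borel"
  shows "(\<integral>\<^sup>+y. f y * indicator (proj v ` A) y \<partial>surface_measure) = (\<integral>\<^sup>+x. f (proj v x) * indicator A x \<partial>flux D Rt v)"
proof -
  have pA[measurable]: "proj v ` A \<in> sets borel" by (rule emeasure_projection(1)[OF v A AT inj])
  have "density surface_measure (indicator (proj v ` A)) = distr (density (flux D Rt v) (indicator A)) borel (proj v)"
  proof (rule measure_eqI)
    fix C assume "C \<in> sets (density surface_measure (indicator (proj v ` A)))"
    then have C[measurable]: "C \<in> sets borel" by simp
    have pC[measurable]: "proj v -` C \<in> sets borel" using measurable_sets[OF measurable_proj C] by simp
    have "emeasure (density surface_measure (indicator (proj v ` A))) C = emeasure surface_measure (proj v ` A \<inter> C)"
      by (subst emeasure_density, measurable) (simp add: indicator_inter_arith[symmetric])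
    also have "proj v ` A \<inter> C = proj v ` (A \<inter> proj v -` C)" by blast
    also have "emeasure surface_measure \<dots> = emeasure (flux D Rt v) (A \<inter> proj v -` C)"
      by (rule emeasure_projection(2)[OF v]) (use AT inj in \<open>auto intro: inj_on_subset\<close>)
    also have "\<dots> = emeasure (density (flux D Rt v) (indicator A)) (proj v -` C)"
      by (subst emeasure_density, measurable) (simp add: indicator_inter_arith[symmetric])
    also have "\<dots> = emeasure (distr (density (flux D Rt v) (indicator A)) borel (proj v)) C"
      by (subst emeasure_distr) auto
    finally show "emeasure (density surface_measure (indicator (proj v ` A))) C = emeasure (distr (density (flux D Rt v) (indicator A)) borel (proj v)) C" .
  qed simp
  then have "(\<integral>\<^sup>+y. f y \<partial>density surface_measure (indicator (proj v ` A))) = (\<integral>\<^sup>+y. f y \<partial>distr (density (flux D Rt v) (indicator A)) borel (proj v))"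
    by simp
  then show ?thesis
    by (simp add: nn_integral_density nn_integral_distr mult.commute)
qed

end

section \<open>Lebesgue measure decomposed along flights\<close>

declare transpose_matrix_vector [simp del]

lemma measurable_fst_borel [measurable]: "fst \<in> borel_measurable (borel :: ('a::euclidean_space \<times> 'b::euclidean_space) measure)"
  and measurable_snd_borel [measurable]: "snd \<in> borel_measurable (borel :: ('a::euclidean_space \<times> 'b::euclidean_space) measure)"
  by (intro borel_measurable_continuous_onI continuous_intros)+

lemma measurable_borel_pair:
  fixes f :: "'a::euclidean_space \<times> 'b::euclidean_space \<Rightarrow> 'c::topological_space"
  assumes "f \<in> borel_measurable borel"
  shows "f \<in> borel_measurable (borel \<Otimes>\<^sub>M lborel)"
proof -
  have "sets (borel \<Otimes>\<^sub>M lborel) = sets (borel :: ('a \<times> 'b) measure)"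
    unfolding borel_prod[symmetric] by (intro sets_pair_measure_cong) auto
  then show ?thesis using assms by (simp cong: measurable_cong_sets)
qed

lemma norm_proj_le:
  assumes v: "norm v = 1" shows "norm (proj v u) \<le> norm u"
proof -
  have "(norm (proj v u))\<^sup>2 = (norm u)\<^sup>2 - (u \<bullet> v)\<^sup>2"
    unfolding power2_norm_eq_inner
    by (simp add: proj_def inner_diff_left inner_diff_right inner_unit[OF v] inner_commute power2_eq_square)
  then have "(norm (proj v u))\<^sup>2 \<le> (norm u)\<^sup>2" by simp
  then show ?thesis by (rule power2_le_imp_le) simp
qed

lemma proj_diff: "proj v (x - y) = proj v x - proj v y"
  by (simp add: proj_def inner_diff_left algebra_simps)

lemma proj_line: "norm v = 1 \<Longrightarrow> proj v (x + t *\<^sub>R v) = proj v x"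
  by (simp add: proj_def inner_add_left inner_unit algebra_simps)

lemma hausdorff_proj_le:
  assumes v: "norm v = 1"
  shows "hausdorff_outer_measure k (proj v ` A) \<le> hausdorff_outer_measure k A"
  using hausdorff_outer_lipschitz_image[of A "proj v" 1 k] norm_proj_le[OF v]
  by (simp add: dist_norm proj_diff[symmetric])

text \<open>Every line over the base has infinite length, and
  \<open>\<infinity> * 0 = 0\<close>.\<close>

lemma lborel_cylinder_null:
  fixes v :: "real^'n"
  assumes v: "norm v = 1" and B[measurable]: "B \<in> sets borel" and null: "emeasure surface_measure (hyperplane v \<inter> B) = 0"
  shows "AE y in lborel. proj v y \<notin> B"
proof -
  have [measurable]: "{y. proj v y \<in> B} \<in> sets borel" by measurable
  have "emeasure lborel {y. proj v y \<in> B} = (\<integral>\<^sup>+y. indicator {y. proj v y \<in> B} y \<partial>lborel)" by simp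
  also have "\<dots> = (\<integral>\<^sup>+x. (\<integral>\<^sup>+h. indicator {y. proj v y \<in> B} (x + h *\<^sub>R v) \<partial>(lborel::real measure)) \<partial>plane_measure v)"
    by (rule nn_integral_slices[OF v]) measurable
  also have "\<dots> = (\<integral>\<^sup>+x. \<infinity> * indicator (hyperplane v \<inter> B) x \<partial>plane_measure v)"
  proof (rule nn_integral_cong)
    fix x assume "x \<in> space (plane_measure v)"
    then have "(\<lambda>h::real. indicator {y. proj v y \<in> B} (x + h *\<^sub>R v)) = (\<lambda>h. indicator (hyperplane v \<inter> B) x :: ennreal)"
      by (auto simp: indicator_def proj_line[OF v] proj_id)
    then show "(\<integral>\<^sup>+h. indicator {y. proj v y \<in> B} (x + h *\<^sub>R v) \<partial>(lborel::real measure)) = (\<infinity> * indicator (hyperplane v \<inter> B) x :: ennreal)"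
      by (simp add: mult.commute)
  qed
  also have "\<dots> = \<infinity> * emeasure (plane_measure v) (hyperplane v \<inter> B)"
    by (rule nn_integral_cmult_indicator) (simp add: sets_plane_measure sets_restrict_space_iff)
  also have "\<dots> = 0" using null by (simp add: emeasure_plane_surface)
  finally show ?thesis by (intro AE_I[of _ _ "{y. proj v y \<in> B}"]) auto
qed

context billiard
begin

lemma openin_transversal:
  assumes v: "norm v = 1" shows "openin (top_of_set (frontier D)) (transversal D Rt v)"
  unfolding openin_contains_ball
proof (intro conjI ballI)
  show "transversal D Rt v \<subseteq> frontier D" using transversal_Rt Rt_frontier by blast
  fix x assume "x \<in> transversal D Rt v"
  from transversal_local[OF v this, of 1] obtain r where "r > 0" "frontier D \<inter> cball x r \<subseteq> transversal D Rt v" by auto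
  then show "\<exists>e>0. ball x e \<inter> frontier D \<subseteq> transversal D Rt v"
    by (intro exI[of _ r]) auto
qed

text \<open>The non-transversal boundary points form a compact null set; \<open>proj v\<close> does
  not increase distances, so their shadow and the cylinder over it are null. Off that cylinder the
  backward hit is transversal, and since the flight from it runs inside \<open>D\<close>, the sign
  is positive.\<close>

lemma AE_enters:
  assumes v: "norm v = 1" and tr: "emeasure surface_measure (frontier D - transversal D Rt v) = 0"
  shows "AE y in lborel. y \<in> D \<longrightarrow> next_hit D y (- v) \<in> entrance D Rt v"
proof -
  let ?N = "frontier D - transversal D Rt v"
  have "closedin (top_of_set (frontier D)) ?N" using openin_transversal[OF v] by (simp add: closedin_diff)
  then have cN: "compact ?N" using compact_F closedin_compact by blast
  then have cB: "compact (proj v ` ?N)" by (intro compact_continuous_image continuous_on_proj)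
  have "emeasure surface_measure (hyperplane v \<inter> proj v ` ?N) = 0"
  proof -
    have b: "hyperplane v \<inter> proj v ` ?N \<in> sets borel" using cB by (intro borel_closed closed_Int compact_imp_closed) auto
    have "hausdorff_outer_measure (CARD('n) - 1) (hyperplane v \<inter> proj v ` ?N) \<le> hausdorff_outer_measure (CARD('n) - 1) (proj v ` ?N)"
      by (rule hausdorff_outer_mono) auto
    also have "\<dots> \<le> hausdorff_outer_measure (CARD('n) - 1) ?N" by (rule hausdorff_proj_le[OF v])
    also have "\<dots> = 0" using tr cN by (simp add: emeasure_surface borel_compact)
    finally show ?thesis by (simp add: emeasure_surface[OF b])
  qed
  from lborel_cylinder_null[OF v _ this] have "AE y in lborel. proj v y \<notin> proj v ` ?N"
    using cB by (simp add: borel_compact)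
  then show ?thesis
  proof eventually_elim
    case (elim y)
    show ?case
    proof
      assume y: "y \<in> D"
      note o = flight_origin[OF open_D bounded v y]
      let ?z = "next_hit D y (- v)"
      have "proj v y = proj v ?z" using o(3) proj_line[OF v] by metis
      then have T: "?z \<in> transversal D Rt v" using elim o(2) by blast
      have "\<not> v \<bullet> nf ?z < 0" using not_starts_inside o(4) T transversal_Rt by blast
      then show "?z \<in> entrance D Rt v" using T by (auto simp: transversal_def entrance_def)
    qed
  qed
qed

text \<open>Injectivity of the projection leaves at most one point of \<open>A\<close> on each line
  along \<open>v\<close>; the points of \<open>D\<close> on this line that flew out of
  \<open>A\<close> then form a single open segment, of length the flight time.\<close>

lemma nn_integral_flights_piece:
  assumes v: "norm v = 1" and A[measurable]: "A \<in> sets borel" "A \<subseteq> entrance D Rt v" and inj: "inj_on (proj v) A"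
    and g[measurable]: "g \<in> borel_measurable borel"
  shows "(\<integral>\<^sup>+y. g (next_hit D y (- v), flight_time D y (- v)) * indicator D y * indicator A (next_hit D y (- v)) \<partial>lborel)
     = (\<integral>\<^sup>+x. (\<integral>\<^sup>+s. g (x, s) * indicator {0<..<flight_time D x v} s \<partial>lborel) * indicator A x \<partial>flux D Rt v)"
proof -
  define G where "G y = g (next_hit D y (- v), flight_time D y (- v)) * indicator D y * indicator A (next_hit D y (- v))" for y
  have [measurable]: "G \<in> borel_measurable borel" unfolding G_def by measurable
  have AT: "A \<subseteq> transversal D Rt v" using A(2) entrance_transversal by blast
  have pA[measurable]: "proj v ` A \<in> sets borel" by (rule emeasure_projection(1)[OF v A(1) AT inj])
  define \<Phi> where "\<Phi> x = (\<integral>\<^sup>+h. G (x + h *\<^sub>R v) \<partial>lborel)" for x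
  have [measurable]: "\<Phi> \<in> borel_measurable borel" unfolding \<Phi>_def by measurable
  have G0: "G y = 0" if "proj v y \<notin> proj v ` A" for y
  proof (cases "y \<in> D \<and> next_hit D y (- v) \<in> A")
    case True
    then have "proj v y = proj v (next_hit D y (- v))"
      using flight_origin(3)[OF open_D bounded v, of y] proj_line[OF v] by metis
    then show ?thesis using True that by blast
  qed (auto simp: G_def indicator_def)
  have \<Phi>0: "\<Phi> x = \<Phi> x * indicator (proj v ` A) x" if x: "x \<in> hyperplane v" for x
  proof (cases "x \<in> proj v ` A")
    case False
    then have "G (x + h *\<^sub>R v) = 0" for h using x by (intro G0) (simp add: proj_line[OF v] proj_id)
    then show ?thesis by (simp add: \<Phi>_def)
  qed simp
  have \<Phi>A: "\<Phi> (proj v x) = (\<integral>\<^sup>+s. g (x, s) * indicator {0<..<flight_time D x v} s \<partial>lborel)" if x: "x \<in> A" for x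
  proof -
    have xe: "x \<in> entrance D Rt v" and xF: "x \<in> frontier D" using x A(2) entrance_transversal transversal_Rt Rt_frontier by blast+
    note ins = entrance_starts_inside[OF xe]
    \<comment> \<open>The line is reparametrized so that time 0 is at \<open>x\<close> and not at
      its shadow.\<close>
    have "\<Phi> (proj v x) = (\<integral>\<^sup>+h. G (x + (- (x \<bullet> v) + h) *\<^sub>R v) \<partial>lborel)"
      unfolding \<Phi>_def proj_def by (intro nn_integral_cong) (simp add: algebra_simps)
    also have "\<dots> = (\<integral>\<^sup>+s. G (x + s *\<^sub>R v) \<partial>distr lborel borel ((+) (- (x \<bullet> v))))"
      by (subst nn_integral_distr) auto
    also have "\<dots> = (\<integral>\<^sup>+s. G (x + s *\<^sub>R v) \<partial>lborel)" by (simp only: lborel_distr_plus)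
    also have "\<dots> = (\<integral>\<^sup>+s. g (x, s) * indicator {0<..<flight_time D x v} s \<partial>lborel)"
    proof (rule nn_integral_cong)
      fix s :: real
      show "G (x + s *\<^sub>R v) = g (x, s) * indicator {0<..<flight_time D x v} s"
      proof (cases "0 < s \<and> s < flight_time D x v")
        case True
        then have "next_hit D (x + s *\<^sub>R v) (- v) = x" "flight_time D (x + s *\<^sub>R v) (- v) = s" "x + s *\<^sub>R v \<in> D"
          using flight_backward[OF open_D bounded v ins xF] flight_props(3)[OF open_D bounded v ins] by auto
        then show ?thesis using True x by (simp add: G_def)
      next
        case False
        \<comment> \<open>A backward hit in \<open>A\<close> would have the same shadow as
          \<open>x\<close>, hence be \<open>x\<close>, and \<open>s\<close> would be a time of the
          flight.\<close>
        have "\<not> (x + s *\<^sub>R v \<in> D \<and> next_hit D (x + s *\<^sub>R v) (- v) \<in> A)"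
        proof
          assume y: "x + s *\<^sub>R v \<in> D \<and> next_hit D (x + s *\<^sub>R v) (- v) \<in> A"
          define z where "z = next_hit D (x + s *\<^sub>R v) (- v)"
          note o = flight_origin[OF open_D bounded v conjunct1[OF y], folded z_def]
          have "proj v z = proj v x" using o(3) proj_line[OF v] by metis
          then have zx: "z = x" using inj x y unfolding inj_on_def z_def by blast
          then have "(s - flight_time D (x + s *\<^sub>R v) (- v)) *\<^sub>R v = 0" using o(3) by (simp add: algebra_simps)
          then have se: "s = flight_time D (x + s *\<^sub>R v) (- v)" using v by auto
          moreover have "flight_time D (x + s *\<^sub>R v) v > 0"
            using flight_props(1)[OF open_D bounded v starts_inside_open[OF open_D bounded conjunct1[OF y] v]] .
          ultimately show False using o(1,5) False zx by simp
        qed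
        then show ?thesis using False by (auto simp: G_def indicator_def)
      qed
    qed
    finally show ?thesis .
  qed
  have "(\<integral>\<^sup>+y. G y \<partial>lborel) = (\<integral>\<^sup>+x. \<Phi> x \<partial>plane_measure v)"
    unfolding \<Phi>_def by (rule nn_integral_slices[OF v]) measurable
  also have "\<dots> = (\<integral>\<^sup>+x. \<Phi> x * indicator (proj v ` A) x \<partial>plane_measure v)"
    using \<Phi>0 by (intro nn_integral_cong) simp
  also have "\<dots> = (\<integral>\<^sup>+x. \<Phi> x * indicator (proj v ` A) x * indicator (hyperplane v) x \<partial>surface_measure)"
    unfolding plane_measure_def by (subst nn_integral_restrict_space) (auto simp: surface_measure_def)
  also have "\<dots> = (\<integral>\<^sup>+x. \<Phi> x * indicator (proj v ` A) x \<partial>surface_measure)"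
    using proj_hyperplane[OF v] by (intro nn_integral_cong) (auto simp: indicator_def)
  also have "\<dots> = (\<integral>\<^sup>+x. \<Phi> (proj v x) * indicator A x \<partial>flux D Rt v)"
    by (rule nn_integral_projection[OF v A(1) AT inj]) measurable
  also have "\<dots> = (\<integral>\<^sup>+x. (\<integral>\<^sup>+s. g (x, s) * indicator {0<..<flight_time D x v} s \<partial>lborel) * indicator A x \<partial>flux D Rt v)"
    using \<Phi>A by (intro nn_integral_cong) (auto simp: indicator_def)
  finally show ?thesis by (simp add: G_def)
qed

lemma nn_integral_flights:
  assumes v: "norm v = 1" and tr: "emeasure surface_measure (frontier D - transversal D Rt v) = 0"
    and g[measurable]: "g \<in> borel_measurable borel"
  shows "(\<integral>\<^sup>+y. g (next_hit D y (- v), flight_time D y (- v)) * indicator D y \<partial>lborel)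
     = (\<integral>\<^sup>+x. (\<integral>\<^sup>+s. g (x, s) * indicator {0<..<flight_time D x v} s \<partial>lborel) * indicator (entrance D Rt v) x \<partial>flux D Rt v)"
proof -
  let ?E = "entrance D Rt v"
  obtain B :: "nat \<Rightarrow> 'n point set" where B: "disjoint_family B" "(\<Union>i. B i) = ?E" "\<And>i. B i \<in> sets borel" "\<And>i. inj_on (proj v) (B i)"
    using transversal_pieces[OF v entrance_borel entrance_transversal, of 1] by (metis zero_less_one)
  note [measurable] = B(3)
  have ind: "indicator ?E x = (\<Sum>i. indicator (B i) x :: ennreal)" for x
    using suminf_indicator[OF B(1), of x] B(2) by simp
  let ?X = "\<lambda>x. (\<integral>\<^sup>+s. g (x, s) * indicator {0<..<flight_time D x v} s \<partial>lborel)"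
  have [measurable]: "?X \<in> borel_measurable borel"
  proof -
    have "(\<lambda>w. g (fst w, snd w) * indicator {w. 0 < snd w \<and> snd w < flight_time D (fst w) v} w) \<in> borel_measurable borel"
      by measurable
    from lborel.borel_measurable_nn_integral_fst[OF measurable_borel_pair[OF this]] show ?thesis
      by (simp add: indicator_def)
  qed
  have "(\<integral>\<^sup>+y. g (next_hit D y (- v), flight_time D y (- v)) * indicator D y \<partial>lborel)
     = (\<integral>\<^sup>+y. g (next_hit D y (- v), flight_time D y (- v)) * indicator D y * indicator ?E (next_hit D y (- v)) \<partial>lborel)"
    using AE_enters[OF v tr] by (intro nn_integral_cong_AE) (auto elim!: eventually_mono simp: indicator_def)
  also have "\<dots> = (\<integral>\<^sup>+y. (\<Sum>i. g (next_hit D y (- v), flight_time D y (- v)) * indicator D y * indicator (B i) (next_hit D y (- v))) \<partial>lborel)"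
    by (simp only: ind ennreal_suminf_cmult)
  also have "\<dots> = (\<Sum>i. \<integral>\<^sup>+y. g (next_hit D y (- v), flight_time D y (- v)) * indicator D y * indicator (B i) (next_hit D y (- v)) \<partial>lborel)"
    by (rule nn_integral_suminf) measurable
  also have "\<dots> = (\<Sum>i. \<integral>\<^sup>+x. ?X x * indicator (B i) x \<partial>flux D Rt v)"
    by (intro suminf_cong nn_integral_flights_piece[OF v B(3) _ B(4) g]) (use B(2) in auto)
  also have "\<dots> = (\<integral>\<^sup>+x. (\<Sum>i. ?X x * indicator (B i) x) \<partial>flux D Rt v)"
    by (rule nn_integral_suminf[symmetric]) measurable
  also have "\<dots> = (\<integral>\<^sup>+x. ?X x * indicator ?E x \<partial>flux D Rt v)"
    by (simp only: ind ennreal_suminf_cmult)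
  finally show ?thesis .
qed

definition "SF = restrict_space surface_measure (frontier D)"

lemma space_SF [simp]: "space SF = frontier D"
  by (simp add: SF_def space_restrict_space)

lemma finite_SF: "finite_measure SF"
proof
  have "emeasure SF (space SF) = emeasure surface_measure (frontier D)"
    unfolding space_SF unfolding SF_def by (subst emeasure_restrict_space) auto
  then show "emeasure SF (space SF) \<noteq> \<infinity>"
    using lipschitz_boundary_finite[OF open_D bounded lipschitz_D] by simp
qed

lemma measurable_SF [measurable (raw)]: "f \<in> borel_measurable borel \<Longrightarrow> f \<in> borel_measurable SF"
  unfolding SF_def by (intro measurable_restrict_space1) (simp add: measurable_def)

lemma nn_integral_SF: "(\<integral>\<^sup>+x. f x \<partial>SF) = (\<integral>\<^sup>+x. f x * indicator (frontier D) x \<partial>surface_measure)"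
  unfolding SF_def by (rule nn_integral_restrict_space) simp

end

section \<open>Surface measure on the sphere and its orthogonal invariance\<close>

lemma space_sphere_measure [simp]: "space sphere_measure = sphere 0 1"
  by (simp add: sphere_measure_def space_restrict_space)

lemma finite_sphere_measure: "finite_measure (sphere_measure :: 'n::finite point measure)"
proof
  have "emeasure (sphere_measure :: 'n point measure) (space sphere_measure) = emeasure surface_measure (sphere (0::'n point) 1)"
    unfolding space_sphere_measure unfolding sphere_measure_def by (subst emeasure_restrict_space) auto
  then show "emeasure (sphere_measure :: 'n point measure) (space sphere_measure) \<noteq> \<infinity>"
    using sphere_surface_finite[where 'n='n] by simp
qed

lemma measurable_sphere_measure [measurable (raw)]: "f \<in> borel_measurable borel \<Longrightarrow> f \<in> borel_measurable sphere_measure"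
  unfolding sphere_measure_def by (intro measurable_restrict_space1) (simp add: measurable_def)

lemma nn_integral_sphere: "(\<integral>\<^sup>+x. f x \<partial>sphere_measure) = (\<integral>\<^sup>+x. f x * indicator (sphere 0 1) x \<partial>surface_measure)"
  unfolding sphere_measure_def by (rule nn_integral_restrict_space) simp

lemma distr_surface_orthogonal:
  fixes Q :: "real^'n \<Rightarrow> real^'n"
  assumes Q: "orthogonal_transformation Q"
  shows "distr surface_measure borel Q = surface_measure"
proof (rule measure_eqI)
  note m = orthogonal_transformation_measurable[OF Q]
  fix A assume "A \<in> sets (distr surface_measure borel Q)"
  then have A: "A \<in> sets borel" by simp
  have QA: "Q -` A \<in> sets borel" using measurable_sets[OF m A] by simp
  have "Q ` (Q -` A) = A" using orthogonal_transformation_surj[OF Q] by (simp add: surj_image_vimage_eq)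
  then have "emeasure surface_measure A = emeasure surface_measure (Q -` A)"
    using emeasure_hausdorff_orthogonal[OF Q QA, of "CARD('n) - 1"] by (simp add: surface_measure_def)
  then show "emeasure (distr surface_measure borel Q) A = emeasure surface_measure A"
    using m A by (subst emeasure_distr) (auto simp: measurable_def)
qed simp

lemma nn_integral_surface_orthogonal:
  fixes Q :: "real^'n \<Rightarrow> real^'n"
  assumes Q: "orthogonal_transformation Q" and f: "f \<in> borel_measurable borel"
  shows "(\<integral>\<^sup>+x. f (Q x) \<partial>surface_measure) = (\<integral>\<^sup>+x. f x \<partial>surface_measure)"
proof -
  have "(\<integral>\<^sup>+x. f x \<partial>surface_measure) = (\<integral>\<^sup>+x. f x \<partial>distr surface_measure borel Q)" by (simp add: distr_surface_orthogonal[OF Q])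
  also have "\<dots> = (\<integral>\<^sup>+x. f (Q x) \<partial>surface_measure)"
    using orthogonal_transformation_measurable[OF Q] f by (intro nn_integral_distr) (auto simp: measurable_def)
  finally show ?thesis by simp
qed

lemma continuous_matrix_vector_pair:
  "continuous_on UNIV (\<lambda>x. fst x *v (snd x :: real^'n))" "continuous_on UNIV (\<lambda>x. transpose (fst x) *v (snd x :: real^'n))"
  unfolding matrix_vector_mult_def transpose_def by (intro continuous_intros; simp)+

lemma measurable_matrix_vector [measurable (raw)]:
  fixes f :: "'a \<Rightarrow> real^'n^'n" and g :: "'a \<Rightarrow> real^'n"
  assumes "f \<in> borel_measurable M" "g \<in> borel_measurable M"
  shows "(\<lambda>x. f x *v g x) \<in> borel_measurable M" "(\<lambda>x. transpose (f x) *v g x) \<in> borel_measurable M"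
  by (rule borel_measurable_continuous_Pair[where H = "\<lambda>A w. A *v w", OF assms continuous_matrix_vector_pair(1)])
     (rule borel_measurable_continuous_Pair[where H = "\<lambda>A w. transpose A *v w", OF assms continuous_matrix_vector_pair(2)])

lemma half_sphere_borel [measurable, simp]: "half_sphere (v :: 'n::finite point) \<in> sets borel"
  unfolding half_sphere_def by measurable

section \<open>Reflected directions\<close>

locale reflecting = billiard D Rt for D Rt :: "'n::{finite,linorder} point set" +
  fixes \<gamma> :: "'n point \<Rightarrow> real" and U :: "'n point \<Rightarrow> 'n matrix"
  assumes dens: "reflection_density \<gamma>" and frames: "reflection_frames D Rt \<gamma> U"
begin

text \<open>The hypotheses control \<gamma> on the half sphere and \<open>U\<close> on the frontier
  only. The extensions by 0 and by the identity are Borel on the whole space, and \<open>U0\<close>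
  is orthogonal everywhere.\<close>

definition "\<gamma>0 u = (if u \<in> half_sphere e_vec then \<gamma> u else 0)"
definition "U0 x = (if x \<in> frontier D then U x else mat 1)"

lemma measurable_\<gamma>0 [measurable]: "\<gamma>0 \<in> borel_measurable borel"
proof -
  have "\<gamma> \<in> borel_measurable (restrict_space borel (half_sphere e_vec))" using dens by (simp add: reflection_density_def)
  then show ?thesis unfolding \<gamma>0_def by (subst (asm) measurable_restrict_space_iff) auto
qed

lemma measurable_U0 [measurable]: "U0 \<in> borel_measurable borel"
proof -
  have "U \<in> borel_measurable (restrict_space borel (frontier D))" using frames by (simp add: reflection_frames_def)
  then show ?thesis unfolding U0_def by (subst (asm) measurable_restrict_space_iff[where c = "mat 1"]) auto
qed

lemma \<gamma>0_nonneg: "\<gamma>0 u \<ge> 0"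
  using dens by (simp add: \<gamma>0_def reflection_density_def)

lemma orthogonal_U0: "orthogonal_matrix (U0 x)"
  using frames by (auto simp: U0_def reflection_frames_def orthogonal_matrix_id)

lemma orthogonal_transformation_U0: "orthogonal_transformation ((*v) (U0 x))"
  using orthogonal_U0 by (simp add: orthogonal_transformation_matrix)

lemma U0_transpose: "transpose (U0 x) *v (U0 x *v u) = u" "U0 x *v (transpose (U0 x) *v u) = u"
  using orthogonal_U0[of x] by (simp_all add: matrix_vector_mul_assoc orthogonal_matrix_def)

lemma U0_normal: "x \<in> Rt \<Longrightarrow> U0 x *v e_vec = nf x"
  using frames Rt_frontier[of x] by (simp add: U0_def reflection_frames_def normal_field_def)

lemma transpose_inner: "(transpose (U0 x) *v v) \<bullet> e_vec = v \<bullet> (U0 x *v e_vec)"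
  by (metis dot_lmul_matrix inner_commute transpose_matrix_vector transpose_transpose)

lemma norm_U0: "norm (U0 x *v u) = norm u" "norm (transpose (U0 x) *v u) = norm u"
  using orthogonal_transformation_norm[OF orthogonal_transformation_U0] U0_transpose(2) by metis+

lemma \<gamma>0_sphere: "\<gamma>0 (transpose (U0 x) *v v) \<noteq> 0 \<Longrightarrow> norm v = 1"
  using norm_U0(2)[of x v] by (auto simp: \<gamma>0_def half_sphere_def split: if_splits)

text \<open>The extended density vanishes unless \<open>v\<close> enters the domain, so integrals
  over the whole sphere carry no indicator of the entrance set.\<close>

lemma \<gamma>0_entrance: "x \<in> Rt \<Longrightarrow> \<gamma>0 (transpose (U0 x) *v v) \<noteq> 0 \<Longrightarrow> v \<bullet> nf x > 0"
  using transpose_inner[of x v] U0_normal[of x]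
  by (auto simp: \<gamma>0_def half_sphere_def inner_commute split: if_splits)

abbreviation "\<rho> \<equiv> reflection_law \<gamma>"

lemma space_\<rho>: "space \<rho> = half_sphere e_vec"
  by (simp add: reflection_law_def space_restrict_space)

lemma sets_\<rho>: "sets \<rho> = sets (restrict_space borel (half_sphere e_vec))"
  unfolding reflection_law_def by (simp, intro sets_restrict_space_cong) simp

lemma prob_\<rho>: "prob_space \<rho>"
  using dens by (simp add: reflection_density_def)

lemma measurable_\<rho> [measurable (raw)]: "f \<in> measurable borel N \<Longrightarrow> f \<in> measurable \<rho> N"
  unfolding measurable_cong_sets[OF sets_\<rho> refl] by (rule measurable_restrict_space1)

lemma nn_integral_\<rho>:
  assumes [measurable]: "f \<in> borel_measurable borel"
  shows "(\<integral>\<^sup>+u. f u \<partial>\<rho>) = (\<integral>\<^sup>+u. ennreal (\<gamma>0 u) * f u \<partial>surface_measure)"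
proof -
  let ?R = "restrict_space surface_measure (half_sphere e_vec) :: 'n point measure"
  have sR: "sets ?R = sets (restrict_space borel (half_sphere e_vec))" by (intro sets_restrict_space_cong) simp
  have 1: "\<gamma> \<in> borel_measurable ?R" using dens by (simp add: reflection_density_def measurable_cong_sets[OF sR refl])
  have 2: "f \<in> borel_measurable ?R" unfolding measurable_cong_sets[OF sR refl] by (rule measurable_restrict_space1) measurable
  have "(\<integral>\<^sup>+u. f u \<partial>\<rho>) = (\<integral>\<^sup>+u. ennreal (\<gamma> u) * f u \<partial>?R)"
    unfolding reflection_law_def using 1 2 by (intro nn_integral_density) auto
  also have "\<dots> = (\<integral>\<^sup>+u. ennreal (\<gamma> u) * f u * indicator (half_sphere e_vec) u \<partial>surface_measure)"
    by (rule nn_integral_restrict_space) simp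
  also have "\<dots> = (\<integral>\<^sup>+u. ennreal (\<gamma>0 u) * f u \<partial>surface_measure)"
    by (intro nn_integral_cong) (auto simp: \<gamma>0_def indicator_def)
  finally show ?thesis .
qed

text \<open>Surface measure is invariant under the orthogonal map \<open>U0 x\<close>, so the
  reflected direction has the transported density on the sphere.\<close>

lemma nn_integral_reflected:
  assumes f[measurable]: "f \<in> borel_measurable borel"
  shows "(\<integral>\<^sup>+u. f (U0 x *v u) \<partial>\<rho>) = (\<integral>\<^sup>+v. ennreal (\<gamma>0 (transpose (U0 x) *v v)) * f v \<partial>sphere_measure)"
proof -
  have "(\<integral>\<^sup>+u. f (U0 x *v u) \<partial>\<rho>) = (\<integral>\<^sup>+u. ennreal (\<gamma>0 u) * f (U0 x *v u) \<partial>surface_measure)"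
    by (rule nn_integral_\<rho>) measurable
  also have "\<dots> = (\<integral>\<^sup>+u. (\<lambda>v. ennreal (\<gamma>0 (transpose (U0 x) *v v)) * f v) (U0 x *v u) \<partial>surface_measure)"
    by (simp add: U0_transpose)
  also have "\<dots> = (\<integral>\<^sup>+v. ennreal (\<gamma>0 (transpose (U0 x) *v v)) * f v \<partial>surface_measure)"
    by (rule nn_integral_surface_orthogonal[OF orthogonal_transformation_U0]) measurable
  also have "\<dots> = (\<integral>\<^sup>+v. ennreal (\<gamma>0 (transpose (U0 x) *v v)) * f v * indicator (sphere 0 1) v \<partial>surface_measure)"
  proof (rule nn_integral_cong)
    fix v
    show "ennreal (\<gamma>0 (transpose (U0 x) *v v)) * f v = ennreal (\<gamma>0 (transpose (U0 x) *v v)) * f v * indicator (sphere 0 1) v"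
      using \<gamma>0_sphere[of x v] by (cases "\<gamma>0 (transpose (U0 x) *v v) = 0") auto
  qed
  finally show ?thesis by (simp add: nn_integral_sphere)
qed

lemma AE_SF_Rt: "AE x in SF. x \<in> Rt"
proof -
  have "frontier D - Rt \<in> null_sets surface_measure" using domain by (simp add: billiard_domain_def)
  then have "AE x in surface_measure. x \<notin> frontier D - Rt" by (rule AE_not_in)
  then have "AE x in surface_measure. x \<in> frontier D \<longrightarrow> x \<in> Rt" by eventually_elim auto
  then show ?thesis unfolding SF_def by (subst AE_restrict_space_iff) auto
qed

lemma measurable_SF_sphere:
  fixes f :: "'n point \<Rightarrow> 'n point \<Rightarrow> ennreal"
  assumes f: "(\<lambda>z. f (fst z) (snd z)) \<in> borel_measurable borel"
  shows "(\<lambda>(x, v). f x v) \<in> borel_measurable (SF \<Otimes>\<^sub>M sphere_measure)"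
proof -
  have "fst \<in> borel_measurable (SF \<Otimes>\<^sub>M (sphere_measure :: 'n point measure))"
    using measurable_compose[OF measurable_fst measurable_SF[OF measurable_ident]] by simp
  moreover have "snd \<in> borel_measurable (SF \<Otimes>\<^sub>M (sphere_measure :: 'n point measure))"
    using measurable_compose[OF measurable_snd measurable_sphere_measure[OF measurable_ident]] by simp
  ultimately have "(\<lambda>z. (fst z, snd z)) \<in> borel_measurable (SF \<Otimes>\<^sub>M (sphere_measure :: 'n point measure))"
    by (rule borel_measurable_Pair)
  from measurable_compose[OF this f] show ?thesis by (simp add: split_beta')
qed

text \<open>For a fixed point of \<open>Rt\<close> the tangential directions form a great sphere,
  which is null; Fubini exchanges the roles of points and directions.\<close>

lemma AE_transversal: "AE v in sphere_measure. emeasure surface_measure (frontier D - transversal D Rt v) = 0"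
proof -
  interpret SF: finite_measure SF by (rule finite_SF)
  interpret SS: finite_measure "sphere_measure :: 'n point measure" by (rule finite_sphere_measure)
  interpret P: pair_sigma_finite SF "sphere_measure :: 'n point measure" ..
  let ?f = "\<lambda>x v. indicator {w. fst w \<in> Rt \<and> snd w \<bullet> nf (fst w) = 0} (x, v) :: ennreal"
  have m: "(\<lambda>(x, v). ?f x v) \<in> borel_measurable (SF \<Otimes>\<^sub>M sphere_measure)"
    by (rule measurable_SF_sphere) measurable
  have eqv: "(\<integral>\<^sup>+x. ?f x v \<partial>SF) = emeasure surface_measure (frontier D - transversal D Rt v)" if v: "norm v = 1" for v
  proof -
    have "(\<integral>\<^sup>+x. ?f x v \<partial>SF) = (\<integral>\<^sup>+x. indicator (frontier D - transversal D Rt v) x \<partial>SF)"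
      using AE_SF_Rt by (intro nn_integral_cong_AE) (auto elim!: eventually_mono simp: indicator_def transversal_def Rt_frontier)
    also have "\<dots> = (\<integral>\<^sup>+x. indicator (frontier D - transversal D Rt v) x \<partial>surface_measure)"
      unfolding nn_integral_SF by (intro nn_integral_cong) (auto simp: indicator_def)
    also have "\<dots> = emeasure surface_measure (frontier D - transversal D Rt v)"
      by (rule nn_integral_indicator) simp
    finally show ?thesis .
  qed
  have "(\<integral>\<^sup>+v. (\<integral>\<^sup>+x. ?f x v \<partial>SF) \<partial>sphere_measure) = (\<integral>\<^sup>+x. (\<integral>\<^sup>+v. ?f x v \<partial>sphere_measure) \<partial>SF)"
    by (rule P.Fubini'[OF m])
  also have "\<dots> = (\<integral>\<^sup>+x. 0 \<partial>SF)"
  proof (rule nn_integral_cong)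
    fix x
    show "(\<integral>\<^sup>+v. ?f x v \<partial>sphere_measure) = 0"
    proof (cases "x \<in> Rt")
      case True
      have "(\<integral>\<^sup>+v. ?f x v \<partial>sphere_measure) = (\<integral>\<^sup>+v. indicator {v. norm v = 1 \<and> v \<bullet> nf x = 0} v \<partial>surface_measure)"
        unfolding nn_integral_sphere using True by (intro nn_integral_cong) (auto simp: indicator_def)
      also have "\<dots> = emeasure surface_measure {v. norm v = 1 \<and> v \<bullet> nf x = 0}"
        by (rule nn_integral_indicator) measurable
      also have "\<dots> = 0" by (rule great_sphere_null[OF norm_nf[OF True]])
      finally show ?thesis .
    qed simp
  qed
  finally have "(\<integral>\<^sup>+v. (\<integral>\<^sup>+x. ?f x v \<partial>SF) \<partial>sphere_measure) = 0" by simp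
  moreover have "(\<lambda>v. \<integral>\<^sup>+x. ?f x v \<partial>SF) \<in> borel_measurable sphere_measure"
    using SF.borel_measurable_nn_integral_fst[OF measurable_compose[OF measurable_pair_swap' m]] by simp
  ultimately have "AE v in sphere_measure. (\<integral>\<^sup>+x. ?f x v \<partial>SF) = 0"
    by (simp add: nn_integral_0_iff_AE)
  then show ?thesis
    using AE_space by eventually_elim (use eqv in auto)
qed

text \<open>Integrals along the flights of the walk started from the density \<open>\<psi>\<close>, expressed in the phase space:
  each point \<open>y\<close> of the domain and direction \<open>v\<close> belong to the flight that left the boundary at \<open>next_hit D y (- v)\<close>.\<close>

lemma flight_formula:
  fixes \<psi> :: "'n point \<Rightarrow> real" and h :: "'n point \<times> 'n point \<times> real \<Rightarrow> ennreal"
  assumes psi[measurable]: "\<psi> \<in> borel_measurable borel" and h[measurable]: "h \<in> borel_measurable borel"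
    and psi0: "\<And>x. \<psi> x \<ge> 0"
  shows "(\<integral>\<^sup>+x. ennreal (\<psi> x) * (\<integral>\<^sup>+u. (\<integral>\<^sup>+s. h (x, U0 x *v u, s) * indicator {0<..<flight_time D x (U0 x *v u)} s \<partial>lborel) \<partial>\<rho>) \<partial>SF)
    = (\<integral>\<^sup>+v. (\<integral>\<^sup>+y. ennreal (\<psi> (next_hit D y (- v)) * (\<gamma>0 (transpose (U0 (next_hit D y (- v))) *v v) / (v \<bullet> nf (next_hit D y (- v)))))
          * h (next_hit D y (- v), v, flight_time D y (- v)) * indicator D y \<partial>lborel) \<partial>sphere_measure)"
proof -
  interpret SF: finite_measure SF by (rule finite_SF)
  interpret SS: finite_measure "sphere_measure :: 'n point measure" by (rule finite_sphere_measure)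
  interpret P: pair_sigma_finite SF "sphere_measure :: 'n point measure" ..
  define G where "G x v = (\<integral>\<^sup>+s. h (x, v, s) * indicator {0<..<flight_time D x v} s \<partial>lborel)" for x v
  have G: "(\<lambda>z. G (fst z) (snd z)) \<in> borel_measurable borel"
  proof -
    have "(\<lambda>w. h (fst (fst w), snd (fst w), snd w) * indicator {w. 0 < snd w \<and> snd w < flight_time D (fst (fst w)) (snd (fst w))} w) \<in> borel_measurable borel"
      by measurable
    from lborel.borel_measurable_nn_integral_fst[OF measurable_borel_pair[OF this]] show ?thesis
      by (simp add: indicator_def G_def)
  qed
  have [measurable (raw)]: "(\<lambda>x. G (f x) (g x)) \<in> borel_measurable M" if "f \<in> borel_measurable M" "g \<in> borel_measurable M" for f g and M :: "'z measure"
    using measurable_compose[OF borel_measurable_Pair[OF that] G] by simp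
  define c where "c x v = \<gamma>0 (transpose (U0 x) *v v)" for x v
  have c: "(\<lambda>z. c (fst z) (snd z)) \<in> borel_measurable borel" unfolding c_def by measurable
  have [measurable (raw)]: "(\<lambda>x. c (f x) (g x)) \<in> borel_measurable M" if "f \<in> borel_measurable M" "g \<in> borel_measurable M" for f g and M :: "'z measure"
    using measurable_compose[OF borel_measurable_Pair[OF that] c] by simp
  have "(\<integral>\<^sup>+x. ennreal (\<psi> x) * (\<integral>\<^sup>+u. G x (U0 x *v u) \<partial>\<rho>) \<partial>SF)
     = (\<integral>\<^sup>+x. (\<integral>\<^sup>+v. ennreal (\<psi> x) * (ennreal (c x v) * G x v) \<partial>sphere_measure) \<partial>SF)"
  proof (rule nn_integral_cong)
    fix x
    have "(\<integral>\<^sup>+u. G x (U0 x *v u) \<partial>\<rho>) = (\<integral>\<^sup>+v. ennreal (c x v) * G x v \<partial>sphere_measure)"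
      unfolding c_def by (rule nn_integral_reflected) measurable
    then show "ennreal (\<psi> x) * (\<integral>\<^sup>+u. G x (U0 x *v u) \<partial>\<rho>) = (\<integral>\<^sup>+v. ennreal (\<psi> x) * (ennreal (c x v) * G x v) \<partial>sphere_measure)"
      by (simp add: nn_integral_cmult)
  qed
  also have "\<dots> = (\<integral>\<^sup>+v. (\<integral>\<^sup>+x. ennreal (\<psi> x) * (ennreal (c x v) * G x v) \<partial>SF) \<partial>sphere_measure)"
    by (rule P.Fubini'[symmetric], rule measurable_SF_sphere) measurable
  also have "\<dots> = (\<integral>\<^sup>+v. (\<integral>\<^sup>+y. ennreal (\<psi> (next_hit D y (- v)) * (c (next_hit D y (- v)) v / (v \<bullet> nf (next_hit D y (- v)))))
          * h (next_hit D y (- v), v, flight_time D y (- v)) * indicator D y \<partial>lborel) \<partial>sphere_measure)"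
  proof (rule nn_integral_cong_AE)
    show "AE v in sphere_measure. (\<integral>\<^sup>+x. ennreal (\<psi> x) * (ennreal (c x v) * G x v) \<partial>SF) =
       (\<integral>\<^sup>+y. ennreal (\<psi> (next_hit D y (- v)) * (c (next_hit D y (- v)) v / (v \<bullet> nf (next_hit D y (- v)))))
          * h (next_hit D y (- v), v, flight_time D y (- v)) * indicator D y \<partial>lborel)"
      using AE_transversal AE_space
    proof eventually_elim
      case (elim v)
      then have v: "norm v = 1" by simp
      define g where "g w = ennreal (\<psi> (fst w) * (c (fst w) v / (v \<bullet> nf (fst w)))) * h (fst w, v, snd w)" for w
      have [measurable]: "g \<in> borel_measurable borel" unfolding g_def by measurable
      have "(\<integral>\<^sup>+y. g (next_hit D y (- v), flight_time D y (- v)) * indicator D y \<partial>lborel)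
        = (\<integral>\<^sup>+x. (\<integral>\<^sup>+s. g (x, s) * indicator {0<..<flight_time D x v} s \<partial>lborel) * indicator (entrance D Rt v) x \<partial>flux D Rt v)"
        by (rule nn_integral_flights[OF v elim(1)]) measurable
      also have "\<dots> = (\<integral>\<^sup>+x. ennreal (\<psi> x * (c x v / (v \<bullet> nf x))) * G x v * indicator (entrance D Rt v) x \<partial>flux D Rt v)"
        unfolding g_def G_def by (intro nn_integral_cong) (simp add: nn_integral_cmult mult.assoc)
      also have "\<dots> = (\<integral>\<^sup>+x. ennreal \<bar>v \<bullet> nf x\<bar> * (ennreal (\<psi> x * (c x v / (v \<bullet> nf x))) * G x v * indicator (entrance D Rt v) x) \<partial>surface_measure)"
        unfolding flux_def by (rule nn_integral_density) measurable
      also have "\<dots> = (\<integral>\<^sup>+x. ennreal \<bar>v \<bullet> nf x\<bar> * (ennreal (\<psi> x * (c x v / (v \<bullet> nf x))) * G x v * indicator (entrance D Rt v) x) \<partial>SF)"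
        unfolding nn_integral_SF
      proof (rule nn_integral_cong)
        fix x
        have "x \<in> entrance D Rt v \<Longrightarrow> x \<in> frontier D"
          using entrance_transversal transversal_Rt Rt_frontier by blast
        then show "ennreal \<bar>v \<bullet> nf x\<bar> * (ennreal (\<psi> x * (c x v / (v \<bullet> nf x))) * G x v * indicator (entrance D Rt v) x)
          = ennreal \<bar>v \<bullet> nf x\<bar> * (ennreal (\<psi> x * (c x v / (v \<bullet> nf x))) * G x v * indicator (entrance D Rt v) x) * indicator (frontier D) x"
          by (cases "x \<in> entrance D Rt v") simp_all
      qed
      also have "\<dots> = (\<integral>\<^sup>+x. ennreal (\<psi> x) * (ennreal (c x v) * G x v) \<partial>SF)"
      proof (rule nn_integral_cong_AE)
        show "AE x in SF. ennreal \<bar>v \<bullet> nf x\<bar> * (ennreal (\<psi> x * (c x v / (v \<bullet> nf x))) * G x v * indicator (entrance D Rt v) x) = ennreal (\<psi> x) * (ennreal (c x v) * G x v)"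
          using AE_SF_Rt
        proof eventually_elim
          case (elim x)
          show ?case
          proof (cases "v \<bullet> nf x > 0")
            case True
            \<comment> \<open>The flux density cancels the division by the cosine.\<close>
            have "ennreal \<bar>v \<bullet> nf x\<bar> * ennreal (\<psi> x * (c x v / (v \<bullet> nf x))) = ennreal (\<psi> x) * ennreal (c x v)"
              using True psi0[of x] \<gamma>0_nonneg by (simp add: ennreal_mult[symmetric] c_def)
            then show ?thesis using True by (simp add: entrance_def mult.assoc[symmetric])
          next
            case False
            then have "c x v = 0" using \<gamma>0_entrance[OF elim] by (auto simp: c_def)
            then show ?thesis using False by (simp add: entrance_def)
          qed
        qed
      qed
      finally show ?case by (simp add: g_def)
    qed
  qed
  finally show ?thesis by (simp only: G_def c_def)
qed

end

section \<open>Paths\<close>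

lemma flight_time_nonneg: "flight_time D x u \<ge> 0"
proof (cases "\<exists>t>0. x + t *\<^sub>R u \<in> frontier D")
  case True
  then have "0 \<le> Inf {t. t > 0 \<and> x + t *\<^sub>R u \<in> frontier D}" by (intro cInf_greatest) auto
  then show ?thesis using True by (simp add: flight_time_def)
next
  case False
  then have "flight_time D x u = 0" unfolding flight_time_def by (rule if_not_P)
  then show ?thesis by simp
qed

text \<open>Valid for every \<open>u\<close>: when hits accumulate at time 0, or there are none, the
  next hit is \<open>x\<close> itself. Thus the walk remains on the frontier without exceptional
  directions.\<close>

lemma next_hit_frontier:
  assumes x: "x \<in> frontier D" shows "next_hit D x u \<in> frontier D"
proof (cases "\<exists>t>0. x + t *\<^sub>R u \<in> frontier D")
  case True
  let ?T = "{t. t > 0 \<and> x + t *\<^sub>R u \<in> frontier D}"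
  have cl: "closed ((\<lambda>t. x + t *\<^sub>R u) -` frontier D)"
    by (intro closed_vimage continuous_intros) auto
  have "Inf ?T \<in> closure ?T" using True by (intro closure_contains_Inf) (auto intro: bdd_belowI[of _ 0])
  moreover have "closure ?T \<subseteq> (\<lambda>t. x + t *\<^sub>R u) -` frontier D" using cl by (intro closure_minimal) auto
  ultimately show ?thesis using True by (auto simp: next_hit_def flight_time_def)
next
  case False
  then have "flight_time D x u = 0" unfolding flight_time_def by (rule if_not_P)
  then show ?thesis using x by (simp add: next_hit_def)
qed

definition leg :: "'n::finite point set \<Rightarrow> ('n point \<Rightarrow> 'n matrix) \<Rightarrow> 'n point \<Rightarrow> (nat \<Rightarrow> 'n point) \<Rightarrow> nat \<Rightarrow> real" where
  "leg D U x \<eta> i = flight_time D (walk D U x \<eta> i) (out_velocity D U x \<eta> i)"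

lemma hit_time_leg: "hit_time D U x \<eta> n = (\<Sum>i<n. leg D U x \<eta> i)"
  by (simp add: hit_time_def leg_def)

lemma leg_nonneg: "leg D U x \<eta> i \<ge> 0"
  by (simp add: leg_def flight_time_nonneg)

lemma walk_shift: "walk D U (next_hit D x (U x *v \<eta> 0)) (\<lambda>n. \<eta> (Suc n)) n = walk D U x \<eta> (Suc n)"
  by (induction n) auto

lemma out_velocity_shift: "out_velocity D U (next_hit D x (U x *v \<eta> 0)) (\<lambda>n. \<eta> (Suc n)) n = out_velocity D U x \<eta> (Suc n)"
  unfolding out_velocity_def walk_shift ..

lemma leg_shift: "leg D U (next_hit D x (U x *v \<eta> 0)) (\<lambda>n. \<eta> (Suc n)) n = leg D U x \<eta> (Suc n)"
  unfolding leg_def walk_shift out_velocity_shift ..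

lemma hit_time_shift:
  "hit_time D U x \<eta> (Suc n) = leg D U x \<eta> 0 + hit_time D U (next_hit D x (U x *v \<eta> 0)) (\<lambda>n. \<eta> (Suc n)) n"
  unfolding hit_time_leg leg_shift by (rule sum.lessThan_Suc_shift)

definition nonexplosive :: "'n::finite point set \<Rightarrow> ('n point \<Rightarrow> 'n matrix) \<Rightarrow> 'n point \<Rightarrow> (nat \<Rightarrow> 'n point) \<Rightarrow> bool" where
  "nonexplosive D U x \<eta> \<longleftrightarrow> (\<forall>t. \<exists>n. t < hit_time D U x \<eta> (Suc n))"

lemma boundary_path_first:
  assumes "t < leg D U x \<eta> 0"
  shows "boundary_path D U x \<eta> t = (x + t *\<^sub>R (U x *v \<eta> 0), U x *v \<eta> 0)"
proof -
  have "(LEAST n. t < hit_time D U x \<eta> (Suc n)) = 0"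
    using assms by (intro Least_eq_0) (simp add: hit_time_leg)
  then show ?thesis by (simp add: boundary_path_def Let_def out_velocity_def hit_time_def)
qed

text \<open>Nonexplosion guarantees that the \<open>LEAST\<close> in the path is attained; past the
  first leg it is one more than the \<open>LEAST\<close> of the shifted walk.\<close>

lemma boundary_path_shift:
  assumes ne: "nonexplosive D U x \<eta>" and t: "t \<ge> leg D U x \<eta> 0"
  shows "boundary_path D U x \<eta> t = boundary_path D U (next_hit D x (U x *v \<eta> 0)) (\<lambda>n. \<eta> (Suc n)) (t - leg D U x \<eta> 0)"
proof -
  let ?x = "next_hit D x (U x *v \<eta> 0)" and ?\<eta> = "\<lambda>n. \<eta> (Suc n)" and ?l = "leg D U x \<eta> 0"
  obtain k where k: "t < hit_time D U x \<eta> (Suc k)" using ne by (auto simp: nonexplosive_def)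
  have "\<not> t < hit_time D U x \<eta> (Suc 0)" using t by (simp add: hit_time_leg)
  with Least_Suc[of "\<lambda>n. t < hit_time D U x \<eta> (Suc n)", OF k]
  have L: "(LEAST n. t < hit_time D U x \<eta> (Suc n)) = Suc (LEAST n. t < hit_time D U x \<eta> (Suc (Suc n)))" by simp
  have iff: "t < hit_time D U x \<eta> (Suc (Suc n)) \<longleftrightarrow> t - ?l < hit_time D U ?x ?\<eta> (Suc n)" for n
    unfolding hit_time_shift[of D U x \<eta> "Suc n"] by auto
  define m where "m = (LEAST n. t - ?l < hit_time D U ?x ?\<eta> (Suc n))"
  have L': "(LEAST n. t < hit_time D U x \<eta> (Suc n)) = Suc m" unfolding L m_def iff ..
  have "t - hit_time D U x \<eta> (Suc m) = t - ?l - hit_time D U ?x ?\<eta> m"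
    unfolding hit_time_shift[of D U x \<eta> m] by simp
  then show ?thesis
    unfolding boundary_path_def L' Let_def m_def[symmetric] walk_shift out_velocity_shift by simp
qed

context reflecting
begin

lemma walk_U0:
  assumes x: "x \<in> frontier D"
  shows "walk D U x \<eta> n = walk D U0 x \<eta> n" "walk D U0 x \<eta> n \<in> frontier D"
proof -
  have "walk D U x \<eta> n = walk D U0 x \<eta> n \<and> walk D U0 x \<eta> n \<in> frontier D"
    using x by (induction n) (auto simp: U0_def next_hit_frontier)
  then show "walk D U x \<eta> n = walk D U0 x \<eta> n" "walk D U0 x \<eta> n \<in> frontier D" by auto
qed

lemma boundary_path_U0:
  assumes x: "x \<in> frontier D" shows "boundary_path D U x \<eta> t = boundary_path D U0 x \<eta> t"
proof -
  have 1: "out_velocity D U x \<eta> n = out_velocity D U0 x \<eta> n" for n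
    using walk_U0[OF x, of \<eta> n] by (simp add: out_velocity_def U0_def)
  have 2: "hit_time D U x \<eta> n = hit_time D U0 x \<eta> n" for n
    by (simp add: hit_time_def 1 walk_U0(1)[OF x])
  show ?thesis unfolding boundary_path_def 1 2 walk_U0(1)[OF x] ..
qed

lemma interior_path_eq:
  "interior_path D V w \<eta> t = (if t < flight_time D (fst w) (snd w) then (fst w + t *\<^sub>R snd w, snd w)
     else boundary_path D V (next_hit D (fst w) (snd w)) \<eta> (t - flight_time D (fst w) (snd w)))"
  by (simp add: interior_path_def split_beta')

lemma interior_path_U0:
  assumes "fst w \<in> D" "norm (snd w) = 1"
  shows "interior_path D U w \<eta> t = interior_path D U0 w \<eta> t"
  using flight_props(2)[OF open_D bounded assms(2) starts_inside_open[OF open_D bounded assms]]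
  by (simp add: interior_path_eq boundary_path_U0)

lemma measurable_walk [measurable (raw)]:
  assumes [measurable]: "f \<in> borel_measurable M" "\<And>n. (\<lambda>z. H z n) \<in> borel_measurable M"
  shows "(\<lambda>z. walk D U0 (f z) (H z) n) \<in> borel_measurable M"
proof (induction n)
  case (Suc n)
  note [measurable] = this
  show ?case unfolding walk.simps by measurable
qed simp

lemma measurable_out_velocity [measurable (raw)]:
  assumes [measurable]: "f \<in> borel_measurable M" "\<And>n. (\<lambda>z. H z n) \<in> borel_measurable M"
  shows "(\<lambda>z. out_velocity D U0 (f z) (H z) n) \<in> borel_measurable M"
  unfolding out_velocity_def by measurable

lemma measurable_leg [measurable (raw)]:
  assumes [measurable]: "f \<in> borel_measurable M" "\<And>n. (\<lambda>z. H z n) \<in> borel_measurable M"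
  shows "(\<lambda>z. leg D U0 (f z) (H z) n) \<in> borel_measurable M"
  unfolding leg_def by measurable

lemma measurable_hit_time [measurable (raw)]:
  assumes [measurable]: "f \<in> borel_measurable M" "\<And>n. (\<lambda>z. H z n) \<in> borel_measurable M"
  shows "(\<lambda>z. hit_time D U0 (f z) (H z) n) \<in> borel_measurable M"
  unfolding hit_time_leg by measurable

lemma measurable_boundary_path [measurable (raw)]:
  assumes [measurable]: "f \<in> borel_measurable M" "\<And>n. (\<lambda>z. H z n) \<in> borel_measurable M" "t \<in> borel_measurable M"
  shows "(\<lambda>z. boundary_path D U0 (f z) (H z) (t z)) \<in> borel_measurable M"
proof -
  have L: "(\<lambda>z. LEAST n. t z < hit_time D U0 (f z) (H z) (Suc n)) \<in> measurable M (count_space UNIV)"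
    by (rule measurable_Least) measurable
  have "(\<lambda>z. (walk D U0 (f z) (H z) n + (t z - hit_time D U0 (f z) (H z) n) *\<^sub>R out_velocity D U0 (f z) (H z) n,
       out_velocity D U0 (f z) (H z) n)) \<in> borel_measurable M" for n
    by (rule borel_measurable_Pair) measurable
  from measurable_compose_countable[OF this L] show ?thesis
    by (simp add: boundary_path_def Let_def)
qed

lemma measurable_interior_path [measurable (raw)]:
  assumes [measurable]: "f \<in> borel_measurable M" "g \<in> borel_measurable M" "\<And>n. (\<lambda>z. H z n) \<in> borel_measurable M" "t \<in> borel_measurable M"
  shows "(\<lambda>z. interior_path D U0 (f z, g z) (H z) (t z)) \<in> borel_measurable M"
  unfolding interior_path_eq fst_conv snd_conv
  by (intro measurable_If borel_measurable_Pair) measurable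

section \<open>The driving noise\<close>

abbreviation "NS \<equiv> noise \<gamma>"

lemma prob_NS: "prob_space NS"
  unfolding noise_def by (rule prob_space_PiM) (rule prob_\<rho>)

lemma measurable_NS_component [measurable]: "(\<lambda>\<eta>. \<eta> n) \<in> borel_measurable NS"
proof -
  have "(\<lambda>\<eta>. \<eta> n) \<in> measurable NS \<rho>" unfolding noise_def by (rule measurable_component_singleton) simp
  moreover have "(\<lambda>x. x) \<in> borel_measurable \<rho>" by (rule measurable_\<rho>) simp
  ultimately show ?thesis by (rule measurable_compose)
qed

lemma measurable_case_nat_NS: "(\<lambda>(u, \<eta>). case_nat u \<eta>) \<in> measurable (\<rho> \<Otimes>\<^sub>M NS) NS"
  unfolding noise_def by measurable

text \<open>The first reflection is independent of the remaining ones, which are distributed like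
  the whole sequence.\<close>

lemma noise_iter:
  assumes G: "G \<in> borel_measurable NS"
  shows "(\<integral>\<^sup>+\<eta>. G \<eta> \<partial>NS) = (\<integral>\<^sup>+u. (\<integral>\<^sup>+\<eta>. G (case_nat u \<eta>) \<partial>NS) \<partial>\<rho>)"
proof -
  interpret N: sequence_space \<rho>
    unfolding sequence_space_def by (rule product_prob_spaceI) (rule prob_\<rho>)
  interpret S: prob_space NS by (rule prob_NS)
  have "(\<integral>\<^sup>+\<eta>. G \<eta> \<partial>NS) = (\<integral>\<^sup>+\<eta>. G \<eta> \<partial>distr (\<rho> \<Otimes>\<^sub>M NS) NS (\<lambda>(u, \<eta>). case_nat u \<eta>))"
    using N.PiM_iter by (simp add: noise_def)
  also have "\<dots> = (\<integral>\<^sup>+z. G ((\<lambda>(u, \<eta>). case_nat u \<eta>) z) \<partial>(\<rho> \<Otimes>\<^sub>M NS))"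
    by (rule nn_integral_distr[OF measurable_case_nat_NS]) (use G in simp)
  also have "\<dots> = (\<integral>\<^sup>+u. (\<integral>\<^sup>+\<eta>. G (case_nat u \<eta>) \<partial>NS) \<partial>\<rho>)"
    using measurable_compose[OF measurable_case_nat_NS G]
    by (subst S.nn_integral_fst[symmetric]) (auto simp: split_beta')
  finally show ?thesis .
qed

lemma noise_first:
  assumes "f \<in> borel_measurable borel"
  shows "(\<integral>\<^sup>+\<eta>. f (\<eta> 0) \<partial>NS) = (\<integral>\<^sup>+u. f u \<partial>\<rho>)"
proof -
  interpret S: prob_space NS by (rule prob_NS)
  have "(\<lambda>\<eta>. f (\<eta> 0)) \<in> borel_measurable NS" using assms by measurable
  then show ?thesis by (subst noise_iter) (auto simp: S.emeasure_space_1)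
qed

lemma measurable_shift_NS: "(\<lambda>\<eta> n. \<eta> (Suc n)) \<in> measurable NS NS"
  unfolding noise_def by (rule measurable_PiM_single') (auto simp: space_PiM PiE_iff)

end

section \<open>The stationary suspension\<close>

locale stationary_walk = reflecting D Rt \<gamma> U
  for D Rt :: "'n::{finite,linorder} point set" and \<gamma> :: "'n point \<Rightarrow> real" and U :: "'n point \<Rightarrow> 'n matrix" +
  fixes \<mu> :: "'n point measure"
  assumes inv: "walk_invariant D Rt \<gamma> U \<mu>"
begin

lemma start: "boundary_start D Rt \<gamma> U \<mu>"
  using inv by (simp add: walk_invariant_def)

lemma prob_\<mu>: "prob_space \<mu>" and sets_\<mu>: "sets \<mu> = sets (boundary_space D)"
  and AE_regular: "AE x in \<mu>. x \<in> regular_points D Rt \<gamma> U"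
  using start by (auto simp: boundary_start_def)

lemma space_\<mu>: "space \<mu> = frontier D"
  using sets_eq_imp_space_eq[OF sets_\<mu>] by (simp add: boundary_space_def space_restrict_space)

lemma measurable_\<mu>: "f \<in> measurable borel N \<Longrightarrow> f \<in> measurable \<mu> N"
  unfolding measurable_cong_sets[OF sets_\<mu> refl] boundary_space_def by (rule measurable_restrict_space1)

abbreviation "PP \<equiv> \<mu> \<Otimes>\<^sub>M NS"

lemma prob_PP: "prob_space PP"
proof -
  interpret \<mu>: prob_space \<mu> by (rule prob_\<mu>)
  interpret N: prob_space NS by (rule prob_NS)
  interpret pair_prob_space \<mu> NS ..
  show ?thesis by unfold_locales
qed

lemma space_PP: "z \<in> space PP \<Longrightarrow> fst z \<in> frontier D" "z \<in> space PP \<Longrightarrow> snd z n \<in> half_sphere e_vec"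
  by (auto simp: space_pair_measure space_\<mu> noise_def space_PiM space_\<rho>)

lemma measurable_fst_PP [measurable]: "fst \<in> borel_measurable PP"
  using measurable_compose[OF measurable_fst measurable_\<mu>[OF measurable_ident]] by simp

lemma measurable_snd_PP [measurable]: "(\<lambda>z. snd z n) \<in> borel_measurable PP"
  by (rule measurable_compose[OF measurable_snd measurable_NS_component])

definition "out z = U0 (fst z) *v snd z 0"
definition "r z = flight_time D (fst z) (out z)"
text \<open>Base map of the suspension flow, whose roof function is \<open>r\<close>: one reflection
  is consumed and the walk restarts.\<close>

definition "\<theta> z = (next_hit D (fst z) (out z), \<lambda>n::nat. snd z (Suc n))"
definition "legs z i = leg D U0 (fst z) (snd z) i"
definition "traj z t = boundary_path D U0 (fst z) (snd z) t"

lemma out_borel [measurable]: "out \<in> borel_measurable PP"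
  unfolding out_def[abs_def] by measurable

lemma r_borel [measurable]: "r \<in> borel_measurable PP"
  unfolding r_def[abs_def] by measurable

lemma legs_borel [measurable]: "(\<lambda>z. legs z i) \<in> borel_measurable PP"
  unfolding legs_def by measurable

lemma legs_0: "legs z 0 = r z"
  by (simp add: legs_def r_def leg_def out_def out_velocity_def)

lemma legs_\<theta>: "legs (\<theta> z) i = legs z (Suc i)"
  by (simp add: legs_def \<theta>_def out_def leg_shift)

lemma r_nonneg: "r z \<ge> 0"
  by (simp add: r_def flight_time_nonneg)

lemma walk_1: "z \<in> space PP \<Longrightarrow> walk D U (fst z) (snd z) 1 = next_hit D (fst z) (out z)"
proof -
  assume z: "z \<in> space PP"
  have "walk D U (fst z) (snd z) 1 = walk D U0 (fst z) (snd z) 1" by (rule walk_U0(1)[OF space_PP(1)[OF z]])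
  then show ?thesis by (simp add: out_def)
qed

lemma measurable_walk_1 [measurable]: "(\<lambda>z. next_hit D (fst z) (out z)) \<in> measurable PP \<mu>"
  unfolding measurable_cong_sets[OF refl sets_\<mu>] boundary_space_def
  by (rule measurable_restrict_space2) (auto intro: next_hit_frontier space_PP)

lemma distr_walk_1: "distr PP \<mu> (\<lambda>z. next_hit D (fst z) (out z)) = \<mu>"
proof -
  have "distr PP \<mu> (\<lambda>z. next_hit D (fst z) (out z)) = distr PP (boundary_space D) (\<lambda>(x, \<eta>). walk D U x \<eta> 1)"
    by (rule distr_cong) (auto simp: sets_\<mu> walk_1[symmetric] simp del: walk.simps split_beta' simp: split_beta')
  also have "\<dots> = \<mu>" using inv by (simp add: walk_invariant_def)
  finally show ?thesis .
qed

lemma nn_integral_walk_1: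
  assumes "f \<in> borel_measurable \<mu>"
  shows "(\<integral>\<^sup>+z. f (next_hit D (fst z) (out z)) \<partial>PP) = (\<integral>\<^sup>+x. f x \<partial>\<mu>)"
proof -
  have "(\<integral>\<^sup>+x. f x \<partial>\<mu>) = (\<integral>\<^sup>+x. f x \<partial>distr PP \<mu> (\<lambda>z. next_hit D (fst z) (out z)))" by (simp add: distr_walk_1)
  also have "\<dots> = (\<integral>\<^sup>+z. f (next_hit D (fst z) (out z)) \<partial>PP)"
    by (rule nn_integral_distr[OF measurable_walk_1]) (use assms in simp)
  finally show ?thesis by simp
qed

lemma measurable_\<theta> [measurable]: "\<theta> \<in> measurable PP PP"
  unfolding \<theta>_def[abs_def]
  by (rule measurable_Pair[OF measurable_walk_1 measurable_compose[OF measurable_snd measurable_shift_NS]])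

lemma nn_integral_PP_iter:
  assumes F: "F \<in> borel_measurable PP"
  shows "(\<integral>\<^sup>+z. F z \<partial>PP) = (\<integral>\<^sup>+x. (\<integral>\<^sup>+u. (\<integral>\<^sup>+\<eta>. F (x, case_nat u \<eta>) \<partial>NS) \<partial>\<rho>) \<partial>\<mu>)"
proof -
  interpret N: prob_space NS by (rule prob_NS)
  have "(\<integral>\<^sup>+z. F z \<partial>PP) = (\<integral>\<^sup>+x. (\<integral>\<^sup>+\<eta>. F (x, \<eta>) \<partial>NS) \<partial>\<mu>)"
    by (rule N.nn_integral_fst[OF F, symmetric])
  also have "\<dots> = (\<integral>\<^sup>+x. (\<integral>\<^sup>+u. (\<integral>\<^sup>+\<eta>. F (x, case_nat u \<eta>) \<partial>NS) \<partial>\<rho>) \<partial>\<mu>)"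
    by (intro nn_integral_cong noise_iter measurable_compose[OF measurable_Pair1' F])
  finally show ?thesis .
qed

text \<open>Integrating over the remaining reflections, which are independent of the first, leaves a
  function of the next position; that position has law \<mu> by stationarity of the walk.\<close>

lemma nn_integral_\<theta>:
  assumes F: "F \<in> borel_measurable PP"
  shows "(\<integral>\<^sup>+z. F (\<theta> z) \<partial>PP) = (\<integral>\<^sup>+z. F z \<partial>PP)"
proof -
  interpret N: prob_space NS by (rule prob_NS)
  define \<Phi> where "\<Phi> y = (\<integral>\<^sup>+\<eta>. F (y, \<eta>) \<partial>NS)" for y
  have \<Phi>: "\<Phi> \<in> borel_measurable \<mu>" unfolding \<Phi>_def by (rule N.borel_measurable_nn_integral_fst[OF F])
  have "(\<integral>\<^sup>+z. F (\<theta> z) \<partial>PP) = (\<integral>\<^sup>+x. (\<integral>\<^sup>+u. (\<integral>\<^sup>+\<eta>. F (\<theta> (x, case_nat u \<eta>)) \<partial>NS) \<partial>\<rho>) \<partial>\<mu>)"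
    by (rule nn_integral_PP_iter) (rule measurable_compose[OF measurable_\<theta> F])
  also have "\<dots> = (\<integral>\<^sup>+x. (\<integral>\<^sup>+u. (\<integral>\<^sup>+\<eta>. \<Phi> (next_hit D (fst (x, case_nat u \<eta>)) (out (x, case_nat u \<eta>))) \<partial>NS) \<partial>\<rho>) \<partial>\<mu>)"
    by (simp add: \<theta>_def out_def \<Phi>_def N.emeasure_space_1)
  also have "\<dots> = (\<integral>\<^sup>+z. \<Phi> (next_hit D (fst z) (out z)) \<partial>PP)"
    by (rule nn_integral_PP_iter[symmetric]) (rule measurable_compose[OF measurable_walk_1 \<Phi>])
  also have "\<dots> = (\<integral>\<^sup>+x. \<Phi> x \<partial>\<mu>)" by (rule nn_integral_walk_1[OF \<Phi>])
  also have "\<dots> = (\<integral>\<^sup>+z. F z \<partial>PP)" unfolding \<Phi>_def by (rule N.nn_integral_fst[OF F])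
  finally show ?thesis .
qed

lemma AE_PP_Rt: "AE z in PP. fst z \<in> Rt"
proof -
  interpret \<mu>: prob_space \<mu> by (rule prob_\<mu>)
  interpret N: prob_space NS by (rule prob_NS)
  interpret PM: pair_sigma_finite \<mu> NS ..
  have 1: "AE x in \<mu>. x \<in> Rt" using AE_regular by eventually_elim (auto simp: regular_points_def split: if_splits)
  have "{z \<in> space PP. fst z \<in> Rt} \<in> sets PP" by measurable
  moreover have "AE x in \<mu>. AE \<eta> in NS. fst (x, \<eta>) \<in> Rt" using 1 by eventually_elim simp
  ultimately show ?thesis by (intro PM.AE_pair_measure)
qed

lemma starts_inside_PP:
  assumes "z \<in> space PP" "fst z \<in> Rt"
  shows "norm (out z) = 1" "starts_inside D (fst z) (out z)"
proof -
  have h: "snd z 0 \<in> half_sphere e_vec" by (rule space_PP(2)[OF assms(1)])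
  then show "norm (out z) = 1" by (simp add: out_def norm_U0 half_sphere_def)
  have "out z \<bullet> nf (fst z) = (transpose (U0 (fst z)) *v out z) \<bullet> e_vec"
    using transpose_inner[of "fst z" "out z"] U0_normal[OF assms(2)] by simp
  also have "\<dots> > 0" using h by (simp add: out_def U0_transpose half_sphere_def inner_commute)
  finally have "fst z \<in> entrance D Rt (out z)" by (simp add: entrance_def)
  then show "starts_inside D (fst z) (out z)" by (rule entrance_starts_inside)
qed

lemma AE_flight: "AE z in PP. norm (out z) = 1 \<and> starts_inside D (fst z) (out z) \<and> r z > 0"
  using AE_PP_Rt AE_space
proof eventually_elim
  case (elim z)
  note s = starts_inside_PP[OF elim(2,1)]
  show ?case using s flight_props(1)[OF open_D bounded s] by (simp add: r_def)
qed

text \<open>By stationarity the expected leg length on the event of explosion is the limit of the expected lengths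
  of the later legs, which is zero.\<close>

lemma AE_nonexplosive: "AE z in PP. nonexplosive D U0 (fst z) (snd z)"
proof -
  interpret PP: prob_space PP by (rule prob_PP)
  define S where "S z = (\<Sum>i. ennreal (legs z i))" for z
  have [measurable]: "S \<in> borel_measurable PP" unfolding S_def by measurable
  \<comment> \<open>The truncation at 1 provides domination. Finiteness of \<open>S\<close> is
    unaffected by \<theta>, so all \<open>f i\<close> have the same integral.\<close>
  define f where "f i z = (if S z < \<infinity> then ennreal (min 1 (legs z i)) else 0)" for i z
  have [measurable]: "f i \<in> borel_measurable PP" for i unfolding f_def by measurable
  have S\<theta>: "S z = ennreal (legs z 0) + S (\<theta> z)" for z
    using suminf_offset[of "\<lambda>i. ennreal (legs z i)" 1] unfolding S_def legs_\<theta> by (simp add: add.commute)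
  have f\<theta>: "f i (\<theta> z) = f (Suc i) z" for i z
    using S\<theta>[of z] by (auto simp: f_def legs_\<theta> less_top[symmetric])
  have int: "(\<integral>\<^sup>+z. f i z \<partial>PP) = (\<integral>\<^sup>+z. f 0 z \<partial>PP)" for i
  proof (induction i)
    case (Suc i)
    have "(\<integral>\<^sup>+z. f (Suc i) z \<partial>PP) = (\<integral>\<^sup>+z. f i (\<theta> z) \<partial>PP)" by (simp add: f\<theta>)
    also have "\<dots> = (\<integral>\<^sup>+z. f i z \<partial>PP)" by (rule nn_integral_\<theta>) measurable
    finally show ?case using Suc by simp
  qed simp
  have lim: "(\<lambda>i. f i z) \<longlonglongrightarrow> 0" for z
  proof (cases "S z < \<infinity>")
    case True
    have "summable (legs z)"
      using True by (intro summable_suminf_not_top) (auto simp: S_def legs_def leg_nonneg less_top)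
    then have "legs z \<longlonglongrightarrow> 0" by (rule summable_LIMSEQ_zero)
    then have "(\<lambda>i. ennreal (min 1 (legs z i))) \<longlonglongrightarrow> ennreal (min 1 0)" by (intro tendsto_intros)
    then show ?thesis using True by (simp add: f_def)
  qed (simp add: f_def)
  have "(\<lambda>i. \<integral>\<^sup>+z. f i z \<partial>PP) \<longlonglongrightarrow> (\<integral>\<^sup>+z. 0 \<partial>PP)"
  proof (rule nn_integral_dominated_convergence[where w = "\<lambda>_. 1"])
    show "AE z in PP. f j z \<le> 1" for j by (auto simp: f_def min_def ennreal_le_1 simp flip: ennreal_1)
    show "(\<integral>\<^sup>+z. 1 \<partial>PP) < \<infinity>" by (simp add: PP.emeasure_space_1)
    show "AE z in PP. (\<lambda>i. f i z) \<longlonglongrightarrow> 0" using lim by simp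
  qed measurable
  moreover have "(\<lambda>i. \<integral>\<^sup>+z. f i z \<partial>PP) = (\<lambda>i. \<integral>\<^sup>+z. f 0 z \<partial>PP)" by (rule ext) (rule int)
  ultimately have "(\<lambda>i::nat. \<integral>\<^sup>+z. f 0 z \<partial>PP) \<longlonglongrightarrow> (\<integral>\<^sup>+z. 0 \<partial>PP)" by simp
  from LIMSEQ_unique[OF this tendsto_const] have "(\<integral>\<^sup>+z. f 0 z \<partial>PP) = 0" by simp
  moreover have "f 0 \<in> borel_measurable PP" by measurable
  ultimately have "AE z in PP. f 0 z = 0" using nn_integral_0_iff_AE by blast
  with AE_flight show ?thesis
  proof eventually_elim
    case (elim z)
    then have "legs z 0 > 0" by (simp add: legs_0)
    then have Sinf: "\<not> S z < \<infinity>" using elim(2) by (auto simp: f_def min_def split: if_splits)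
    show ?case unfolding nonexplosive_def
    proof (rule allI, rule ccontr)
      fix t assume "\<nexists>n. t < hit_time D U0 (fst z) (snd z) (Suc n)"
      then have le: "(\<Sum>i<Suc n. legs z i) \<le> t" for n
        by (auto simp: hit_time_leg legs_def not_less simp del: sum.lessThan_Suc)
      have "(\<Sum>i<n. ennreal (legs z i)) \<le> ennreal t" for n
      proof -
        have "(\<Sum>i<n. ennreal (legs z i)) = ennreal (\<Sum>i<n. legs z i)"
          by (rule sum_ennreal) (simp add: legs_def leg_nonneg)
        also have "\<dots> \<le> ennreal (\<Sum>i<Suc n. legs z i)"
          by (intro ennreal_leI) (simp add: legs_def leg_nonneg)
        also have "\<dots> \<le> ennreal t" by (intro ennreal_leI le)
        finally show ?thesis .
      qed
      then have "S z \<le> ennreal t" unfolding S_def suminf_eq_SUP by (intro SUP_least)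
      then have "S z < \<infinity>" by (rule order.strict_trans1) simp
      then show False using Sinf by simp
    qed
  qed
qed

lemma traj_first: "t < r z \<Longrightarrow> traj z t = (fst z + t *\<^sub>R out z, out z)"
  using boundary_path_first[of t D U0 "fst z" "snd z"] legs_0[of z] by (simp add: traj_def out_def legs_def)

lemma traj_\<theta>: "nonexplosive D U0 (fst z) (snd z) \<Longrightarrow> t \<ge> r z \<Longrightarrow> traj z t = traj (\<theta> z) (t - r z)"
  using boundary_path_shift[of D U0 "fst z" "snd z" t] legs_0[of z] by (simp add: traj_def out_def legs_def \<theta>_def)

lemma measurable_traj [measurable (raw)]:
  assumes "f \<in> measurable M PP" "t \<in> borel_measurable M"
  shows "(\<lambda>z. traj (f z) (t z)) \<in> borel_measurable M"
  unfolding traj_def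
  by (rule measurable_boundary_path[OF measurable_compose[OF assms(1) measurable_fst_PP] measurable_compose[OF assms(1) measurable_snd_PP] assms(2)])

definition "occupation A a b z = (\<integral>\<^sup>+s. indicator A (traj z s) * indicator {a<..<b} s \<partial>lborel)" for A :: "('n point \<times> 'n point) set"

lemma measurable_occupation [measurable (raw)]:
  assumes A[measurable]: "A \<in> sets borel" and [measurable]: "a \<in> borel_measurable PP" "b \<in> borel_measurable PP"
  shows "(\<lambda>z. occupation A (a z) (b z) z) \<in> borel_measurable PP"
proof -
  have "(\<lambda>w. indicator A (traj (fst w) (snd w)) * indicator {w. a (fst w) < snd w \<and> snd w < b (fst w)} w :: ennreal) \<in> borel_measurable (PP \<Otimes>\<^sub>M lborel)"
    by measurable
  from lborel.borel_measurable_nn_integral_fst[OF this] show ?thesis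
    unfolding occupation_def by (simp add: indicator_def)
qed

lemma occupation_split:
  assumes [measurable]: "A \<in> sets borel" and z: "z \<in> space PP" and ab: "a \<le> b" "b \<le> c"
  shows "occupation A a c z = occupation A a b z + occupation A b c z"
proof -
  have [measurable]: "(\<lambda>s. traj z s) \<in> borel_measurable borel"
    unfolding traj_def by (rule measurable_boundary_path) auto
  have "occupation A a c z = (\<integral>\<^sup>+s. indicator A (traj z s) * indicator {a<..<b} s + indicator A (traj z s) * indicator {b<..<c} s \<partial>lborel)"
    unfolding occupation_def
  proof (rule nn_integral_cong_AE)
    have "AE s in lborel. s \<noteq> b" by (rule AE_lborel_singleton)
    then show "AE s in lborel. indicator A (traj z s) * indicator {a<..<c} s = indicator A (traj z s) * indicator {a<..<b} s + (indicator A (traj z s) * indicator {b<..<c} s :: ennreal)"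
      by eventually_elim (use ab in \<open>auto simp: indicator_def\<close>)
  qed
  also have "\<dots> = occupation A a b z + occupation A b c z"
    unfolding occupation_def by (rule nn_integral_add) measurable
  finally show ?thesis .
qed

lemma occupation_shift:
  assumes [measurable]: "A \<in> sets borel"
  shows "(\<integral>\<^sup>+s. indicator A (traj z (s + t)) * indicator {a<..<b} s \<partial>lborel) = occupation A (a + t) (b + t) z"
proof -
  have [measurable]: "(\<lambda>s. traj z s) \<in> borel_measurable borel"
    unfolding traj_def by (rule measurable_boundary_path) auto
  have "occupation A (a + t) (b + t) z = (\<integral>\<^sup>+s. indicator A (traj z s) * indicator {a + t<..<b + t} s \<partial>distr lborel borel ((+) t))"
    unfolding occupation_def by (simp add: lborel_distr_plus)
  also have "\<dots> = (\<integral>\<^sup>+s. indicator A (traj z (t + s)) * indicator {a + t<..<b + t} (t + s) \<partial>lborel)"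
    by (rule nn_integral_distr) measurable
  also have "\<dots> = (\<integral>\<^sup>+s. indicator A (traj z (s + t)) * indicator {a<..<b} s \<partial>lborel)"
    by (intro nn_integral_cong) (auto simp: indicator_def add.commute)
  finally show ?thesis by simp
qed

text \<open>The time intervals \<open>(0, t)\<close> and \<open>(r, r + t)\<close> contribute the same expected occupation time.\<close>

lemma occupation_stationary:
  assumes A[measurable]: "A \<in> sets borel" and t: "t \<ge> 0"
  shows "(\<integral>\<^sup>+z. occupation A t (r z + t) z \<partial>PP) = (\<integral>\<^sup>+z. occupation A 0 (r z) z \<partial>PP)"
proof -
  interpret PP: prob_space PP by (rule prob_PP)
  define K where "K = (\<integral>\<^sup>+z. occupation A 0 t z \<partial>PP)"
  \<comment> \<open>\<open>K\<close> will be cancelled from both decompositions of the interval, for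
    which it has to be finite.\<close>
  have "K \<le> (\<integral>\<^sup>+z. ennreal t \<partial>PP)"
  proof (unfold K_def, rule nn_integral_mono)
    fix z
    have "occupation A 0 t z \<le> (\<integral>\<^sup>+s. indicator {0<..<t} s \<partial>lborel)"
      unfolding occupation_def by (intro nn_integral_mono) (auto simp: indicator_def)
    then show "occupation A 0 t z \<le> ennreal t" using t by simp
  qed
  also have "\<dots> < \<infinity>" by (simp add: PP.emeasure_space_1)
  finally have K: "K \<noteq> \<infinity>" by simp
  have 1: "(\<integral>\<^sup>+z. occupation A 0 (r z + t) z \<partial>PP) = K + (\<integral>\<^sup>+z. occupation A t (r z + t) z \<partial>PP)"
  proof -
    have "(\<integral>\<^sup>+z. occupation A 0 (r z + t) z \<partial>PP) = (\<integral>\<^sup>+z. occupation A 0 t z + occupation A t (r z + t) z \<partial>PP)"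
      using t r_nonneg by (intro nn_integral_cong occupation_split) auto
    then show ?thesis unfolding K_def by (subst (asm) nn_integral_add) auto
  qed
  have 2: "(\<integral>\<^sup>+z. occupation A 0 (r z + t) z \<partial>PP) = (\<integral>\<^sup>+z. occupation A 0 (r z) z \<partial>PP) + K"
  proof -
    have "(\<integral>\<^sup>+z. occupation A 0 (r z + t) z \<partial>PP) = (\<integral>\<^sup>+z. occupation A 0 (r z) z + occupation A (r z) (r z + t) z \<partial>PP)"
      using t r_nonneg by (intro nn_integral_cong occupation_split) auto
    also have "\<dots> = (\<integral>\<^sup>+z. occupation A 0 (r z) z \<partial>PP) + (\<integral>\<^sup>+z. occupation A (r z) (r z + t) z \<partial>PP)"
      by (rule nn_integral_add) measurable
    also have "(\<integral>\<^sup>+z. occupation A (r z) (r z + t) z \<partial>PP) = (\<integral>\<^sup>+z. occupation A 0 t (\<theta> z) \<partial>PP)"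
    proof (rule nn_integral_cong_AE)
      show "AE z in PP. occupation A (r z) (r z + t) z = occupation A 0 t (\<theta> z)"
        using AE_nonexplosive
      proof eventually_elim
        case (elim z)
        have "occupation A (r z) (r z + t) z = (\<integral>\<^sup>+s. indicator A (traj z (s + r z)) * indicator {0<..<t} s \<partial>lborel)"
          using occupation_shift[OF A, of z "r z" 0 t] by (simp add: add.commute)
        also have "\<dots> = occupation A 0 t (\<theta> z)"
          unfolding occupation_def using traj_\<theta>[OF elim] by (intro nn_integral_cong) (auto simp: indicator_def)
        finally show ?case .
      qed
    qed
    also have "\<dots> = K" unfolding K_def by (rule nn_integral_\<theta>) measurable
    finally show ?thesis .
  qed
  have "K + (\<integral>\<^sup>+z. occupation A t (r z + t) z \<partial>PP) = K + (\<integral>\<^sup>+z. occupation A 0 (r z) z \<partial>PP)"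
    using 1 2 by (simp add: add.commute)
  then show ?thesis using K by (simp add: ennreal_add_left_cancel)
qed

end

section \<open>The phase space as a product\<close>

lemma sets_eq_of_ident:
  assumes "(\<lambda>x. x) \<in> measurable M N" "(\<lambda>x. x) \<in> measurable N M" "space M = space N"
  shows "sets M = sets N"
proof
  show "sets M \<subseteq> sets N"
  proof
    fix X assume X: "X \<in> sets M"
    then have "X \<subseteq> space N" using sets.sets_into_space assms(3) by blast
    then show "X \<in> sets N" using measurable_sets[OF assms(2) X] by (simp add: Int_absorb2)
  qed
  show "sets N \<subseteq> sets M"
  proof
    fix X assume X: "X \<in> sets N"
    then have "X \<subseteq> space M" using sets.sets_into_space assms(3) by blast
    then show "X \<in> sets M" using measurable_sets[OF assms(1) X] by (simp add: Int_absorb2)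
  qed
qed

lemma measurable_pair_ident:
  assumes M: "(\<lambda>x. x) \<in> borel_measurable (M :: 'a::euclidean_space measure)"
    and N: "(\<lambda>x. x) \<in> borel_measurable (N :: 'b::euclidean_space measure)"
  shows "(\<lambda>z. z) \<in> borel_measurable (M \<Otimes>\<^sub>M N)"
proof -
  have "(\<lambda>z. (fst z, snd z)) \<in> borel_measurable (M \<Otimes>\<^sub>M N)"
    by (intro borel_measurable_Pair measurable_compose[OF measurable_fst M] measurable_compose[OF measurable_snd N])
  then show ?thesis by simp
qed

lemma volume_on_ident: "(\<lambda>x. x) \<in> borel_measurable (volume_on (D :: 'n::finite point set))"
  unfolding volume_on_def by (intro measurable_restrict_space1) simp

lemma sphere_measure_ident: "(\<lambda>x. x) \<in> borel_measurable (sphere_measure :: 'n::finite point measure)"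
  by (rule measurable_sphere_measure) simp

lemma space_volume_on [simp]: "space (volume_on D) = D"
  by (simp add: volume_on_def space_restrict_space)

text \<open>The law \<chi> is given on a restriction of the Borel sets and its density on a product
  of restrictions; the two sigma-algebras must be the same for an equality of measures.\<close>

lemma sets_volume_sphere: "sets (volume_on D \<Otimes>\<^sub>M sphere_measure) = sets (phase_space (D :: 'n::finite point set))"
proof (rule sets_eq_of_ident)
  show sp: "space (volume_on D \<Otimes>\<^sub>M sphere_measure) = space (phase_space D)"
    by (simp add: space_pair_measure phase_space_def space_restrict_space)
  show "(\<lambda>x. x) \<in> measurable (volume_on D \<Otimes>\<^sub>M sphere_measure) (phase_space D)"
    unfolding phase_space_def
    using measurable_pair_ident[OF volume_on_ident sphere_measure_ident, of D]
    by (intro measurable_restrict_space2) (auto simp: space_pair_measure)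
  have "(\<lambda>x. (fst x, snd x)) \<in> measurable (phase_space D) (volume_on D \<Otimes>\<^sub>M sphere_measure)"
  proof (rule measurable_Pair)
    have f: "fst \<in> borel_measurable (phase_space D)" "snd \<in> borel_measurable (phase_space D)"
      unfolding phase_space_def by (auto intro: measurable_restrict_space1)
    show "fst \<in> measurable (phase_space D) (volume_on D)"
      unfolding volume_on_def using f(1)
      by (intro measurable_restrict_space2) (auto simp: phase_space_def space_restrict_space measurable_def)
    show "snd \<in> measurable (phase_space D) sphere_measure"
      unfolding sphere_measure_def using f(2)
      by (intro measurable_restrict_space2) (auto simp: phase_space_def space_restrict_space measurable_def)
  qed
  then show "(\<lambda>x. x) \<in> measurable (phase_space D) (volume_on D \<Otimes>\<^sub>M sphere_measure)" by simp
qed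

context billiard
begin

lemma finite_volume: "finite_measure (volume_on D)"
proof
  have "emeasure (volume_on D) (space (volume_on D)) = emeasure lborel D"
    unfolding space_volume_on unfolding volume_on_def by (subst emeasure_restrict_space) auto
  then show "emeasure (volume_on D) (space (volume_on D)) \<noteq> \<infinity>"
    using emeasure_bounded_finite[OF bounded] by simp
qed

abbreviation "VS \<equiv> volume_on D \<Otimes>\<^sub>M (sphere_measure :: 'n point measure)"

lemma space_VS: "space VS = D \<times> sphere 0 1"
  by (simp add: space_pair_measure)

lemma measurable_VS: "f \<in> measurable borel N \<Longrightarrow> f \<in> measurable VS N"
proof -
  assume f: "f \<in> measurable borel N"
  from measurable_compose[OF measurable_pair_ident[OF volume_on_ident sphere_measure_ident, of D] f]
  show ?thesis by simp
qed

lemma nn_integral_VS: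
  assumes f: "f \<in> borel_measurable borel"
  shows "(\<integral>\<^sup>+w. f w \<partial>VS) = (\<integral>\<^sup>+v. (\<integral>\<^sup>+y. f (y, v) * indicator D y \<partial>lborel) \<partial>sphere_measure)"
proof -
  interpret V: finite_measure "volume_on D" by (rule finite_volume)
  interpret SS: finite_measure "sphere_measure :: 'n point measure" by (rule finite_sphere_measure)
  interpret P: pair_sigma_finite "volume_on D" "sphere_measure :: 'n point measure" ..
  have m: "f \<in> borel_measurable VS" by (rule measurable_VS[OF f])
  have "(\<integral>\<^sup>+w. f w \<partial>VS) = (\<integral>\<^sup>+y. (\<integral>\<^sup>+v. f (y, v) \<partial>sphere_measure) \<partial>volume_on D)"
    by (rule SS.nn_integral_fst[OF m, symmetric])
  also have "\<dots> = (\<integral>\<^sup>+v. (\<integral>\<^sup>+y. f (y, v) \<partial>volume_on D) \<partial>sphere_measure)"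
    by (rule P.Fubini'[symmetric]) (use m in simp)
  also have "\<dots> = (\<integral>\<^sup>+v. (\<integral>\<^sup>+y. f (y, v) * indicator D y \<partial>lborel) \<partial>sphere_measure)"
    unfolding volume_on_def by (subst nn_integral_restrict_space) auto
  finally show ?thesis .
qed

lemma AE_VS:
  assumes P: "{w. P w} \<in> sets borel" and ae: "AE v in sphere_measure. AE y in lborel. y \<in> D \<longrightarrow> P (y, v)"
  shows "AE w in VS. P w"
proof -
  interpret V: finite_measure "volume_on D" by (rule finite_volume)
  interpret SS: finite_measure "sphere_measure :: 'n point measure" by (rule finite_sphere_measure)
  interpret P: pair_sigma_finite "volume_on D" "sphere_measure :: 'n point measure" ..
  have m: "{w \<in> space VS. P w} \<in> sets VS"
    using measurable_sets[OF measurable_pair_ident[OF volume_on_ident sphere_measure_ident, of D] P]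
    by (simp add: Int_def vimage_def conj_commute)
  have "AE v in sphere_measure. AE y in volume_on D. P (y, v)"
    using ae unfolding volume_on_def by (subst AE_restrict_space_iff) auto
  then have "AE y in volume_on D. AE v in sphere_measure. P (y, v)"
    using P.AE_commute[of "\<lambda>y v. P (y, v)"] m by simp
  then show ?thesis by (intro P.AE_pair_measure m) simp
qed

end

context reflecting
begin

lemma AE_VS_entrance: "AE w in VS. next_hit D (fst w) (- snd w) \<in> entrance D Rt (snd w)"
proof (rule AE_VS)
  show "{w. next_hit D (fst w) (- snd w) \<in> entrance D Rt (snd w)} \<in> sets borel"
    unfolding entrance_def mem_Collect_eq by measurable
  show "AE v in sphere_measure. AE y in lborel. y \<in> D \<longrightarrow> next_hit D (fst (y, v)) (- snd (y, v)) \<in> entrance D Rt (snd (y, v))"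
    using AE_transversal AE_space by eventually_elim (use AE_enters in simp)
qed

end

section \<open>The density and the invariance of the suspension measure\<close>

locale stationary_density = stationary_walk D Rt \<gamma> U \<mu>
  for D Rt :: "'n::{finite,linorder} point set" and \<gamma> :: "'n point \<Rightarrow> real" and U :: "'n point \<Rightarrow> 'n matrix"
    and \<mu> :: "'n point measure" +
  fixes \<psi> :: "'n point \<Rightarrow> real"
  assumes psi: "boundary_density D \<mu> \<psi>"
begin

definition "\<psi>0 x = (if x \<in> frontier D then \<psi> x else 0)"

lemma measurable_\<psi>0 [measurable]: "\<psi>0 \<in> borel_measurable borel"
proof -
  have "\<psi> \<in> borel_measurable (restrict_space borel (frontier D))" using psi by (simp add: boundary_density_def boundary_space_def)
  then show ?thesis unfolding \<psi>0_def by (subst (asm) measurable_restrict_space_iff) auto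
qed

lemma \<psi>0_nonneg: "\<psi>0 x \<ge> 0"
  using psi by (simp add: \<psi>0_def boundary_density_def)

lemma \<mu>_density: "\<mu> = density SF (\<lambda>x. ennreal (\<psi>0 x))"
proof -
  have "\<mu> = density SF (\<lambda>x. ennreal (\<psi> x))" using psi by (simp add: boundary_density_def SF_def)
  also have "\<dots> = density SF (\<lambda>x. ennreal (\<psi>0 x))"
  proof (rule density_cong)
    have "\<psi> \<in> borel_measurable SF"
      using psi unfolding boundary_density_def boundary_space_def SF_def
      by (simp add: measurable_cong_sets[OF sets_restrict_space_cong[OF surface_measure_sets] refl])
    then show "(\<lambda>x. ennreal (\<psi> x)) \<in> borel_measurable SF" by measurable
    show "(\<lambda>x. ennreal (\<psi>0 x)) \<in> borel_measurable SF" by measurable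
    show "AE x in SF. ennreal (\<psi> x) = ennreal (\<psi>0 x)" using AE_space by eventually_elim (simp add: \<psi>0_def)
  qed
  finally show ?thesis .
qed

abbreviation "mj \<equiv> mean_jump D \<gamma> U \<mu>"

lemma mean_jump_r: "mj = (\<integral>z. r z \<partial>PP)"
  unfolding mean_jump_def
proof (rule Bochner_Integration.integral_cong)
  fix z assume z: "z \<in> space PP"
  have n: "norm (out z) = 1" using space_PP(2)[OF z, of 0] by (simp add: out_def norm_U0 half_sphere_def)
  have "walk D U (fst z) (snd z) 1 - walk D U (fst z) (snd z) 0 = r z *\<^sub>R out z"
    unfolding walk_1[OF z] by (simp add: next_hit_def r_def)
  then show "(case z of (x, \<eta>) \<Rightarrow> norm (walk D U x \<eta> 1 - walk D U x \<eta> 0)) = r z"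
    using n r_nonneg[of z] by (simp add: split_beta')
qed simp

lemma integrable_r: "integrable PP r"
proof -
  interpret PP: prob_space PP by (rule prob_PP)
  have "AE z in PP. norm (r z) \<le> diameter (frontier D)"
    using AE_flight AE_space
  proof eventually_elim
    case (elim z)
    have "r z = dist (fst z) (next_hit D (fst z) (out z))"
      using elim by (simp add: next_hit_def r_def dist_norm flight_time_nonneg)
    also have "\<dots> \<le> diameter (frontier D)"
      using space_PP(1)[OF elim(2)] compact_F
      by (intro diameter_bounded_bound compact_imp_bounded next_hit_frontier)
    finally show ?case using r_nonneg[of z] by simp
  qed
  then show ?thesis by (intro PP.integrable_const_bound[of _ "diameter (frontier D)"]) auto
qed

lemma nn_integral_r: "(\<integral>\<^sup>+z. ennreal (r z) \<partial>PP) = ennreal mj"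
  unfolding mean_jump_r by (rule nn_integral_eq_integral[OF integrable_r]) (simp add: r_nonneg)

lemma mj_pos: "mj > 0"
proof -
  interpret PP: prob_space PP by (rule prob_PP)
  have "mj \<ge> 0" unfolding mean_jump_r by (rule integral_nonneg_AE) (simp add: r_nonneg)
  moreover have "mj \<noteq> 0"
  proof
    assume "mj = 0"
    then have "(\<integral>\<^sup>+z. ennreal (r z) \<partial>PP) = 0" by (simp add: nn_integral_r)
    moreover have "(\<lambda>z. ennreal (r z)) \<in> borel_measurable PP" by measurable
    ultimately have "AE z in PP. ennreal (r z) = 0" using nn_integral_0_iff_AE by blast
    with AE_flight have "AE z in PP. False" by eventually_elim auto
    then show False by (simp add: PP.AE_False)
  qed
  ultimately show ?thesis by simp
qed

text \<open>A Borel form of the claimed density, with the extended \<open>\<psi>0\<close>,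
  \<open>\<gamma>0\<close> and \<open>U0\<close>, the transpose as the inverse, and the inner
  product as the cosine.\<close>

definition "phase_density w = (let z = next_hit D (fst w) (- snd w) in
   1 / mj * (\<psi>0 z * (\<gamma>0 (transpose (U0 z) *v snd w) / (snd w \<bullet> nf z))))"

definition "\<pi> = density VS (\<lambda>w. ennreal (phase_density w))"

lemma measurable_phase_density [measurable]: "phase_density \<in> borel_measurable borel"
  unfolding phase_density_def[abs_def] Let_def by measurable

lemma sets_\<pi>: "sets \<pi> = sets (phase_space D)"
  by (simp add: \<pi>_def sets_volume_sphere)

lemma space_\<pi>: "space \<pi> = D \<times> sphere 0 1"
  by (simp add: \<pi>_def space_VS)

lemma measurable_\<pi>: "f \<in> measurable borel N \<Longrightarrow> f \<in> measurable \<pi> N"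
proof -
  assume f: "f \<in> measurable borel N"
  have "sets \<pi> = sets VS" unfolding \<pi>_def by (rule sets_density)
  from measurable_cong_sets[OF this refl] measurable_VS[OF f] show ?thesis by blast
qed

text \<open>\<open>\<pi>\<close> is the law of a uniformly chosen point of a length-biased leg of the stationary walk.\<close>

lemma nn_integral_\<pi>:
  assumes f[measurable]: "f \<in> borel_measurable borel"
  shows "(\<integral>\<^sup>+w. f w \<partial>\<pi>) = ennreal (1 / mj) * (\<integral>\<^sup>+z. (\<integral>\<^sup>+s. f (fst z + s *\<^sub>R out z, out z) * indicator {0<..<r z} s \<partial>lborel) \<partial>PP)"
proof -
  interpret N: prob_space NS by (rule prob_NS)
  define h where "h w = f (fst w + snd (snd w) *\<^sub>R fst (snd w), fst (snd w))" for w :: "'n point \<times> 'n point \<times> real"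
  have h[measurable]: "h \<in> borel_measurable borel"
  proof -
    have "(\<lambda>w::'n point \<times> 'n point \<times> real. (fst w + snd (snd w) *\<^sub>R fst (snd w), fst (snd w))) \<in> borel_measurable borel"
      by (intro borel_measurable_Pair) measurable
    from measurable_compose[OF this f] show ?thesis by (simp add: h_def[abs_def])
  qed
  define G where "G x v = (\<integral>\<^sup>+s. h (x, v, s) * indicator {0<..<flight_time D x v} s \<partial>lborel)" for x v
  have G: "(\<lambda>z. G (fst z) (snd z)) \<in> borel_measurable borel"
  proof -
    have m: "(\<lambda>w :: ('n point \<times> 'n point) \<times> real. (fst (fst w), snd (fst w), snd w)) \<in> borel_measurable borel"
      by (intro borel_measurable_Pair) measurable
    have "(\<lambda>w. h (fst (fst w), snd (fst w), snd w) * indicator {w. 0 < snd w \<and> snd w < flight_time D (fst (fst w)) (snd (fst w))} w) \<in> borel_measurable borel"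
      using measurable_compose[OF m h] by measurable
    from lborel.borel_measurable_nn_integral_fst[OF measurable_borel_pair[OF this]] show ?thesis
      by (simp add: indicator_def G_def)
  qed
  have GM: "(\<lambda>x. G (f x) (g x)) \<in> borel_measurable M" if "f \<in> borel_measurable M" "g \<in> borel_measurable M" for f g and M :: "'z measure"
    using measurable_compose[OF borel_measurable_Pair[OF that] G] by simp
  have GP: "(\<lambda>z. G (fst z) (out z)) \<in> borel_measurable PP" by (intro GM) measurable
  have Gx: "(\<lambda>u. G x (U0 x *v u)) \<in> borel_measurable borel" for x by (intro GM) measurable
  have "(\<integral>\<^sup>+z. (\<integral>\<^sup>+s. f (fst z + s *\<^sub>R out z, out z) * indicator {0<..<r z} s \<partial>lborel) \<partial>PP) = (\<integral>\<^sup>+z. G (fst z) (out z) \<partial>PP)"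
    by (simp add: G_def h_def r_def)
  also have "\<dots> = (\<integral>\<^sup>+x. (\<integral>\<^sup>+\<eta>. G x (U0 x *v \<eta> 0) \<partial>NS) \<partial>\<mu>)"
    using N.nn_integral_fst[OF GP] by (simp add: out_def)
  also have "\<dots> = (\<integral>\<^sup>+x. (\<integral>\<^sup>+u. G x (U0 x *v u) \<partial>\<rho>) \<partial>\<mu>)"
    by (intro nn_integral_cong noise_first Gx)
  also have "\<dots> = (\<integral>\<^sup>+x. ennreal (\<psi>0 x) * (\<integral>\<^sup>+u. G x (U0 x *v u) \<partial>\<rho>) \<partial>SF)"
  proof -
    interpret R: prob_space \<rho> by (rule prob_\<rho>)
    have "(\<lambda>z. G (fst z) (U0 (fst z) *v snd z)) \<in> borel_measurable (SF \<Otimes>\<^sub>M \<rho>)"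
    proof -
      have [measurable]: "fst \<in> borel_measurable (SF \<Otimes>\<^sub>M \<rho>)"
        using measurable_compose[OF measurable_fst measurable_SF[OF measurable_ident]] by simp
      have [measurable]: "snd \<in> borel_measurable (SF \<Otimes>\<^sub>M \<rho>)"
        using measurable_compose[OF measurable_snd measurable_\<rho>[OF measurable_ident]] by simp
      show ?thesis by (intro GM) measurable
    qed
    from R.borel_measurable_nn_integral_fst[OF this]
    have "(\<lambda>x. \<integral>\<^sup>+u. G x (U0 x *v u) \<partial>\<rho>) \<in> borel_measurable SF" by simp
    then show ?thesis by (subst \<mu>_density, subst nn_integral_density) auto
  qed
  also have "\<dots> = (\<integral>\<^sup>+v. (\<integral>\<^sup>+y. ennreal (\<psi>0 (next_hit D y (- v)) * (\<gamma>0 (transpose (U0 (next_hit D y (- v))) *v v) / (v \<bullet> nf (next_hit D y (- v)))))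
          * h (next_hit D y (- v), v, flight_time D y (- v)) * indicator D y \<partial>lborel) \<partial>sphere_measure)"
    unfolding G_def by (rule flight_formula) (auto simp: \<psi>0_nonneg)
  finally have main: "(\<integral>\<^sup>+z. (\<integral>\<^sup>+s. f (fst z + s *\<^sub>R out z, out z) * indicator {0<..<r z} s \<partial>lborel) \<partial>PP) =
    (\<integral>\<^sup>+v. (\<integral>\<^sup>+y. ennreal (\<psi>0 (next_hit D y (- v)) * (\<gamma>0 (transpose (U0 (next_hit D y (- v))) *v v) / (v \<bullet> nf (next_hit D y (- v)))))
          * h (next_hit D y (- v), v, flight_time D y (- v)) * indicator D y \<partial>lborel) \<partial>sphere_measure)" .
  define q where "q w = (let z = next_hit D (fst w) (- snd w) in \<psi>0 z * (\<gamma>0 (transpose (U0 z) *v snd w) / (snd w \<bullet> nf z)))" for w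
  have [measurable]: "q \<in> borel_measurable borel" unfolding q_def[abs_def] Let_def by measurable
  have "(\<integral>\<^sup>+w. f w \<partial>\<pi>) = (\<integral>\<^sup>+w. ennreal (phase_density w) * f w \<partial>VS)"
    unfolding \<pi>_def by (rule nn_integral_density) (auto intro!: measurable_VS)
  also have "\<dots> = (\<integral>\<^sup>+w. ennreal (1 / mj) * (ennreal (q w) * f w) \<partial>VS)"
  proof -
    have mj0: "0 \<le> 1 / mj" using mj_pos by simp
    show ?thesis unfolding phase_density_def q_def Let_def
      by (simp only: ennreal_mult'[OF mj0] mult.assoc)
  qed
  also have "\<dots> = ennreal (1 / mj) * (\<integral>\<^sup>+w. ennreal (q w) * f w \<partial>VS)"
    by (rule nn_integral_cmult) (rule measurable_VS, measurable)
  also have "(\<integral>\<^sup>+w. ennreal (q w) * f w \<partial>VS) = (\<integral>\<^sup>+v. (\<integral>\<^sup>+y. ennreal (q (y, v)) * f (y, v) * indicator D y \<partial>lborel) \<partial>sphere_measure)"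
    by (rule nn_integral_VS) measurable
  also have "\<dots> = (\<integral>\<^sup>+v. (\<integral>\<^sup>+y. ennreal (\<psi>0 (next_hit D y (- v)) * (\<gamma>0 (transpose (U0 (next_hit D y (- v))) *v v) / (v \<bullet> nf (next_hit D y (- v)))))
          * h (next_hit D y (- v), v, flight_time D y (- v)) * indicator D y \<partial>lborel) \<partial>sphere_measure)"
  proof (intro nn_integral_cong)
    fix y v :: "'n point"
    show "ennreal (q (y, v)) * f (y, v) * indicator D y = ennreal (\<psi>0 (next_hit D y (- v)) * (\<gamma>0 (transpose (U0 (next_hit D y (- v))) *v v) / (v \<bullet> nf (next_hit D y (- v)))))
          * h (next_hit D y (- v), v, flight_time D y (- v)) * indicator D y"
      by (simp add: q_def Let_def h_def next_hit_def)
  qed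
  finally show ?thesis unfolding main .
qed

lemma prob_\<pi>: "prob_space \<pi>"
proof
  have "emeasure \<pi> (space \<pi>) = (\<integral>\<^sup>+w. 1 \<partial>\<pi>)" by simp
  also have "\<dots> = ennreal (1 / mj) * (\<integral>\<^sup>+z. (\<integral>\<^sup>+s. 1 * indicator {0<..<r z} s \<partial>lborel) \<partial>PP)"
    by (rule nn_integral_\<pi>) simp
  also have "\<dots> = ennreal (1 / mj) * ennreal mj" by (simp add: r_nonneg nn_integral_r)
  also have "\<dots> = 1" using mj_pos by (simp add: ennreal_mult[symmetric])
  finally show "emeasure \<pi> (space \<pi>) = 1" .
qed

text \<open>From any point of a flight the next hit is the end of that flight, and under
  \<open>PP\<close> the ends have law \<mu>, which charges regular points only.\<close>

lemma AE_\<pi>_regular: "AE w in \<pi>. next_hit D (fst w) (snd w) \<in> regular_points D Rt \<gamma> U"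
proof -
  obtain N where N: "{x \<in> space \<mu>. x \<notin> regular_points D Rt \<gamma> U} \<subseteq> N" "emeasure \<mu> N = 0" "N \<in> sets \<mu>"
    using AE_E[OF AE_regular] by blast
  have Nb[measurable]: "N \<in> sets borel"
    using N(3) unfolding sets_\<mu> boundary_space_def by (auto simp: sets_restrict_space_iff)
  define f where "f w = (indicator N (next_hit D (fst w) (snd w)) :: ennreal)" for w
  have fm[measurable]: "f \<in> borel_measurable borel" unfolding f_def by measurable
  have "(\<integral>\<^sup>+w. f w \<partial>\<pi>) = ennreal (1 / mj) * (\<integral>\<^sup>+z. (\<integral>\<^sup>+s. f (fst z + s *\<^sub>R out z, out z) * indicator {0<..<r z} s \<partial>lborel) \<partial>PP)"
    by (rule nn_integral_\<pi>) measurable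
  also have "(\<integral>\<^sup>+z. (\<integral>\<^sup>+s. f (fst z + s *\<^sub>R out z, out z) * indicator {0<..<r z} s \<partial>lborel) \<partial>PP) = (\<integral>\<^sup>+z. 0 \<partial>PP)"
  proof (rule nn_integral_cong_AE)
    have "(\<integral>\<^sup>+z. indicator N (next_hit D (fst z) (out z)) \<partial>PP) = (\<integral>\<^sup>+x. indicator N x \<partial>\<mu>)"
      by (rule nn_integral_walk_1) (use N(3) in measurable)
    also have "\<dots> = 0" using N(2,3) by simp
    finally have "(\<integral>\<^sup>+z. indicator N (next_hit D (fst z) (out z)) \<partial>PP) = (0::ennreal)" .
    moreover have "(\<lambda>z. indicator N (next_hit D (fst z) (out z)) :: ennreal) \<in> borel_measurable PP" by measurable
    ultimately have "AE z in PP. indicator N (next_hit D (fst z) (out z)) = (0::ennreal)" using nn_integral_0_iff_AE by blast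
    with AE_flight show "AE z in PP. (\<integral>\<^sup>+s. f (fst z + s *\<^sub>R out z, out z) * indicator {0<..<r z} s \<partial>lborel) = 0"
    proof eventually_elim
      case (elim z)
      have "f (fst z + s *\<^sub>R out z, out z) * indicator {0<..<r z} s = 0" for s
        using flight_forward(2)[OF open_D bounded, of "out z" "fst z" s] elim
        by (auto simp: f_def r_def indicator_def split: if_splits)
      then have "(\<integral>\<^sup>+s. f (fst z + s *\<^sub>R out z, out z) * indicator {0<..<r z} s \<partial>lborel) = (\<integral>\<^sup>+s. 0 \<partial>(lborel::real measure))"
        by (rule nn_integral_cong)
      then show ?case by (rule trans) simp
    qed
  qed
  finally have "(\<integral>\<^sup>+w. f w \<partial>\<pi>) = 0" by simp
  moreover have "f \<in> borel_measurable \<pi>" by (rule measurable_\<pi>) measurable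
  ultimately have "AE w in \<pi>. f w = 0" using nn_integral_0_iff_AE by blast
  then show ?thesis using AE_space
  proof eventually_elim
    case (elim w)
    then have w: "fst w \<in> D" "norm (snd w) = 1" by (auto simp: space_\<pi>)
    have "next_hit D (fst w) (snd w) \<in> space \<mu>"
      using flight_props(2)[OF open_D bounded w(2) starts_inside_open[OF open_D bounded w]] by (simp add: space_\<mu>)
    then show ?case using elim(1) N(1) by (auto simp: f_def indicator_def split: if_splits)
  qed
qed

lemma interior_start_\<pi>: "interior_start D Rt \<gamma> U \<pi>"
  using prob_\<pi> sets_\<pi> AE_\<pi>_regular by (simp add: interior_start_def split_beta')

text \<open>A phase point under \<pi> is at some time \<open>s\<close> of the first leg. After
  running for time \<open>t\<close> it is at \<open>traj z (s + t)\<close>, so the new law is the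
  occupation measure of the window from \<open>t\<close> to \<open>r z + t\<close>, and stationarity
  shifts this window back to 0.\<close>

lemma law_from_interior_\<pi>:
  assumes t: "t \<ge> 0" shows "law_from_interior D \<gamma> U \<pi> t = ambient \<pi>"
proof (rule measure_eqI)
  interpret N: prob_space NS by (rule prob_NS)
  interpret NL: pair_sigma_finite NS lborel ..
  have idpi: "(\<lambda>w. w) \<in> borel_measurable \<pi>" by (rule measurable_\<pi>) simp
  show "sets (law_from_interior D \<gamma> U \<pi> t) = sets (ambient \<pi>)" by (simp add: law_from_interior_def ambient_def)
  fix A assume "A \<in> sets (law_from_interior D \<gamma> U \<pi> t)"
  then have A[measurable]: "A \<in> sets borel" by (simp add: law_from_interior_def)
  have [measurable]: "(\<lambda>z. fst (fst z)) \<in> borel_measurable (\<pi> \<Otimes>\<^sub>M NS)" "(\<lambda>z. snd (fst z)) \<in> borel_measurable (\<pi> \<Otimes>\<^sub>M NS)"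
    using measurable_compose[OF measurable_compose[OF measurable_fst idpi] measurable_fst_borel]
      measurable_compose[OF measurable_compose[OF measurable_fst idpi] measurable_snd_borel] by auto
  have [measurable]: "(\<lambda>z. snd z n) \<in> borel_measurable (\<pi> \<Otimes>\<^sub>M NS)" for n
    by (rule measurable_compose[OF measurable_snd measurable_NS_component])
  have "(\<lambda>z. interior_path D U0 (fst (fst z), snd (fst z)) (snd z) t) \<in> borel_measurable (\<pi> \<Otimes>\<^sub>M NS)" by measurable
  moreover have U: "interior_path D U0 (fst (fst z), snd (fst z)) (snd z) t = interior_path D U (fst z) (snd z) t" if "z \<in> space (\<pi> \<Otimes>\<^sub>M NS)" for z
    using that interior_path_U0[of "fst z" "snd z" t] by (auto simp: space_pair_measure space_\<pi>)
  ultimately have m: "(\<lambda>(w, \<eta>). interior_path D U w \<eta> t) \<in> borel_measurable (\<pi> \<Otimes>\<^sub>M NS)"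
    by (subst measurable_cong[OF _]) (auto simp: split_beta')
  define f where "f w = (\<integral>\<^sup>+\<eta>. indicator A (interior_path D U0 w \<eta> t) \<partial>NS)" for w
  have fm: "f \<in> borel_measurable borel"
  proof -
    have [measurable]: "(\<lambda>z. fst (fst z)) \<in> borel_measurable ((borel :: ('n point \<times> 'n point) measure) \<Otimes>\<^sub>M NS)"
      by (rule measurable_compose[OF measurable_fst measurable_fst_borel])
    have [measurable]: "(\<lambda>z. snd (fst z)) \<in> borel_measurable ((borel :: ('n point \<times> 'n point) measure) \<Otimes>\<^sub>M NS)"
      by (rule measurable_compose[OF measurable_fst measurable_snd_borel])
    have [measurable]: "(\<lambda>z. snd z n) \<in> borel_measurable (borel \<Otimes>\<^sub>M NS)" for n
      by (rule measurable_compose[OF measurable_snd measurable_NS_component])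
    have "(\<lambda>z. indicator A (interior_path D U0 (fst (fst z), snd (fst z)) (snd z) t) :: ennreal) \<in> borel_measurable (borel \<Otimes>\<^sub>M NS)"
      by measurable
    from N.borel_measurable_nn_integral_fst[OF this] show ?thesis by (simp add: f_def[abs_def])
  qed
  have "emeasure (law_from_interior D \<gamma> U \<pi> t) A = (\<integral>\<^sup>+z. indicator A (case z of (w, \<eta>) \<Rightarrow> interior_path D U w \<eta> t) \<partial>(\<pi> \<Otimes>\<^sub>M NS))"
    unfolding law_from_interior_def using m
    by (subst nn_integral_indicator[symmetric], simp, subst nn_integral_distr) auto
  also have "\<dots> = (\<integral>\<^sup>+w. (\<integral>\<^sup>+\<eta>. indicator A (interior_path D U w \<eta> t) \<partial>NS) \<partial>\<pi>)"
    using m by (subst N.nn_integral_fst[symmetric]) (auto intro: measurable_compose)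
  also have "\<dots> = (\<integral>\<^sup>+w. f w \<partial>\<pi>)"
    unfolding f_def using interior_path_U0 by (intro nn_integral_cong) (auto simp: space_\<pi>)
  also have "\<dots> = ennreal (1 / mj) * (\<integral>\<^sup>+z. (\<integral>\<^sup>+s. f (fst z + s *\<^sub>R out z, out z) * indicator {0<..<r z} s \<partial>lborel) \<partial>PP)"
    by (rule nn_integral_\<pi>[OF fm])
  also have "(\<integral>\<^sup>+z. (\<integral>\<^sup>+s. f (fst z + s *\<^sub>R out z, out z) * indicator {0<..<r z} s \<partial>lborel) \<partial>PP) = (\<integral>\<^sup>+z. occupation A 0 (r z) z \<partial>PP)"
  proof -
    define J where "J w s = (indicator A (interior_path D U0 (fst (fst w) + s *\<^sub>R snd (fst w), snd (fst w)) (snd w) t)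
      * indicator {0<..<flight_time D (fst (fst w)) (snd (fst w))} s :: ennreal)" for w s
    \<comment> \<open>The first reflection has been spent on the current flight; the path restarted
      inside it is driven by the remaining ones, which are fresh noise for the average
      \<open>f\<close>.\<close>
    define \<Psi> where "\<Psi> z = (\<integral>\<^sup>+s. J ((fst z, out z), \<lambda>n. snd z (Suc n)) s \<partial>lborel)" for z
    have \<Psi>m: "\<Psi> \<in> borel_measurable PP"
    proof -
      have [measurable]: "(\<lambda>w. fst (fst w)) \<in> borel_measurable (PP \<Otimes>\<^sub>M lborel)" "(\<lambda>w. out (fst w)) \<in> borel_measurable (PP \<Otimes>\<^sub>M lborel)"
        "(\<lambda>w. r (fst w)) \<in> borel_measurable (PP \<Otimes>\<^sub>M lborel)"
        using measurable_compose[OF measurable_fst measurable_fst_PP] measurable_compose[OF measurable_fst out_borel] measurable_compose[OF measurable_fst r_borel] by auto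
      have [measurable]: "(\<lambda>w. snd (fst w) n) \<in> borel_measurable (PP \<Otimes>\<^sub>M lborel)" for n
        by (rule measurable_compose[OF measurable_fst measurable_snd_PP])
      have "(\<lambda>w. indicator A (interior_path D U0 (fst (fst w) + snd w *\<^sub>R out (fst w), out (fst w)) (\<lambda>n. snd (fst w) (Suc n)) t)
         * indicator {w. 0 < snd w \<and> snd w < r (fst w)} w :: ennreal) \<in> borel_measurable (PP \<Otimes>\<^sub>M lborel)"
        by measurable
      from lborel.borel_measurable_nn_integral_fst[OF this]
      have "(\<lambda>z. \<integral>\<^sup>+s. indicator A (interior_path D U0 (fst z + s *\<^sub>R out z, out z) (\<lambda>n. snd z (Suc n)) t)
         * indicator {w. 0 < snd w \<and> snd w < r (fst w)} (z, s) \<partial>lborel) \<in> borel_measurable PP"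
        by simp
      moreover have "\<Psi> = (\<lambda>z. \<integral>\<^sup>+s. indicator A (interior_path D U0 (fst z + s *\<^sub>R out z, out z) (\<lambda>n. snd z (Suc n)) t)
         * indicator {w. 0 < snd w \<and> snd w < r (fst w)} (z, s) \<partial>lborel)"
        unfolding \<Psi>_def by (intro ext nn_integral_cong) (simp add: J_def indicator_def r_def)
      ultimately show ?thesis by simp
    qed
    have fub: "(\<integral>\<^sup>+\<eta>. (\<integral>\<^sup>+s. J ((x, v), \<eta>) s \<partial>lborel) \<partial>NS) = (\<integral>\<^sup>+s. f (x + s *\<^sub>R v, v) * indicator {0<..<flight_time D x v} s \<partial>lborel)" for x v
    proof -
      have [measurable]: "(\<lambda>w. fst w n) \<in> borel_measurable (NS \<Otimes>\<^sub>M lborel)" for n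
        by (rule measurable_compose[OF measurable_fst measurable_NS_component])
      have Jm: "(\<lambda>(\<eta>, s). J ((x, v), \<eta>) s) \<in> borel_measurable (NS \<Otimes>\<^sub>M lborel)"
      proof -
        have "(\<lambda>w. indicator A (interior_path D U0 (x + snd w *\<^sub>R v, v) (fst w) t)
          * indicator {0<..<flight_time D x v} (snd w) :: ennreal) \<in> borel_measurable (NS \<Otimes>\<^sub>M lborel)"
          by measurable
        then show ?thesis by (simp add: J_def split_beta')
      qed
      have "(\<integral>\<^sup>+\<eta>. (\<integral>\<^sup>+s. J ((x, v), \<eta>) s \<partial>lborel) \<partial>NS) = (\<integral>\<^sup>+s. (\<integral>\<^sup>+\<eta>. J ((x, v), \<eta>) s \<partial>NS) \<partial>lborel)"
        by (rule NL.Fubini'[OF Jm, symmetric])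
      also have "\<dots> = (\<integral>\<^sup>+s. f (x + s *\<^sub>R v, v) * indicator {0<..<flight_time D x v} s \<partial>lborel)"
      proof (rule nn_integral_cong)
        fix s
        have "(\<lambda>\<eta>. indicator A (interior_path D U0 (x + s *\<^sub>R v, v) \<eta> t) :: ennreal) \<in> borel_measurable NS" by measurable
        then show "(\<integral>\<^sup>+\<eta>. J ((x, v), \<eta>) s \<partial>NS) = f (x + s *\<^sub>R v, v) * indicator {0<..<flight_time D x v} s"
          by (simp add: J_def f_def nn_integral_multc)
      qed
      finally show ?thesis .
    qed
    let ?Q = "\<lambda>z. (\<integral>\<^sup>+s. f (fst z + s *\<^sub>R out z, out z) * indicator {0<..<r z} s \<partial>lborel)"
    have Qm: "?Q \<in> borel_measurable PP"
    proof -
      have [measurable]: "(\<lambda>w. fst (fst w)) \<in> borel_measurable (PP \<Otimes>\<^sub>M lborel)" "(\<lambda>w. out (fst w)) \<in> borel_measurable (PP \<Otimes>\<^sub>M lborel)"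
        "(\<lambda>w. r (fst w)) \<in> borel_measurable (PP \<Otimes>\<^sub>M lborel)"
        using measurable_compose[OF measurable_fst measurable_fst_PP] measurable_compose[OF measurable_fst out_borel] measurable_compose[OF measurable_fst r_borel] by auto
      have "(\<lambda>w. (fst (fst w) + snd w *\<^sub>R out (fst w), out (fst w))) \<in> borel_measurable (PP \<Otimes>\<^sub>M lborel)"
        by (rule borel_measurable_Pair) measurable
      note [measurable] = measurable_compose[OF this fm]
      have "(\<lambda>w. f (fst (fst w) + snd w *\<^sub>R out (fst w), out (fst w)) * indicator {w. 0 < snd w \<and> snd w < r (fst w)} w) \<in> borel_measurable (PP \<Otimes>\<^sub>M lborel)"
        by measurable
      from lborel.borel_measurable_nn_integral_fst[OF this] show ?thesis by (simp add: indicator_def)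
    qed
    have "(\<integral>\<^sup>+z. ?Q z \<partial>PP) = (\<integral>\<^sup>+x. (\<integral>\<^sup>+u. (\<integral>\<^sup>+\<eta>. ?Q (x, case_nat u \<eta>) \<partial>NS) \<partial>\<rho>) \<partial>\<mu>)"
      by (rule nn_integral_PP_iter[OF Qm])
    also have "\<dots> = (\<integral>\<^sup>+x. (\<integral>\<^sup>+u. (\<integral>\<^sup>+\<eta>. \<Psi> (x, case_nat u \<eta>) \<partial>NS) \<partial>\<rho>) \<partial>\<mu>)"
      by (simp add: \<Psi>_def fub out_def r_def N.emeasure_space_1)
    also have "\<dots> = (\<integral>\<^sup>+z. \<Psi> z \<partial>PP)" by (rule nn_integral_PP_iter[OF \<Psi>m, symmetric])
    also have "\<dots> = (\<integral>\<^sup>+z. occupation A t (r z + t) z \<partial>PP)"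
    proof (rule nn_integral_cong_AE)
      show "AE z in PP. \<Psi> z = occupation A t (r z + t) z"
        using AE_nonexplosive AE_flight
      proof eventually_elim
        case (elim z)
        then have ins: "norm (out z) = 1" "starts_inside D (fst z) (out z)" by auto
        have "interior_path D U0 (fst z + s *\<^sub>R out z, out z) (\<lambda>n. snd z (Suc n)) t = traj z (s + t)"
          if s: "0 < s" "s < r z" for s
        proof -
          note ff = flight_forward[OF open_D bounded ins s(1) s(2)[unfolded r_def]]
          show ?thesis
          proof (cases "t < r z - s")
            case True
            then show ?thesis using traj_first[of "s + t" z]
              by (simp add: interior_path_eq ff r_def algebra_simps)
          next
            case False
            then have "traj z (s + t) = traj (\<theta> z) (s + t - r z)" using elim(1) by (intro traj_\<theta>) auto
            then show ?thesis using False by (simp add: interior_path_eq ff r_def[symmetric] traj_def \<theta>_def algebra_simps)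
          qed
        qed
        then have "\<Psi> z = (\<integral>\<^sup>+s. indicator A (traj z (s + t)) * indicator {0<..<r z} s \<partial>lborel)"
          unfolding \<Psi>_def J_def by (intro nn_integral_cong) (auto simp: indicator_def r_def)
        then show ?case using occupation_shift[OF A, of z t 0 "r z"] by simp
      qed
    qed
    also have "\<dots> = (\<integral>\<^sup>+z. occupation A 0 (r z) z \<partial>PP)" by (rule occupation_stationary[OF A t])
    finally show ?thesis .
  qed
  also have "(\<integral>\<^sup>+z. occupation A 0 (r z) z \<partial>PP) = (\<integral>\<^sup>+z. (\<integral>\<^sup>+s. indicator A (fst z + s *\<^sub>R out z, out z) * indicator {0<..<r z} s \<partial>lborel) \<partial>PP)"
    unfolding occupation_def by (intro nn_integral_cong) (simp add: traj_first indicator_def)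
  also have "ennreal (1 / mj) * \<dots> = (\<integral>\<^sup>+w. indicator A w \<partial>\<pi>)"
    by (rule nn_integral_\<pi>[symmetric]) measurable
  also have "\<dots> = emeasure (ambient \<pi>) A"
    unfolding ambient_def using idpi by (subst nn_integral_indicator[symmetric], simp, subst nn_integral_distr) auto
  finally show "emeasure (law_from_interior D \<gamma> U \<pi> t) A = emeasure (ambient \<pi>) A" .
qed

lemma billiard_invariant_\<pi>: "billiard_invariant D Rt \<gamma> U \<pi>"
  using interior_start_\<pi> law_from_interior_\<pi> by (simp add: billiard_invariant_def)

end

section \<open>Identification of the limit\<close>

lemma tv_distance_eq_0:
  assumes M: "prob_space M" "sets M = sets borel" and N: "prob_space N" "sets N = sets borel"
    and tv: "tv_distance M N = 0"
  shows "M = N"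
proof (rule measure_eqI)
  interpret M: prob_space M by fact
  interpret N: prob_space N by fact
  show "sets M = sets N" using M N by simp
  fix A assume "A \<in> sets M"
  then have A: "A \<in> sets borel" using M by simp
  have bdd: "bdd_above ((\<lambda>A. \<bar>measure M A - measure N A\<bar>) ` sets borel)"
  proof (rule bdd_aboveI2)
    fix B
    show "\<bar>measure M B - measure N B\<bar> \<le> 1"
      using M.prob_le_1[of B] N.prob_le_1[of B] measure_nonneg[of M B] measure_nonneg[of N B] by linarith
  qed
  have "\<bar>measure M A - measure N A\<bar> \<le> tv_distance M N"
    unfolding tv_distance_def by (rule cSUP_upper[OF A bdd])
  then have "measure M A = measure N A" using tv by simp
  then show "emeasure M A = emeasure N A" by (simp add: M.emeasure_eq_measure N.emeasure_eq_measure)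
qed

lemma matrix_inv_orthogonal:
  fixes A :: "real ^ 'n ^ 'n"
  assumes "orthogonal_matrix A" shows "matrix_inv A = transpose A"
  unfolding matrix_inv_def
proof (rule some_equality)
  show "A ** transpose A = mat 1 \<and> transpose A ** A = mat 1" using assms by (simp add: orthogonal_matrix_def)
  fix B assume B: "A ** B = mat 1 \<and> B ** A = mat 1"
  have "B = (transpose A ** A) ** B" using assms by (simp add: orthogonal_matrix_def)
  also have "\<dots> = transpose A" using B by (simp add: matrix_mul_assoc[symmetric])
  finally show "B = transpose A" .
qed

lemma prob_space_ambient:
  assumes "prob_space \<mu>" "sets \<mu> = sets (phase_space D)"
  shows "prob_space (ambient \<mu>)"
proof -
  have "(\<lambda>s. s) \<in> borel_measurable \<mu>"
    unfolding measurable_cong_sets[OF assms(2) refl] phase_space_def by (intro measurable_restrict_space1) simp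
  then show ?thesis unfolding ambient_def by (rule prob_space.prob_space_distr[OF assms(1)])
qed

lemma ambient_inj:
  fixes D :: "'n::finite point set"
  assumes D: "D \<in> sets borel" and M: "sets \<mu> = sets (phase_space D)" and N: "sets \<nu> = sets (phase_space D)" and eq: "ambient \<mu> = ambient \<nu>"
  shows "\<mu> = \<nu>"
proof (rule measure_eqI)
  have id: "(\<lambda>s. s) \<in> borel_measurable \<mu>" "(\<lambda>s. s) \<in> borel_measurable \<nu>"
    unfolding measurable_cong_sets[OF M refl] measurable_cong_sets[OF N refl] phase_space_def
    by (intro measurable_restrict_space1; simp)+
  show "sets \<mu> = sets \<nu>" using M N by simp
  fix A assume A: "A \<in> sets \<mu>"
  have "D \<times> sphere (0::'n point) 1 \<in> sets borel"
    unfolding borel_prod[symmetric] by (rule pair_measureI) (use D in auto)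
  then have Ab: "A \<in> sets borel" using A unfolding M phase_space_def by (auto simp: sets_restrict_space_iff)
  have "emeasure \<mu> A = emeasure (ambient \<mu>) A"
    unfolding ambient_def using id(1) Ab sets.sets_into_space[OF A] by (simp add: emeasure_distr Int_absorb2)
  moreover have "emeasure \<nu> A = emeasure (ambient \<nu>) A"
    unfolding ambient_def using id(2) Ab sets.sets_into_space[OF A[unfolded M, folded N]] by (simp add: emeasure_distr Int_absorb2)
  ultimately show "emeasure \<mu> A = emeasure \<nu> A" using eq by simp
qed

text \<open>Stated for arbitrary functions because the formula of the theorem, with the original
  \<gamma>, \<open>U\<close> and \<open>inner_normal\<close>, comes without measurability on the
  whole phase space.\<close>

lemma density_cong_AE:
  assumes "AE x in M. f x = g x"
  shows "density M f = density M g"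
proof -
  have "(\<integral>\<^sup>+x. f x * indicator A x \<partial>M) = (\<integral>\<^sup>+x. g x * indicator A x \<partial>M)" for A
    by (rule nn_integral_cong_AE) (use assms in \<open>auto elim!: eventually_mono\<close>)
  then show ?thesis unfolding density_def by simp
qed

context reflecting
begin

text \<open>The reflected direction has a probability density on the sphere, which is impossible on
  a null set.\<close>

lemma sphere_measure_pos: "emeasure (sphere_measure :: 'n point measure) (sphere 0 1) > 0"
proof -
  interpret R: prob_space \<rho> by (rule prob_\<rho>)
  have "emeasure (sphere_measure :: 'n point measure) (sphere 0 1) \<noteq> 0"
  proof
    assume 0: "emeasure (sphere_measure :: 'n point measure) (sphere 0 1) = 0"
    have "AE v in (sphere_measure :: 'n point measure). False"
      using 0 by (intro AE_I[of _ _ "sphere 0 1"]) (auto simp: sphere_measure_def sets_restrict_space_iff)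
    then have "(\<integral>\<^sup>+v. ennreal (\<gamma>0 (transpose (U0 0) *v v)) * 1 \<partial>sphere_measure) = (\<integral>\<^sup>+v. 0 \<partial>(sphere_measure :: 'n point measure))"
      by (intro nn_integral_cong_AE) (auto elim: eventually_mono)
    moreover have "(\<integral>\<^sup>+u. 1 \<partial>\<rho>) = (\<integral>\<^sup>+v. ennreal (\<gamma>0 (transpose (U0 0) *v v)) * 1 \<partial>sphere_measure)"
      by (rule nn_integral_reflected) simp
    ultimately show False by (simp add: R.emeasure_space_1)
  qed
  then show ?thesis by (simp add: zero_less_iff_neq_zero)
qed

lemma sphere_measure_finite': "emeasure (sphere_measure :: 'n point measure) (sphere 0 1) \<noteq> \<infinity>"
  using finite_measure.emeasure_finite[OF finite_sphere_measure, of "sphere 0 1"] by simp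

lemma volume_pos: "emeasure (volume_on D) D > 0"
proof -
  have vol: "emeasure (volume_on D) D = emeasure lborel D"
    unfolding volume_on_def by (subst emeasure_restrict_space) auto
  have "D \<noteq> {}" using domain by (simp add: billiard_domain_def)
  then obtain p s where p: "s > 0" "ball p s \<subseteq> D" using open_D unfolding open_contains_ball by blast
  have "emeasure lborel (ball p s) \<le> emeasure lborel D" using p(2) by (intro emeasure_mono) auto
  moreover have "unit_ball_vol (real CARD('n)) \<noteq> 0" by (rule less_imp_neq[symmetric]) simp
  ultimately have "emeasure lborel D \<noteq> 0" using p(1) by (auto simp: emeasure_ball not_le)
  then show ?thesis by (simp add: vol zero_less_iff_neq_zero)
qed

lemma volume_finite': "emeasure (volume_on D) D \<noteq> \<infinity>"
  using finite_measure.emeasure_finite[OF finite_volume, of D] by simp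

lemma uniform_phase_density:
  "uniform_phase D = density VS (\<lambda>_. 1 / (emeasure (volume_on D) D * emeasure (sphere_measure :: 'n point measure) (sphere 0 1)))"
proof -
  let ?V = "volume_on D" and ?S = "sphere_measure :: 'n point measure"
  let ?a = "emeasure ?V D" and ?b = "emeasure ?S (sphere 0 1)"
  have DV: "D \<in> sets ?V" using sets.top[of ?V] by simp
  have SS: "sphere 0 1 \<in> sets ?S" using sets.top[of ?S] by simp
  have 1: "uniform_measure ?V D = density ?V (\<lambda>_. 1 / ?a)"
    unfolding uniform_measure_def by (rule density_cong_AE) (use AE_space in \<open>auto elim!: eventually_mono\<close>)
  have 2: "uniform_measure ?S (sphere 0 1) = density ?S (\<lambda>_. 1 / ?b)"
    unfolding uniform_measure_def by (rule density_cong_AE) (use AE_space in \<open>auto elim!: eventually_mono\<close>)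
  have P: "prob_space (density ?S (\<lambda>_. 1 / ?b))"
    unfolding 2[symmetric] using sphere_measure_pos sphere_measure_finite' by (intro prob_space_uniform_measure) auto
  have "uniform_phase D = density VS (\<lambda>(x, y). 1 / ?a * (1 / ?b))"
    unfolding uniform_phase_def 1 2
  proof (rule pair_measure_density)
    show "sigma_finite_measure ?S" using finite_sphere_measure by (rule finite_measure.sigma_finite_measure)
    show "sigma_finite_measure (density ?S (\<lambda>_. 1 / ?b))" using P by (rule prob_space_imp_sigma_finite)
  qed auto
  also have "1 / ?a * (1 / ?b) = 1 / (?a * ?b)"
    using volume_pos sphere_measure_pos volume_finite' sphere_measure_finite'
    by (cases ?a; cases ?b) (auto simp: divide_ennreal ennreal_mult[symmetric] simp flip: ennreal_1)
  finally show ?thesis by (simp add: split_beta')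
qed

lemma uniform_phase_null:
  assumes "N \<in> null_sets (uniform_phase D)" shows "N \<in> null_sets VS"
proof -
  let ?k = "1 / (emeasure (volume_on D) D * emeasure (sphere_measure :: 'n point measure) (sphere 0 1))"
  have k: "?k \<noteq> 0"
    using volume_finite' sphere_measure_finite' by (auto simp: ennreal_mult_eq_top_iff ennreal_divide_eq_0_iff)
  have N: "N \<in> sets VS" "emeasure (uniform_phase D) N = 0" using assms unfolding uniform_phase_density by (auto simp: null_sets_def)
  have "?k * emeasure VS N = 0"
    using N(2) unfolding uniform_phase_density by (simp add: emeasure_density N(1) nn_integral_cmult_indicator)
  then show ?thesis using k N(1) by (auto simp: null_sets_def)
qed

end

context stationary_density
begin

text \<open>Started from \<pi>, the law does not change, so its total variation distance to \<chi>
  is constant; being convergent to 0, it is 0.\<close>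

lemma limit_eq_\<pi>:
  assumes lim: "billiard_limit D Rt \<gamma> U chi" shows "chi = \<pi>"
proof -
  have chi: "prob_space chi" "sets chi = sets (phase_space D)" using lim by (auto simp: billiard_limit_def)
  have "((\<lambda>t. tv_distance (law_from_interior D \<gamma> U \<pi> t) (ambient chi)) \<longlongrightarrow> 0) at_top"
    using lim interior_start_\<pi> by (simp add: billiard_limit_def)
  moreover have "eventually (\<lambda>t. tv_distance (law_from_interior D \<gamma> U \<pi> t) (ambient chi) = tv_distance (ambient \<pi>) (ambient chi)) at_top"
    using eventually_ge_at_top[of 0] by eventually_elim (simp add: law_from_interior_\<pi>)
  ultimately have "((\<lambda>t::real. tv_distance (ambient \<pi>) (ambient chi)) \<longlongrightarrow> 0) at_top"
    using tendsto_cong by force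
  then have "tv_distance (ambient \<pi>) (ambient chi) = 0" by (simp add: tendsto_const_iff)
  then have "ambient \<pi> = ambient chi"
    by (intro tv_distance_eq_0 prob_space_ambient[OF prob_\<pi> sets_\<pi>] prob_space_ambient[OF chi]) (auto simp: ambient_def)
  then have "\<pi> = chi" by (rule ambient_inj[OF D_borel sets_\<pi> chi(2)])
  then show ?thesis by simp
qed

text \<open>For almost every phase point the backward hit is in the entrance set. There the extended
  functions agree with the given ones, the inverse of the orthogonal frame is its transpose, and the
  cosine undoes the \<open>arccos\<close>.\<close>

lemma \<pi>_formula:
  "\<pi> = density VS (\<lambda>(x, v). let z = next_hit D x (- v) in
          ennreal (1 / mj * (\<psi> z * (\<gamma> (matrix_inv (U z) *v v) / cos (normal_angle D z v)))))"
  unfolding \<pi>_def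
proof (rule density_cong_AE)
  show "AE w in VS. ennreal (phase_density w) = (case w of (x, v) \<Rightarrow> let z = next_hit D x (- v) in
          ennreal (1 / mj * (\<psi> z * (\<gamma> (matrix_inv (U z) *v v) / cos (normal_angle D z v)))))"
    using AE_VS_entrance AE_space
  proof eventually_elim
    case (elim w)
    define v where "v = snd w"
    define z where "z = next_hit D (fst w) (- v)"
    have v: "norm v = 1" using elim(2) by (auto simp: space_VS v_def)
    have ze: "z \<in> entrance D Rt v" using elim(1) by (simp add: z_def v_def)
    then have zR: "z \<in> Rt" using entrance_transversal transversal_Rt by blast
    have zF: "z \<in> frontier D" by (rule Rt_frontier[OF zR])
    have n: "nf z = inner_normal D z" using zR by (simp add: normal_field_def)
    have vn: "v \<bullet> nf z > 0" using ze by (simp add: entrance_def)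
    have "\<bar>v \<bullet> nf z\<bar> \<le> 1" using Cauchy_Schwarz_ineq2[of v "nf z"] v norm_nf[OF zR] by simp
    then have c: "cos (normal_angle D z v) = v \<bullet> nf z" unfolding normal_angle_def n[symmetric] by (intro cos_arccos_abs)
    have oU: "orthogonal_matrix (U z)" using frames zF by (simp add: reflection_frames_def)
    have mi: "matrix_inv (U z) = transpose (U0 z)"
      using zF oU matrix_inv_orthogonal by (simp add: U0_def)
    have "transpose (U0 z) *v v \<in> half_sphere e_vec"
      using transpose_inner[of z v] U0_normal[OF zR] vn v by (simp add: half_sphere_def norm_U0 inner_commute)
    then have "\<gamma>0 (transpose (U0 z) *v v) = \<gamma> (matrix_inv (U z) *v v)" by (simp add: \<gamma>0_def mi)
    moreover have "\<psi>0 z = \<psi> z" using zF by (simp add: \<psi>0_def)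
    ultimately show ?case
      unfolding phase_density_def Let_def split_beta' v_def[symmetric] z_def[symmetric] c by simp
  qed
qed

lemma \<pi>_absolutely_continuous: "absolutely_continuous (uniform_phase D) \<pi>"
  unfolding absolutely_continuous_def
proof
  fix N assume "N \<in> null_sets (uniform_phase D)"
  then have "N \<in> null_sets VS" by (rule uniform_phase_null)
  moreover have "absolutely_continuous VS \<pi>" unfolding \<pi>_def by (rule absolutely_continuousI_density) (rule measurable_VS, measurable)
  ultimately show "N \<in> null_sets \<pi>" by (auto simp: absolutely_continuous_def)
qed

end

section \<open>The cosine law\<close>

text \<open>Only proportionality to the cosine matters below; the constant stays abstract and is
  instantiated with the normalization in the theorem.\<close>

locale cosine_reflecting = reflecting D Rt \<gamma> U
  for D Rt :: "'n::{finite,linorder} point set" and \<gamma> :: "'n point \<Rightarrow> real" and U :: "'n point \<Rightarrow> 'n matrix" +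
  fixes c :: real
  assumes cosine: "\<And>u. u \<in> half_sphere e_vec \<Longrightarrow> \<gamma> u = c * (e_vec \<bullet> u)"
begin

lemma \<gamma>0_cosine:
  assumes x: "x \<in> Rt" and v: "norm v = 1" and p: "v \<bullet> nf x > 0"
  shows "\<gamma>0 (transpose (U0 x) *v v) / (v \<bullet> nf x) = c"
proof -
  have e: "e_vec \<bullet> (transpose (U0 x) *v v) = v \<bullet> nf x"
    using transpose_inner[of x v] U0_normal[OF x] by (simp add: inner_commute)
  then have "transpose (U0 x) *v v \<in> half_sphere e_vec" using p v by (simp add: half_sphere_def norm_U0)
  then show ?thesis using cosine e p by (simp add: \<gamma>0_def)
qed

text \<open>Distributing the mass of a flight evenly over its chord gives an integral over the phase space in which
  exchanging \<open>v\<close> and \<open>- v\<close> exchanges the two end points.\<close>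

lemma cosine_chords:
  fixes k :: "'n point \<times> 'n point \<Rightarrow> ennreal" and a :: real
  assumes k[measurable]: "k \<in> borel_measurable borel" and a: "a \<ge> 0"
  shows "(\<integral>\<^sup>+x. ennreal a * (\<integral>\<^sup>+u. k (x, next_hit D x (U0 x *v u)) \<partial>\<rho>) \<partial>SF)
    = (\<integral>\<^sup>+v. (\<integral>\<^sup>+y. ennreal (a * c) * (k (next_hit D y (- v), next_hit D y v) / ennreal (flight_time D y (- v) + flight_time D y v)) * indicator D y \<partial>lborel) \<partial>sphere_measure)"
proof -
  define h where "h w = k (fst w, next_hit D (fst w) (fst (snd w))) / ennreal (flight_time D (fst w) (fst (snd w)))" for w :: "'n point \<times> 'n point \<times> real"
  have h[measurable]: "h \<in> borel_measurable borel"
  proof -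
    have "(\<lambda>w::'n point \<times> 'n point \<times> real. (fst w, next_hit D (fst w) (fst (snd w)))) \<in> borel_measurable borel"
      by (intro borel_measurable_Pair) measurable
    note [measurable] = measurable_compose[OF this k]
    show ?thesis unfolding h_def[abs_def] by measurable
  qed
  have "(\<integral>\<^sup>+x. ennreal a * (\<integral>\<^sup>+u. k (x, next_hit D x (U0 x *v u)) \<partial>\<rho>) \<partial>SF)
     = (\<integral>\<^sup>+x. ennreal a * (\<integral>\<^sup>+u. (\<integral>\<^sup>+s. h (x, U0 x *v u, s) * indicator {0<..<flight_time D x (U0 x *v u)} s \<partial>lborel) \<partial>\<rho>) \<partial>SF)"
  proof (rule nn_integral_cong_AE)
    show "AE x in SF. ennreal a * (\<integral>\<^sup>+u. k (x, next_hit D x (U0 x *v u)) \<partial>\<rho>) =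
      ennreal a * (\<integral>\<^sup>+u. (\<integral>\<^sup>+s. h (x, U0 x *v u, s) * indicator {0<..<flight_time D x (U0 x *v u)} s \<partial>lborel) \<partial>\<rho>)"
      using AE_SF_Rt
    proof eventually_elim
      case (elim x)
      have "k (x, next_hit D x (U0 x *v u)) = (\<integral>\<^sup>+s. h (x, U0 x *v u, s) * indicator {0<..<flight_time D x (U0 x *v u)} s \<partial>lborel)"
        if u: "u \<in> space \<rho>" for u
      proof -
        let ?v = "U0 x *v u"
        have uh: "norm u = 1" "e_vec \<bullet> u > 0" using u by (auto simp: space_\<rho> half_sphere_def)
        have nv: "norm ?v = 1" using uh by (simp add: norm_U0)
        have "?v \<bullet> nf x = u \<bullet> e_vec" using transpose_inner[of x ?v] U0_normal[OF elim] by (simp add: U0_transpose)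
        then have "x \<in> entrance D Rt ?v" using uh by (simp add: entrance_def inner_commute)
        then have "flight_time D x ?v > 0"
          using flight_props(1)[OF open_D bounded nv] entrance_starts_inside by blast
        then have p: "ennreal (flight_time D x ?v) \<noteq> 0" and r0: "flight_time D x ?v \<ge> 0" by auto
        have "(\<integral>\<^sup>+s. h (x, ?v, s) * indicator {0<..<flight_time D x ?v} s \<partial>lborel)
          = (\<integral>\<^sup>+s. (k (x, next_hit D x ?v) / ennreal (flight_time D x ?v)) * indicator {0<..<flight_time D x ?v} s \<partial>lborel)"
          unfolding h_def fst_conv snd_conv ..
        also have "\<dots> = (k (x, next_hit D x ?v) / ennreal (flight_time D x ?v)) * ennreal (flight_time D x ?v)"
          by (subst nn_integral_cmult_indicator) (use r0 in auto)
        also have "\<dots> = k (x, next_hit D x ?v)"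
          using ennreal_divide_self[OF p] by (simp add: ennreal_divide_times)
        finally show ?thesis by (rule sym)
      qed
      then show ?case by (simp cong: nn_integral_cong)
    qed
  qed
  also have "\<dots> = (\<integral>\<^sup>+v. (\<integral>\<^sup>+y. ennreal (a * (\<gamma>0 (transpose (U0 (next_hit D y (- v))) *v v) / (v \<bullet> nf (next_hit D y (- v)))))
          * h (next_hit D y (- v), v, flight_time D y (- v)) * indicator D y \<partial>lborel) \<partial>sphere_measure)"
    by (rule flight_formula[where \<psi> = "\<lambda>_. a"]) (use a in auto)
  also have "\<dots> = (\<integral>\<^sup>+v. (\<integral>\<^sup>+y. ennreal (a * c) * (k (next_hit D y (- v), next_hit D y v) / ennreal (flight_time D y (- v) + flight_time D y v)) * indicator D y \<partial>lborel) \<partial>sphere_measure)"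
  proof (rule nn_integral_cong_AE)
    show "AE v in sphere_measure. (\<integral>\<^sup>+y. ennreal (a * (\<gamma>0 (transpose (U0 (next_hit D y (- v))) *v v) / (v \<bullet> nf (next_hit D y (- v)))))
          * h (next_hit D y (- v), v, flight_time D y (- v)) * indicator D y \<partial>lborel)
       = (\<integral>\<^sup>+y. ennreal (a * c) * (k (next_hit D y (- v), next_hit D y v) / ennreal (flight_time D y (- v) + flight_time D y v)) * indicator D y \<partial>lborel)"
      using AE_transversal AE_space
    proof eventually_elim
      case (elim v)
      then have v: "norm v = 1" by simp
      show ?case
      proof (rule nn_integral_cong_AE)
        show "AE y in lborel. ennreal (a * (\<gamma>0 (transpose (U0 (next_hit D y (- v))) *v v) / (v \<bullet> nf (next_hit D y (- v)))))
          * h (next_hit D y (- v), v, flight_time D y (- v)) * indicator D y =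
          ennreal (a * c) * (k (next_hit D y (- v), next_hit D y v) / ennreal (flight_time D y (- v) + flight_time D y v)) * indicator D y"
          using AE_enters[OF v elim(1)]
        proof eventually_elim
          case (elim y)
          show ?case
          proof (cases "y \<in> D")
            case True
            then have ze: "next_hit D y (- v) \<in> entrance D Rt v" using elim by blast
            then have "next_hit D y (- v) \<in> Rt" "v \<bullet> nf (next_hit D y (- v)) > 0"
              using entrance_transversal transversal_Rt by (auto simp: entrance_def)
            then have 1: "\<gamma>0 (transpose (U0 (next_hit D y (- v))) *v v) / (v \<bullet> nf (next_hit D y (- v))) = c"
              using \<gamma>0_cosine v by blast
            show ?thesis unfolding 1
              by (simp add: h_def flight_origin(5,6)[OF open_D bounded v True])
          qed simp
        qed
      qed
    qed
  qed
  finally show ?thesis .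
qed

text \<open>Detailed balance of the walk with respect to surface measure. The chord integral is
  symmetric up to the sign of \<open>v\<close>, and the sphere measure is invariant under that
  sign.\<close>

lemma cosine_reciprocity:
  fixes k :: "'n point \<times> 'n point \<Rightarrow> ennreal" and a :: real
  assumes k: "k \<in> borel_measurable borel" and a: "a \<ge> 0"
  shows "(\<integral>\<^sup>+x. ennreal a * (\<integral>\<^sup>+u. k (x, next_hit D x (U0 x *v u)) \<partial>\<rho>) \<partial>SF)
    = (\<integral>\<^sup>+x. ennreal a * (\<integral>\<^sup>+u. k (next_hit D x (U0 x *v u), x) \<partial>\<rho>) \<partial>SF)"
proof -
  have sw: "(\<lambda>w. (snd w, fst w)) \<in> borel_measurable (borel :: ('n point \<times> 'n point) measure)"
    by (intro borel_measurable_Pair) measurable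
  have k': "(\<lambda>w. k (snd w, fst w)) \<in> borel_measurable borel" by (rule measurable_compose[OF sw k])
  define F where "F v = (\<integral>\<^sup>+y. ennreal (a * c) * (k (next_hit D y (- v), next_hit D y v) / ennreal (flight_time D y (- v) + flight_time D y v)) * indicator D y \<partial>lborel)" for v
  have Fm: "F \<in> borel_measurable borel"
  proof -
    have "(\<lambda>w :: 'n point \<times> 'n point. (next_hit D (snd w) (- fst w), next_hit D (snd w) (fst w))) \<in> borel_measurable borel"
      by (intro borel_measurable_Pair) measurable
    note [measurable] = measurable_compose[OF this k]
    have "(\<lambda>w :: 'n point \<times> 'n point. ennreal (a * c) * (k (next_hit D (snd w) (- fst w), next_hit D (snd w) (fst w)) / ennreal (flight_time D (snd w) (- fst w) + flight_time D (snd w) (fst w))) * indicator D (snd w)) \<in> borel_measurable borel"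
      by measurable
    from lborel.borel_measurable_nn_integral_fst[OF measurable_borel_pair[OF this]] show ?thesis
      by (simp add: F_def[abs_def])
  qed
  have Sb[measurable]: "sphere (0::'n point) 1 \<in> sets borel" by simp
  have neg: "orthogonal_transformation (uminus :: 'n point \<Rightarrow> 'n point)"
    by (simp add: orthogonal_transformation_def linear_iff)
  have "(\<integral>\<^sup>+v. F v \<partial>sphere_measure) = (\<integral>\<^sup>+v. F v * indicator (sphere 0 1) v \<partial>surface_measure)" by (rule nn_integral_sphere)
  also have "\<dots> = (\<integral>\<^sup>+v. F (- v) * indicator (sphere 0 1) (- v) \<partial>surface_measure)"
    by (rule nn_integral_surface_orthogonal[OF neg, of "\<lambda>v. F v * indicator (sphere 0 1) v", symmetric]) (use Fm in measurable)
  also have "\<dots> = (\<integral>\<^sup>+v. F (- v) \<partial>sphere_measure)" unfolding nn_integral_sphere by (simp add: indicator_def)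
  finally have sym: "(\<integral>\<^sup>+v. F v \<partial>sphere_measure) = (\<integral>\<^sup>+v. F (- v) \<partial>sphere_measure)" .
  have "(\<integral>\<^sup>+x. ennreal a * (\<integral>\<^sup>+u. k (x, next_hit D x (U0 x *v u)) \<partial>\<rho>) \<partial>SF) = (\<integral>\<^sup>+v. F v \<partial>sphere_measure)"
    unfolding F_def by (rule cosine_chords[OF k a])
  also have "\<dots> = (\<integral>\<^sup>+v. F (- v) \<partial>sphere_measure)" by (rule sym)
  also have "\<dots> = (\<integral>\<^sup>+x. ennreal a * (\<integral>\<^sup>+u. k (snd (x, next_hit D x (U0 x *v u)), fst (x, next_hit D x (U0 x *v u))) \<partial>\<rho>) \<partial>SF)"
    unfolding F_def cosine_chords[OF k' a] by (simp add: add.commute)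
  finally show ?thesis by simp
qed

text \<open>The positivity condition on compact sets, taken at the single point
  \<open>e_vec\<close>, where \<gamma> has the value \<open>c\<close>.\<close>

lemma c_pos: "c > 0"
proof -
  have e: "e_vec \<bullet> (e_vec :: 'n point) = 1" by (simp add: e_vec_def)
  then have "e_vec \<in> half_sphere (e_vec :: 'n point)" by (simp add: half_sphere_def norm_eq_1)
  moreover have "(INF u\<in>{e_vec}. \<gamma> u) > 0"
    using dens \<open>e_vec \<in> half_sphere e_vec\<close> unfolding reflection_density_def
    by (elim conjE allE[of _ "{e_vec}"]) simp
  ultimately show ?thesis using cosine[of e_vec] e by simp
qed

lemma axially_symmetric: "axially_symmetric \<gamma>"
  unfolding axially_symmetric_def using cosine by (intro exI[of _ "\<lambda>t. c * t"]) (simp add: inner_commute)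

lemma regular_points: "regular_points D Rt \<gamma> U = Rt"
  using axially_symmetric by (simp add: regular_points_def)

text \<open>If the boundary were null, the chord formula for the constant function \<infinity> would
  equate 0 with \<infinity> times the positive volume of the phase space.\<close>

lemma surface_pos: "emeasure SF (frontier D) > 0"
proof -
  have "emeasure SF (frontier D) \<noteq> 0"
  proof
    assume 0: "emeasure SF (frontier D) = 0"
    have "AE x in SF. False"
      using 0 by (intro AE_I[of _ _ "frontier D"]) (auto simp: SF_def sets_restrict_space_iff)
    then have "(\<integral>\<^sup>+x. ennreal 1 * (\<integral>\<^sup>+u. (\<lambda>_. \<infinity>) (x, next_hit D x (U0 x *v u)) \<partial>\<rho>) \<partial>SF) = (\<integral>\<^sup>+x. 0 \<partial>SF)"
      by (intro nn_integral_cong_AE) (auto elim: eventually_mono)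
    then have "0 = (\<integral>\<^sup>+v. (\<integral>\<^sup>+y. ennreal (1 * c) * (\<infinity> / ennreal (flight_time D y (- v) + flight_time D y v)) * indicator D y \<partial>lborel) \<partial>(sphere_measure :: 'n point measure))"
      by (subst (asm) cosine_chords) auto
    also have "\<dots> = (\<integral>\<^sup>+v. (\<integral>\<^sup>+y. \<infinity> * indicator D y \<partial>lborel) \<partial>(sphere_measure :: 'n point measure))"
      using c_pos by (simp add: ennreal_top_divide ennreal_mult_top)
    also have "\<dots> = \<infinity> * emeasure lborel D * emeasure (sphere_measure :: 'n point measure) (sphere 0 1)"
      by (simp add: nn_integral_cmult_indicator)
    finally show False
      using volume_pos sphere_measure_pos unfolding volume_on_def
      by (subst (asm) emeasure_restrict_space) (auto simp: ennreal_top_mult split: if_splits)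
  qed
  then show ?thesis by (simp add: zero_less_iff_neq_zero)
qed

definition "area = measure SF (frontier D)"

lemma area: "emeasure SF (frontier D) = ennreal area" "area > 0"
proof -
  interpret finite_measure SF by (rule finite_SF)
  show 1: "emeasure SF (frontier D) = ennreal area" by (simp add: area_def emeasure_eq_measure)
  show "area > 0" using surface_pos unfolding 1 by simp
qed

definition "\<nu> = density SF (\<lambda>_. ennreal (1 / area))"

lemma sets_\<nu>: "sets \<nu> = sets (boundary_space D)"
  unfolding \<nu>_def sets_density SF_def boundary_space_def by (rule sets_restrict_space_cong) simp

lemma space_\<nu>: "space \<nu> = frontier D"
  unfolding sets_eq_imp_space_eq[OF sets_\<nu>] by (simp add: boundary_space_def space_restrict_space)

lemma boundary_start_\<nu>: "boundary_start D Rt \<gamma> U \<nu>"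
  unfolding boundary_start_def regular_points
proof (intro conjI sets_\<nu>)
  have F: "frontier D \<in> sets SF" using sets.top[of SF] by (simp add: SF_def space_restrict_space)
  show "prob_space \<nu>"
  proof
    show "emeasure \<nu> (space \<nu>) = 1"
      unfolding space_\<nu> using area F
      by (simp add: \<nu>_def emeasure_density nn_integral_cmult_indicator ennreal_mult[symmetric])
  qed
  show "AE x in \<nu>. x \<in> Rt" unfolding \<nu>_def by (subst AE_density) (use AE_SF_Rt in \<open>auto elim: eventually_mono\<close>)
qed

text \<open>Reciprocity for the indicator of the end point lying in \<open>A\<close> turns the mass
  that arrives in \<open>A\<close> into the mass that starts there.\<close>

lemma walk_invariant_\<nu>: "walk_invariant D Rt \<gamma> U \<nu>"
  unfolding walk_invariant_def
proof (intro conjI boundary_start_\<nu> measure_eqI)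
  interpret \<nu>: prob_space \<nu> using boundary_start_\<nu> by (simp add: boundary_start_def)
  interpret N: prob_space NS by (rule prob_NS)
  interpret R: prob_space \<rho> by (rule prob_\<rho>)
  let ?M = "\<nu> \<Otimes>\<^sub>M NS"
  have id\<nu>: "(\<lambda>x. x) \<in> borel_measurable \<nu>"
    unfolding measurable_cong_sets[OF sets_\<nu> refl] boundary_space_def by (rule measurable_restrict_space1) simp
  have [measurable]: "fst \<in> borel_measurable ?M" using measurable_compose[OF measurable_fst id\<nu>, of NS] by simp
  have [measurable]: "(\<lambda>z. snd z n) \<in> borel_measurable ?M" for n
    by (rule measurable_compose[OF measurable_snd measurable_NS_component])
  have w: "(case z of (x, \<eta>) \<Rightarrow> walk D U x \<eta> 1) = next_hit D (fst z) (U0 (fst z) *v snd z 0)"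
    and wF: "(case z of (x, \<eta>) \<Rightarrow> walk D U x \<eta> 1) \<in> frontier D" if "z \<in> space ?M" for z
  proof -
    have z: "fst z \<in> frontier D" using that by (auto simp: space_pair_measure space_\<nu>)
    show "(case z of (x, \<eta>) \<Rightarrow> walk D U x \<eta> 1) = next_hit D (fst z) (U0 (fst z) *v snd z 0)"
      by (simp add: split_beta' U0_def z)
    show "(case z of (x, \<eta>) \<Rightarrow> walk D U x \<eta> 1) \<in> frontier D"
      using walk_U0[OF z, of "snd z" 1] by (simp add: split_beta' del: walk.simps One_nat_def)
  qed
  have wb: "(\<lambda>z. next_hit D (fst z) (U0 (fst z) *v snd z 0)) \<in> borel_measurable ?M" by measurable
  have wm: "(\<lambda>(x, \<eta>). walk D U x \<eta> 1) \<in> measurable ?M (boundary_space D)"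
    unfolding boundary_space_def
  proof (rule measurable_restrict_space2)
    show "(\<lambda>(x, \<eta>). walk D U x \<eta> 1) \<in> space ?M \<rightarrow> frontier D" using wF by blast
    show "(\<lambda>(x, \<eta>). walk D U x \<eta> 1) \<in> borel_measurable ?M" by (subst measurable_cong[OF w]) (simp_all add: wb)
  qed
  show "sets (distr ?M (boundary_space D) (\<lambda>(x, \<eta>). walk D U x \<eta> 1)) = sets \<nu>" by (simp add: sets_\<nu>)
  fix A assume "A \<in> sets (distr ?M (boundary_space D) (\<lambda>(x, \<eta>). walk D U x \<eta> 1))"
  then have A: "A \<in> sets (boundary_space D)" by simp
  then have Ab[measurable]: "A \<in> sets borel" by (auto simp: boundary_space_def sets_restrict_space_iff)
  define k where "k w = (indicator A (snd w) :: ennreal)" for w :: "'n point \<times> 'n point"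
  have k: "k \<in> borel_measurable borel" unfolding k_def by measurable
  have km: "(\<lambda>u. indicator A (next_hit D x (U0 x *v u)) :: ennreal) \<in> borel_measurable borel" for x by measurable
  have "emeasure (distr ?M (boundary_space D) (\<lambda>(x, \<eta>). walk D U x \<eta> 1)) A = (\<integral>\<^sup>+y. indicator A y \<partial>distr ?M (boundary_space D) (\<lambda>(x, \<eta>). walk D U x \<eta> 1))"
    using A by simp
  also have "\<dots> = (\<integral>\<^sup>+z. indicator A (case z of (x, \<eta>) \<Rightarrow> walk D U x \<eta> 1) \<partial>?M)"
    by (rule nn_integral_distr[OF wm]) (use A in simp)
  also have "\<dots> = (\<integral>\<^sup>+z. indicator A (next_hit D (fst z) (U0 (fst z) *v snd z 0)) \<partial>?M)"
    by (rule nn_integral_cong) (simp only: w)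
  also have "\<dots> = (\<integral>\<^sup>+x. (\<integral>\<^sup>+\<eta>. indicator A (next_hit D x (U0 x *v \<eta> 0)) \<partial>NS) \<partial>\<nu>)"
  proof -
    have "(\<lambda>z. indicator A (next_hit D (fst z) (U0 (fst z) *v snd z 0)) :: ennreal) \<in> borel_measurable ?M" using wb by measurable
    from N.nn_integral_fst[OF this] show ?thesis by simp
  qed
  also have "\<dots> = (\<integral>\<^sup>+x. (\<integral>\<^sup>+u. k (x, next_hit D x (U0 x *v u)) \<partial>\<rho>) \<partial>\<nu>)"
    unfolding k_def snd_conv by (intro nn_integral_cong noise_first km)
  also have "\<dots> = (\<integral>\<^sup>+x. ennreal (1 / area) * (\<integral>\<^sup>+u. k (x, next_hit D x (U0 x *v u)) \<partial>\<rho>) \<partial>SF)"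
  proof -
    have "(\<lambda>z. k (fst z, next_hit D (fst z) (U0 (fst z) *v snd z))) \<in> borel_measurable (SF \<Otimes>\<^sub>M \<rho>)"
    proof -
      have [measurable]: "fst \<in> borel_measurable (SF \<Otimes>\<^sub>M \<rho>)"
        using measurable_compose[OF measurable_fst measurable_SF[OF measurable_ident]] by simp
      have [measurable]: "snd \<in> borel_measurable (SF \<Otimes>\<^sub>M \<rho>)"
        using measurable_compose[OF measurable_snd measurable_\<rho>[OF measurable_ident]] by simp
      show ?thesis unfolding k_def snd_conv by measurable
    qed
    from R.borel_measurable_nn_integral_fst[OF this]
    have "(\<lambda>x. \<integral>\<^sup>+u. k (x, next_hit D x (U0 x *v u)) \<partial>\<rho>) \<in> borel_measurable SF" by simp
    then show ?thesis unfolding \<nu>_def by (subst nn_integral_density) auto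
  qed
  also have "\<dots> = (\<integral>\<^sup>+x. ennreal (1 / area) * (\<integral>\<^sup>+u. k (next_hit D x (U0 x *v u), x) \<partial>\<rho>) \<partial>SF)"
    by (rule cosine_reciprocity[OF k]) (use area in simp)
  also have "\<dots> = (\<integral>\<^sup>+x. ennreal (1 / area) * indicator A x \<partial>SF)"
    by (simp add: k_def R.emeasure_space_1)
  also have "\<dots> = emeasure \<nu> A"
    unfolding \<nu>_def by (rule emeasure_density[symmetric]) (use A sets_\<nu> in \<open>auto simp: \<nu>_def\<close>)
  finally show "emeasure (distr ?M (boundary_space D) (\<lambda>(x, \<eta>). walk D U x \<eta> 1)) A = emeasure \<nu> A" .
qed

text \<open>With the uniform boundary law the cosine cancels and the suspension density is a
  constant \<open>K\<close>. Total mass 1 determines it, so the mean chord length need not be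
  computed.\<close>

lemma billiard_invariant_uniform: "billiard_invariant D Rt \<gamma> U (uniform_phase D)"
proof -
  interpret S: stationary_density D Rt \<gamma> U \<nu> "\<lambda>_. 1 / area"
  proof (unfold_locales, rule walk_invariant_\<nu>)
    show "boundary_density D \<nu> (\<lambda>_. 1 / area)"
      using area(2) unfolding boundary_density_def \<nu>_def SF_def by simp
  qed
  interpret V: finite_measure "volume_on D" by (rule finite_volume)
  interpret SS: finite_measure "sphere_measure :: 'n point measure" by (rule finite_sphere_measure)
  define K where "K = ennreal (1 / S.mj * (1 / area * c))"
  have \<pi>K: "S.\<pi> = density VS (\<lambda>_. K)"
    unfolding S.\<pi>_def
  proof (rule density_cong_AE)
    show "AE w in VS. ennreal (S.phase_density w) = K"
      using AE_VS_entrance AE_space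
    proof eventually_elim
      case (elim w)
      have ze: "next_hit D (fst w) (- snd w) \<in> entrance D Rt (snd w)" by (rule elim(1))
      have "norm (snd w) = 1" using elim(2) by (auto simp: space_VS)
      moreover have zR: "next_hit D (fst w) (- snd w) \<in> Rt" using ze entrance_transversal transversal_Rt by blast
      moreover have "snd w \<bullet> nf (next_hit D (fst w) (- snd w)) > 0" using ze by (simp add: entrance_def)
      ultimately have q: "\<gamma>0 (transpose (U0 (next_hit D (fst w) (- snd w))) *v snd w) / (snd w \<bullet> nf (next_hit D (fst w) (- snd w))) = c"
        using \<gamma>0_cosine by blast
      show ?case
        unfolding S.phase_density_def Let_def q K_def using Rt_frontier[OF zR] by (simp add: S.\<psi>0_def)
    qed
  qed
  let ?a = "emeasure (volume_on D) D" and ?b = "emeasure (sphere_measure :: 'n point measure) (sphere 0 1)"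
  have DS: "D \<in> sets (volume_on D)" "sphere 0 1 \<in> sets (sphere_measure :: 'n point measure)"
    using sets.top[of "volume_on D"] sets.top[of "sphere_measure :: 'n point measure"] by simp_all
  have "1 = emeasure S.\<pi> (space S.\<pi>)" using prob_space.emeasure_space_1[OF S.prob_\<pi>] by simp
  also have "\<dots> = K * emeasure VS (D \<times> sphere 0 1)"
    unfolding S.space_\<pi> unfolding \<pi>K using DS by (simp add: emeasure_density nn_integral_cmult_indicator)
  also have "emeasure VS (D \<times> sphere 0 1) = ?a * ?b" using DS by (rule SS.emeasure_pair_measure_Times)
  finally have 1: "K * (?a * ?b) = 1" by simp
  have "?a * ?b \<noteq> 0" "?a * ?b \<noteq> \<infinity>"
    using volume_pos sphere_measure_pos volume_finite' sphere_measure_finite' by (auto simp: ennreal_mult_eq_top_iff)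
  then have "K = 1 / (?a * ?b)" using ennreal_mult_divide_eq[of "?a * ?b" K] 1 by simp
  then have "S.\<pi> = uniform_phase D" unfolding \<pi>K uniform_phase_density by simp
  then show ?thesis using S.billiard_invariant_\<pi> by simp
qed

end

text \<open>On \<open>Rt\<close> the normal is \<open>U x *v e_vec\<close>, so it inherits
  measurability from the frames.\<close>

lemma measurable_normal_field:
  assumes D: "billiard_domain D Rt" and fr: "reflection_frames D Rt \<gamma> U"
  shows "normal_field D Rt \<in> borel_measurable borel"
proof -
  have "U \<in> borel_measurable (restrict_space borel (frontier D))" using fr by (simp add: reflection_frames_def)
  then have [measurable]: "(\<lambda>x. if x \<in> frontier D then U x else mat 1) \<in> borel_measurable borel"
    by (subst (asm) measurable_restrict_space_iff[where c = "mat 1"]) auto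
  have "openin (top_of_set (frontier D)) Rt" using D by (simp add: billiard_domain_def)
  then obtain T where T: "open T" "Rt = frontier D \<inter> T" by (auto simp: openin_open)
  then have [measurable]: "Rt \<in> sets borel" by simp
  have "normal_field D Rt x = (if x \<in> Rt then (if x \<in> frontier D then U x else mat 1) *v e_vec else 0)" for x
    using fr T(2) by (simp add: normal_field_def reflection_frames_def)
  then have n: "normal_field D Rt = (\<lambda>x. if x \<in> Rt then (if x \<in> frontier D then U x else mat 1) *v e_vec else 0)" by blast
  show ?thesis unfolding n by measurable
qed

theorem theorem2p4:
  fixes D Rt :: "'n::{finite,linorder} point set"
    and \<gamma> :: "'n point \<Rightarrow> real"
    and U :: "'n point \<Rightarrow> 'n matrix"
  assumes "CARD('n) \<ge> 2"
    and "billiard_domain D Rt"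
    and "bounded D"
    and "reflection_density \<gamma>"
    and "reflection_frames D Rt \<gamma> U"
  shows "(\<forall>\<mu> \<psi> chi.
            unique_walk_invariant D Rt \<gamma> U \<mu> \<and> boundary_density D \<mu> \<psi> \<and>
            billiard_limit D Rt \<gamma> U chi \<longrightarrow>
              absolutely_continuous (uniform_phase D) chi \<and>
              chi = density (volume_on D \<Otimes>\<^sub>M sphere_measure)
                    (\<lambda>(x, v). let z = next_hit D x (- v) in
                       ennreal (1 / mean_jump D \<gamma> U \<mu> *
                         (\<psi> z * (\<gamma> (matrix_inv (U z) *v v) / cos (normal_angle D z v)))))) \<and>
         ((\<forall>u \<in> half_sphere e_vec. \<gamma> u = cosine_density u) \<longrightarrow>
            billiard_invariant D Rt \<gamma> U (uniform_phase D))"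
proof (intro conjI allI impI; (elim conjE)?)
  interpret reflecting D Rt \<gamma> U
    by unfold_locales (use assms measurable_normal_field in blast)+
  {
    fix \<mu> \<psi> chi
    assume \<mu>: "unique_walk_invariant D Rt \<gamma> U \<mu>" and \<psi>: "boundary_density D \<mu> \<psi>" and chi: "billiard_limit D Rt \<gamma> U chi"
    interpret S: stationary_density D Rt \<gamma> U \<mu> \<psi>
      by unfold_locales (use \<mu> \<psi> in \<open>simp_all add: unique_walk_invariant_def\<close>)
    have "chi = S.\<pi>" by (rule S.limit_eq_\<pi>[OF chi])
    then show "absolutely_continuous (uniform_phase D) chi"
      and "chi = density (volume_on D \<Otimes>\<^sub>M sphere_measure)
                    (\<lambda>(x, v). let z = next_hit D x (- v) in
                       ennreal (1 / mean_jump D \<gamma> U \<mu> *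
                         (\<psi> z * (\<gamma> (matrix_inv (U z) *v v) / cos (normal_angle D z v)))))"
      using S.\<pi>_absolutely_continuous S.\<pi>_formula by simp_all
  next
    assume cosine: "\<forall>u \<in> half_sphere e_vec. \<gamma> u = cosine_density u"
    interpret C: cosine_reflecting D Rt \<gamma> U "inverse (LINT w|restrict_space surface_measure (half_sphere (e_vec :: 'n point)). w \<bullet> e_vec)"
      by unfold_locales (use cosine in \<open>simp add: cosine_density_def\<close>)
    show "billiard_invariant D Rt \<gamma> U (uniform_phase D)" by (rule C.billiard_invariant_uniform)
  }
qed

end
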